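(* Let $M_1=G_1/H_1$, $M_2=G_2/H_2$ be homogeneous spaces of compact Lie groups and $f:M_1\to M_2$ a morphism of homogeneous spaces, with underlying Lie group morphism $\rho:G_1\to G_2$. Then $f$ induces a graded algebra homomorphism $$f^*:\mathrm H^+_{\mathbb E}(M_2)\to\mathrm H^+_{\mathbb E}(M_1),$$ namely the restriction of $\mathcal Q((D_{\mathbf o}f)^* )$, which preserves the decomposition $\mathrm H^+_{\mathbb E}=\mathrm H_{\mathbb E}\oplus\mathrm H_c$ and is composed of homomorphisms of graded algebras $f^*:\mathrm H_{\mathbb E}(M_2)\to\mathrm H_{\mathbb E}(M_1)$ and $f^*:\mathrm H_c(M_2)\to\mathrm H_c(M_1)$. It satisfies: (1) For a sequence of morphisms $M_1\xrightarrow{f_1}M_2\xrightarrow{f_2}M_3$, we have $(f_2\circ f_1)^*=f_1^*\circ f_2^*$. (2) For any integrable random simple vector $\xi\in\Lambda^d(T^*_{\mathbf o}M_2)$ with $H_2$-invariant distribution, $f^*[Z(\xi)]=[Z(f^*\xi)]$, where $f^*$ on the right-hand side denotes the pullback of skew symmetric forms. (3) If $f$ is surjective, then $f^*$ is injective. (4) If $f$ is injective and $\rho(H_1)=H_2$, then $f^*$ is surjective.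
   Context: Zonoids. For a finite-dimensional Euclidean space $W$, a zonoid is a Hausdorff limit of finite Minkowski sums of segments; it has a center of symmetry $c(Z)$ and is centered if $c(Z)=0$. $\widehat{\mathcal Z}(W)$, $\widehat{\mathcal Z}_o(W)$: vector spaces of formal differences (Minkowski addition) of zonoids, resp. centered zonoids. For an integrable random vector $\xi\in W$, $Z(\xi)$ and $K(\xi)$ are the zonoids with support functions $\mathbb E\max\{0,\langle u,\xi\rangle\}$ and $\frac12\mathbb E|\langle u,\xi\rangle|$; $Z(\xi)=K(\xi)+\frac12\mathbb E\xi$; every centered zonoid is some $K(\xi)$. Algebra. For Euclidean $V$, $\bigoplus_d\widehat{\mathcal Z}(\Lambda^dV)$ is a graded algebra with bilinear product determined by $Z(\xi_1)\wedge Z(\xi_2)=Z(\xi_1\wedge\xi_2)$ for independent integrable $\xi_i\in\Lambda^{d_i}V$ (then also $K(\xi_1)\wedge K(\xi_2)=K(\xi_1\wedge\xi_2)$); $Z(\xi)\mapsto(K(\xi),\mathbb E\xi)$ identifies it with $\big(\bigoplus_d\widehat{\mathcal Z}_o(\Lambda^dV)\big)\oplus\Lambda(V)$ with componentwise multiplication. $\widehat{\mathcal G}_o^d(V)$ is the span of the $K(\xi)$ with $\xi\in\Lambda^dV$ integrable and a.s. simple ($=v_1\wedge\dots\wedge v_d$); $\widehat{\mathcal G}^d(V)$ is the span of the $K+p$ with $K$ such a zonoid and $p\in\Lambda^dV$. With the pairing $\langle K(\xi),K(\zeta)\rangle=\mathbb E|\langle\xi,\zeta\rangle|$ ($\xi,\zeta$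 independent), $\mathcal I^d(V)=\{K\in\widehat{\mathcal G}_o^d(V):\langle K,L\rangle=0\ \forall L\in\widehat{\mathcal G}_o^d(V)\}$; $\bigoplus_d\mathcal I^d(V)$ is an ideal. $\mathcal Q(V)=\bigoplus_d\widehat{\mathcal G}^d(V)/\mathcal I^d(V)$, $\mathcal Q_o(V)=\bigoplus_d\widehat{\mathcal G}_o^d(V)/\mathcal I^d(V)$, and $\mathcal Q(V)=\mathcal Q_o(V)\oplus\Lambda(V)$. These algebras do not depend on the inner product. A linear map $\varphi:V\to W$ induces a graded algebra homomorphism $\mathcal Q(\varphi):\mathcal Q(V)\to\mathcal Q(W)$ by taking images of zonoids under $\Lambda^d\varphi$ (so $[Z(\xi)]\mapsto[Z(\Lambda^d\varphi(\xi))]$). Homogeneous spaces. For a compact Lie group $G$ and closed subgroup $H$, $M=G/H$ with $\mathbf o=eH$ (endowed with a $G$-invariant Riemannian metric), $V=T^*_{\mathbf o}M$, with $H$-action $h\mapsto(D_{\mathbf o}a_{h^{-1}})^*$, $a_g(x)=gx$. $\mathrm H^+_{\mathbb E}(M)=\mathcal Q(V)^H$, $\mathrm H_{\mathbb E}(M)=\mathcal Q_o(V)^H$, $\mathrm H_c(M)=\Lambda(V)^H$, so $\mathrm H^+_{\mathbb E}(M)=\mathrm H_{\mathbb E}(M)\oplus\mathrm H_c(M)$. Morphisms. Given a Lie group morphism $\rho:G_1\to G_2$ with $\rho(H_1)\subseteq H_2$, a morphism of homogeneous spaces is a smooth map $f:M_1\to M_2$ with $f(\mathbf o_{M_1})=\mathbf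 o_{M_2}$ and $f(g_1p)=\rho(g_1)f(p)$ for all $g_1\in G_1,p\in M_1$. $(D_{\mathbf o}f)^*:T^*_{\mathbf o}M_2\to T^*_{\mathbf o}M_1$ is the dual of the differential. *)

theory Defs
  imports
    "HOL-Analysis.Analysis"
    "HOL-Probability.Probability"
    "HOL-Algebra.Left_Coset"
    "HOL-Algebra.QuotRing"
    "HOL-Algebra.Module"
begin

section \<open>Smooth manifolds\<close>

text \<open>
  Charts take values in a linear subspace \<open>model\<close> of a Euclidean space rather than in the whole
  type, because a type of class \<open>euclidean_space\<close> has positive dimension whereas Lie groups and
  homogeneous spaces of dimension 0 (finite groups, points) have to be included.
  A chart is a pair of its domain and its coordinate map.
\<close>

record ('m, 'e) manifold =
  mtop :: "'m topology"
  model :: "'e set"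
  atlas :: "('m set \<times> ('m \<Rightarrow> 'e)) set"

text \<open>For \<open>S\<close> relatively open in a linear subspace, \<open>C_k k S f\<close> says that \<open>f\<close> is of class \<open>C\<^sup>k\<close> on \<open>S\<close>.\<close>

fun C_k :: "nat \<Rightarrow> 'e::euclidean_space set \<Rightarrow> ('e \<Rightarrow> 'f::euclidean_space) \<Rightarrow> bool" where
  "C_k 0 S f \<longleftrightarrow> continuous_on S f"
| "C_k (Suc k) S f \<longleftrightarrow>
     (\<exists>f'. (\<forall>x\<in>S. (f has_derivative f' x) (at x within S)) \<and> (\<forall>v. C_k k S (\<lambda>x. f' x v)))"

definition C_infinity :: "'e::euclidean_space set \<Rightarrow> ('e \<Rightarrow> 'f::euclidean_space) \<Rightarrow> bool" where
  "C_infinity S f \<longleftrightarrow> (\<forall>k. C_k k S f)"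

definition smooth_manifold :: "('m, 'e::euclidean_space) manifold \<Rightarrow> bool" where
  "smooth_manifold M \<longleftrightarrow>
     Hausdorff_space (mtop M) \<and> second_countable (mtop M) \<and> subspace (model M) \<and>
     (\<Union>(U, c)\<in>atlas M. U) = topspace (mtop M) \<and>
     (\<forall>(U, c)\<in>atlas M.
        openin (mtop M) U \<and> openin (top_of_set (model M)) (c ` U) \<and>
        homeomorphic_map (subtopology (mtop M) U) (top_of_set (c ` U)) c) \<and>
     (\<forall>(U, c)\<in>atlas M. \<forall>(U', c')\<in>atlas M. C_infinity (c ` (U \<inter> U')) (c' \<circ> inv_into U c))"

definition smooth_map ::
  "('m, 'e::euclidean_space) manifold \<Rightarrow> ('n, 'f::euclidean_space) manifold \<Rightarrow> ('m \<Rightarrow> 'n) \<Rightarrow> bool"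
where
  "smooth_map M N f \<longleftrightarrow>
     continuous_map (mtop M) (mtop N) f \<and>
     (\<forall>(U, c)\<in>atlas M. \<forall>(U', c')\<in>atlas N.
        C_infinity (c ` (U \<inter> f -` U')) (c' \<circ> f \<circ> inv_into U c))"

definition prod_manifold ::
  "('m, 'e) manifold \<Rightarrow> ('n, 'f) manifold \<Rightarrow> ('m \<times> 'n, 'e \<times> 'f) manifold"
where
  "prod_manifold M N =
     \<lparr>mtop = prod_topology (mtop M) (mtop N),
      model = model M \<times> model N,
      atlas = {(U \<times> U', map_prod c c') | U c U' c'. (U, c) \<in> atlas M \<and> (U', c') \<in> atlas N}\<rparr>"

text \<open>
  The differential of \<open>f\<close> at \<open>p\<close>, read in the chart \<open>(U, c)\<close> of \<open>M\<close> at \<open>p\<close> and the chart \<open>(U', c')\<close>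
  of \<open>N\<close> at \<open>f p\<close>, that is, as a map from \<open>model M\<close> to \<open>model N\<close>. As a map on the whole type
  it is normalised to vanish on the orthogonal complement of \<open>model M\<close>; this makes it unique, and
  makes its adjoint vanish on the orthogonal complement of \<open>model N\<close> and take values in \<open>model M\<close>.
\<close>

definition differential ::
  "('m, 'e::euclidean_space) manifold \<Rightarrow> 'm set \<times> ('m \<Rightarrow> 'e) \<Rightarrow> 'n set \<times> ('n \<Rightarrow> 'f::euclidean_space) \<Rightarrow>
   ('m \<Rightarrow> 'n) \<Rightarrow> 'm \<Rightarrow> 'e \<Rightarrow> 'f"
where
  "differential M = (\<lambda>(U, c) (U', c') f p.
     THE D. linear D \<and> (\<forall>v\<in>(model M)\<^sup>\<bottom>. D v = 0) \<and>
            ((c' \<circ> f \<circ> inv_into U c) has_derivative D) (at (c p) within model M))"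

definition submersion ::
  "('m, 'e::euclidean_space) manifold \<Rightarrow> ('n, 'f::euclidean_space) manifold \<Rightarrow> ('m \<Rightarrow> 'n) \<Rightarrow> bool"
where
  "submersion M N f \<longleftrightarrow> smooth_map M N f \<and>
     (\<forall>p\<in>topspace (mtop M). \<forall>c\<in>atlas M. \<forall>c'\<in>atlas N. p \<in> fst c \<and> f p \<in> fst c' \<longrightarrow>
        differential M c c' f p ` model M = model N)"

definition lie_group :: "'g monoid \<Rightarrow> ('g, 'e::euclidean_space) manifold \<Rightarrow> bool" where
  "lie_group G M \<longleftrightarrow> group G \<and> smooth_manifold M \<and> topspace (mtop M) = carrier G \<and>
     smooth_map (prod_manifold M M) M (\<lambda>(x, y). x \<otimes>\<^bsub>G\<^esub> y) \<and> smooth_map M M (\<lambda>x. inv\<^bsub>G\<^esub> x)"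

section \<open>The exterior algebra\<close>

text \<open>
  The exterior algebra of \<open>\<real>\<^sup>n\<close> is \<open>real ^ ('n set)\<close>: the unit vector at \<open>S = {i\<^sub>1 < \<dots> < i\<^sub>d}\<close> is
  the basis vector \<open>e\<^sub>i\<^sub>1 \<and> \<dots> \<and> e\<^sub>i\<^sub>d\<close>. The inner product of \<open>real ^ ('n set)\<close> is then
  the one induced from \<open>\<real>\<^sup>n\<close>, so that \<open>\<langle>v\<^sub>1 \<and> \<dots> \<and> v\<^sub>d, w\<^sub>1 \<and> \<dots> \<and> w\<^sub>d\<rangle> = det \<langle>v\<^sub>i, w\<^sub>j\<rangle>\<close>.
\<close>

type_synonym 'n ext = "real ^ ('n set)"

definition shuffle_sign :: "'n::linorder set \<Rightarrow> 'n set \<Rightarrow> real" where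
  "shuffle_sign A B = (-1) ^ card {(a, b). a \<in> A \<and> b \<in> B \<and> b < a}"

definition wedge :: "'n::{finite,linorder} ext \<Rightarrow> 'n ext \<Rightarrow> 'n ext" where
  "wedge x y = (\<chi> S. \<Sum>A\<in>Pow S. shuffle_sign A (S - A) * x $ A * y $ (S - A))"

definition ext_one :: "'n::finite ext" where
  "ext_one = axis {} 1"

definition ext_vec :: "real ^ 'n::finite \<Rightarrow> 'n ext" where
  "ext_vec v = (\<Sum>i\<in>UNIV. v $ i *\<^sub>R axis {i} 1)"

definition wedge_list :: "(real ^ 'n::{finite,linorder}) list \<Rightarrow> 'n ext" where
  "wedge_list vs = foldr (\<lambda>v w. wedge (ext_vec v) w) vs ext_one"

definition ext_pow :: "nat \<Rightarrow> (real ^ 'n::{finite,linorder}) set \<Rightarrow> 'n ext set" where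
  "ext_pow d V = span {wedge_list vs | vs. length vs = d \<and> set vs \<subseteq> V}"

definition ext_carrier :: "(real ^ 'n::{finite,linorder}) set \<Rightarrow> 'n ext set" where
  "ext_carrier V = span {wedge_list vs | vs. set vs \<subseteq> V}"

definition ext_component :: "nat \<Rightarrow> 'n::finite ext \<Rightarrow> 'n ext" where
  "ext_component d w = (\<chi> S. if card S = d then w $ S else 0)"

text \<open>The scalar factor only matters for \<open>d = 0\<close>, where all scalars count as simple.\<close>

definition simple_vectors :: "nat \<Rightarrow> (real ^ 'n::{finite,linorder}) set \<Rightarrow> 'n ext set" where
  "simple_vectors d V = {a *\<^sub>R wedge_list vs | a vs. length vs = d \<and> set vs \<subseteq> V}"

text \<open>\<open>ext_map \<phi>\<close> is the direct sum of the maps \<open>\<Lambda>\<^sup>d\<phi>\<close>.\<close>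

definition ext_map ::
  "(real ^ 'n::{finite,linorder} \<Rightarrow> real ^ 'm::{finite,linorder}) \<Rightarrow> 'n ext \<Rightarrow> 'm ext"
where
  "ext_map \<phi> x =
     (\<Sum>S\<in>UNIV. x $ S *\<^sub>R wedge_list (map (\<lambda>i. \<phi> (axis i 1)) (sorted_list_of_set S)))"

definition ext_algebra :: "(real ^ 'n::{finite,linorder}) set \<Rightarrow> (real, 'n ext) module" where
  "ext_algebra V =
     \<lparr>carrier = ext_carrier V, mult = wedge, one = ext_one, zero = 0, add = (+), smult = (*\<^sub>R)\<rparr>"

section \<open>Zonoids and virtual zonoids\<close>

definition zonotope :: "'a::euclidean_space set \<Rightarrow> bool" where
  "zonotope S \<longleftrightarrow> (\<exists>n a b. S = (\<Sum>i<n::nat. closed_segment (a i) (b i)))"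

text \<open>Limits of zonotopes in the Hausdorff distance.\<close>

definition zonoid :: "'a::euclidean_space set \<Rightarrow> bool" where
  "zonoid Z \<longleftrightarrow> compact Z \<and> Z \<noteq> {} \<and>
     (\<forall>\<epsilon>>0. \<exists>S. zonotope S \<and> Z \<subseteq> S + cball 0 \<epsilon> \<and> S \<subseteq> Z + cball 0 \<epsilon>)"

definition support :: "'a::euclidean_space set \<Rightarrow> 'a \<Rightarrow> real" where
  "support A u = (SUP x\<in>A. x \<bullet> u)"

definition body_of :: "('a::euclidean_space \<Rightarrow> real) \<Rightarrow> 'a set" where
  "body_of h = {x. \<forall>u. x \<bullet> u \<le> h u}"

definition Z_body :: "'w measure \<Rightarrow> ('w \<Rightarrow> 'a::euclidean_space) \<Rightarrow> 'a set" where
  "Z_body M \<xi> = body_of (\<lambda>u. \<integral>\<omega>. max 0 (u \<bullet> \<xi> \<omega>) \<partial>M)"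

definition K_body :: "'w measure \<Rightarrow> ('w \<Rightarrow> 'a::euclidean_space) \<Rightarrow> 'a set" where
  "K_body M \<xi> = body_of (\<lambda>u. (1/2) * (\<integral>\<omega>. \<bar>u \<bullet> \<xi> \<omega>\<bar> \<partial>M))"

lemma support_eqI:
  assumes "x \<in> A" "x \<bullet> u = r" "\<And>y. y \<in> A \<Longrightarrow> y \<bullet> u \<le> r"
  shows "support A u = r"
  unfolding support_def using assms by (intro cSup_eq_maximum) (auto simp: image_iff)

text \<open>\<open>Z_body M \<xi>\<close> and \<open>K_body M \<xi>\<close> do have the support functions they are meant to have.\<close>

lemma support_Z_body:
  fixes \<xi> :: "'w \<Rightarrow> 'a::euclidean_space"
  assumes \<xi>: "integrable M \<xi>"
  shows "support (Z_body M \<xi>) u = (\<integral>\<omega>. max 0 (u \<bullet> \<xi> \<omega>) \<partial>M)"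
proof -
  have m [measurable]: "\<xi> \<in> borel_measurable M" using \<xi> by auto
  have int: "integrable M (\<lambda>\<omega>. max 0 (v \<bullet> \<xi> \<omega>))" for v
    using \<xi> by (intro integrable_max) auto
  define A where "A = {\<omega> \<in> space M. u \<bullet> \<xi> \<omega> > 0}"
  have [measurable]: "A \<in> sets M" unfolding A_def by measurable
  define \<eta> where "\<eta> = (\<lambda>\<omega>. indicator A \<omega> *\<^sub>R \<xi> \<omega>)"
  have \<eta>: "integrable M \<eta>"
    unfolding \<eta>_def using \<xi> by (rule integrable_mult_indicator[rotated]) auto
  define x where "x = (\<integral>\<omega>. \<eta> \<omega> \<partial>M)"
  have x: "x \<bullet> v = (\<integral>\<omega>. v \<bullet> \<eta> \<omega> \<partial>M)" for v
    unfolding x_def using \<eta> by (simp add: inner_commute)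
  have "x \<bullet> v \<le> (\<integral>\<omega>. max 0 (v \<bullet> \<xi> \<omega>) \<partial>M)" for v
    unfolding x
    by (intro integral_mono integrable_inner_right \<eta> int) (auto simp: \<eta>_def indicator_def)
  then have "x \<in> Z_body M \<xi>" by (simp add: Z_body_def body_of_def)
  moreover have "x \<bullet> u = (\<integral>\<omega>. max 0 (u \<bullet> \<xi> \<omega>) \<partial>M)"
    unfolding x by (rule Bochner_Integration.integral_cong) (auto simp: \<eta>_def A_def indicator_def)
  ultimately show ?thesis
    by (rule support_eqI) (auto simp: Z_body_def body_of_def)
qed

lemma support_K_body:
  fixes \<xi> :: "'w \<Rightarrow> 'a::euclidean_space"
  assumes \<xi>: "integrable M \<xi>"
  shows "support (K_body M \<xi>) u = (1/2) * (\<integral>\<omega>. \<bar>u \<bullet> \<xi> \<omega>\<bar> \<partial>M)"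
proof -
  have m [measurable]: "\<xi> \<in> borel_measurable M" using \<xi> by auto
  have int: "integrable M (\<lambda>\<omega>. \<bar>v \<bullet> \<xi> \<omega>\<bar>)" for v
    using \<xi> by auto
  define \<eta> where "\<eta> = (\<lambda>\<omega>. sgn (u \<bullet> \<xi> \<omega>) *\<^sub>R \<xi> \<omega>)"
  have \<eta>: "integrable M \<eta>"
    by (rule Bochner_Integration.integrable_bound[OF \<xi>]) (auto simp: \<eta>_def sgn_if)
  define x where "x = (1/2) *\<^sub>R (\<integral>\<omega>. \<eta> \<omega> \<partial>M)"
  have x: "x \<bullet> v = (1/2) * (\<integral>\<omega>. v \<bullet> \<eta> \<omega> \<partial>M)" for v
    unfolding x_def using \<eta> by (simp add: inner_commute)
  have "(\<integral>\<omega>. v \<bullet> \<eta> \<omega> \<partial>M) \<le> (\<integral>\<omega>. \<bar>v \<bullet> \<xi> \<omega>\<bar> \<partial>M)" for v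
    by (intro integral_mono integrable_inner_right \<eta> int) (auto simp: \<eta>_def sgn_if)
  then have "x \<in> K_body M \<xi>" by (simp add: K_body_def body_of_def x)
  moreover have "x \<bullet> u = (1/2) * (\<integral>\<omega>. \<bar>u \<bullet> \<xi> \<omega>\<bar> \<partial>M)"
    unfolding x by (simp add: \<eta>_def abs_sgn mult.commute)
  ultimately show ?thesis
    by (rule support_eqI) (auto simp: K_body_def body_of_def)
qed

text \<open>
  A formal difference of convex bodies \<open>A - B\<close> is represented by the difference of the support
  functions; \<open>formal_difference_eq_iff\<close> below shows that this is the same as working modulo
  \<open>A - B \<sim> C - D \<longleftrightarrow> A + D = C + B\<close> for Minkowski addition.
\<close>

type_synonym 'a virtual_body = "'a \<Rightarrow> real"

definition virtual_zonoids :: "'a::euclidean_space set \<Rightarrow> 'a virtual_body set" where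
  "virtual_zonoids W =
     {\<lambda>u. support A u - support B u | A B. zonoid A \<and> zonoid B \<and> A \<subseteq> W \<and> B \<subseteq> W}"

lemma support_bdd:
  fixes A :: "'a::euclidean_space set"
  assumes "compact A"
  shows "bdd_above ((\<lambda>x. x \<bullet> u) ` A)"
proof -
  have "compact ((\<lambda>x. x \<bullet> u) ` A)"
    using assms by (intro compact_continuous_image continuous_intros)
  then show ?thesis by (intro bounded_imp_bdd_above compact_imp_bounded)
qed

lemma support_Minkowski_sum:
  fixes A B :: "'a::euclidean_space set"
  assumes "compact A" "A \<noteq> {}" "compact B" "B \<noteq> {}"
  shows "support (A + B) u = support A u + support B u"
proof -
  have "\<exists>x\<in>A. \<forall>y\<in>A. y \<bullet> u \<le> x \<bullet> u" "\<exists>x\<in>B. \<forall>y\<in>B. y \<bullet> u \<le> x \<bullet> u"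
    using assms by (auto intro!: continuous_attains_sup continuous_intros)
  then obtain a b where a: "a \<in> A" "\<forall>y\<in>A. y \<bullet> u \<le> a \<bullet> u" and b: "b \<in> B" "\<forall>y\<in>B. y \<bullet> u \<le> b \<bullet> u"
    by blast
  have "support A u = a \<bullet> u" "support B u = b \<bullet> u"
    using a b by (auto intro: support_eqI)
  moreover have "support (A + B) u = a \<bullet> u + b \<bullet> u"
    by (rule support_eqI[of "a + b"]) (use a b in \<open>auto simp: inner_add_left set_plus_def intro!: add_mono\<close>)
  ultimately show ?thesis by simp
qed

lemma body_of_support:
  fixes A :: "'a::euclidean_space set"
  assumes "compact A" "convex A" "A \<noteq> {}"
  shows "body_of (support A) = A"
proof
  show "A \<subseteq> body_of (support A)"
    by (auto simp: body_of_def support_def intro!: cSUP_upper support_bdd assms)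
  show "body_of (support A) \<subseteq> A"
  proof
    fix z assume z: "z \<in> body_of (support A)"
    show "z \<in> A"
    proof (rule ccontr)
      assume "z \<notin> A"
      then obtain a b where ab: "a \<bullet> z < b" "\<forall>x\<in>A. b < a \<bullet> x"
        using separating_hyperplane_closed_point[of A z] assms compact_imp_closed by blast
      have "support A (- a) \<le> - b"
        unfolding support_def using ab assms
        by (intro cSUP_least) (auto simp: inner_commute less_imp_le)
      moreover have "z \<bullet> (- a) \<le> support A (- a)"
        using z by (simp only: body_of_def mem_Collect_eq)
      ultimately show False using ab by (simp add: inner_commute)
    qed
  qed
qed

lemma formal_difference_eq_iff:
  fixes A B C D :: "'a::euclidean_space set"
  assumes "compact A" "convex A" "A \<noteq> {}" "compact B" "convex B" "B \<noteq> {}"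
    "compact C" "convex C" "C \<noteq> {}" "compact D" "convex D" "D \<noteq> {}"
  shows "(\<lambda>u. support A u - support B u) = (\<lambda>u. support C u - support D u) \<longleftrightarrow> A + D = C + B"
proof -
  have compact_plus: "compact (S + T)" if "compact S" "compact T" for S T :: "'a set"
  proof -
    have "S + T = {x + y | x y. x \<in> S \<and> y \<in> T}" by (auto simp: set_plus_def)
    then show ?thesis using compact_sums[OF that] by simp
  qed
  have AD: "compact (A + D)" "convex (A + D)" "A + D \<noteq> {}"
   and CB: "compact (C + B)" "convex (C + B)" "C + B \<noteq> {}"
    using assms by (simp_all add: compact_plus convex_set_plus) (use assms in \<open>blast intro: set_plus_intro\<close>)+
  have "(\<lambda>u. support A u - support B u) = (\<lambda>u. support C u - support D u) \<longleftrightarrow>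
        support (A + D) = support (C + B)"
    using assms by (auto simp: support_Minkowski_sum fun_eq_iff algebra_simps)
  also have "\<dots> \<longleftrightarrow> A + D = C + B"
    using body_of_support[OF AD] body_of_support[OF CB] by metis
  finally show ?thesis .
qed

text \<open>This is why \<open>virtual_map\<close> below is the map that takes images of zonoids.\<close>

lemma support_linear_image:
  fixes \<phi> :: "'a::euclidean_space \<Rightarrow> 'b::euclidean_space"
  assumes "linear \<phi>"
  shows "support (\<phi> ` A) u = support A (adjoint \<phi> u)"
  unfolding support_def by (simp add: image_image adjoint_works[OF assms])

definition virtual_map ::
  "('a::euclidean_space \<Rightarrow> 'b::euclidean_space) \<Rightarrow> 'a virtual_body \<Rightarrow> 'b virtual_body"
where
  "virtual_map \<phi> h = (\<lambda>u. h (adjoint \<phi> u))"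

definition lin_span :: "'a virtual_body set \<Rightarrow> 'a virtual_body set" where
  "lin_span S = {\<lambda>u. \<Sum>i<n. a i * k i u | (n::nat) a k. \<forall>i<n. k i \<in> S}"

definition bilinear_on ::
  "'a virtual_body set \<Rightarrow> 'b virtual_body set \<Rightarrow> ('a virtual_body \<Rightarrow> 'b virtual_body \<Rightarrow> real) \<Rightarrow> bool"
where
  "bilinear_on S T B \<longleftrightarrow>
     (\<forall>h\<in>S. \<forall>h'\<in>S. \<forall>k\<in>T. \<forall>a b. B (\<lambda>u. a * h u + b * h' u) k = a * B h k + b * B h' k) \<and>
     (\<forall>h\<in>S. \<forall>k\<in>T. \<forall>k'\<in>T. \<forall>a b. B h (\<lambda>u. a * k u + b * k' u) = a * B h k + b * B h k')"

section \<open>The algebra of Grassmannian zonoids and its quotient\<close>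

text \<open>
  Throughout, \<open>V\<close> is a linear subspace of \<open>\<real>\<^sup>n\<close> with the induced inner product. Every law of a
  random vector in \<open>'n ext\<close> is realised on the sample space \<open>'n ext\<close>, and every joint law of a
  pair of such vectors on \<open>'n ext \<times> 'n ext\<close>, so it is enough to quantify over these.
\<close>

definition random_simple ::
  "'w measure \<Rightarrow> nat \<Rightarrow> (real ^ 'n::{finite,linorder}) set \<Rightarrow> ('w \<Rightarrow> 'n ext) \<Rightarrow> bool"
where
  "random_simple M d V \<xi> \<longleftrightarrow>
     prob_space M \<and> integrable M \<xi> \<and> (AE \<omega> in M. \<xi> \<omega> \<in> simple_vectors d V)"

definition G_centered :: "nat \<Rightarrow> (real ^ 'n::{finite,linorder}) set \<Rightarrow> 'n ext virtual_body set" where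
  "G_centered d V =
     lin_span {support (K_body M \<xi>) | (M :: 'n ext measure) \<xi>. random_simple M d V \<xi>}"

definition G_all :: "nat \<Rightarrow> (real ^ 'n::{finite,linorder}) set \<Rightarrow> 'n ext virtual_body set" where
  "G_all d V =
     lin_span {support (K_body M \<xi> + {p}) | (M :: 'n ext measure) \<xi> p.
                 random_simple M d V \<xi> \<and> p \<in> ext_pow d V}"

text \<open>The pairing is determined, on \<open>G_centered d V\<close>, by its values on the \<open>K(\<xi>)\<close>.\<close>

definition pairing ::
  "nat \<Rightarrow> (real ^ 'n::{finite,linorder}) set \<Rightarrow> 'n ext virtual_body \<Rightarrow> 'n ext virtual_body \<Rightarrow> real"
where
  "pairing d V = (SOME B. bilinear_on (G_centered d V) (G_centered d V) B \<and>
     (\<forall>(M :: ('n ext \<times> 'n ext) measure) \<xi> \<zeta>.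
        random_simple M d V \<xi> \<and> random_simple M d V \<zeta> \<and> prob_space.indep_var M borel \<xi> borel \<zeta> \<longrightarrow>
        B (support (K_body M \<xi>)) (support (K_body M \<zeta>)) = (\<integral>\<omega>. \<bar>\<xi> \<omega> \<bullet> \<zeta> \<omega>\<bar> \<partial>M)))"

definition I_deg :: "nat \<Rightarrow> (real ^ 'n::{finite,linorder}) set \<Rightarrow> 'n ext virtual_body set" where
  "I_deg d V = {K \<in> G_centered d V. \<forall>L\<in>G_centered d V. pairing d V K L = 0}"

text \<open>The product of virtual zonoids of degrees \<open>p\<close> and \<open>q\<close>, determined by its values on the \<open>Z(\<xi>)\<close>.\<close>

definition zonoid_product ::
  "(real ^ 'n::{finite,linorder}) set \<Rightarrow> nat \<Rightarrow> nat \<Rightarrow>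
   'n ext virtual_body \<Rightarrow> 'n ext virtual_body \<Rightarrow> 'n ext virtual_body"
where
  "zonoid_product V p q = (SOME B.
     (\<forall>u. bilinear_on (virtual_zonoids (ext_pow p V)) (virtual_zonoids (ext_pow q V)) (\<lambda>h k. B h k u)) \<and>
     (\<forall>(M :: ('n ext \<times> 'n ext) measure) \<xi>1 \<xi>2.
        prob_space M \<and> integrable M \<xi>1 \<and> integrable M \<xi>2 \<and>
        (AE \<omega> in M. \<xi>1 \<omega> \<in> ext_pow p V) \<and> (AE \<omega> in M. \<xi>2 \<omega> \<in> ext_pow q V) \<and>
        prob_space.indep_var M borel \<xi>1 borel \<xi>2 \<longrightarrow>
        B (support (Z_body M \<xi>1)) (support (Z_body M \<xi>2)) =
          support (Z_body M (\<lambda>\<omega>. wedge (\<xi>1 \<omega>) (\<xi>2 \<omega>)))))"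

text \<open>
  Elements of the direct sums over \<open>d\<close> are families indexed by \<open>d\<close>; finiteness of the support is
  automatic since the exterior powers above the dimension of \<open>V\<close> are 0. The units are the segments
  \<open>Z(1) = [0, 1]\<close> and \<open>K(1) = [-1/2, 1/2]\<close> in \<open>\<Lambda>\<^sup>0V = \<real>\<close>.
\<close>

type_synonym 'n graded_zonoid = "nat \<Rightarrow> 'n ext virtual_body"

definition in_degree :: "nat \<Rightarrow> 'n::finite ext virtual_body \<Rightarrow> 'n graded_zonoid" where
  "in_degree d h = (\<lambda>e. if e = d then h else (\<lambda>_. 0))"

definition G_algebra ::
  "(real ^ 'n::{finite,linorder}) set \<Rightarrow> (real, 'n graded_zonoid) module"
where
  "G_algebra V =
     \<lparr>carrier = {x. \<forall>d. x d \<in> G_all d V},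
      mult = (\<lambda>x y n u. \<Sum>p\<le>n. zonoid_product V p (n - p) (x p) (y (n - p)) u),
      one = in_degree 0 (support (closed_segment 0 ext_one)),
      zero = (\<lambda>d u. 0),
      add = (\<lambda>x y d u. x d u + y d u),
      smult = (\<lambda>a x d u. a * x d u)\<rparr>"

definition G_centered_algebra ::
  "(real ^ 'n::{finite,linorder}) set \<Rightarrow> (real, 'n graded_zonoid) module"
where
  "G_centered_algebra V = (G_algebra V)
     \<lparr>carrier := {x. \<forall>d. x d \<in> G_centered d V},
      one := in_degree 0 (support (closed_segment ((-1/2) *\<^sub>R ext_one) ((1/2) *\<^sub>R ext_one)))\<rparr>"

definition I_ideal :: "(real ^ 'n::{finite,linorder}) set \<Rightarrow> 'n graded_zonoid set" where
  "I_ideal V = {x. \<forall>d. x d \<in> I_deg d V}"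

definition quotient_algebra :: "('a, 'b) module \<Rightarrow> 'b set \<Rightarrow> ('a, 'b set) module" where
  "quotient_algebra R I =
     ring.extend (R Quot I) (module.fields (\<lambda>a X. \<Union>x\<in>X. I +>\<^bsub>R\<^esub> (a \<odot>\<^bsub>R\<^esub> x)))"

definition Q :: "(real ^ 'n::{finite,linorder}) set \<Rightarrow> (real, 'n graded_zonoid set) module" where
  "Q V = quotient_algebra (G_algebra V) (I_ideal V)"

text \<open>
  As the ideal consists of centered elements, a coset of a centered element is literally
  the same set in \<open>Q V\<close> and in \<open>Q_centered V\<close>: the inclusion of the latter is the identity.
\<close>

definition Q_centered ::
  "(real ^ 'n::{finite,linorder}) set \<Rightarrow> (real, 'n graded_zonoid set) module"
where
  "Q_centered V = quotient_algebra (G_centered_algebra V) (I_ideal V)"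

definition Q_class ::
  "(real ^ 'n::{finite,linorder}) set \<Rightarrow> 'n graded_zonoid \<Rightarrow> 'n graded_zonoid set"
where
  "Q_class V x = I_ideal V +>\<^bsub>G_algebra V\<^esub> x"

definition Q_deg :: "nat \<Rightarrow> (real ^ 'n::{finite,linorder}) set \<Rightarrow> 'n graded_zonoid set set" where
  "Q_deg d V = {Q_class V (in_degree d h) | h. h \<in> G_all d V}"

text \<open>
  The inclusion of \<open>\<Lambda>(V)\<close> as a summand of \<open>Q V\<close>. It sends \<open>w\<close> to the class of the point \<open>w/2\<close>: since
  \<open>Z(\<xi>) = K(\<xi>) + E\<xi>/2\<close> corresponds to the pair \<open>(K(\<xi>), E\<xi>)\<close>, the pair \<open>(0, w)\<close> is the point \<open>w/2\<close>.
\<close>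

definition ext_incl ::
  "(real ^ 'n::{finite,linorder}) set \<Rightarrow> 'n ext \<Rightarrow> 'n graded_zonoid set"
where
  "ext_incl V w = Q_class V (\<lambda>d. support {(1/2) *\<^sub>R ext_component d w})"

text \<open>\<open>Q_map V \<phi>\<close> is the map \<open>Q(\<phi>)\<close> with target \<open>Q V\<close>.\<close>

definition Q_map ::
  "(real ^ 'm::{finite,linorder}) set \<Rightarrow> (real ^ 'n::{finite,linorder} \<Rightarrow> real ^ 'm::{finite,linorder}) \<Rightarrow>
   'n graded_zonoid set \<Rightarrow> 'm graded_zonoid set"
where
  "Q_map V \<phi> X = (\<Union>x\<in>X. Q_class V (\<lambda>d. virtual_map (ext_map \<phi>) (x d)))"

section \<open>Homogeneous spaces\<close>

text \<open>
  The field \<open>base_chart\<close> is an arbitrary chart at the base point. It identifies the tangent space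
  at the base point with the model space, and the inner product of the model space identifies the
  latter with its dual. In this way \<open>cotangent\<close> is the cotangent space at the base point, and
  the dual of a differential is its adjoint.
\<close>

record ('g, 'e, 'n::finite) hspace =
  grp :: "'g monoid"
  grp_manifold :: "('g, 'e) manifold"
  stab :: "'g set"
  quot_manifold :: "('g set, real ^ 'n) manifold"
  base_chart :: "'g set set \<times> ('g set \<Rightarrow> real ^ 'n)"

text \<open>
  The smooth structure of \<open>G/H\<close> is the unique one for which the projection is a submersion.
\<close>

definition homogeneous_space ::
  "('g, 'e::euclidean_space, 'n::{finite,linorder}) hspace \<Rightarrow> bool"
where
  "homogeneous_space X \<longleftrightarrow>
     lie_group (grp X) (grp_manifold X) \<and> compact_space (mtop (grp_manifold X)) \<and>
     subgroup (stab X) (grp X) \<and> closedin (mtop (grp_manifold X)) (stab X) \<and>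
     smooth_manifold (quot_manifold X) \<and>
     topspace (mtop (quot_manifold X)) = lcosets\<^bsub>grp X\<^esub> (stab X) \<and>
     submersion (grp_manifold X) (quot_manifold X) (\<lambda>g. g <#\<^bsub>grp X\<^esub> stab X) \<and>
     base_chart X \<in> atlas (quot_manifold X) \<and> stab X \<in> fst (base_chart X)"

abbreviation points :: "('g, 'e, 'n::finite) hspace \<Rightarrow> 'g set set" where
  "points X \<equiv> lcosets\<^bsub>grp X\<^esub> (stab X)"

definition act :: "('g, 'e, 'n::finite) hspace \<Rightarrow> 'g \<Rightarrow> 'g set \<Rightarrow> 'g set" where
  "act X g p = g <#\<^bsub>grp X\<^esub> p"

definition hspace_morphism ::
  "('g1, 'e1::euclidean_space, 'n1::{finite,linorder}) hspace \<Rightarrow>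
   ('g2, 'e2::euclidean_space, 'n2::{finite,linorder}) hspace \<Rightarrow>
   ('g1 \<Rightarrow> 'g2) \<Rightarrow> ('g1 set \<Rightarrow> 'g2 set) \<Rightarrow> bool"
where
  "hspace_morphism X Y \<rho> f \<longleftrightarrow>
     \<rho> \<in> hom (grp X) (grp Y) \<and> smooth_map (grp_manifold X) (grp_manifold Y) \<rho> \<and>
     \<rho> ` stab X \<subseteq> stab Y \<and>
     smooth_map (quot_manifold X) (quot_manifold Y) f \<and> f (stab X) = stab Y \<and>
     (\<forall>g\<in>carrier (grp X). \<forall>p\<in>points X. f (act X g p) = act Y (\<rho> g) (f p))"

definition cotangent :: "('g, 'e, 'n::finite) hspace \<Rightarrow> (real ^ 'n) set" where
  "cotangent X = model (quot_manifold X)"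

definition base_diff ::
  "('g1, 'e1, 'n1::finite) hspace \<Rightarrow> ('g2, 'e2, 'n2::finite) hspace \<Rightarrow> ('g1 set \<Rightarrow> 'g2 set) \<Rightarrow>
   real ^ 'n1 \<Rightarrow> real ^ 'n2"
where
  "base_diff X Y f = differential (quot_manifold X) (base_chart X) (base_chart Y) f (stab X)"

definition base_codiff ::
  "('g1, 'e1, 'n1::finite) hspace \<Rightarrow> ('g2, 'e2, 'n2::finite) hspace \<Rightarrow> ('g1 set \<Rightarrow> 'g2 set) \<Rightarrow>
   real ^ 'n2 \<Rightarrow> real ^ 'n1"
where
  "base_codiff X Y f = adjoint (base_diff X Y f)"

definition stab_action :: "('g, 'e, 'n::finite) hspace \<Rightarrow> 'g \<Rightarrow> real ^ 'n \<Rightarrow> real ^ 'n" where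
  "stab_action X h = base_codiff X X (act X (inv\<^bsub>grp X\<^esub> h))"

definition H_plus ::
  "('g, 'e, 'n::{finite,linorder}) hspace \<Rightarrow> (real, 'n graded_zonoid set) module"
where
  "H_plus X = (Q (cotangent X))\<lparr>carrier :=
     {x \<in> carrier (Q (cotangent X)). \<forall>h\<in>stab X. Q_map (cotangent X) (stab_action X h) x = x}\<rparr>"

definition H_E ::
  "('g, 'e, 'n::{finite,linorder}) hspace \<Rightarrow> (real, 'n graded_zonoid set) module"
where
  "H_E X = (Q_centered (cotangent X))\<lparr>carrier :=
     {x \<in> carrier (Q_centered (cotangent X)). \<forall>h\<in>stab X. Q_map (cotangent X) (stab_action X h) x = x}\<rparr>"

definition H_c :: "('g, 'e, 'n::{finite,linorder}) hspace \<Rightarrow> (real, 'n ext) module" where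
  "H_c X = (ext_algebra (cotangent X))\<lparr>carrier :=
     {w \<in> ext_carrier (cotangent X). \<forall>h\<in>stab X. ext_map (stab_action X h) w = w}\<rparr>"

definition H_plus_deg ::
  "('g, 'e, 'n::{finite,linorder}) hspace \<Rightarrow> nat \<Rightarrow> 'n graded_zonoid set set"
where
  "H_plus_deg X d = carrier (H_plus X) \<inter> Q_deg d (cotangent X)"

definition H_E_deg ::
  "('g, 'e, 'n::{finite,linorder}) hspace \<Rightarrow> nat \<Rightarrow> 'n graded_zonoid set set"
where
  "H_E_deg X d = carrier (H_E X) \<inter> Q_deg d (cotangent X)"

definition H_c_deg :: "('g, 'e, 'n::{finite,linorder}) hspace \<Rightarrow> nat \<Rightarrow> 'n ext set" where
  "H_c_deg X d = carrier (H_c X) \<inter> ext_pow d (cotangent X)"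

definition graded_algebra_hom ::
  "('k, 'a) module \<Rightarrow> (nat \<Rightarrow> 'a set) \<Rightarrow> ('k, 'b) module \<Rightarrow> (nat \<Rightarrow> 'b set) \<Rightarrow> ('a \<Rightarrow> 'b) \<Rightarrow> bool"
where
  "graded_algebra_hom A A_deg B B_deg \<psi> \<longleftrightarrow>
     \<psi> \<in> ring_hom A B \<and>
     (\<forall>a. \<forall>x\<in>carrier A. \<psi> (a \<odot>\<^bsub>A\<^esub> x) = a \<odot>\<^bsub>B\<^esub> \<psi> x) \<and>
     (\<forall>d. \<psi> ` A_deg d \<subseteq> B_deg d)"

text \<open>The maps induced by \<open>f\<close> on \<open>H_plus\<close> (restricting to \<open>H_E\<close>) and on \<open>H_c\<close>.\<close>

definition pull_H ::
  "('g1, 'e1, 'n1::{finite,linorder}) hspace \<Rightarrow> ('g2, 'e2, 'n2::{finite,linorder}) hspace \<Rightarrow>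
   ('g1 set \<Rightarrow> 'g2 set) \<Rightarrow> 'n2 graded_zonoid set \<Rightarrow> 'n1 graded_zonoid set"
where
  "pull_H X Y f = Q_map (cotangent X) (base_codiff X Y f)"

definition pull_H_c ::
  "('g1, 'e1, 'n1::{finite,linorder}) hspace \<Rightarrow> ('g2, 'e2, 'n2::{finite,linorder}) hspace \<Rightarrow>
   ('g1 set \<Rightarrow> 'g2 set) \<Rightarrow> 'n2 ext \<Rightarrow> 'n1 ext"
where
  "pull_H_c X Y f = ext_map (base_codiff X Y f)"

text \<open>
  An element \<open>\<omega>\<close> of the exterior algebra of the cotangent space is the skew symmetric form
  \<open>(v\<^sub>1, \<dots>, v\<^sub>d) \<mapsto> \<omega> \<bullet> (v\<^sub>1 \<and> \<dots> \<and> v\<^sub>d)\<close> on the tangent space (in degree \<open>d\<close>).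
\<close>

definition form_eval :: "'n::{finite,linorder} ext \<Rightarrow> (real ^ 'n::{finite,linorder}) list \<Rightarrow> real" where
  "form_eval \<omega> vs = \<omega> \<bullet> wedge_list vs"

definition pull_form ::
  "('g1, 'e1, 'n1::{finite,linorder}) hspace \<Rightarrow> ('g2, 'e2, 'n2::{finite,linorder}) hspace \<Rightarrow>
   ('g1 set \<Rightarrow> 'g2 set) \<Rightarrow> 'n2 ext \<Rightarrow> 'n1 ext"
where
  "pull_form X Y f \<omega> = (THE \<eta>. \<eta> \<in> ext_carrier (cotangent X) \<and>
     (\<forall>vs. set vs \<subseteq> cotangent X \<longrightarrow> form_eval \<eta> vs = form_eval \<omega> (map (base_diff X Y f) vs)))"

definition invariant_distribution ::
  "('g, 'e, 'n::{finite,linorder}) hspace \<Rightarrow> 'w measure \<Rightarrow> ('w \<Rightarrow> 'n ext) \<Rightarrow> bool"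
where
  "invariant_distribution X M \<xi> \<longleftrightarrow>
     (\<forall>h\<in>stab X. distr M borel (\<lambda>\<omega>. ext_map (stab_action X h) (\<xi> \<omega>)) = distr M borel \<xi>)"

definition Z_class ::
  "('g, 'e, 'n::{finite,linorder}) hspace \<Rightarrow> nat \<Rightarrow> 'w measure \<Rightarrow> ('w \<Rightarrow> 'n ext) \<Rightarrow> 'n graded_zonoid set"
where
  "Z_class X d M \<xi> = Q_class (cotangent X) (in_degree d (support (Z_body M \<xi>)))"

end

(*
  The kernel I(V) of the pairing consists of the virtual Grassmannian zonoids whose support
  function vanishes on the simple vectors. Hence it is an ideal, because contraction by a simple
  vector preserves simple vectors, and it is preserved by linear maps, whose adjoints also preserve
  simple vectors. So Q is functorial, and f^* is Q of the adjoint of the differential Df at the base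
  point. The equivariance of f makes this adjoint equivariant for the stabilizers; invariance of the
  images and functoriality follow from the chain rule.

  By equivariance f has constant rank. If f is surjective, then Df is onto: otherwise f would be
  locally a map into a null set, and countably many null sets do not cover an open set. The adjoint
  then has a left inverse, and so has f^*. If f is injective, then Df is injective by the constant
  rank theorem, and the adjoint has a right inverse. An equivariant right inverse is a fixed
  point of the stabilizer on the convex set of all right inverses. It is found without Haar measure,
  by minimising the norm sup_h |h s|, which is invariant and, since the stabilizer acts by a bounded
  group, strictly convex in mean square. Such a right inverse maps invariant classes to invariant
  classes, which gives (4).
*)
theory Submission imports Defs "HOL-Library.Function_Algebras" begin

section \<open>Exterior algebra\<close>

text \<open>The product and the pairing are given by \<open>SOME\<close>, so nothing is known about
  them until a bilinear map with the prescribed values on random vectors is exhibited. Choosing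
  representing random vectors gives maps that are linear in one argument only; Fubini identifies the
  two one-sided versions, and this forces independence of the choices. The resulting integral
  formulas later show that products vanish on simple vectors. Nor is smoothness of the action on the
  homogeneous space part of the definition: smoothness is assumed of the group operations and of the
  projection. Differentiability of the action is obtained by descending along local sections of the
  projection. The bound on the stabilizer action comes from writing its differential, composed with
  that of the projection, as a continuous function of the group element on a compact set. Models of
  charts are subspaces, possibly zero, so calculus is done after composing with the orthogonal
  projection onto the model, which makes domains open. The price is that the unit of the stabilizer
  acts as a projection and that maps are controlled on the model spaces only.\<close>

lemma linear_eq_axis:
  fixes f g :: "real ^ 'n \<Rightarrow> 'b::real_vector"
  assumes "linear f" "linear g" "\<And>i. f (axis i 1) = g (axis i 1)"
  shows "f x = g x"
proof -
  have "f b = g b" if "b \<in> Basis" for b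
    using that assms(3) by (auto simp: Basis_vec_def)
  then show ?thesis using linear_eq_stdbasis[OF assms(1,2)] by metis
qed

lemma axis_nth_if: "axis k x $ i = (if i = k then x else 0)"
  by (simp add: axis_def)

lemma bilinear_eq_axis:
  fixes f g :: "real ^ 'n \<Rightarrow> real ^ 'm \<Rightarrow> 'b::real_vector"
  assumes "bilinear f" "bilinear g" "\<And>i j. f (axis i 1) (axis j 1) = g (axis i 1) (axis j 1)"
  shows "f x y = g x y"
proof (rule linear_eq_axis[where f="\<lambda>x. f x y" and g="\<lambda>x. g x y"])
  show "linear (\<lambda>x. f x y)" "linear (\<lambda>x. g x y)" using assms by (auto simp: bilinear_def)
  show "f (axis i 1) y = g (axis i 1) y" for i
    by (rule linear_eq_axis) (use assms in \<open>auto simp: bilinear_def\<close>)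
qed

section \<open>Multiplication: associativity and anticommutativity\<close>

lemma bilinear_wedge: "bilinear (wedge :: 'n::{finite,linorder} ext \<Rightarrow> _)"
  unfolding bilinear_def
  by (auto intro!: linearI simp: wedge_def vec_eq_iff algebra_simps sum.distrib sum_distrib_left)

lemmas wedge_linear_simps =
  bilinear_ladd[OF bilinear_wedge] bilinear_radd[OF bilinear_wedge]
  bilinear_lmul[OF bilinear_wedge] bilinear_rmul[OF bilinear_wedge]
  bilinear_lneg[OF bilinear_wedge] bilinear_rneg[OF bilinear_wedge]
  bilinear_lzero[OF bilinear_wedge] bilinear_rzero[OF bilinear_wedge]
  bilinear_lsub[OF bilinear_wedge] bilinear_rsub[OF bilinear_wedge]

lemma linear_wedge_right: "linear (wedge x)" and linear_wedge_left: "linear (\<lambda>x. wedge x y)"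
  using bilinear_wedge by (auto simp: bilinear_def)

lemma bounded_bilinear_wedge: "bounded_bilinear (wedge :: 'n::{finite,linorder} ext \<Rightarrow> _)"
  using bilinear_wedge by (simp add: bilinear_conv_bounded_bilinear)

text \<open>The exponent counts inversions, and the inversions with a disjoint union split into
  those with each of the two sets.\<close>

lemma shuffle_sign_Un:
  fixes A B C :: "'n::{finite,linorder} set"
  shows "A \<inter> B = {} \<Longrightarrow> shuffle_sign (A \<union> B) C = shuffle_sign A C * shuffle_sign B C"
    and "B \<inter> C = {} \<Longrightarrow> shuffle_sign A (B \<union> C) = shuffle_sign A B * shuffle_sign A C"
proof -
  assume "A \<inter> B = {}"
  then show "shuffle_sign (A \<union> B) C = shuffle_sign A C * shuffle_sign B C"
    unfolding shuffle_sign_def power_add[symmetric]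
    by (subst card_Un_disjoint[symmetric]) (auto intro!: arg_cong[where f="\<lambda>X. (-1) ^ card X"])
next
  assume "B \<inter> C = {}"
  then show "shuffle_sign A (B \<union> C) = shuffle_sign A B * shuffle_sign A C"
    unfolding shuffle_sign_def power_add[symmetric]
    by (subst card_Un_disjoint[symmetric]) (auto intro!: arg_cong[where f="\<lambda>X. (-1) ^ card X"])
qed

text \<open>Both sides are sums over the ordered partitions of \<open>S\<close> into three blocks,
  weighted with the product of the three pairwise shuffle signs; this common form is
  \<open>?T\<close>.\<close>

lemma wedge_assoc: "wedge (wedge x y) z = wedge x (wedge y z)"
proof -
  have "wedge (wedge x y) z $ S = wedge x (wedge y z) $ S" for S
  proof -
    let ?T = "\<lambda>B C D. shuffle_sign B C * shuffle_sign B D * shuffle_sign C D * x $ B * y $ C * z $ D"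
    have "wedge (wedge x y) z $ S =
        (\<Sum>A\<in>Pow S. \<Sum>B\<in>Pow A. shuffle_sign A (S - A) * (shuffle_sign B (A - B) * x $ B * y $ (A - B)) * z $ (S - A))"
      by (simp add: wedge_def sum_distrib_left sum_distrib_right)
    also have "\<dots> = (\<Sum>A\<in>Pow S. \<Sum>B\<in>Pow A. ?T B (A - B) (S - A))"
    proof (intro sum.cong refl)
      fix A B assume "A \<in> Pow S" "B \<in> Pow A"
      then have "A = B \<union> (A - B)" "B \<inter> (A - B) = {}" by auto
      then have "shuffle_sign A (S - A) = shuffle_sign B (S - A) * shuffle_sign (A - B) (S - A)"
        by (metis shuffle_sign_Un(1))
      then show "shuffle_sign A (S - A) * (shuffle_sign B (A - B) * x $ B * y $ (A - B)) * z $ (S - A)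
          = ?T B (A - B) (S - A)" by simp
    qed
    also have "\<dots> = (\<Sum>(A, B)\<in>(SIGMA A:Pow S. Pow A). ?T B (A - B) (S - A))"
      by (rule sum.Sigma) auto
    \<comment> \<open>The index consisting of the union of the first two blocks and the first block
      is replaced by these two blocks themselves.\<close>
    also have "\<dots> = (\<Sum>(B, C)\<in>(SIGMA B:Pow S. Pow (S - B)). ?T B C (S - B - C))"
      by (rule sum.reindex_bij_witness[where i="\<lambda>(B, C). (B \<union> C, B)" and j="\<lambda>(A, B). (B, A - B)"])
        (auto simp: Un_absorb1 Un_Diff Diff_triv Int_commute Diff_eq intro!: arg_cong2[where f="(*)"] arg_cong2[where f=shuffle_sign] arg_cong[where f="($) _"])
    also have "\<dots> = (\<Sum>B\<in>Pow S. \<Sum>C\<in>Pow (S - B). ?T B C (S - B - C))"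
      by (rule sum.Sigma[symmetric]) auto
    also have "\<dots> = (\<Sum>B\<in>Pow S. \<Sum>C\<in>Pow (S - B). shuffle_sign B (S - B) * x $ B *
        (shuffle_sign C (S - B - C) * y $ C * z $ (S - B - C)))"
    proof (intro sum.cong refl)
      fix B C assume "B \<in> Pow S" "C \<in> Pow (S - B)"
      then have "S - B = C \<union> (S - B - C)" "C \<inter> (S - B - C) = {}" by auto
      then have "shuffle_sign B (S - B) = shuffle_sign B C * shuffle_sign B (S - B - C)"
        by (metis shuffle_sign_Un(2))
      then show "?T B C (S - B - C) = shuffle_sign B (S - B) * x $ B *
        (shuffle_sign C (S - B - C) * y $ C * z $ (S - B - C))" by simp
    qed
    also have "\<dots> = wedge x (wedge y z) $ S"
      by (simp add: wedge_def sum_distrib_left)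
    finally show ?thesis .
  qed
  then show ?thesis by (simp add: vec_eq_iff)
qed

lemma wedge_one_left: "wedge ext_one x = x"
proof -
  have "wedge ext_one x $ S = x $ S" for S
  proof -
    have "wedge ext_one x $ S = (\<Sum>A\<in>Pow S. if A = {} then x $ S else 0)"
      unfolding wedge_def vec_lambda_beta
      by (rule sum.cong[OF refl]) (auto simp: ext_one_def axis_nth_if shuffle_sign_def)
    then show ?thesis by simp
  qed
  then show ?thesis by (simp add: vec_eq_iff)
qed

text \<open>The sign of a basis vector \<open>i\<close> multiplied from the left onto the increasing
  product over \<open>S\<close>: moving it to its place passes the elements of \<open>S\<close>
  below \<open>i\<close>.\<close>

definition insert_sign :: "'n::{finite,linorder} \<Rightarrow> 'n set \<Rightarrow> real" where
  "insert_sign i S = (-1) ^ card {s \<in> S. s < i}"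

lemma insert_sign_insert:
  "j \<notin> S \<Longrightarrow> insert_sign i (insert j S) = (if j < i then - insert_sign i S else insert_sign i S)"
proof -
  assume "j \<notin> S"
  moreover have "{s. (s = j \<or> s \<in> S) \<and> s < i} = (if j < i then insert j {s \<in> S. s < i} else {s \<in> S. s < i})"
    by auto
  ultimately show ?thesis by (auto simp: insert_sign_def)
qed

lemma insert_sign_sq [simp]: "insert_sign i S * insert_sign i S = 1"
  by (simp add: insert_sign_def flip: power_mult_distrib)

lemma insert_sign_self [simp]: "insert_sign i (insert i S) = insert_sign i S"
  by (simp add: insert_sign_def) (metis (no_types, lifting) order_less_irrefl)

lemma ext_vec_axis: "ext_vec (axis i 1) = axis {i} 1"
proof -
  have "ext_vec (axis i 1) = (\<Sum>j\<in>UNIV. if j = i then axis {i} 1 else 0)"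
    unfolding ext_vec_def by (intro sum.cong) (auto simp: axis_def)
  then show ?thesis by simp
qed

lemma linear_ext_vec: "linear ext_vec"
  by (auto intro!: linearI simp: ext_vec_def algebra_simps sum.distrib scaleR_right.sum)

lemmas ext_vec_simps = linear_add[OF linear_ext_vec] linear_cmul[OF linear_ext_vec]
  linear_0[OF linear_ext_vec] linear_diff[OF linear_ext_vec] linear_neg[OF linear_ext_vec]

lemma wedge_axis_nth:
  "wedge (axis {i} 1) x $ S = (if i \<in> S then insert_sign i (S - {i}) * x $ (S - {i}) else 0)"
proof -
  have "wedge (axis {i} 1) x $ S =
      (\<Sum>A\<in>Pow S. if A = {i} then shuffle_sign {i} (S - {i}) * x $ (S - {i}) else 0)"
    unfolding wedge_def vec_lambda_beta by (rule sum.cong[OF refl]) (auto simp: axis_nth_if)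
  also have "shuffle_sign {i} (S - {i}) = insert_sign i (S - {i})"
  proof -
    have "{(a, b). a \<in> {i} \<and> b \<in> S - {i} \<and> b < a} = Pair i ` {s \<in> S - {i}. s < i}" by auto
    then show ?thesis by (simp add: shuffle_sign_def insert_sign_def card_image inj_on_def)
  qed
  finally show ?thesis by (simp add: sum.delta')
qed

lemma wedge_axis_axis:
  "wedge (axis {i} 1) (axis S 1) = (if i \<in> S then 0 else insert_sign i S *\<^sub>R axis (insert i S) 1)"
  by (auto simp: vec_eq_iff wedge_axis_nth axis_nth_if)

text \<open>Of \<open>i < j\<close> and \<open>j < i\<close> exactly one holds, so by
  \<open>insert_sign_insert\<close> exactly one of the two orders picks up an extra sign.\<close>

lemma wedge_anticommute_axis:
  "wedge (axis {i} 1) (wedge (axis {j} 1) x) = - wedge (axis {j} 1) (wedge (axis {i} 1) x)"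
proof (cases "i = j")
  case True
  then show ?thesis by (auto simp: vec_eq_iff wedge_axis_nth)
next
  case False
  have "wedge (axis {i} 1) (wedge (axis {j} 1) x) $ S = - wedge (axis {j} 1) (wedge (axis {i} 1) x) $ S" for S
  proof (cases "i \<in> S \<and> j \<in> S")
    case True
    define T where "T = S - {i, j}"
    have S: "S = insert i (insert j T)" "i \<notin> T" "j \<notin> T" using True by (auto simp: T_def)
    have 1: "S - {i} = insert j T" "S - {j} = insert i T" "S - {i} - {j} = T" "S - {j} - {i} = T"
      using S False by auto
    show ?thesis
      using True False S(2,3) by (simp add: wedge_axis_nth 1 insert_sign_insert) (metis neqE order_less_asym)
  qed (auto simp: wedge_axis_nth)
  then show ?thesis by (simp add: vec_eq_iff)
qed

lemma bilinear_wedge2: "bilinear (\<lambda>v w. wedge (ext_vec v) (wedge (ext_vec w) x))"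
  by (auto simp: bilinear_def intro!: linearI simp: ext_vec_simps wedge_linear_simps)

lemma bilinear_swap_neg: "bilinear f \<Longrightarrow> bilinear (\<lambda>v w. - f w v)"
  unfolding bilinear_def by (auto intro: linear_compose_neg)

lemma wedge_anticommute:
  "wedge (ext_vec v) (wedge (ext_vec w) x) = - wedge (ext_vec w) (wedge (ext_vec v) x)"
  by (rule bilinear_eq_axis[OF bilinear_wedge2 bilinear_swap_neg[OF bilinear_wedge2]])
    (simp add: ext_vec_axis wedge_anticommute_axis[symmetric])

lemma wedge_square: "wedge (ext_vec v) (wedge (ext_vec v) x) = 0"
proof -
  have "y = 0" if "y = - y" for y :: "'b::real_vector"
    using that by (metis eq_neg_iff_add_eq_0 scaleR_2 scaleR_eq_0_iff zero_neq_numeral)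
  then show ?thesis using wedge_anticommute by blast
qed

lemma wedge_list_Nil [simp]: "wedge_list [] = ext_one"
  and wedge_list_Cons [simp]: "wedge_list (v # vs) = wedge (ext_vec v) (wedge_list vs)"
  by (simp_all add: wedge_list_def)

lemma wedge_list_append: "wedge_list (vs @ ws) = wedge (wedge_list vs) (wedge_list ws)"
  by (induction vs) (simp_all add: wedge_one_left wedge_assoc)

text \<open>Sorting a factor into an increasing product uses only anticommutativity and vanishing
  squares, so the rule found for basis vectors also holds for their images \<open>f i\<close>. This
  is what makes \<open>ext_map\<close> multiplicative.\<close>

lemma wedge_list_insort:
  fixes f :: "'n::{finite,linorder} \<Rightarrow> real ^ 'm::{finite,linorder}"
  assumes "sorted xs" "distinct xs"
  shows "wedge (ext_vec (f i)) (wedge_list (map f xs)) =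
    (if i \<in> set xs then 0 else insert_sign i (set xs) *\<^sub>R wedge_list (map f (insort i xs)))"
  using assms
proof (induction xs)
  case Nil
  then show ?case by (simp add: insert_sign_def)
next
  case (Cons a xs)
  have IH: "wedge (ext_vec (f i)) (wedge_list (map f xs)) =
    (if i \<in> set xs then 0 else insert_sign i (set xs) *\<^sub>R wedge_list (map f (insort i xs)))"
    using Cons by auto
  have nin: "a \<notin> set xs" and le: "\<And>s. s \<in> set xs \<Longrightarrow> a \<le> s" using Cons by auto
  consider "i = a" | "i < a" | "a < i" by force
  then show ?case
  proof cases
    case 1
    then show ?thesis by (simp add: wedge_square)
  next
    case 2
    then have "i \<notin> set (a # xs)" and e: "{s \<in> set (a # xs). s < i} = {}" using le by fastforce+
    moreover have "insert_sign i (set (a # xs)) = 1" unfolding insert_sign_def e by simp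
    ultimately show ?thesis using 2[THEN less_imp_le] by simp
  next
    case 3
    have "wedge (ext_vec (f i)) (wedge_list (map f (a # xs))) =
      - wedge (ext_vec (f a)) (wedge (ext_vec (f i)) (wedge_list (map f xs)))"
      by (simp add: wedge_anticommute[of "f i"])
    then show ?thesis using 3 nin
      by (auto simp: IH wedge_linear_simps insert_sign_insert)
  qed
qed

lemma axis_eq_wedge_list:
  "axis S 1 = wedge_list (map (\<lambda>i. axis i 1) (sorted_list_of_set S))"
proof -
  have "wedge_list (map (\<lambda>i. axis i 1) xs) = axis (set xs) 1" if "sorted xs" "distinct xs"
    for xs :: "'a list" using that
  proof (induction xs)
    case Nil
    then show ?case by (simp add: ext_one_def)
  next
    case (Cons a xs)
    have "{s \<in> set xs. s < a} = {}" using Cons.prems by fastforce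
    then have "insert_sign a (set xs) = 1" unfolding insert_sign_def by (simp only: card.empty power_0)
    then show ?case using Cons by (simp add: ext_vec_axis wedge_axis_axis)
  qed
  from this[of "sorted_list_of_set S"] show ?thesis by simp
qed

text \<open>The basis consists of wedge products of vectors, so linear identities can be checked on
  \<open>wedge_list vs\<close>, typically by induction on the list.\<close>

lemma linear_eq_wedge_list:
  fixes f g :: "'n::{finite,linorder} ext \<Rightarrow> 'b::real_vector"
  assumes "linear f" "linear g" "\<And>vs. f (wedge_list vs) = g (wedge_list vs)"
  shows "f x = g x"
  by (rule linear_eq_axis[OF assms(1,2)]) (simp add: axis_eq_wedge_list assms(3))

section \<open>Functoriality of the exterior algebra\<close>

lemma linear_ext_map: "linear (ext_map \<phi>)"
  by (auto intro!: linearI simp: ext_map_def algebra_simps sum.distrib scaleR_right.sum)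

lemma ext_map_axis: "ext_map \<phi> (axis S 1) = wedge_list (map (\<lambda>i. \<phi> (axis i 1)) (sorted_list_of_set S))"
proof -
  have "ext_map \<phi> (axis S 1) = (\<Sum>T\<in>UNIV. if T = S then wedge_list (map (\<lambda>i. \<phi> (axis i 1)) (sorted_list_of_set S)) else 0)"
    unfolding ext_map_def by (intro sum.cong) (auto simp: axis_def)
  then show ?thesis by simp
qed

text \<open>On basis vectors both sides follow the sorting rule of \<open>wedge_list_insort\<close>
  with the same sign; bilinearity does the rest.\<close>

lemma ext_map_wedge_vec:
  assumes "linear \<phi>"
  shows "ext_map \<phi> (wedge (ext_vec v) x) = wedge (ext_vec (\<phi> v)) (ext_map \<phi> x)"
proof (rule bilinear_eq_axis[where f="\<lambda>v x. ext_map \<phi> (wedge (ext_vec v) x)"])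
  show "bilinear (\<lambda>v x. ext_map \<phi> (wedge (ext_vec v) x))"
    "bilinear (\<lambda>v x. wedge (ext_vec (\<phi> v)) (ext_map \<phi> x))"
    by (auto simp: bilinear_def intro!: linearI
        simp: ext_vec_simps wedge_linear_simps linear_add[OF linear_ext_map] linear_cmul[OF linear_ext_map]
         linear_add[OF assms] linear_cmul[OF assms])
  show "ext_map \<phi> (wedge (ext_vec (axis i 1)) (axis S 1)) = wedge (ext_vec (\<phi> (axis i 1))) (ext_map \<phi> (axis S 1))"
    for i S
    by (auto simp: ext_vec_axis wedge_axis_axis ext_map_axis wedge_list_insort[where f="\<lambda>i. \<phi> (axis i 1)"]
        linear_0[OF linear_ext_map] linear_cmul[OF linear_ext_map] sorted_list_of_set_insert)
qed

lemma ext_map_one: "ext_map \<phi> ext_one = ext_one"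
  by (simp add: ext_one_def ext_map_axis)

lemma ext_map_wedge_list: "linear \<phi> \<Longrightarrow> ext_map \<phi> (wedge_list vs) = wedge_list (map \<phi> vs)"
  by (induction vs) (simp_all add: ext_map_one ext_map_wedge_vec)

lemma ext_map_wedge:
  assumes "linear \<phi>"
  shows "ext_map \<phi> (wedge x y) = wedge (ext_map \<phi> x) (ext_map \<phi> y)"
proof (rule linear_eq_wedge_list[where f="\<lambda>x. ext_map \<phi> (wedge x y)"])
  show "linear (\<lambda>x. ext_map \<phi> (wedge x y))" "linear (\<lambda>x. wedge (ext_map \<phi> x) (ext_map \<phi> y))"
    by (auto intro!: linearI simp: wedge_linear_simps linear_add[OF linear_ext_map] linear_cmul[OF linear_ext_map])
  show "ext_map \<phi> (wedge (wedge_list vs) y) = wedge (ext_map \<phi> (wedge_list vs)) (ext_map \<phi> y)" for vs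
    by (induction vs) (simp_all add: ext_map_wedge_vec assms wedge_assoc wedge_one_left ext_map_one)
qed

lemma ext_map_comp:
  assumes "linear \<phi>" "linear \<psi>"
  shows "ext_map \<phi> (ext_map \<psi> x) = ext_map (\<phi> \<circ> \<psi>) x"
proof (rule linear_eq_wedge_list[where f="\<lambda>x. ext_map \<phi> (ext_map \<psi> x)"])
  show "linear (\<lambda>x. ext_map \<phi> (ext_map \<psi> x))"
    using linear_compose[OF linear_ext_map linear_ext_map] by (simp add: o_def)
  show "linear (\<lambda>x. ext_map (\<phi> \<circ> \<psi>) x)" by (rule linear_ext_map)
  show "ext_map \<phi> (ext_map \<psi> (wedge_list vs)) = ext_map (\<phi> \<circ> \<psi>) (wedge_list vs)" for vs
    using ext_map_wedge_list[OF linear_compose[OF assms(2,1)], of vs]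
    by (simp only: ext_map_wedge_list[OF assms(1)] ext_map_wedge_list[OF assms(2)] map_map o_def)
qed

section \<open>Interior products and the adjoint of an induced map\<close>

text \<open>The interior product by \<open>v\<close>, which is read as a covector through the inner
  product.\<close>

definition contract :: "real ^ 'n::{finite,linorder} \<Rightarrow> 'n ext \<Rightarrow> 'n ext" where
  "contract v = adjoint (wedge (ext_vec v))"

lemma inner_contract: "x \<bullet> contract v y = wedge (ext_vec v) x \<bullet> y"
  unfolding contract_def by (rule adjoint_works) (rule linear_wedge_right)

lemma bilinear_contract: "bilinear contract"
  unfolding bilinear_def
  by (intro conjI allI linearI; subst vector_eq_ldot[symmetric])
    (auto simp: inner_contract inner_add_right inner_add_left wedge_linear_simps ext_vec_simps)

lemma contract_axis_nth:
  "contract (axis i 1) y $ S = (if i \<in> S then 0 else insert_sign i S * y $ insert i S)"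
proof -
  have "contract (axis i 1) y $ S = axis S 1 \<bullet> contract (axis i 1) y" by (simp add: inner_axis')
  then show ?thesis
    by (simp add: inner_contract ext_vec_axis wedge_axis_axis inner_axis')
qed

text \<open>The antiderivation rule. On basis vectors with \<open>i = j\<close> the two
  contributions to \<open>y\<close> live on the sets without and with \<open>i\<close>; for
  different indices removal and insertion anticommute by \<open>insert_sign_insert\<close>.\<close>

lemma contract_wedge:
  "contract v (wedge (ext_vec w) y) = (v \<bullet> w) *\<^sub>R y - wedge (ext_vec w) (contract v y)"
proof (rule bilinear_eq_axis[where f="\<lambda>v w. contract v (wedge (ext_vec w) y)"])
  show "bilinear (\<lambda>v w. contract v (wedge (ext_vec w) y))"
    "bilinear (\<lambda>v w. (v \<bullet> w) *\<^sub>R y - wedge (ext_vec w) (contract v y))"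
    by (auto simp: bilinear_def intro!: linearI
        simp: ext_vec_simps wedge_linear_simps bilinear_ladd[OF bilinear_contract] bilinear_radd[OF bilinear_contract]
          bilinear_lmul[OF bilinear_contract] bilinear_rmul[OF bilinear_contract] algebra_simps inner_add_left inner_add_right)
  show "contract (axis i 1) (wedge (ext_vec (axis j 1)) y) =
      (axis i 1 \<bullet> axis j (1::real)) *\<^sub>R y - wedge (ext_vec (axis j 1)) (contract (axis i 1) y)" for i j
  proof (cases "i = j")
    case True
    then show ?thesis
      by (auto simp: vec_eq_iff contract_axis_nth ext_vec_axis wedge_axis_nth insert_absorb)
  next
    case False
    have "contract (axis i 1) (wedge (axis {j} 1) y) $ S = - wedge (axis {j} 1) (contract (axis i 1) y) $ S" for S
    proof (cases "i \<notin> S \<and> j \<in> S")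
      case True
      define T where "T = S - {j}"
      have S: "S = insert j T" "i \<notin> T" "j \<notin> T" using True by (auto simp: T_def)
      have 1: "insert i S - {j} = insert i T" "S - {j} = T" using S False by auto
      show ?thesis
        using False S True by (simp add: contract_axis_nth wedge_axis_nth 1 insert_sign_insert del: insert_Diff_single)
          (use False in \<open>auto simp: insert_Diff_if insert_sign_insert\<close>)
    qed (use False in \<open>auto simp: contract_axis_nth wedge_axis_nth\<close>)
    then show ?thesis using False
      by (simp add: vec_eq_iff ext_vec_axis inner_axis_axis)
  qed
qed

lemma contract_ext_one: "contract v ext_one = 0"
proof (rule linear_eq_axis[where f="\<lambda>v. contract v ext_one" and g="\<lambda>_. 0"])
  show "linear (\<lambda>v. contract v ext_one)" by (rule bilinear_contract[unfolded bilinear_def, THEN conjunct2, rule_format])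
qed (auto simp: vec_eq_iff contract_axis_nth ext_one_def axis_nth_if linear_zero)

lemma inner_ext_one_wedge: "ext_one \<bullet> wedge (ext_vec v) z = 0"
  using inner_contract[of z v ext_one] by (simp add: contract_ext_one inner_commute)

text \<open>Degree 0 is untouched by \<open>ext_map\<close>, and \<open>ext_one\<close> is
  orthogonal to all products with a vector factor. This is the base case of
  \<open>adjoint_ext_map\<close>.\<close>

lemma inner_ext_one_ext_map:
  assumes "linear \<psi>"
  shows "ext_one \<bullet> ext_map \<psi> y = ext_one \<bullet> y"
proof (rule linear_eq_wedge_list[where f="\<lambda>y. ext_one \<bullet> ext_map \<psi> y"])
  show "linear (\<lambda>y. ext_one \<bullet> ext_map \<psi> y)" "linear (\<lambda>y. ext_one \<bullet> y)"
    by (auto intro!: linearI simp: linear_add[OF linear_ext_map] linear_cmul[OF linear_ext_map] inner_add_right)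
  show "ext_one \<bullet> ext_map \<psi> (wedge_list vs) = ext_one \<bullet> wedge_list vs" for vs
  proof (cases vs)
    case Nil
    then show ?thesis by (simp add: ext_map_one) (simp add: ext_one_def inner_axis_axis)
  next
    case (Cons w ws)
    then show ?thesis using assms by (simp add: ext_map_wedge_vec inner_ext_one_wedge)
  qed
qed

lemma contract_ext_map:
  fixes \<psi> :: "real ^ 'n::{finite,linorder} \<Rightarrow> real ^ 'm::{finite,linorder}"
  assumes "linear \<psi>"
  shows "contract v (ext_map \<psi> y) = ext_map \<psi> (contract (adjoint \<psi> v) y)"
proof (rule linear_eq_wedge_list[where f="\<lambda>y. contract v (ext_map \<psi> y)"])
  have lc: "linear (contract u)" for u :: "real ^ 'k::{finite,linorder}"
    using bilinear_contract by (auto simp: bilinear_def)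
  show "linear (\<lambda>y. contract v (ext_map \<psi> y))" "linear (\<lambda>y. ext_map \<psi> (contract (adjoint \<psi> v) y))"
    using linear_compose[OF linear_ext_map lc] linear_compose[OF lc linear_ext_map] by (auto simp: o_def)
  show "contract v (ext_map \<psi> (wedge_list vs)) = ext_map \<psi> (contract (adjoint \<psi> v) (wedge_list vs))" for vs
    by (induction vs) (simp_all add: contract_ext_one ext_map_one linear_0[OF linear_ext_map] ext_map_wedge_vec[OF assms]
        contract_wedge linear_diff[OF linear_ext_map] linear_cmul[OF linear_ext_map] adjoint_works[OF assms] inner_commute[of v]
        inner_commute[of "adjoint \<psi> v"])
qed

text \<open>Induction on the wedge list replaces the comparison of Gram determinants: a leading
  vector moves across the inner product as a contraction, and contraction commutes with induced maps
  by \<open>contract_ext_map\<close>.\<close>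

lemma adjoint_ext_map:
  fixes \<phi> :: "real ^ 'n::{finite,linorder} \<Rightarrow> real ^ 'm::{finite,linorder}"
  assumes "linear \<phi>"
  shows "adjoint (ext_map \<phi>) = ext_map (adjoint \<phi>)"
proof (rule adjoint_unique, intro allI)
  fix x y
  have l': "linear (adjoint \<phi>)" by (rule adjoint_linear[OF assms])
  show "ext_map \<phi> x \<bullet> y = x \<bullet> ext_map (adjoint \<phi>) y"
  proof (rule linear_eq_wedge_list[where f="\<lambda>x. ext_map \<phi> x \<bullet> y"])
    show "linear (\<lambda>x. ext_map \<phi> x \<bullet> y)"
      using linear_compose[OF linear_ext_map, of "\<lambda>z. z \<bullet> y" \<phi>] by (simp add: o_def bounded_linear.linear bounded_linear_inner_left)
    show "linear (\<lambda>x. x \<bullet> ext_map (adjoint \<phi>) y)"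
      by (simp add: bounded_linear.linear bounded_linear_inner_left)
    show "ext_map \<phi> (wedge_list vs) \<bullet> y = wedge_list vs \<bullet> ext_map (adjoint \<phi>) y" for vs
    proof (induction vs arbitrary: y)
      case Nil
      then show ?case by (simp add: ext_map_one inner_ext_one_ext_map[OF l'])
    next
      case (Cons v vs)
      have "ext_map \<phi> (wedge_list (v # vs)) \<bullet> y = ext_map \<phi> (wedge_list vs) \<bullet> contract (\<phi> v) y"
        by (simp add: ext_map_wedge_vec assms inner_contract)
      also have "\<dots> = wedge_list vs \<bullet> ext_map (adjoint \<phi>) (contract (\<phi> v) y)" by (rule Cons)
      also have "\<dots> = wedge_list vs \<bullet> contract v (ext_map (adjoint \<phi>) y)"
        by (simp add: contract_ext_map[OF l'] adjoint_adjoint[OF assms])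
      finally show ?case by (simp add: inner_contract)
    qed
  qed
qed


lemma wedge_one_right: "wedge x ext_one = x"
  by (rule linear_eq_wedge_list[where f="\<lambda>x. wedge x ext_one"])
    (use wedge_list_append[of _ "[]", symmetric] in \<open>auto simp: linear_wedge_left linear_iff\<close>)

text \<open>\<open>ext_map uminus\<close> is the grading involution.\<close>

lemma linear_uminus: "linear (uminus :: 'a::real_vector \<Rightarrow> 'a)"
  by (simp add: linear_iff)

lemma wedge_vec_right: "wedge x (ext_vec v) = wedge (ext_vec v) (ext_map uminus x)"
proof (rule linear_eq_wedge_list[where f="\<lambda>x. wedge x (ext_vec v)"])
  show "linear (\<lambda>x. wedge x (ext_vec v))" by (rule linear_wedge_left)
  show "linear (\<lambda>x. wedge (ext_vec v) (ext_map uminus x))"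
    using linear_compose[OF linear_ext_map linear_wedge_right] by (simp add: o_def)
  show "wedge (wedge_list ws) (ext_vec v) = wedge (ext_vec v) (ext_map uminus (wedge_list ws))" for ws
  proof (induction ws)
    case Nil
    then show ?case by (simp add: wedge_one_left wedge_one_right ext_map_one)
  next
    case (Cons w ws)
    have "wedge (wedge_list (w # ws)) (ext_vec v) = wedge (ext_vec w) (wedge (ext_vec v) (ext_map uminus (wedge_list ws)))"
      by (simp add: wedge_assoc Cons)
    also have "\<dots> = wedge (ext_vec v) (ext_map uminus (wedge_list (w # ws)))"
      by (subst wedge_anticommute) (simp add: ext_map_wedge_vec[OF linear_uminus] ext_vec_simps wedge_linear_simps)
    finally show ?case .
  qed
qed

section \<open>Simple vectors and the exterior algebra of a subspace\<close>

lemma simple_vectorsI: "length vs = d \<Longrightarrow> set vs \<subseteq> V \<Longrightarrow> wedge_list vs \<in> simple_vectors d V"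
  unfolding simple_vectors_def by (rule CollectI, rule exI[of _ 1]) auto

lemma simple_vectors_scale: "x \<in> simple_vectors d V \<Longrightarrow> a *\<^sub>R x \<in> simple_vectors d V"
  unfolding simple_vectors_def by (auto; metis scaleR_scaleR)

lemma simple_vectors_subset_ext_pow: "simple_vectors d V \<subseteq> ext_pow d V"
  unfolding simple_vectors_def ext_pow_def by (auto; rule span_scale, rule span_base, blast)

lemma subspace_ext_pow: "subspace (ext_pow d V)" and subspace_ext_carrier: "subspace (ext_carrier V)"
  by (simp_all add: ext_pow_def ext_carrier_def)

lemma ext_pow_subset_carrier: "ext_pow d V \<subseteq> ext_carrier V"
  unfolding ext_pow_def ext_carrier_def by (rule span_mono) auto

lemma ext_map_simple:
  assumes "linear \<phi>" "\<phi> ` V \<subseteq> W" "x \<in> simple_vectors d V"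
  shows "ext_map \<phi> x \<in> simple_vectors d W"
proof -
  obtain a vs where "x = a *\<^sub>R wedge_list vs" "length vs = d" "set vs \<subseteq> V"
    using assms(3) by (auto simp: simple_vectors_def)
  moreover have "ext_map \<phi> x = a *\<^sub>R wedge_list (map \<phi> vs)"
    using calculation(1) by (simp only: linear_cmul[OF linear_ext_map] ext_map_wedge_list[OF assms(1)])
  moreover have "\<phi> v \<in> W" if "v \<in> set vs" for v using that calculation(3) assms(2) by auto
  ultimately show ?thesis
    by (simp only:, intro simple_vectors_scale simple_vectorsI) auto
qed

lemma ext_map_span:
  assumes "linear \<phi>" "\<phi> ` V \<subseteq> W"
  shows "x \<in> ext_pow d V \<Longrightarrow> ext_map \<phi> x \<in> ext_pow d W"
    and "x \<in> ext_carrier V \<Longrightarrow> ext_map \<phi> x \<in> ext_carrier W"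
proof -
  have *: "ext_map \<phi> ` span A \<subseteq> span B" if "ext_map \<phi> ` A \<subseteq> B" for A B
    by (metis linear_ext_map linear_span_image span_mono that)
  have vs: "set (map \<phi> vs) \<subseteq> W" if "set vs \<subseteq> V" for vs
    using that assms(2) by auto
  have "ext_map \<phi> ` {wedge_list vs | vs. length vs = d \<and> set vs \<subseteq> V}
      \<subseteq> {wedge_list vs | vs. length vs = d \<and> set vs \<subseteq> W}"
    using vs ext_map_wedge_list[OF assms(1)] by (blast intro: length_map)
  from *[OF this] show "x \<in> ext_pow d V \<Longrightarrow> ext_map \<phi> x \<in> ext_pow d W"
    unfolding ext_pow_def by blast
  have "ext_map \<phi> ` {wedge_list vs | vs. set vs \<subseteq> V} \<subseteq> {wedge_list vs | vs. set vs \<subseteq> W}"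
    using vs ext_map_wedge_list[OF assms(1)] by blast
  from *[OF this] show "x \<in> ext_carrier V \<Longrightarrow> ext_map \<phi> x \<in> ext_carrier W"
    unfolding ext_carrier_def by blast
qed

lemma ext_map_in_carrier:
  assumes "linear \<phi>" "range \<phi> \<subseteq> W"
  shows "ext_map \<phi> x \<in> ext_carrier W"
proof -
  have "x \<in> ext_carrier UNIV"
  proof -
    have "(Basis :: 'a ext set) \<subseteq> {wedge_list vs | vs. set vs \<subseteq> UNIV}"
      using axis_eq_wedge_list by (auto simp: Basis_vec_def)
    then have "span (Basis :: 'a ext set) \<subseteq> ext_carrier UNIV" unfolding ext_carrier_def by (rule span_mono)
    then show ?thesis by auto
  qed
  then show ?thesis using ext_map_span(2)[OF assms(1)] assms(2) by blast
qed

lemma ext_map_id_on: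
  assumes "linear \<phi>" "\<And>v. v \<in> V \<Longrightarrow> \<phi> v = v" "x \<in> ext_carrier V"
  shows "ext_map \<phi> x = x"
  using assms(3) unfolding ext_carrier_def
proof (induction rule: span_induct)
  case (step x)
  then show ?case using assms(1,2) by (auto simp: ext_map_wedge_list subset_iff map_idI)
next
  show "subspace {x. ext_map \<phi> x = x}"
    by (auto simp: subspace_def linear_add[OF linear_ext_map] linear_cmul[OF linear_ext_map] linear_0[OF linear_ext_map])
qed

text \<open>The coordinates of \<open>wedge_list vs\<close> vanish at sets whose cardinality is not
  the length of \<open>vs\<close>. So the projection to a degree keeps or kills a wedge product
  according to its length, which \<open>ext_map\<close> does not change.\<close>

lemma ext_map_component: 
  assumes "linear \<phi>"
  shows "ext_component d (ext_map \<phi> x) = ext_map \<phi> (ext_component d x)"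
proof -
  have lc: "linear (ext_component d :: 'k::finite ext \<Rightarrow> _)" for d
    by (auto intro!: linearI simp: ext_component_def vec_eq_iff)
  have z: "wedge_list vs $ S = 0" if "card S \<noteq> length vs" for vs :: "(real ^ 'k::{finite,linorder}) list" and S
    using that
  proof (induction vs arbitrary: S)
    case Nil
    then show ?case by (auto simp: ext_one_def axis_nth_if)
  next
    case (Cons v vs)
    have "wedge (ext_vec v) (wedge_list vs) $ S = (\<lambda>_. 0 :: real) v"
    proof (rule linear_eq_axis[where f="\<lambda>v. wedge (ext_vec v) (wedge_list vs) $ S" and g="\<lambda>_. 0"])
      show "linear (\<lambda>v. wedge (ext_vec v) (wedge_list vs) $ S)"
        by (auto intro!: linearI simp: ext_vec_simps wedge_linear_simps)
      show "wedge (ext_vec (axis i 1)) (wedge_list vs) $ S = 0" for i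
        using Cons.prems
        by (auto simp: ext_vec_axis wedge_axis_nth intro!: Cons.IH)
          (metis Suc_pred card_gt_0_iff empty_iff finite_class.finite)
    qed (simp add: linear_zero)
    then show ?case by simp
  qed
  have w: "ext_component d (wedge_list vs) = (if length vs = d then wedge_list vs else 0)"
    for vs :: "(real ^ 'k::{finite,linorder}) list"
    by (auto simp: vec_eq_iff ext_component_def z)
  show ?thesis
  proof (rule linear_eq_wedge_list[where f="\<lambda>x. ext_component d (ext_map \<phi> x)"])
    show "linear (\<lambda>x. ext_component d (ext_map \<phi> x))" "linear (\<lambda>x. ext_map \<phi> (ext_component d x))"
      using linear_compose[OF linear_ext_map lc] linear_compose[OF lc linear_ext_map] by (simp_all add: o_def)
  qed (simp add: ext_map_wedge_list assms w linear_0[OF linear_ext_map])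
qed

lemma wedge_simple:
  assumes "x \<in> simple_vectors p V" "y \<in> simple_vectors q V"
  shows "wedge x y \<in> simple_vectors (p + q) V"
proof -
  obtain a vs b ws where "x = a *\<^sub>R wedge_list vs" "length vs = p" "set vs \<subseteq> V"
    "y = b *\<^sub>R wedge_list ws" "length ws = q" "set ws \<subseteq> V"
    using assms by (auto simp: simple_vectors_def)
  then show ?thesis
    by (auto simp: wedge_linear_simps wedge_list_append[symmetric] intro!: simple_vectors_scale simple_vectorsI)
qed

lemma contract_orthogonal:
  "\<forall>r\<in>set rs. v \<bullet> r = 0 \<Longrightarrow> contract v (wedge_list rs) = 0"
  by (induction rs) (simp_all add: contract_ext_one contract_wedge wedge_linear_simps)

text \<open>The elementary operations that leave a wedge product unchanged (adding a multiple of
  another factor, swapping two factors with a sign) make all factors but the first orthogonal to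
  \<open>v\<close> without leaving \<open>V\<close>.\<close>

lemma wedge_list_orthogonalize:
  assumes V: "subspace V" and "set (w # ws) \<subseteq> V"
  shows "\<exists>r rs. length rs = length ws \<and> set (r # rs) \<subseteq> V \<and> (\<forall>s\<in>set rs. v \<bullet> s = 0) \<and>
    wedge_list (w # ws) = wedge_list (r # rs)"
  using assms(2)
proof (induction ws arbitrary: w)
  case Nil
  then show ?case by (intro exI[of _ w] exI[of _ "[]"]) auto
next
  case (Cons a ws)
  then obtain r rs where r: "length rs = length ws" "set (r # rs) \<subseteq> V" "\<forall>s\<in>set rs. v \<bullet> s = 0"
    "wedge_list (a # ws) = wedge_list (r # rs)" by (meson set_subset_Cons subset_trans)
  have w: "w \<in> V" using Cons.prems by auto
  have eq: "wedge_list (w # a # ws) = wedge (ext_vec w) (wedge (ext_vec r) (wedge_list rs))"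
    using r(4) by simp
  show ?case
  proof (cases "v \<bullet> w = 0")
    \<comment> \<open>Here \<open>w\<close> is orthogonal to \<open>v\<close> and goes behind
      \<open>r\<close>; the sign of the swap is absorbed into \<open>- r\<close>.\<close>
    case True
    have "wedge_list (w # a # ws) = wedge_list ((- r) # w # rs)"
      unfolding eq by (subst wedge_anticommute) (simp add: ext_vec_simps wedge_linear_simps)
    then show ?thesis using r w V True
      by (intro exI[of _ "- r"] exI[of _ "w # rs"]) (auto simp: subspace_neg)
  next
    case False
    \<comment> \<open>The multiple of \<open>w\<close> is chosen such that the second factor becomes
      orthogonal to \<open>v\<close>; now \<open>w\<close> is the exceptional factor.\<close>
    define r' where "r' = r - ((v \<bullet> r) / (v \<bullet> w)) *\<^sub>R w"
    have "wedge_list (w # a # ws) = wedge_list (w # r' # rs)"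
      unfolding eq by (simp add: r'_def ext_vec_simps wedge_linear_simps wedge_square)
    moreover have "v \<bullet> r' = 0" using False by (simp add: r'_def inner_diff_right)
    moreover have "r' \<in> V" using r w V by (auto simp: r'_def subspace_diff subspace_scale)
    ultimately show ?thesis using r w by (intro exI[of _ w] exI[of _ "r' # rs"]) auto
  qed
qed

text \<open>After orthogonalisation only the first factor meets \<open>v\<close>, so contraction
  deletes it and multiplies by \<open>v \<bullet> r\<close>.\<close>

lemma contract_simple:
  assumes V: "subspace V" and "x \<in> simple_vectors (Suc d) V"
  shows "contract v x \<in> simple_vectors d V"
proof -
  obtain a w ws where x: "x = a *\<^sub>R wedge_list (w # ws)" "length ws = d" "set (w # ws) \<subseteq> V"
    using assms by (auto simp: simple_vectors_def length_Suc_conv)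
  obtain r rs where r: "length rs = length ws" "set (r # rs) \<subseteq> V" "\<forall>s\<in>set rs. v \<bullet> s = 0"
    "wedge_list (w # ws) = wedge_list (r # rs)"
    using wedge_list_orthogonalize[OF V x(3)] by blast
  have "contract v x = (a * (v \<bullet> r)) *\<^sub>R wedge_list rs"
    using r by (simp add: x bilinear_rmul[OF bilinear_contract] contract_wedge contract_orthogonal wedge_linear_simps)
  then show ?thesis using r x by (auto intro!: simple_vectors_scale simple_vectorsI)
qed

lemma adjoint_uminus: "adjoint (uminus :: 'a::euclidean_space \<Rightarrow> 'a) = uminus"
  by (rule adjoint_unique) simp

text \<open>Multiplication by a simple vector is a composition of multiplications by vectors, so its
  adjoint is an iterated contraction, and each contraction keeps simple vectors simple.\<close>

lemma adjoint_wedge_simple: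
  assumes V: "subspace V" and z: "z \<in> simple_vectors q V" and u: "u \<in> simple_vectors (p + q) V"
  shows "adjoint (wedge z) u \<in> simple_vectors p V"
    and "adjoint (\<lambda>x. wedge x z) u \<in> simple_vectors p V"
proof -
  obtain a zs where zs: "z = a *\<^sub>R wedge_list zs" "length zs = q" "set zs \<subseteq> V"
    using z by (auto simp: simple_vectors_def)
  have "\<exists>u'\<in>simple_vectors p V. \<forall>x. wedge (wedge_list zs) x \<bullet> u = x \<bullet> u'"
    using zs(2) u
  proof (induction zs arbitrary: q u)
    case Nil
    then show ?case by (auto simp: wedge_one_left)
  next
    case (Cons z zs)
    then have "contract z u \<in> simple_vectors (p + length zs) V"
      using contract_simple[OF V, of u "p + length zs"] by auto
    from Cons.IH[OF refl this] obtain u' where "u' \<in> simple_vectors p V"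
      "\<forall>x. wedge (wedge_list zs) x \<bullet> contract z u = x \<bullet> u'" by blast
    then show ?case by (auto simp: wedge_assoc inner_contract)
  qed
  then obtain u' where u': "u' \<in> simple_vectors p V" "\<forall>x. wedge (wedge_list zs) x \<bullet> u = x \<bullet> u'" by blast
  have "adjoint (wedge z) u = a *\<^sub>R u'"
    using u' adjoint_works[OF linear_wedge_right, of _ z u]
    by (subst vector_eq_ldot[symmetric]) (auto simp: zs wedge_linear_simps)
  then show "adjoint (wedge z) u \<in> simple_vectors p V" using u' by (simp add: simple_vectors_scale)
  have "\<exists>u'\<in>simple_vectors p V. \<forall>x. wedge x (wedge_list zs) \<bullet> u = x \<bullet> u'"
    using zs(2) u
  proof (induction zs arbitrary: p q)
    case Nil
    then show ?case by (auto simp: wedge_one_right)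
  next
    case (Cons z zs)
    from Cons.prems have "u \<in> simple_vectors (Suc p + length zs) V" by auto
    from Cons.IH[OF refl this] obtain u' where u': "u' \<in> simple_vectors (Suc p) V"
      "\<forall>x. wedge x (wedge_list zs) \<bullet> u = x \<bullet> u'" by blast
    \<comment> \<open>Multiplication by a vector from the right is multiplication from the left
      after the grading involution, which is its own adjoint.\<close>
    let ?u = "ext_map uminus (contract z u')"
    have "wedge x (wedge_list (z # zs)) \<bullet> u = x \<bullet> ?u" for x
    proof -
      have "wedge x (wedge_list (z # zs)) \<bullet> u = ext_map uminus x \<bullet> contract z u'"
        using u' by (simp add: wedge_assoc[symmetric] inner_contract) (simp add: wedge_vec_right)
      also have "\<dots> = x \<bullet> ?u"
        using adjoint_works[OF linear_ext_map, of x uminus "contract z u'"]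
        by (simp add: adjoint_ext_map[OF linear_uminus] adjoint_uminus inner_commute)
      finally show ?thesis .
    qed
    moreover have "?u \<in> simple_vectors p V"
      using contract_simple[OF V u'(1)] subspace_neg[OF V] by (intro ext_map_simple[OF linear_uminus, of V]) auto
    ultimately show ?case by blast
  qed
  then obtain u' where u': "u' \<in> simple_vectors p V" "\<forall>x. wedge x (wedge_list zs) \<bullet> u = x \<bullet> u'" by blast
  have "adjoint (\<lambda>x. wedge x z) u = a *\<^sub>R u'"
    using u' adjoint_works[OF linear_wedge_left, of _ z u]
    by (subst vector_eq_ldot[symmetric]) (auto simp: zs wedge_linear_simps)
  then show "adjoint (\<lambda>x. wedge x z) u \<in> simple_vectors p V" using u' by (simp add: simple_vectors_scale)
qed

section \<open>Bilinear extension on spaces of functions\<close>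

text \<open>Virtual bodies are real functions. This structure provides spans, independent subsets
  and linear extension from a basis for them.\<close>

interpretation fun_space: vector_space "\<lambda>(a::real) (f :: 'a \<Rightarrow> real) x. a * f x"
  by unfold_locales (auto simp: fun_eq_iff algebra_simps)

interpretation fun_functional: vector_space_pair "\<lambda>(a::real) (f :: 'a \<Rightarrow> real) x. a * f x" "(*) :: real \<Rightarrow> real \<Rightarrow> real"
proof -
  have "vector_space ((*) :: real \<Rightarrow> real \<Rightarrow> real)" by standard (simp_all add: algebra_simps)
  then show "vector_space_pair (\<lambda>(a::real) (f :: 'a \<Rightarrow> real) x. a * f x) ((*) :: real \<Rightarrow> real \<Rightarrow> real)"
    by (rule vector_space_pair.intro[OF fun_space.vector_space_axioms])
qed

definition linear_functional_on :: "('a \<Rightarrow> real) set \<Rightarrow> (('a \<Rightarrow> real) \<Rightarrow> real) \<Rightarrow> bool" where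
  "linear_functional_on T L \<longleftrightarrow>
     (\<forall>h\<in>T. \<forall>k\<in>T. \<forall>a b. L (\<lambda>u. a * h u + b * k u) = a * L h + b * L k)"

lemma fun_subspace_iff:
  "fun_space.subspace T \<longleftrightarrow> T \<noteq> {} \<and> (\<forall>h\<in>T. \<forall>k\<in>T. \<forall>a b. (\<lambda>u. a * h u + b * k u) \<in> T)" (is "_ \<longleftrightarrow> ?R")
proof
  assume T: "fun_space.subspace T"
  have "(\<lambda>u. a * h u + b * k u) \<in> T" if "h \<in> T" "k \<in> T" for h k a b
  proof -
    have "(\<lambda>u. a * h u) + (\<lambda>u. b * k u) \<in> T"
      using T that by (intro fun_space.subspace_add fun_space.subspace_scale)
    then show ?thesis by (simp add: plus_fun_def)
  qed
  moreover have "T \<noteq> {}" using fun_space.subspace_0[OF T] by blast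
  ultimately show ?R by (intro conjI ballI allI)
next
  assume R: ?R
  have comb: "(\<lambda>u. a * h u + b * k u) \<in> T" if "h \<in> T" "k \<in> T" for h k a b
    by (rule R[THEN conjunct2, THEN bspec, THEN bspec, THEN spec, THEN spec, OF that])
  obtain h where "h \<in> T" using R by blast
  with comb[of h h 0 0] have "(\<lambda>u. 0) \<in> T" by simp
  moreover have "h + k \<in> T" if "h \<in> T" "k \<in> T" for h k
    using comb[OF that, of 1 1] by (simp add: plus_fun_def)
  moreover have "(\<lambda>u. c * h u) \<in> T" if "h \<in> T" for h c
    using comb[OF that that, of c 0] by simp
  ultimately show "fun_space.subspace T" by (auto simp: fun_space.subspace_def zero_fun_def)
qed

lemma fun_span_comb:
  "h \<in> fun_space.span A \<Longrightarrow> k \<in> fun_space.span A \<Longrightarrow> (\<lambda>u. a * h u + b * k u) \<in> fun_space.span A"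
  by (rule fun_space.subspace_span[of A, unfolded fun_subspace_iff, THEN conjunct2, THEN bspec, THEN bspec, THEN spec, THEN spec])

lemma fun_span_induct [consumes 1, case_names base comb]:
  assumes "h \<in> fun_space.span A"
    and "\<And>h. h \<in> A \<Longrightarrow> P h"
    and "\<And>h k a b. h \<in> fun_space.span A \<Longrightarrow> k \<in> fun_space.span A \<Longrightarrow> P h \<Longrightarrow> P k \<Longrightarrow> P (\<lambda>u. a * h u + b * k u)"
    and "P (\<lambda>_. 0)"
  shows "P h"
proof -
  have "h \<in> fun_space.span A \<and> P h"
    using assms(1)
  proof (induction rule: fun_space.span_induct)
    show "fun_space.subspace {x. x \<in> fun_space.span A \<and> P x}"
      unfolding fun_subspace_iff
    proof (intro conjI ballI allI)
      have "(\<lambda>_. 0) \<in> {x. x \<in> fun_space.span A \<and> P x}"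
        using fun_space.span_zero[of A] assms(4) by (simp add: zero_fun_def)
      then show "{x. x \<in> fun_space.span A \<and> P x} \<noteq> {}" by blast
    qed (simp add: fun_span_comb assms(3))
  qed (use assms(2) in \<open>auto intro: fun_space.span_base\<close>)
  then show ?thesis by simp
qed

lemma linear_functional_on_eq:
  assumes "linear_functional_on (fun_space.span A) L" "linear_functional_on (fun_space.span A) R"
    "\<And>h. h \<in> A \<Longrightarrow> L h = R h" "h \<in> fun_space.span A"
  shows "L h = R h"
  using assms(4)
proof (induction rule: fun_span_induct)
  case (comb h k a b)
  then show ?case using assms(1,2) by (simp add: linear_functional_on_def)
next
  have "L (\<lambda>_. 0) = 0" if "linear_functional_on (fun_space.span A) L" for L
    using that[unfolded linear_functional_on_def, rule_format, of "0" "0" 0 0]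
      fun_space.span_zero[of A] by (simp add: zero_fun_def)
  from this[OF assms(1)] this[OF assms(2)] show "L (\<lambda>_. 0) = R (\<lambda>_. 0)" by simp
qed (use assms(3) in blast)

lemma linear_functional_on_subset: "linear_functional_on T L \<Longrightarrow> S \<subseteq> T \<Longrightarrow> linear_functional_on S L"
  by (auto simp: linear_functional_on_def subset_iff)

lemma lin_span_eq_span: "lin_span S = fun_space.span S"
proof
  have "(\<lambda>u. \<Sum>i<n. a i * k i u) \<in> fun_space.span S" if "\<forall>i<n. k i \<in> S" for n :: nat and a k
    using that
  proof (induction n)
    case 0
    then show ?case using fun_space.span_zero[of S] by (simp add: zero_fun_def)
  next
    case (Suc n)
    then have "(\<lambda>u. \<Sum>i<n. a i * k i u) \<in> fun_space.span S" "k n \<in> fun_space.span S"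
      by (auto intro: fun_space.span_base)
    from fun_span_comb[OF this, of 1 "a n"] show ?case by simp
  qed
  then show "lin_span S \<subseteq> fun_space.span S" by (auto simp: lin_span_def)
  show "fun_space.span S \<subseteq> lin_span S"
  proof
    fix h assume "h \<in> fun_space.span S"
    then show "h \<in> lin_span S"
    proof (induction rule: fun_space.span_induct_alt)
      case base
      show ?case unfolding lin_span_def by (rule CollectI) (rule exI[of _ 0], auto simp: zero_fun_def)
    next
      case (step c x y)
      then obtain n :: nat and a k where y: "y = (\<lambda>u. \<Sum>i<n. a i * k i u)" "\<forall>i<n. k i \<in> S"
        by (auto simp: lin_span_def)
      show ?case unfolding lin_span_def
        by (rule CollectI, rule exI[of _ "Suc n"], rule exI[of _ "a(n := c)"], rule exI[of _ "k(n := x)"])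
          (use y step(1) in \<open>auto simp: fun_eq_iff less_Suc_eq\<close>)
    qed
  qed
qed

text \<open>Both one-sided linear extensions together allow to extend by zero on a complement of the spans.\<close>

lemma bilinear_extension:
  fixes A :: "('a \<Rightarrow> real) set" and A' :: "('b \<Rightarrow> real) set"
  assumes L: "\<And>x. x \<in> A \<Longrightarrow> linear_functional_on (fun_space.span A') (L x)"
    and R: "\<And>y. y \<in> A' \<Longrightarrow> linear_functional_on (fun_space.span A) (R y)"
    and LR: "\<And>x y. x \<in> A \<Longrightarrow> y \<in> A' \<Longrightarrow> L x y = R y x"
  shows "\<exists>B. bilinear_on UNIV UNIV B \<and> (\<forall>x\<in>A. \<forall>y\<in>A'. B x y = L x y)"
proof -
  obtain E where E: "E \<subseteq> A" "fun_space.independent E" "A \<subseteq> fun_space.span E"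
    using fun_space.maximal_independent_subset by blast
  obtain E' where E': "E' \<subseteq> A'" "fun_space.independent E'" "A' \<subseteq> fun_space.span E'"
    using fun_space.maximal_independent_subset by blast
  have span: "fun_space.span E = fun_space.span A" "fun_space.span E' = fun_space.span A'"
    by (intro subset_antisym fun_space.span_mono fun_space.span_minimal E E' fun_space.subspace_span)+
  let ?c = "fun_functional.construct"
  have lin: "linear_functional_on UNIV (?c F g)" if "fun_space.independent F" for F and g :: "('c \<Rightarrow> real) \<Rightarrow> real"
  proof -
    interpret c: Vector_Spaces.linear "\<lambda>(a::real) (f :: 'c \<Rightarrow> real) x. a * f x" "(*) :: real \<Rightarrow> real \<Rightarrow> real" "?c F g"
      by (rule fun_functional.linear_construct[OF that])
    show ?thesis unfolding linear_functional_on_def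
      using c.add c.scale by (auto simp: plus_fun_def)
  qed
  define B where "B h k = ?c E (\<lambda>b. ?c E' (L b) k) h" for h k
  have "bilinear_on UNIV UNIV B"
    unfolding bilinear_on_def
  proof (intro conjI ballI allI)
    fix h h' :: "'a \<Rightarrow> real" and k k' :: "'b \<Rightarrow> real" and a b :: real
    show "B (\<lambda>u. a * h u + b * h' u) k = a * B h k + b * B h' k"
      using lin[OF E(2)] by (simp add: B_def linear_functional_on_def)
    have "(\<lambda>x. ?c E' (L x) (\<lambda>u. a * k u + b * k' u)) = (\<lambda>x. a * ?c E' (L x) k + b * ?c E' (L x) k')"
      using lin[OF E'(2)] by (simp add: fun_eq_iff linear_functional_on_def)
    then show "B h (\<lambda>u. a * k u + b * k' u) = a * B h k + b * B h k'"
      by (simp add: B_def fun_functional.construct_add[OF E(2)] fun_functional.construct_scale[OF E(2)])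
  qed
  moreover have "B x y = L x y" if "x \<in> A" "y \<in> A'" for x y
  proof -
    have 1: "?c E' (L b) y = L b y" if "b \<in> E" for b
      by (rule linear_functional_on_eq[where A=E'])
        (use that E E' \<open>y \<in> A'\<close> span L lin[OF E'(2)] in
          \<open>auto simp: fun_functional.construct_basis intro: linear_functional_on_subset[of UNIV]\<close>)
    \<comment> \<open>For fixed \<open>y\<close>, linearity in the first argument is known only
      through \<open>R y\<close>, which agrees on the basis \<open>E\<close> with the values that
      enter \<open>B\<close>; hence the detour over \<open>R\<close>.\<close>
    have "B x y = R y x" unfolding B_def
      by (rule linear_functional_on_eq[where A=E])
        (use that E E' span R LR lin[OF E(2)] in
          \<open>auto simp: fun_functional.construct_basis 1 intro: linear_functional_on_subset[of UNIV]\<close>)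
    then show ?thesis using LR that by simp
  qed
  ultimately show ?thesis by blast
qed

section \<open>Support functions and zonoids\<close>

lemma compact_body_of:
  fixes h :: "'a::euclidean_space \<Rightarrow> real"
  assumes "\<And>u. h u \<le> C * norm u"
  shows "compact (body_of h)" "convex (body_of h)"
proof -
  have eq: "body_of h = (\<Inter>u. {x. u \<bullet> x \<le> h u})" by (auto simp: body_of_def inner_commute)
  have "closed (body_of h)" unfolding eq by (intro closed_INT ballI closed_halfspace_le)
  moreover have "body_of h \<subseteq> cball 0 \<bar>C\<bar>"
  proof
    fix x assume "x \<in> body_of h"
    then have "x \<bullet> x \<le> C * norm x" using assms[of x] by (auto simp: body_of_def intro: order_trans)
    then have "norm x * norm x \<le> \<bar>C\<bar> * norm x"
      by (simp add: dot_square_norm power2_eq_square) (meson abs_ge_self mult_right_mono norm_ge_zero order_trans)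
    then show "x \<in> cball 0 \<bar>C\<bar>" by (cases "x = 0") auto
  qed
  ultimately show "compact (body_of h)"
    using bounded_subset[OF bounded_cball] by (auto simp: compact_eq_bounded_closed)
  show "convex (body_of h)" unfolding eq by (intro convex_INT ballI convex_halfspace_le)
qed

lemma subset_if_support_le:
  fixes A B :: "'a::euclidean_space set"
  assumes "compact A" "compact B" "convex B" "B \<noteq> {}" "\<And>u. support A u \<le> support B u"
  shows "A \<subseteq> B"
proof -
  have "A \<subseteq> body_of (support B)"
  proof
    fix x assume "x \<in> A"
    then have "x \<bullet> u \<le> support A u" for u
      unfolding support_def by (auto intro!: cSUP_upper support_bdd assms)
    then show "x \<in> body_of (support B)" unfolding body_of_def using assms(5) order_trans by blast
  qed
  then show ?thesis using body_of_support assms by metis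
qed

lemma support_cball: "e \<ge> 0 \<Longrightarrow> support (cball (0::'a::euclidean_space) e) u = e * norm u"
proof (rule support_eqI[of "if u = 0 then 0 else (e / norm u) *\<^sub>R u"])
  assume "e \<ge> 0"
  then show "y \<bullet> u \<le> e * norm u" if "y \<in> cball 0 e" for y
    using that Cauchy_Schwarz_ineq2[of y u] mult_right_mono[of "norm y" e "norm u"] by auto
qed (auto simp: dot_square_norm power2_eq_square)

lemma support_segment: "support (closed_segment (0::'a::euclidean_space) p) u = max 0 (u \<bullet> p)"
proof (rule support_eqI[of "if u \<bullet> p \<ge> 0 then p else 0"])
  show "y \<bullet> u \<le> max 0 (u \<bullet> p)" if y: "y \<in> closed_segment 0 p" for y
  proof -
    obtain t where "0 \<le> t" "t \<le> 1" "y = t *\<^sub>R p" using y by (auto simp: closed_segment_def)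
    then show ?thesis
      using mult_left_le_one_le[of "u \<bullet> p" t] mult_nonneg_nonpos[of t "u \<bullet> p"]
      by (cases "u \<bullet> p \<ge> 0") (auto simp: inner_commute)
  qed
qed (auto simp: inner_commute)

lemma support_sing: "support {p} u = p \<bullet> u"
  by (rule support_eqI[of p]) auto

lemma compact_plus:
  fixes S T :: "'a::euclidean_space set"
  shows "compact S \<Longrightarrow> compact T \<Longrightarrow> compact (S + T)"
proof -
  assume ST: "compact S" "compact T"
  have "S + T = {x + y | x y. x \<in> S \<and> y \<in> T}" by (auto simp: set_plus_def)
  then show "compact (S + T)" using compact_sums[OF ST] by simp
qed

section \<open>Closure properties of zonotopes and zonoids\<close>

lemma zonotope_props:
  fixes a b :: "nat \<Rightarrow> 'a::euclidean_space"
  shows "compact (\<Sum>i<n. closed_segment (a i) (b i)) \<and> convex (\<Sum>i<n. closed_segment (a i) (b i)) \<and>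
    (\<Sum>i<n. closed_segment (a i) (b i)) \<noteq> {} \<and>
    (\<forall>u. support (\<Sum>i<n. closed_segment (a i) (b i)) u = (\<Sum>i<n. support (closed_segment (a i) (b i)) u))"
proof (induction n)
  case 0
  then show ?case by (simp add: set_zero[where 'a='a] support_sing)
next
  case (Suc n)
  define P where "P = (\<Sum>i<n. closed_segment (a i) (b i))"
  define Q where "Q = closed_segment (a n) (b n)"
  have P: "compact P" "convex P" "P \<noteq> {}" "\<And>u. support P u = (\<Sum>i<n. support (closed_segment (a i) (b i)) u)"
    using Suc by (simp_all add: P_def)
  have Q: "compact Q" "convex Q" "Q \<noteq> {}" by (simp_all add: Q_def)
  have eq: "(\<Sum>i<Suc n. closed_segment (a i) (b i)) = P + Q" by (simp add: P_def Q_def)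
  obtain p q where "p \<in> P" "q \<in> Q" using P(3) Q(3) by blast
  then have "p + q \<in> P + Q" by (rule set_plus_intro)
  then have "P + Q \<noteq> {}" by blast
  moreover have "support (P + Q) u = (\<Sum>i<Suc n. support (closed_segment (a i) (b i)) u)" for u
    unfolding support_Minkowski_sum[OF P(1,3) Q(1,3)] P(4) by (simp add: Q_def)
  ultimately show ?case
    unfolding eq using compact_plus[OF P(1) Q(1)] convex_set_plus[OF P(2) Q(2)] by blast
qed

lemma zonotope_cases:
  assumes "zonotope S" shows "compact S" "convex S" "S \<noteq> {}"
proof -
  obtain n a b where "S = (\<Sum>i<n::nat. closed_segment (a i) (b i))"
    using assms by (auto simp: zonotope_def)
  then show "compact S" "convex S" "S \<noteq> {}" using zonotope_props[where n=n and a=a and b=b] by auto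
qed

lemma zonotope_plus:
  fixes S T :: "'a::euclidean_space set"
  assumes "zonotope S" "zonotope T" shows "zonotope (S + T)"
proof -
  obtain n a b where S: "S = (\<Sum>i<n::nat. closed_segment (a i) (b i))"
    using assms(1) by (auto simp: zonotope_def)
  obtain m c d where T: "T = (\<Sum>i<m::nat. closed_segment (c i) (d i))"
    using assms(2) by (auto simp: zonotope_def)
  have "\<exists>n a b. S + (\<Sum>i<m::nat. closed_segment (c i) (d i)) = (\<Sum>i<n::nat. closed_segment (a i) (b i))" for m
  proof (induction m)
    case 0
    then show ?case by (intro exI[of _ n] exI[of _ a] exI[of _ b]) (simp add: S)
  next
    case (Suc m)
    then obtain k x y where k: "S + (\<Sum>i<m. closed_segment (c i) (d i)) = (\<Sum>i<k::nat. closed_segment (x i) (y i))" by auto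
    have "S + (\<Sum>i<Suc m. closed_segment (c i) (d i)) = (\<Sum>i<k. closed_segment (x i) (y i)) + closed_segment (c m) (d m)"
      by (simp add: k[symmetric] add.assoc)
    also have "\<dots> = (\<Sum>i<Suc k. closed_segment ((x(k := c m)) i) ((y(k := d m)) i))" by simp
    finally show ?case by (intro exI)
  qed
  then show ?thesis unfolding zonotope_def T .
qed

lemma scaleR_image_set_plus:
  "(*\<^sub>R) c ` (S + T) = (*\<^sub>R) c ` S + (*\<^sub>R) c ` (T :: 'a::real_vector set)"
proof (intro subset_antisym subsetI)
  fix x assume "x \<in> (*\<^sub>R) c ` (S + T)"
  then obtain s t where "s \<in> S" "t \<in> T" "x = c *\<^sub>R s + c *\<^sub>R t"
    by (auto elim!: set_plus_elim simp: scaleR_right_distrib)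
  then show "x \<in> (*\<^sub>R) c ` S + (*\<^sub>R) c ` T" by (auto intro!: set_plus_intro)
next
  fix x assume "x \<in> (*\<^sub>R) c ` S + (*\<^sub>R) c ` T"
  then obtain s t where "s \<in> S" "t \<in> T" "x = c *\<^sub>R (s + t)"
    by (auto elim!: set_plus_elim simp: scaleR_right_distrib)
  then show "x \<in> (*\<^sub>R) c ` (S + T)" by (auto intro!: set_plus_intro)
qed

lemma zonotope_scale:
  fixes S :: "'a::euclidean_space set"
  assumes "zonotope S" shows "zonotope ((*\<^sub>R) c ` S)"
proof -
  have "(*\<^sub>R) c ` (\<Sum>i<n. closed_segment (a i) (b i)) = (\<Sum>i<n. closed_segment (c *\<^sub>R a i) (c *\<^sub>R b i))"
    for n :: nat and a b :: "nat \<Rightarrow> 'a"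
  proof (induction n)
    case (Suc n)
    then show ?case by (simp add: scaleR_image_set_plus closed_segment_linear_image linear_scaleR)
  qed (simp add: set_zero)
  moreover obtain n a b where "S = (\<Sum>i<n::nat. closed_segment (a i) (b i))"
    using assms by (auto simp: zonotope_def)
  ultimately have "(*\<^sub>R) c ` S = (\<Sum>i<n. closed_segment (c *\<^sub>R a i) (c *\<^sub>R b i))" by simp
  then show ?thesis unfolding zonotope_def by (intro exI)
qed

text \<open>The support function of the ball of radius \<epsilon> is \<epsilon> times the norm, so
  the two inclusions in \<open>zonoid\<close> are the two halves of the estimate on support
  functions.\<close>

lemma zonoidI_support:
  fixes Z :: "'a::euclidean_space set"
  assumes Z: "compact Z" "convex Z" "Z \<noteq> {}"
    and approx: "\<And>\<epsilon>. \<epsilon> > 0 \<Longrightarrow> \<exists>S. zonotope S \<and> (\<forall>u. \<bar>support Z u - support S u\<bar> \<le> \<epsilon> * norm u)"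
  shows "zonoid Z"
  unfolding zonoid_def
proof (intro conjI allI impI Z)
  fix \<epsilon> :: real assume "\<epsilon> > 0"
  then obtain S where S: "zonotope S" "\<And>u. \<bar>support Z u - support S u\<bar> \<le> \<epsilon> * norm u" using approx by blast
  have ball: "compact (cball (0::'a) \<epsilon>)" "cball (0::'a) \<epsilon> \<noteq> {}" "convex (cball (0::'a) \<epsilon>)" using \<open>\<epsilon> > 0\<close> by auto
  have ne: "A + B \<noteq> {}" if "A \<noteq> {}" "B \<noteq> {}" for A B :: "'a set" using that by (auto simp: set_plus_def)
  note zS = zonotope_cases[OF S(1)]
  have "Z \<subseteq> S + cball 0 \<epsilon>"
    by (rule subset_if_support_le)
      (use Z ball zS \<open>\<epsilon> > 0\<close> S(2) in \<open>auto simp: compact_plus convex_set_plus ne support_Minkowski_sum support_cball abs_le_iff algebra_simps\<close>)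
  moreover have "S \<subseteq> Z + cball 0 \<epsilon>"
    by (rule subset_if_support_le)
      (use Z ball zS \<open>\<epsilon> > 0\<close> S(2) in \<open>auto simp: compact_plus convex_set_plus ne support_Minkowski_sum support_cball abs_le_iff algebra_simps\<close>)
  ultimately show "\<exists>S. zonotope S \<and> Z \<subseteq> S + cball 0 \<epsilon> \<and> S \<subseteq> Z + cball 0 \<epsilon>" using S(1) by blast
qed

lemma zonoid_plus:
  fixes A B :: "'a::euclidean_space set"
  assumes A: "zonoid A" and B: "zonoid B" shows "zonoid (A + B)"
  unfolding zonoid_def
proof (intro conjI allI impI)
  show "compact (A + B)" using A B by (auto simp: zonoid_def compact_plus)
  have "A \<noteq> {}" "B \<noteq> {}" using A B by (auto simp: zonoid_def)
  then show "A + B \<noteq> {}" by (auto simp: set_plus_def)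
  fix \<epsilon> :: real assume "\<epsilon> > 0"
  then obtain S T where S: "zonotope S" "A \<subseteq> S + cball 0 (\<epsilon>/2)" "S \<subseteq> A + cball 0 (\<epsilon>/2)"
    and T: "zonotope T" "B \<subseteq> T + cball 0 (\<epsilon>/2)" "T \<subseteq> B + cball 0 (\<epsilon>/2)"
    using A B unfolding zonoid_def by (meson half_gt_zero)
  have ball: "cball (0::'a) (\<epsilon>/2) + cball 0 (\<epsilon>/2) \<subseteq> cball 0 \<epsilon>"
    by (auto simp: set_plus_def intro!: order_trans[OF norm_triangle_ineq])
  have sum: "P + Q \<subseteq> (P' + Q') + cball 0 \<epsilon>"
    if "P \<subseteq> P' + cball 0 (\<epsilon>/2)" "Q \<subseteq> Q' + cball 0 (\<epsilon>/2)" for P Q P' Q' :: "'a set"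
  proof -
    have "P + Q \<subseteq> (P' + cball 0 (\<epsilon>/2)) + (Q' + cball 0 (\<epsilon>/2))" by (rule set_plus_mono2[OF that])
    also have "\<dots> = (P' + Q') + (cball 0 (\<epsilon>/2) + cball 0 (\<epsilon>/2))" by (simp only: ac_simps)
    also have "\<dots> \<subseteq> (P' + Q') + cball 0 \<epsilon>" by (rule set_plus_mono2[OF order_refl ball])
    finally show ?thesis .
  qed
  show "\<exists>S. zonotope S \<and> A + B \<subseteq> S + cball 0 \<epsilon> \<and> S \<subseteq> A + B + cball 0 \<epsilon>"
    using zonotope_plus[OF S(1) T(1)] sum[OF S(2) T(2)] sum[OF S(3) T(3)] by blast
qed

lemma zonoid_scale:
  fixes A :: "'a::euclidean_space set"
  assumes A: "zonoid A" and c: "c \<ge> 0" shows "zonoid ((*\<^sub>R) c ` A)"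
  unfolding zonoid_def
proof (intro conjI allI impI)
  show "compact ((*\<^sub>R) c ` A)" "(*\<^sub>R) c ` A \<noteq> {}" using A by (auto simp: zonoid_def compact_scaling)
  fix \<epsilon> :: real assume "\<epsilon> > 0"
  moreover have "c + 1 > 0" using c by simp
  ultimately obtain S where S: "zonotope S" "A \<subseteq> S + cball 0 (\<epsilon>/(c+1))" "S \<subseteq> A + cball 0 (\<epsilon>/(c+1))"
    using A unfolding zonoid_def by (meson divide_pos_pos)
  have ball: "(*\<^sub>R) c ` cball (0::'a) (\<epsilon>/(c+1)) \<subseteq> cball 0 \<epsilon>"
  proof
    fix x assume "x \<in> (*\<^sub>R) c ` cball (0::'a) (\<epsilon>/(c+1))"
    then obtain y where y: "norm y \<le> \<epsilon>/(c+1)" "x = c *\<^sub>R y" by auto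
    have "c * norm y \<le> (c + 1) * (\<epsilon>/(c+1))" by (intro mult_mono) (use y c in auto)
    then show "x \<in> cball 0 \<epsilon>" using y c \<open>c + 1 > 0\<close> by simp
  qed
  have "(*\<^sub>R) c ` A \<subseteq> (*\<^sub>R) c ` S + cball 0 \<epsilon>" "(*\<^sub>R) c ` S \<subseteq> (*\<^sub>R) c ` A + cball 0 \<epsilon>"
    by (rule order_trans[OF image_mono[OF S(2), of "(*\<^sub>R) c", unfolded scaleR_image_set_plus]
          set_plus_mono2[OF order_refl ball]],
        rule order_trans[OF image_mono[OF S(3), of "(*\<^sub>R) c", unfolded scaleR_image_set_plus]
          set_plus_mono2[OF order_refl ball]])
  then show "\<exists>T. zonotope T \<and> (*\<^sub>R) c ` A \<subseteq> T + cball 0 \<epsilon> \<and> T \<subseteq> (*\<^sub>R) c ` A + cball 0 \<epsilon>"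
    using zonotope_scale[OF S(1), of c] by blast
qed

lemma support_scale:
  fixes A :: "'a::euclidean_space set"
  assumes "compact A" "A \<noteq> {}" "c \<ge> 0"
  shows "support ((*\<^sub>R) c ` A) u = c * support A u"
proof -
  have "\<exists>x\<in>A. \<forall>y\<in>A. y \<bullet> u \<le> x \<bullet> u"
    by (intro continuous_attains_sup continuous_intros assms)
  then obtain a where a: "a \<in> A" "\<forall>y\<in>A. y \<bullet> u \<le> a \<bullet> u" by blast
  then have "support A u = a \<bullet> u" by (intro support_eqI) auto
  moreover have "support ((*\<^sub>R) c ` A) u = c * (a \<bullet> u)"
    by (rule support_eqI[of "c *\<^sub>R a"]) (use a assms mult_left_mono[OF _ assms(3)] in auto)
  ultimately show ?thesis by simp
qed

text \<open>A formal difference is negated by exchanging its two bodies, so zonoids have to be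
  scaled by nonnegative factors only.\<close>

lemma subspace_virtual_zonoids:
  fixes W :: "'a::euclidean_space set"
  assumes W: "subspace W"
  shows "fun_space.subspace (virtual_zonoids W)"
proof -
  have zc: "compact A" "A \<noteq> {}" if "zonoid A" for A :: "'a set" using that by (auto simp: zonoid_def)
  have sub: "A + B \<subseteq> W" if "A \<subseteq> W" "B \<subseteq> W" for A B
    using that by (auto simp: set_plus_def subset_iff intro: subspace_add[OF W])
  have add: "(\<lambda>u. h u + k u) \<in> virtual_zonoids W" if h: "h \<in> virtual_zonoids W" and k: "k \<in> virtual_zonoids W" for h k
  proof -
    obtain A B where h': "h = (\<lambda>u. support A u - support B u)" "zonoid A" "zonoid B" "A \<subseteq> W" "B \<subseteq> W"
      using h by (auto simp: virtual_zonoids_def)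
    obtain C D where k': "k = (\<lambda>u. support C u - support D u)" "zonoid C" "zonoid D" "C \<subseteq> W" "D \<subseteq> W"
      using k by (auto simp: virtual_zonoids_def)
    show ?thesis unfolding virtual_zonoids_def
      by (rule CollectI, rule exI[of _ "A + C"], rule exI[of _ "B + D"])
        (use h' k' sub[of A C] sub[of B D] in \<open>auto simp: zonoid_plus support_Minkowski_sum zc fun_eq_iff\<close>)
  qed
  have neg: "(\<lambda>u. - h u) \<in> virtual_zonoids W" if h: "h \<in> virtual_zonoids W" for h
  proof -
    obtain A B where h': "h = (\<lambda>u. support A u - support B u)" "zonoid A" "zonoid B" "A \<subseteq> W" "B \<subseteq> W"
      using h by (auto simp: virtual_zonoids_def)
    show ?thesis unfolding virtual_zonoids_def
      by (rule CollectI, rule exI[of _ "B"], rule exI[of _ "A"]) (use h' in auto)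
  qed
  have pos: "(\<lambda>u. c * h u) \<in> virtual_zonoids W" if h: "h \<in> virtual_zonoids W" and c: "c \<ge> 0" for h c
  proof -
    obtain A B where h': "h = (\<lambda>u. support A u - support B u)" "zonoid A" "zonoid B" "A \<subseteq> W" "B \<subseteq> W"
      using h by (auto simp: virtual_zonoids_def)
    show ?thesis unfolding virtual_zonoids_def
      by (rule CollectI, rule exI[of _ "(*\<^sub>R) c ` A"], rule exI[of _ "(*\<^sub>R) c ` B"])
       (use h' c in \<open>auto simp: zonoid_scale support_scale zc algebra_simps intro: subspace_scale[OF W]\<close>)
  qed
  have scale: "(\<lambda>u. c * h u) \<in> virtual_zonoids W" if h: "h \<in> virtual_zonoids W" for h c
    using pos[OF h, of c] neg[OF pos[OF h, of "- c"]] by (cases "c \<ge> 0") auto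
  have "zonotope {0 :: 'a}" unfolding zonotope_def by (rule exI[of _ 0]) (simp add: set_zero)
  then have "zonoid {0 :: 'a}" by (intro zonoidI_support exI[of _ "{0}"]) auto
  then have "(\<lambda>u. support {0} u - support {0} u) \<in> virtual_zonoids W"
    unfolding virtual_zonoids_def
    by (intro CollectI exI[of _ "{0}"]) (simp add: subspace_0[OF W])
  then show ?thesis unfolding fun_subspace_iff
    by (intro conjI ballI allI add scale) blast+
qed

section \<open>Zonoids of integrable random vectors\<close>

lemma Z_body_props:
  fixes \<xi> :: "'w \<Rightarrow> 'a::euclidean_space"
  assumes \<xi>: "integrable M \<xi>"
  shows "compact (Z_body M \<xi>)" "convex (Z_body M \<xi>)" "Z_body M \<xi> \<noteq> {}"
    "\<bar>support (Z_body M \<xi>) u\<bar> \<le> (\<integral>\<omega>. norm (\<xi> \<omega>) \<partial>M) * norm u"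
proof -
  have m: "max 0 (u \<bullet> x) \<le> norm x * norm u" for u x :: 'a
    using Cauchy_Schwarz_ineq2[of u x] by (auto simp: mult.commute)
  have int: "integrable M (\<lambda>\<omega>. max 0 (v \<bullet> \<xi> \<omega>))" for v
    using \<xi> by (intro integrable_max) auto
  have *: "(\<integral>\<omega>. max 0 (u \<bullet> \<xi> \<omega>) \<partial>M) \<le> (\<integral>\<omega>. norm (\<xi> \<omega>) \<partial>M) * norm u" for u
    using integral_mono[OF int[of u], of "\<lambda>\<omega>. norm (\<xi> \<omega>) * norm u"] m \<xi> by auto
  show "compact (Z_body M \<xi>)" "convex (Z_body M \<xi>)"
    unfolding Z_body_def by (rule compact_body_of, rule *)+
  show "\<bar>support (Z_body M \<xi>) u\<bar> \<le> (\<integral>\<omega>. norm (\<xi> \<omega>) \<partial>M) * norm u"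
    unfolding support_Z_body[OF \<xi>] using * by (subst abs_of_nonneg) auto
  \<comment> \<open>The expectation is a point of the body, since the maximum with 0 only increases
    the integrand.\<close>
  have "(\<integral>\<omega>. \<xi> \<omega> \<partial>M) \<in> Z_body M \<xi>"
    unfolding Z_body_def body_of_def
  proof (rule CollectI, rule allI)
    fix v
    have "(\<integral>\<omega>. \<xi> \<omega> \<partial>M) \<bullet> v = (\<integral>\<omega>. v \<bullet> \<xi> \<omega> \<partial>M)" using \<xi> by (simp add: inner_commute)
    also have "\<dots> \<le> (\<integral>\<omega>. max 0 (v \<bullet> \<xi> \<omega>) \<partial>M)" by (intro integral_mono int) (use \<xi> in auto)
    finally show "(\<integral>\<omega>. \<xi> \<omega> \<partial>M) \<bullet> v \<le> (\<integral>\<omega>. max 0 (v \<bullet> \<xi> \<omega>) \<partial>M)" .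
  qed
  then show "Z_body M \<xi> \<noteq> {}" by blast
qed

text \<open>The support function of the body depends Lipschitz continuously on \<xi> in mean. A
  simple function \<open>t\<close> close to \<xi> has finitely many values, and its body is the
  zonotope with one segment from 0 for each value, scaled by the measure of the fibre.\<close>

lemma zonoid_Z_body:
  fixes \<xi> :: "'w \<Rightarrow> 'a::euclidean_space"
  assumes \<xi>: "integrable M \<xi>"
  shows "zonoid (Z_body M \<xi>)"
proof (rule zonoidI_support[OF Z_body_props(1-3)[OF \<xi>]])
  fix \<epsilon> :: real assume e: "\<epsilon> > 0"
  have [measurable]: "\<xi> \<in> borel_measurable M" using \<xi> by auto
  obtain x where "has_bochner_integral M \<xi> x" using \<xi> by (auto simp: integrable.simps)
  then obtain s where s: "\<And>i::nat. Bochner_Integration.simple_bochner_integrable M (s i)"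
    and lim: "(\<lambda>i. \<integral>\<^sup>+x. norm (\<xi> x - s i x) \<partial>M) \<longlonglongrightarrow> 0"
    by (cases rule: has_bochner_integral.cases) blast
  have "\<forall>\<^sub>F i in sequentially. (\<integral>\<^sup>+x. norm (\<xi> x - s i x) \<partial>M) < ennreal \<epsilon>"
    using order_tendstoD(2)[OF lim, of "ennreal \<epsilon>"] e by simp
  then obtain i where i: "(\<integral>\<^sup>+x. norm (\<xi> x - s i x) \<partial>M) < ennreal \<epsilon>" by (auto simp: eventually_sequentially)
  define t where "t = s i"
  have t: "Bochner_Integration.simple_bochner_integrable M t" using s by (simp add: t_def)
  have tint: "integrable M t" using has_bochner_integral_simple_bochner_integrable[OF t] by (auto simp: integrable.simps)
  then have [measurable]: "t \<in> borel_measurable M" by auto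
  have tf: "simple_function M t" using t by (auto simp: simple_bochner_integrable.simps)
  have diff: "(\<integral>x. norm (\<xi> x - t x) \<partial>M) \<le> \<epsilon>"
  proof -
    have "ennreal (\<integral>x. norm (\<xi> x - t x) \<partial>M) = (\<integral>\<^sup>+x. norm (\<xi> x - t x) \<partial>M)"
      using \<xi> tint by (intro nn_integral_eq_integral[symmetric]) auto
    also have "\<dots> \<le> ennreal \<epsilon>" using i by (simp add: t_def less_imp_le)
    finally show ?thesis using e by simp
  qed
  have fin: "finite (t ` space M)" using tf by (auto simp: simple_function_def)
  \<comment> \<open>The enumeration of the values is injective, so each value contributes exactly
    one segment.\<close>
  obtain n :: nat and f where f: "t ` space M = f ` {i. i < n}" "inj_on f {i. i < n}"
    using finite_imp_nat_seg_image_inj_on[OF fin] by (elim exE conjE) (rule that)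
  let ?p = "\<lambda>y. measure M {x \<in> space M. t x = y}"
  let ?S = "\<Sum>i<n. closed_segment 0 (?p (f i) *\<^sub>R f i)"
  have sup: "support ?S u = (\<integral>\<omega>. max 0 (u \<bullet> t \<omega>) \<partial>M)" for u
  proof -
    have sb: "Bochner_Integration.simple_bochner_integrable M (\<lambda>\<omega>. max 0 (u \<bullet> t \<omega>))"
      using simple_bochner_integrable_compose2[where p="\<lambda>y z. max 0 (u \<bullet> y)", OF _ t t] by simp
    have "(\<integral>\<omega>. max 0 (u \<bullet> t \<omega>) \<partial>M) = Bochner_Integration.simple_bochner_integral M (\<lambda>\<omega>. max 0 (u \<bullet> t \<omega>))"
      by (rule simple_bochner_integrable_eq_integral[OF sb, symmetric])
    also have "\<dots> = (\<Sum>y\<in>t ` space M. ?p y *\<^sub>R max 0 (u \<bullet> y))"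
      by (rule simple_bochner_integral_partition[OF sb tf]) auto
    also have "\<dots> = (\<Sum>i<n. ?p (f i) * max 0 (u \<bullet> f i))"
      unfolding f(1) by (subst sum.reindex[OF f(2)]) (simp add: lessThan_def)
    also have "\<dots> = (\<Sum>i<n. max 0 (u \<bullet> (?p (f i) *\<^sub>R f i)))"
      by (intro sum.cong refl) (auto simp: max_mult_distrib_left)
    also have "\<dots> = support ?S u"
      using zonotope_props[where a="\<lambda>_. 0" and b="\<lambda>i. ?p (f i) *\<^sub>R f i"] by (simp add: support_segment)
    finally show ?thesis by simp
  qed
  have "\<bar>support (Z_body M \<xi>) u - support ?S u\<bar> \<le> \<epsilon> * norm u" for u
  proof -
    have int: "integrable M (\<lambda>\<omega>. max 0 (u \<bullet> \<eta> \<omega>))" if "integrable M \<eta>" for \<eta>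
      using that by (intro integrable_max) auto
    have "support (Z_body M \<xi>) u - support ?S u = (\<integral>\<omega>. max 0 (u \<bullet> \<xi> \<omega>) - max 0 (u \<bullet> t \<omega>) \<partial>M)"
      by (simp add: support_Z_body[OF \<xi>] sup int \<xi> tint)
    also have "\<bar>\<dots>\<bar> \<le> (\<integral>\<omega>. \<bar>max 0 (u \<bullet> \<xi> \<omega>) - max 0 (u \<bullet> t \<omega>)\<bar> \<partial>M)" by (rule integral_abs_bound)
    also have "\<dots> \<le> (\<integral>\<omega>. norm (\<xi> \<omega> - t \<omega>) * norm u \<partial>M)"
    proof (rule integral_mono)
      show "\<bar>max 0 (u \<bullet> \<xi> \<omega>) - max 0 (u \<bullet> t \<omega>)\<bar> \<le> norm (\<xi> \<omega> - t \<omega>) * norm u" for \<omega>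
        using Cauchy_Schwarz_ineq2[of u "\<xi> \<omega> - t \<omega>"] by (auto simp: inner_diff_right mult.commute)
    qed (use int \<xi> tint in auto)
    also have "\<dots> \<le> \<epsilon> * norm u" using diff by (simp add: mult_right_mono)
    finally show ?thesis .
  qed
  moreover have "zonotope ?S" unfolding zonotope_def by (rule exI, rule exI, rule exI, rule refl)
  ultimately show "\<exists>S. zonotope S \<and> (\<forall>u. \<bar>support (Z_body M \<xi>) u - support S u\<bar> \<le> \<epsilon> * norm u)" by blast
qed

text \<open>The component \<open>z\<close> of a point of the body orthogonal to \<open>W\<close> is
  almost surely orthogonal to \<xi>, so the support function vanishes at \<open>z\<close>, which
  forces \<open>z \<bullet> z \<le> 0\<close>.\<close>

lemma Z_body_subset:
  fixes \<xi> :: "'w \<Rightarrow> 'a::euclidean_space"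
  assumes \<xi>: "integrable M \<xi>" and W: "subspace W" and AE: "AE \<omega> in M. \<xi> \<omega> \<in> W"
  shows "Z_body M \<xi> \<subseteq> W"
proof
  fix x assume x: "x \<in> Z_body M \<xi>"
  have [measurable]: "\<xi> \<in> borel_measurable M" using \<xi> by auto
  obtain y z where yz: "y \<in> span W" "\<And>w. w \<in> span W \<Longrightarrow> orthogonal z w" "x = y + z"
    using orthogonal_subspace_decomp_exists[of W x] by blast
  have "(\<integral>\<omega>. max 0 (z \<bullet> \<xi> \<omega>) \<partial>M) = 0"
  proof -
    have "(\<integral>\<omega>. max 0 (z \<bullet> \<xi> \<omega>) \<partial>M) = (\<integral>\<omega>. 0 \<partial>M)"
    proof (rule integral_cong_AE)
      show "AE \<omega> in M. max 0 (z \<bullet> \<xi> \<omega>) = 0"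
        using AE by eventually_elim (use yz in \<open>auto simp: orthogonal_def span_base\<close>)
    qed auto
    then show ?thesis by simp
  qed
  then have "x \<bullet> z \<le> 0" using x by (auto simp: Z_body_def body_of_def dest!: spec[of _ z])
  moreover have "y \<bullet> z = 0" using yz by (auto simp: orthogonal_def inner_commute)
  ultimately have "z \<bullet> z \<le> 0" by (simp add: yz(3) inner_add_left)
  then have "z = 0" using inner_ge_zero[of z] by (simp add: antisym)
  then show "x \<in> W" using yz(1,3) span_eq_iff[THEN iffD2, OF W] by simp
qed

section \<open>Products of independent random vectors\<close>

lemma distr_pair_marginals:
  assumes "prob_space M" "prob_space N"
  shows "distr (M \<Otimes>\<^sub>M N) M fst = M" "distr (M \<Otimes>\<^sub>M N) N snd = N"
proof -
  interpret M: prob_space M by fact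
  interpret N: prob_space N by fact
  interpret pair_sigma_finite M N ..
  show "distr (M \<Otimes>\<^sub>M N) M fst = M"
  proof (rule measure_eqI)
    fix A assume A: "A \<in> sets (distr (M \<Otimes>\<^sub>M N) M fst)"
    then have "fst -` A \<inter> space (M \<Otimes>\<^sub>M N) = A \<times> space N"
      using sets.sets_into_space[of A M] by (auto simp: space_pair_measure)
    then show "emeasure (distr (M \<Otimes>\<^sub>M N) M fst) A = emeasure M A"
      using A by (simp add: emeasure_distr N.emeasure_pair_measure_Times N.emeasure_space_1)
  qed simp
  show "distr (M \<Otimes>\<^sub>M N) N snd = N"
  proof (rule measure_eqI)
    fix A assume A: "A \<in> sets (distr (M \<Otimes>\<^sub>M N) N snd)"
    then have "snd -` A \<inter> space (M \<Otimes>\<^sub>M N) = space M \<times> A"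
      using sets.sets_into_space[of A N] by (auto simp: space_pair_measure)
    then show "emeasure (distr (M \<Otimes>\<^sub>M N) N snd) A = emeasure N A"
      using A by (simp add: emeasure_distr N.emeasure_pair_measure_Times M.emeasure_space_1)
  qed simp
qed

text \<open>Independent copies of two random vectors on the product of their sample spaces. The
  specifications of the product and of the pairing speak of independent vectors on one sample space,
  and this brings generators given separately into that form.\<close>

lemma pair_marginal_props:
  fixes \<xi> :: "'a \<Rightarrow> 'c::euclidean_space" and \<zeta> :: "'b \<Rightarrow> 'c"
  assumes M: "prob_space M" and N: "prob_space N" and \<xi>: "integrable M \<xi>" and \<zeta>: "integrable N \<zeta>"
  shows "prob_space (M \<Otimes>\<^sub>M N)"
    "integrable (M \<Otimes>\<^sub>M N) (\<lambda>\<omega>. \<xi> (fst \<omega>))" "integrable (M \<Otimes>\<^sub>M N) (\<lambda>\<omega>. \<zeta> (snd \<omega>))"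
    "prob_space.indep_var (M \<Otimes>\<^sub>M N) borel (\<lambda>\<omega>. \<xi> (fst \<omega>)) borel (\<lambda>\<omega>. \<zeta> (snd \<omega>))"
    "(AE \<omega> in M. P \<omega>) \<Longrightarrow> (AE \<omega> in M \<Otimes>\<^sub>M N. P (fst \<omega>))"
    "(AE \<omega> in N. R \<omega>) \<Longrightarrow> (AE \<omega> in M \<Otimes>\<^sub>M N. R (snd \<omega>))"
    "f \<in> borel_measurable M \<Longrightarrow> (\<integral>\<omega>. f (fst \<omega>) \<partial>(M \<Otimes>\<^sub>M N)) = (\<integral>\<omega>. (f \<omega> :: real) \<partial>M)"
    "g \<in> borel_measurable N \<Longrightarrow> (\<integral>\<omega>. g (snd \<omega>) \<partial>(M \<Otimes>\<^sub>M N)) = (\<integral>\<omega>. (g \<omega> :: real) \<partial>N)"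
proof -
  interpret M: prob_space M by fact
  interpret N: prob_space N by fact
  interpret P: pair_prob_space M N ..
  note d = distr_pair_marginals[OF M N]
  have [measurable]: "\<xi> \<in> borel_measurable M" "\<zeta> \<in> borel_measurable N" using \<xi> \<zeta> by auto
  show "prob_space (M \<Otimes>\<^sub>M N)" by (rule P.prob_space_axioms)
  show i1: "integrable (M \<Otimes>\<^sub>M N) (\<lambda>\<omega>. \<xi> (fst \<omega>))"
    using \<xi> by (subst integrable_distr_eq[of fst "M \<Otimes>\<^sub>M N" M \<xi>, symmetric]) (auto simp: d)
  show i2: "integrable (M \<Otimes>\<^sub>M N) (\<lambda>\<omega>. \<zeta> (snd \<omega>))"
    using \<zeta> by (subst integrable_distr_eq[of snd "M \<Otimes>\<^sub>M N" N \<zeta>, symmetric]) (auto simp: d)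
  have e1: "distr (M \<Otimes>\<^sub>M N) borel (\<lambda>\<omega>. \<xi> (fst \<omega>)) = distr M borel \<xi>"
    by (subst (2) d(1)[symmetric]) (simp add: distr_distr o_def)
  have e2: "distr (M \<Otimes>\<^sub>M N) borel (\<lambda>\<omega>. \<zeta> (snd \<omega>)) = distr N borel \<zeta>"
    by (subst (2) d(2)[symmetric]) (simp add: distr_distr o_def)
  have "distr M borel \<xi> \<Otimes>\<^sub>M distr N borel \<zeta> = distr (M \<Otimes>\<^sub>M N) (borel \<Otimes>\<^sub>M borel) (\<lambda>(x, y). (\<xi> x, \<zeta> y))"
    by (rule pair_measure_distr) (auto intro!: prob_space_imp_sigma_finite N.prob_space_distr)
  then show "prob_space.indep_var (M \<Otimes>\<^sub>M N) borel (\<lambda>\<omega>. \<xi> (fst \<omega>)) borel (\<lambda>\<omega>. \<zeta> (snd \<omega>))"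
    unfolding P.indep_var_distribution_eq e1 e2 by (simp add: case_prod_beta')
  show "AE \<omega> in M \<Otimes>\<^sub>M N. P (fst \<omega>)" if P: "AE \<omega> in M. P \<omega>"
  proof (rule AE_distrD[of fst "M \<Otimes>\<^sub>M N" M])
    show "AE \<omega> in distr (M \<Otimes>\<^sub>M N) M fst. P \<omega>" unfolding d by (rule P)
  qed simp
  show "AE \<omega> in M \<Otimes>\<^sub>M N. R (snd \<omega>)" if R: "AE \<omega> in N. R \<omega>"
  proof (rule AE_distrD[of snd "M \<Otimes>\<^sub>M N" N])
    show "AE \<omega> in distr (M \<Otimes>\<^sub>M N) N snd. R \<omega>" unfolding d by (rule R)
  qed simp
  show "f \<in> borel_measurable M \<Longrightarrow> (\<integral>\<omega>. f (fst \<omega>) \<partial>(M \<Otimes>\<^sub>M N)) = (\<integral>\<omega>. (f \<omega> :: real) \<partial>M)"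
    by (subst (2) d(1)[symmetric]) (simp add: integral_distr)
  show "g \<in> borel_measurable N \<Longrightarrow> (\<integral>\<omega>. g (snd \<omega>) \<partial>(M \<Otimes>\<^sub>M N)) = (\<integral>\<omega>. (g \<omega> :: real) \<partial>N)"
    by (subst (2) d(2)[symmetric]) (simp add: integral_distr)
qed

text \<open>The integrand is dominated by a multiple of the product of the norms, which are
  independent and integrable.\<close>

lemma indep_integrable:
  fixes \<xi> :: "'w \<Rightarrow> 'a::euclidean_space" and \<zeta> :: "'w \<Rightarrow> 'a"
    and g :: "'a \<times> 'a \<Rightarrow> 'c::euclidean_space"
  assumes M: "prob_space M" and \<xi>: "integrable M \<xi>" and \<zeta>: "integrable M \<zeta>"
    and ind: "prob_space.indep_var M borel \<xi> borel \<zeta>"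
    and g: "continuous_on UNIV g" "\<And>x y. norm (g (x, y)) \<le> C * norm x * norm y"
  shows "integrable M (\<lambda>\<omega>. g (\<xi> \<omega>, \<zeta> \<omega>))"
proof -
  interpret prob_space M by fact
  have [measurable]: "\<xi> \<in> borel_measurable M" "\<zeta> \<in> borel_measurable M" using \<xi> \<zeta> by auto
  have [measurable]: "g \<in> borel_measurable (borel \<Otimes>\<^sub>M borel)"
    using borel_measurable_continuous_onI[OF g(1)] by (simp add: borel_prod)
  have "indep_var borel (norm \<circ> \<xi>) borel (norm \<circ> \<zeta>)"
    by (rule indep_var_compose[OF ind]) auto
  then have "integrable M (\<lambda>\<omega>. (norm \<circ> \<xi>) \<omega> * (norm \<circ> \<zeta>) \<omega>)"
    by (rule indep_var_integrable) (use \<xi> \<zeta> in \<open>auto simp: o_def\<close>)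
  then have "integrable M (\<lambda>\<omega>. C * (norm (\<xi> \<omega>) * norm (\<zeta> \<omega>)))" by (simp add: o_def)
  then show ?thesis
    by (rule Bochner_Integration.integrable_bound) (use g(2) in \<open>auto intro!: order_trans[OF g(2)] simp: mult.assoc\<close>)
qed

text \<open>By independence the joint law is the product of the laws, so Fubini for the laws gives
  both orders of integration.\<close>

lemma indep_integral:
  fixes \<xi> :: "'w \<Rightarrow> 'a::euclidean_space" and \<zeta> :: "'w \<Rightarrow> 'a"
    and g :: "'a \<times> 'a \<Rightarrow> real"
  assumes M: "prob_space M" and \<xi>: "integrable M \<xi>" and \<zeta>: "integrable M \<zeta>"
    and ind: "prob_space.indep_var M borel \<xi> borel \<zeta>"
    and g: "continuous_on UNIV g" "\<And>x y. norm (g (x, y)) \<le> C * norm x * norm y"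
  shows "(\<integral>\<omega>. g (\<xi> \<omega>, \<zeta> \<omega>) \<partial>M) = (\<integral>\<omega>. \<integral>\<omega>'. g (\<xi> \<omega>, \<zeta> \<omega>') \<partial>M \<partial>M)"
    "(\<integral>\<omega>. g (\<xi> \<omega>, \<zeta> \<omega>) \<partial>M) = (\<integral>\<omega>'. \<integral>\<omega>. g (\<xi> \<omega>, \<zeta> \<omega>') \<partial>M \<partial>M)"
proof -
  interpret prob_space M by fact
  have [measurable]: "\<xi> \<in> borel_measurable M" "\<zeta> \<in> borel_measurable M" using \<xi> \<zeta> by auto
  have gm [measurable]: "g \<in> borel_measurable (borel \<Otimes>\<^sub>M borel)"
    using borel_measurable_continuous_onI[OF g(1)] by (simp add: borel_prod)
  let ?D = "distr M borel \<xi>" and ?E = "distr M borel \<zeta>"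
  interpret D: prob_space ?D by (rule prob_space_distr) simp
  interpret E: prob_space ?E by (rule prob_space_distr) simp
  interpret pair_sigma_finite ?D ?E ..
  have eq: "?D \<Otimes>\<^sub>M ?E = distr M (borel \<Otimes>\<^sub>M borel) (\<lambda>x. (\<xi> x, \<zeta> x))"
    using ind by (simp add: indep_var_distribution_eq)
  have int: "integrable (?D \<Otimes>\<^sub>M ?E) g"
    unfolding eq using indep_integrable[OF assms] by (subst integrable_distr_eq) auto
  have e: "(\<integral>\<omega>. g (\<xi> \<omega>, \<zeta> \<omega>) \<partial>M) = (\<integral>z. g z \<partial>(?D \<Otimes>\<^sub>M ?E))"
    unfolding eq by (subst integral_distr) auto
  have "(\<integral>z. g z \<partial>(?D \<Otimes>\<^sub>M ?E)) = (\<integral>x. \<integral>y. g (x, y) \<partial>?E \<partial>?D)"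
    by (rule integral_fst'[OF int, symmetric])
  also have "\<dots> = (\<integral>\<omega>. \<integral>\<omega>'. g (\<xi> \<omega>, \<zeta> \<omega>') \<partial>M \<partial>M)"
    by (subst integral_distr) (auto simp: integral_distr)
  finally show "(\<integral>\<omega>. g (\<xi> \<omega>, \<zeta> \<omega>) \<partial>M) = (\<integral>\<omega>. \<integral>\<omega>'. g (\<xi> \<omega>, \<zeta> \<omega>') \<partial>M \<partial>M)" by (simp add: e)
  have "(\<integral>z. g z \<partial>(?D \<Otimes>\<^sub>M ?E)) = (\<integral>y. \<integral>x. g (x, y) \<partial>?D \<partial>?E)"
    using integral_snd[of "\<lambda>x y. g (x, y)"] int by simp
  also have "\<dots> = (\<integral>\<omega>'. \<integral>\<omega>. g (\<xi> \<omega>, \<zeta> \<omega>') \<partial>M \<partial>M)"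
    by (subst integral_distr) (auto simp: integral_distr)
  finally show "(\<integral>\<omega>. g (\<xi> \<omega>, \<zeta> \<omega>) \<partial>M) = (\<integral>\<omega>'. \<integral>\<omega>. g (\<xi> \<omega>, \<zeta> \<omega>') \<partial>M \<partial>M)" by (simp add: e)
qed

lemma iterated_integral_swap:
  fixes \<xi> :: "'v \<Rightarrow> 'a::euclidean_space" and \<zeta> :: "'w \<Rightarrow> 'a"
    and g :: "'a \<times> 'a \<Rightarrow> real"
  assumes M: "prob_space M" and N: "prob_space N" and \<xi>: "integrable M \<xi>" and \<zeta>: "integrable N \<zeta>"
    and g: "continuous_on UNIV g" "\<And>x y. norm (g (x, y)) \<le> C * norm x * norm y"
  shows "(\<integral>\<omega>. \<integral>\<omega>'. g (\<xi> \<omega>, \<zeta> \<omega>') \<partial>N \<partial>M) = (\<integral>\<omega>'. \<integral>\<omega>. g (\<xi> \<omega>, \<zeta> \<omega>') \<partial>M \<partial>N)"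
proof -
  interpret M: prob_space M by fact
  interpret N: prob_space N by fact
  interpret pair_sigma_finite M N ..
  note p = pair_marginal_props[OF M N \<xi> \<zeta>]
  have "integrable (M \<Otimes>\<^sub>M N) (\<lambda>(x, y). g (\<xi> x, \<zeta> y))"
    using indep_integrable[OF p(1-4) g] by (simp add: case_prod_beta')
  from Fubini_integral[OF this] show ?thesis by simp
qed

section \<open>Contractions by multivectors and functions of linear growth\<close>

text \<open>Moving \<open>z\<close> to the other side of the inner product turns the average over
  one factor of a wedge product into the support function of that factor, evaluated at a contraction
  of \<open>u\<close>.\<close>

definition left_contract :: "'n::{finite,linorder} ext \<Rightarrow> 'n ext \<Rightarrow> 'n ext" where
  "left_contract z u = adjoint (wedge z) u"

definition right_contract :: "'n::{finite,linorder} ext \<Rightarrow> 'n ext \<Rightarrow> 'n ext" where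
  "right_contract z u = adjoint (\<lambda>x. wedge x z) u"

lemma inner_left_contract: "left_contract z u \<bullet> x = u \<bullet> wedge z x"
  unfolding left_contract_def using adjoint_works[OF linear_wedge_right, of x z u] by (simp add: inner_commute)

lemma inner_right_contract: "right_contract z u \<bullet> x = u \<bullet> wedge x z"
  unfolding right_contract_def using adjoint_works[OF linear_wedge_left, of x z u] by (simp add: inner_commute)

lemma bounded_linear_contract:
  "bounded_linear (\<lambda>z. left_contract z u)" "bounded_linear (\<lambda>z. right_contract z u)"
  unfolding linear_conv_bounded_linear[symmetric]
  by (intro linearI; subst vector_eq_rdot[symmetric]; simp add: inner_left_contract inner_right_contract
      inner_add_left wedge_linear_simps inner_add_right)+

lemma contract_minus: "left_contract (- z) u = - left_contract z u" "right_contract (- z) u = - right_contract z u"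
  by (rule bounded_linear_contract(1)[THEN bounded_linear.linear, THEN linear_neg],
      rule bounded_linear_contract(2)[THEN bounded_linear.linear, THEN linear_neg])

text \<open>A space of functions that contains the support functions of the bodies \<open>Z\<close>
  of integrable vectors, and on which averaging along an integrable random vector is a well-defined
  linear functional.\<close>

definition linear_growth :: "('a::euclidean_space \<Rightarrow> real) set" where
  "linear_growth = {h. continuous_on UNIV h \<and> (\<exists>C. \<forall>u. \<bar>h u\<bar> \<le> C * norm u)}"

lemma subspace_linear_growth: "fun_space.subspace linear_growth"
  unfolding fun_subspace_iff
proof (intro conjI ballI allI)
  have "(\<lambda>_. 0) \<in> linear_growth" by (auto simp: linear_growth_def intro!: exI[of _ 0])
  then show "linear_growth \<noteq> {}" by blast
  fix h k :: "'a \<Rightarrow> real" and a b assume "h \<in> linear_growth" "k \<in> linear_growth"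
  then obtain C D where h: "continuous_on UNIV h" "\<And>u. \<bar>h u\<bar> \<le> C * norm u"
    and k: "continuous_on UNIV k" "\<And>u. \<bar>k u\<bar> \<le> D * norm u" by (auto simp: linear_growth_def)
  have "\<bar>a * h u + b * k u\<bar> \<le> (\<bar>a\<bar> * C + \<bar>b\<bar> * D) * norm u" for u
  proof -
    have "\<bar>a * h u + b * k u\<bar> \<le> \<bar>a\<bar> * \<bar>h u\<bar> + \<bar>b\<bar> * \<bar>k u\<bar>"
      by (metis abs_mult abs_triangle_ineq)
    also have "\<dots> \<le> \<bar>a\<bar> * (C * norm u) + \<bar>b\<bar> * (D * norm u)"
      using h(2) k(2) by (intro add_mono mult_left_mono) auto
    finally show ?thesis by (simp add: algebra_simps)
  qed
  then show "(\<lambda>u. a * h u + b * k u) \<in> linear_growth"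
    using h k by (auto simp: linear_growth_def intro!: continuous_intros)
qed

lemma linear_growth_integrable:
  fixes \<xi> :: "'w \<Rightarrow> 'a::euclidean_space" and L :: "'a \<Rightarrow> 'b::euclidean_space"
  assumes \<xi>: "integrable M \<xi>" and h: "h \<in> linear_growth" and L: "bounded_linear L"
  shows "integrable M (\<lambda>\<omega>. h (L (\<xi> \<omega>)))"
proof -
  obtain C where c: "continuous_on UNIV h" and C: "\<And>u. \<bar>h u\<bar> \<le> C * norm u"
    using h by (auto simp: linear_growth_def)
  have i: "integrable M (\<lambda>\<omega>. L (\<xi> \<omega>))" by (rule integrable_bounded_linear[OF L \<xi>])
  have [measurable]: "h \<in> borel_measurable borel" by (rule borel_measurable_continuous_onI[OF c])
  have [measurable]: "(\<lambda>\<omega>. L (\<xi> \<omega>)) \<in> borel_measurable M" using i by auto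
  have "integrable M (\<lambda>\<omega>. C * norm (L (\<xi> \<omega>)))" using i by simp
  then show ?thesis
    by (rule Bochner_Integration.integrable_bound) (use C in \<open>auto intro!: order_trans[OF C]\<close>)
qed

lemma linear_functional_on_integral:
  fixes \<xi> :: "'w \<Rightarrow> 'a::euclidean_space" and L :: "'a \<Rightarrow> 'b::euclidean_space"
  assumes \<xi>: "integrable M \<xi>" and L: "bounded_linear L" and T: "T \<subseteq> linear_growth"
  shows "linear_functional_on T (\<lambda>h. c * (\<integral>\<omega>. h (L (\<xi> \<omega>)) \<partial>M))"
  unfolding linear_functional_on_def
proof (intro ballI allI)
  fix h k a b assume "h \<in> T" "k \<in> T"
  then have "integrable M (\<lambda>\<omega>. h (L (\<xi> \<omega>)))" "integrable M (\<lambda>\<omega>. k (L (\<xi> \<omega>)))"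
    using T by (auto intro!: linear_growth_integrable[OF \<xi> _ L])
  then show "c * (\<integral>\<omega>. a * h (L (\<xi> \<omega>)) + b * k (L (\<xi> \<omega>)) \<partial>M) =
    a * (c * (\<integral>\<omega>. h (L (\<xi> \<omega>)) \<partial>M)) + b * (c * (\<integral>\<omega>. k (L (\<xi> \<omega>)) \<partial>M))"
    by (simp add: algebra_simps)
qed

lemma support_Z_body_growth:
  fixes \<xi> :: "'w \<Rightarrow> 'a::euclidean_space"
  assumes \<xi>: "integrable M \<xi>"
  shows "support (Z_body M \<xi>) \<in> linear_growth"
proof -
  have int: "integrable M (\<lambda>\<omega>. max 0 (v \<bullet> \<xi> \<omega>))" for v
    using \<xi> by (intro integrable_max) auto
  have lip: "\<bar>support (Z_body M \<xi>) u - support (Z_body M \<xi>) v\<bar> \<le> (\<integral>\<omega>. norm (\<xi> \<omega>) \<partial>M) * norm (u - v)" for u v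
  proof -
    have "support (Z_body M \<xi>) u - support (Z_body M \<xi>) v = (\<integral>\<omega>. max 0 (u \<bullet> \<xi> \<omega>) - max 0 (v \<bullet> \<xi> \<omega>) \<partial>M)"
      by (simp add: support_Z_body[OF \<xi>] int)
    also have "\<bar>\<dots>\<bar> \<le> (\<integral>\<omega>. \<bar>max 0 (u \<bullet> \<xi> \<omega>) - max 0 (v \<bullet> \<xi> \<omega>)\<bar> \<partial>M)" by (rule integral_abs_bound)
    also have "\<dots> \<le> (\<integral>\<omega>. norm (\<xi> \<omega>) * norm (u - v) \<partial>M)"
    proof (rule integral_mono)
      show "\<bar>max 0 (u \<bullet> \<xi> \<omega>) - max 0 (v \<bullet> \<xi> \<omega>)\<bar> \<le> norm (\<xi> \<omega>) * norm (u - v)" for \<omega>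
        using Cauchy_Schwarz_ineq2[of "u - v" "\<xi> \<omega>"] by (auto simp: inner_diff_left mult.commute)
    qed (use int \<xi> in auto)
    finally show ?thesis by simp
  qed
  have "continuous_on UNIV (support (Z_body M \<xi>))"
  proof (rule lipschitz_on_continuous_on)
    show "(\<integral>\<omega>. norm (\<xi> \<omega>) \<partial>M)-lipschitz_on UNIV (support (Z_body M \<xi>))"
      by (rule lipschitz_onI) (use lip in \<open>auto simp: dist_norm\<close>)
  qed
  then show ?thesis using Z_body_props(4)[OF \<xi>] by (auto simp: linear_growth_def)
qed

section \<open>The product of virtual zonoids\<close>

definition Z_generators :: "nat \<Rightarrow> (real ^ 'n::{finite,linorder}) set \<Rightarrow> 'n ext virtual_body set" where
  "Z_generators d V = {support (Z_body M \<xi>) | (M :: 'n ext measure) \<xi>.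
     prob_space M \<and> integrable M \<xi> \<and> (AE \<omega> in M. \<xi> \<omega> \<in> ext_pow d V)}"

text \<open>The zonoid depends only on the law, and the law of \<xi> is realised by the identity on
  the exterior algebra. So fixing the sample space in \<open>Z_generators\<close> is no
  restriction.\<close>

lemma Z_generatorsI:
  fixes \<xi> :: "'w \<Rightarrow> 'n::{finite,linorder} ext"
  assumes "prob_space M" and \<xi>: "integrable M \<xi>" and AE: "AE \<omega> in M. \<xi> \<omega> \<in> ext_pow d V"
  shows "support (Z_body M \<xi>) \<in> Z_generators d V"
proof -
  interpret prob_space M by fact
  have [measurable]: "\<xi> \<in> borel_measurable M" using \<xi> by auto
  let ?D = "distr M borel \<xi>"
  have i: "integrable ?D (\<lambda>x. x)" using \<xi> by (subst integrable_distr_eq) auto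
  have "support (Z_body M \<xi>) = support (Z_body ?D (\<lambda>x. x))"
    by (simp add: fun_eq_iff support_Z_body[OF \<xi>] support_Z_body[OF i] integral_distr)
  moreover have "AE x in ?D. x \<in> ext_pow d V"
    using AE closed_subspace[OF subspace_ext_pow, of d V] by (subst AE_distr_iff) auto
  moreover have "prob_space ?D" by (rule prob_space_distr) simp
  ultimately show ?thesis using i unfolding Z_generators_def by blast
qed

lemma Z_generators_growth: "fun_space.span (Z_generators d V) \<subseteq> linear_growth"
  by (rule fun_space.span_minimal[OF _ subspace_linear_growth]) (auto simp: Z_generators_def support_Z_body_growth)

lemma Z_generators_virtual: "fun_space.span (Z_generators d V) \<subseteq> virtual_zonoids (ext_pow d V)"
proof (rule fun_space.span_minimal[OF _ subspace_virtual_zonoids[OF subspace_ext_pow]], rule subsetI)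
  fix h assume "h \<in> Z_generators d V"
  then obtain M :: "'a ext measure" and \<xi> where h: "h = support (Z_body M \<xi>)" "integrable M \<xi>" "AE \<omega> in M. \<xi> \<omega> \<in> ext_pow d V"
    by (auto simp: Z_generators_def)
  have "zonotope {0 :: 'a ext}" unfolding zonotope_def by (rule exI[of _ 0]) (simp add: set_zero)
  then have z: "zonoid {0 :: 'a ext}" by (intro zonoidI_support exI[of _ "{0}"]) auto
  show "h \<in> virtual_zonoids (ext_pow d V)"
    unfolding virtual_zonoids_def
    by (rule CollectI, rule exI[of _ "Z_body M \<xi>"], rule exI[of _ "{0}"])
      (simp add: h(1) support_sing zonoid_Z_body[OF h(2)] Z_body_subset[OF h(2) subspace_ext_pow h(3)] z subspace_0[OF subspace_ext_pow])
qed

lemma wedge_integrand: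
  fixes u :: "'n::{finite,linorder} ext"
  defines "g \<equiv> \<lambda>(x, y). max 0 (u \<bullet> wedge x y)"
  shows "continuous_on UNIV g" "\<exists>C. \<forall>x y. norm (g (x, y)) \<le> C * norm x * norm y"
    "continuous_on UNIV (\<lambda>(x :: 'n ext, y). wedge x y)" "\<exists>C. \<forall>x y :: 'n ext. norm (wedge x y) \<le> C * norm x * norm y"
proof -
  interpret bounded_bilinear "wedge :: 'n ext \<Rightarrow> _" by (rule bounded_bilinear_wedge)
  show c: "continuous_on UNIV (\<lambda>(x :: 'n ext, y). wedge x y)"
    unfolding case_prod_beta' by (intro continuous_on continuous_intros)
  show "continuous_on UNIV g" unfolding g_def using c unfolding case_prod_beta'
    by (intro continuous_intros)
  obtain K where K': "\<forall>x y :: 'n ext. norm (wedge x y) \<le> norm x * norm y * K" using bounded by (elim exE) (rule that)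
  note K = K'[rule_format]
  then show "\<exists>C. \<forall>x y :: 'n ext. norm (wedge x y) \<le> C * norm x * norm y"
    by (intro exI[of _ K]) (simp add: mult_ac)
  have "norm (g (x, y)) \<le> (norm u * K) * norm x * norm y" for x y
  proof -
    have "norm (g (x, y)) \<le> \<bar>u \<bullet> wedge x y\<bar>" by (auto simp: g_def)
    also have "\<dots> \<le> norm u * (norm x * norm y * K)"
      using Cauchy_Schwarz_ineq2 mult_left_mono[OF K norm_ge_zero] by (rule order_trans)
    finally show ?thesis by (simp add: mult_ac)
  qed
  then show "\<exists>C. \<forall>x y. norm (g (x, y)) \<le> C * norm x * norm y" by blast
qed

text \<open>Both sides are iterated integrals of \<open>max 0 (u \<bullet> wedge (\<xi> \<omega>)
  (\<zeta> \<omega>'))\<close>, taken in opposite orders.\<close>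

lemma wedge_swap:
  fixes \<xi> :: "'v \<Rightarrow> 'n::{finite,linorder} ext" and \<zeta> :: "'w \<Rightarrow> 'n ext"
  assumes "prob_space M" "prob_space N" and \<xi>: "integrable M \<xi>" and \<zeta>: "integrable N \<zeta>"
  shows "(\<integral>\<omega>. support (Z_body N \<zeta>) (left_contract (\<xi> \<omega>) u) \<partial>M) =
    (\<integral>\<omega>. support (Z_body M \<xi>) (right_contract (\<zeta> \<omega>) u) \<partial>N)"
proof -
  obtain C where C: "\<forall>x y. norm (case (x, y) of (x, y) \<Rightarrow> max 0 (u \<bullet> wedge x y)) \<le> C * norm x * norm y"
    using wedge_integrand(2) by blast
  show ?thesis
    using iterated_integral_swap[OF assms wedge_integrand(1) C[rule_format]]
    by (simp add: support_Z_body[OF \<xi>] support_Z_body[OF \<zeta>] inner_left_contract inner_right_contract)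
qed

lemma wedge_indep:
  fixes \<xi> \<zeta> :: "'v \<Rightarrow> 'n::{finite,linorder} ext"
  assumes M: "prob_space M" and \<xi>: "integrable M \<xi>" and \<zeta>: "integrable M \<zeta>"
    and ind: "prob_space.indep_var M borel \<xi> borel \<zeta>"
  shows "integrable M (\<lambda>\<omega>. wedge (\<xi> \<omega>) (\<zeta> \<omega>))"
    "support (Z_body M (\<lambda>\<omega>. wedge (\<xi> \<omega>) (\<zeta> \<omega>))) u = (\<integral>\<omega>. support (Z_body M \<zeta>) (left_contract (\<xi> \<omega>) u) \<partial>M)"
proof -
  obtain K where K: "\<forall>x y :: 'n ext. norm (wedge x y) \<le> K * norm x * norm y"
    using wedge_integrand(4) by blast
  show i: "integrable M (\<lambda>\<omega>. wedge (\<xi> \<omega>) (\<zeta> \<omega>))"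
    using indep_integrable[OF assms wedge_integrand(3), of K] K by simp
  obtain C where C: "\<forall>x y. norm (case (x, y) of (x, y) \<Rightarrow> max 0 (u \<bullet> wedge x y)) \<le> C * norm x * norm y"
    using wedge_integrand(2) by blast
  show "support (Z_body M (\<lambda>\<omega>. wedge (\<xi> \<omega>) (\<zeta> \<omega>))) u = (\<integral>\<omega>. support (Z_body M \<zeta>) (left_contract (\<xi> \<omega>) u) \<partial>M)"
    using indep_integral(1)[OF assms wedge_integrand(1) C[rule_format]]
    by (simp add: support_Z_body[OF i] support_Z_body[OF \<zeta>] inner_left_contract)
qed

text \<open>Choosing a random vector for each generator gives \<open>L u x\<close>, linear in the
  second argument, and \<open>R u y\<close>, linear in the first. They agree on pairs of generators
  by \<open>wedge_swap\<close>, so \<open>bilinear_extension\<close> applies for every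
  \<open>u\<close>.\<close>

lemma zonoid_product_exists:
  fixes V :: "(real ^ 'n::{finite,linorder}) set"
  shows "\<exists>B. (\<forall>u. bilinear_on (virtual_zonoids (ext_pow p V)) (virtual_zonoids (ext_pow q V)) (\<lambda>h k. B h k u)) \<and>
     (\<forall>(M :: ('n ext \<times> 'n ext) measure) \<xi>1 \<xi>2.
        prob_space M \<and> integrable M \<xi>1 \<and> integrable M \<xi>2 \<and>
        (AE \<omega> in M. \<xi>1 \<omega> \<in> ext_pow p V) \<and> (AE \<omega> in M. \<xi>2 \<omega> \<in> ext_pow q V) \<and>
        prob_space.indep_var M borel \<xi>1 borel \<xi>2 \<longrightarrow>
        B (support (Z_body M \<xi>1)) (support (Z_body M \<xi>2)) =
          support (Z_body M (\<lambda>\<omega>. wedge (\<xi>1 \<omega>) (\<xi>2 \<omega>))))"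
proof -
  have "\<forall>x\<in>Z_generators d V. \<exists>M\<xi>. prob_space (fst M\<xi> :: 'n ext measure) \<and> integrable (fst M\<xi>) (snd M\<xi>) \<and> x = support (Z_body (fst M\<xi>) (snd M\<xi>))" for d
    by (auto simp: Z_generators_def)
  then have "\<forall>d. \<exists>f. \<forall>x\<in>Z_generators d V. prob_space (fst (f x) :: 'n ext measure) \<and> integrable (fst (f x)) (snd (f x)) \<and> x = support (Z_body (fst (f x)) (snd (f x)))"
    by (intro allI bchoice) blast
  then obtain f where f: "\<And>d x. x \<in> Z_generators d V \<Longrightarrow> prob_space (fst (f d x) :: 'n ext measure)"
    "\<And>d x. x \<in> Z_generators d V \<Longrightarrow> integrable (fst (f d x)) (snd (f d x))"
    "\<And>d x. x \<in> Z_generators d V \<Longrightarrow> support (Z_body (fst (f d x)) (snd (f d x))) = x"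
    by metis
  define L where "L u x k = 1 * (\<integral>\<omega>. k (left_contract (snd (f p x) \<omega>) u) \<partial>(fst (f p x)))" for u and x :: "'n ext virtual_body" and k :: "'n ext virtual_body"
  define R where "R u y h = 1 * (\<integral>\<omega>. h (right_contract (snd (f q y) \<omega>) u) \<partial>(fst (f q y)))" for u and y :: "'n ext virtual_body" and h :: "'n ext virtual_body"
  have "\<exists>B. bilinear_on UNIV UNIV B \<and> (\<forall>x\<in>Z_generators p V. \<forall>y\<in>Z_generators q V. B x y = L u x y)" for u
  proof (rule bilinear_extension)
    show "linear_functional_on (fun_space.span (Z_generators q V)) (L u x)" if "x \<in> Z_generators p V" for x
      unfolding L_def using f(2)[OF that] bounded_linear_contract(1) Z_generators_growth by (rule linear_functional_on_integral)
    show "linear_functional_on (fun_space.span (Z_generators p V)) (R u x)" if "x \<in> Z_generators q V" for x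
      unfolding R_def using f(2)[OF that] bounded_linear_contract(2) Z_generators_growth by (rule linear_functional_on_integral)
    show "L u x y = R u y x" if x: "x \<in> Z_generators p V" and y: "y \<in> Z_generators q V" for x y
      using wedge_swap[OF f(1)[OF x] f(1)[OF y] f(2)[OF x] f(2)[OF y], of u]
      by (simp add: L_def R_def f(3)[OF x] f(3)[OF y])
  qed
  then obtain B where B: "\<And>u. bilinear_on UNIV UNIV (B u)"
    "\<And>u x y. x \<in> Z_generators p V \<Longrightarrow> y \<in> Z_generators q V \<Longrightarrow> B u x y = L u x y"
    by metis
  show ?thesis
  proof (intro exI[of _ "\<lambda>h k u. B u h k"] conjI allI impI)
    show "bilinear_on (virtual_zonoids (ext_pow p V)) (virtual_zonoids (ext_pow q V)) (\<lambda>h k. B u h k)" for u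
      using B(1)[of u] by (simp add: bilinear_on_def)
    fix M :: "('n ext \<times> 'n ext) measure" and \<xi> \<zeta>
    assume *: "prob_space M \<and> integrable M \<xi> \<and> integrable M \<zeta> \<and>
        (AE \<omega> in M. \<xi> \<omega> \<in> ext_pow p V) \<and> (AE \<omega> in M. \<zeta> \<omega> \<in> ext_pow q V) \<and>
        prob_space.indep_var M borel \<xi> borel \<zeta>"
    then have M: "prob_space M" and \<xi>: "integrable M \<xi>" and \<zeta>: "integrable M \<zeta>"
      and x: "support (Z_body M \<xi>) \<in> Z_generators p V" and y: "support (Z_body M \<zeta>) \<in> Z_generators q V"
      by (auto intro: Z_generatorsI)
    have "B u (support (Z_body M \<xi>)) (support (Z_body M \<zeta>)) = support (Z_body M (\<lambda>\<omega>. wedge (\<xi> \<omega>) (\<zeta> \<omega>))) u" for u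
    proof -
      \<comment> \<open>The chosen representative of the first factor is traded for its support
        function by \<open>wedge_swap\<close>; the value no longer depends on the choice and can
        then be computed with \<xi> itself.\<close>
      have "B u (support (Z_body M \<xi>)) (support (Z_body M \<zeta>)) =
          (\<integral>\<omega>. support (Z_body M \<xi>) (right_contract (\<zeta> \<omega>) u) \<partial>M)"
        using wedge_swap[OF f(1)[OF x] M f(2)[OF x] \<zeta>, of u] by (simp add: B(2)[OF x y] L_def f(3)[OF x])
      also have "\<dots> = support (Z_body M (\<lambda>\<omega>. wedge (\<xi> \<omega>) (\<zeta> \<omega>))) u"
        using * wedge_swap[OF M M \<xi> \<zeta>, of u] wedge_indep(2)[OF M \<xi> \<zeta>, of u] by simp
      finally show ?thesis .
    qed
    then show "(\<lambda>u. B u (support (Z_body M \<xi>)) (support (Z_body M \<zeta>))) = support (Z_body M (\<lambda>\<omega>. wedge (\<xi> \<omega>) (\<zeta> \<omega>)))"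
      by (simp add: fun_eq_iff)
  qed
qed

lemmas zonoid_product_spec = someI_ex[OF zonoid_product_exists, folded zonoid_product_def]

section \<open>Integral formulas for the product\<close>

lemma zonoid_product_bilinear:
  assumes "h \<in> fun_space.span (Z_generators p V)" "h' \<in> fun_space.span (Z_generators p V)"
    "k \<in> fun_space.span (Z_generators q V)" "k' \<in> fun_space.span (Z_generators q V)"
  shows "zonoid_product V p q (\<lambda>u. a * h u + b * h' u) k u = a * zonoid_product V p q h k u + b * zonoid_product V p q h' k u"
    and "zonoid_product V p q h (\<lambda>u. a * k u + b * k' u) u = a * zonoid_product V p q h k u + b * zonoid_product V p q h k' u"
  using zonoid_product_spec(1)[of p V q, THEN conjunct1, rule_format, of u] assms Z_generators_virtual
  unfolding bilinear_on_def by blast+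

lemma zonoid_product_generators:
  fixes M N :: "'n::{finite,linorder} ext measure" and \<xi> \<zeta> :: "'n ext \<Rightarrow> 'n ext"
  assumes M: "prob_space M" and N: "prob_space N" and \<xi>: "integrable M \<xi>" and \<zeta>: "integrable N \<zeta>"
    and AE: "AE \<omega> in M. \<xi> \<omega> \<in> ext_pow p V" "AE \<omega> in N. \<zeta> \<omega> \<in> ext_pow q V"
  shows "zonoid_product V p q (support (Z_body M \<xi>)) (support (Z_body N \<zeta>)) =
      support (Z_body (M \<Otimes>\<^sub>M N) (\<lambda>\<omega>. wedge (\<xi> (fst \<omega>)) (\<zeta> (snd \<omega>))))"
    and "zonoid_product V p q (support (Z_body M \<xi>)) (support (Z_body N \<zeta>)) u =
      (\<integral>\<omega>. support (Z_body N \<zeta>) (left_contract (\<xi> \<omega>) u) \<partial>M)"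
proof -
  note pm = pair_marginal_props[OF M N \<xi> \<zeta>]
  have [measurable]: "\<xi> \<in> borel_measurable M" "\<zeta> \<in> borel_measurable N" using \<xi> \<zeta> by auto
  have e1: "support (Z_body (M \<Otimes>\<^sub>M N) (\<lambda>\<omega>. \<xi> (fst \<omega>))) = support (Z_body M \<xi>)"
    using pm(7)[where f="\<lambda>\<omega>. max 0 (u \<bullet> \<xi> \<omega>)" for u]
    by (intro ext) (simp add: support_Z_body[OF pm(2)] support_Z_body[OF \<xi>])
  have e2: "support (Z_body (M \<Otimes>\<^sub>M N) (\<lambda>\<omega>. \<zeta> (snd \<omega>))) = support (Z_body N \<zeta>)"
    using pm(8)[where g="\<lambda>\<omega>. max 0 (u \<bullet> \<zeta> \<omega>)" for u]
    by (intro ext) (simp add: support_Z_body[OF pm(3)] support_Z_body[OF \<zeta>])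
  show e: "zonoid_product V p q (support (Z_body M \<xi>)) (support (Z_body N \<zeta>)) =
      support (Z_body (M \<Otimes>\<^sub>M N) (\<lambda>\<omega>. wedge (\<xi> (fst \<omega>)) (\<zeta> (snd \<omega>))))"
    using zonoid_product_spec[of p V q, THEN conjunct2, rule_format, of "M \<Otimes>\<^sub>M N" "\<lambda>\<omega>. \<xi> (fst \<omega>)" "\<lambda>\<omega>. \<zeta> (snd \<omega>)"]
      pm(1-4) pm(5)[OF AE(1)] pm(6)[OF AE(2)] by (simp add: e1 e2)
  have "(\<lambda>\<omega>. support (Z_body N \<zeta>) (left_contract (\<xi> \<omega>) u)) \<in> borel_measurable M"
    using linear_growth_integrable[OF \<xi> support_Z_body_growth[OF \<zeta>] bounded_linear_contract(1)] by auto
  then show "zonoid_product V p q (support (Z_body M \<xi>)) (support (Z_body N \<zeta>)) u =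
      (\<integral>\<omega>. support (Z_body N \<zeta>) (left_contract (\<xi> \<omega>) u) \<partial>M)"
    using wedge_indep(2)[OF pm(1-4), of u] pm(7) by (simp add: e e2)
qed

text \<open>Both sides are linear in \<open>k\<close>, so the formula known for generators extends
  to their span. It makes products with an arbitrary second factor computable, in particular with
  elements of \<open>I_deg\<close>.\<close>

lemma zonoid_product_left:
  fixes M :: "'n::{finite,linorder} ext measure" and \<xi> :: "'n ext \<Rightarrow> 'n ext"
  assumes M: "prob_space M" and \<xi>: "integrable M \<xi>" and AE: "AE \<omega> in M. \<xi> \<omega> \<in> ext_pow p V"
    and k: "k \<in> fun_space.span (Z_generators q V)"
  shows "zonoid_product V p q (support (Z_body M \<xi>)) k u = (\<integral>\<omega>. k (left_contract (\<xi> \<omega>) u) \<partial>M)"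
proof (rule linear_functional_on_eq[OF _ _ _ k, where L="\<lambda>k. zonoid_product V p q (support (Z_body M \<xi>)) k u"])
  have g: "support (Z_body M \<xi>) \<in> fun_space.span (Z_generators p V)"
    by (intro fun_space.span_base Z_generatorsI M \<xi> AE)
  show "linear_functional_on (fun_space.span (Z_generators q V)) (\<lambda>k. zonoid_product V p q (support (Z_body M \<xi>)) k u)"
    using zonoid_product_bilinear(2)[OF g g] by (simp add: linear_functional_on_def)
  show "linear_functional_on (fun_space.span (Z_generators q V)) (\<lambda>k. \<integral>\<omega>. k (left_contract (\<xi> \<omega>) u) \<partial>M)"
    using linear_functional_on_integral[OF \<xi> bounded_linear_contract(1) Z_generators_growth, where c=1] by simp
  show "zonoid_product V p q (support (Z_body M \<xi>)) h u = (\<integral>\<omega>. h (left_contract (\<xi> \<omega>) u) \<partial>M)"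
    if gen: "h \<in> Z_generators q V" for h
  proof -
    obtain N :: "'n ext measure" and \<zeta> where h: "h = support (Z_body N \<zeta>)" "prob_space N" "integrable N \<zeta>"
      "AE \<omega> in N. \<zeta> \<omega> \<in> ext_pow q V"
      using gen by (auto simp: Z_generators_def)
    show ?thesis unfolding h(1) by (rule zonoid_product_generators(2)[OF M h(2) \<xi> h(3) AE h(4)])
  qed
qed

lemma zonoid_product_right:
  fixes N :: "'n::{finite,linorder} ext measure" and \<zeta> :: "'n ext \<Rightarrow> 'n ext"
  assumes N: "prob_space N" and \<zeta>: "integrable N \<zeta>" and AE: "AE \<omega> in N. \<zeta> \<omega> \<in> ext_pow q V"
    and h: "h \<in> fun_space.span (Z_generators p V)"
  shows "zonoid_product V p q h (support (Z_body N \<zeta>)) u = (\<integral>\<omega>. h (right_contract (\<zeta> \<omega>) u) \<partial>N)"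
proof (rule linear_functional_on_eq[OF _ _ _ h, where L="\<lambda>h. zonoid_product V p q h (support (Z_body N \<zeta>)) u"])
  have g: "support (Z_body N \<zeta>) \<in> fun_space.span (Z_generators q V)"
    by (intro fun_space.span_base Z_generatorsI N \<zeta> AE)
  show "linear_functional_on (fun_space.span (Z_generators p V)) (\<lambda>h. zonoid_product V p q h (support (Z_body N \<zeta>)) u)"
    using zonoid_product_bilinear(1)[OF _ _ g g] by (simp add: linear_functional_on_def)
  show "linear_functional_on (fun_space.span (Z_generators p V)) (\<lambda>h. \<integral>\<omega>. h (right_contract (\<zeta> \<omega>) u) \<partial>N)"
    using linear_functional_on_integral[OF \<zeta> bounded_linear_contract(2) Z_generators_growth, where c=1] by simp
  show "zonoid_product V p q h (support (Z_body N \<zeta>)) u = (\<integral>\<omega>. h (right_contract (\<zeta> \<omega>) u) \<partial>N)"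
    if gen: "h \<in> Z_generators p V" for h
  proof -
    obtain M :: "'n ext measure" and \<xi> where h: "h = support (Z_body M \<xi>)" "prob_space M" "integrable M \<xi>"
      "AE \<omega> in M. \<xi> \<omega> \<in> ext_pow p V"
      using gen by (auto simp: Z_generators_def)
    show ?thesis unfolding h(1)
      using zonoid_product_generators(2)[OF h(2) N h(3) \<zeta> h(4) AE, of u] wedge_swap[OF h(2) N h(3) \<zeta>, of u] by simp
  qed
qed

section \<open>Grassmannian zonoids\<close>

text \<open>From \<open>\<bar>t\<bar> = max 0 t + max 0 (-t)\<close>. It carries the product
  formula, which is given for the bodies \<open>Z\<close>, over to the bodies
  \<open>K\<close>.\<close>

lemma support_K_eq_Z:
  fixes \<xi> :: "'w \<Rightarrow> 'a::euclidean_space"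
  assumes \<xi>: "integrable M \<xi>"
  shows "support (K_body M \<xi>) = (\<lambda>u. (1/2) * support (Z_body M \<xi>) u + (1/2) * support (Z_body M (\<lambda>\<omega>. - \<xi> \<omega>)) u)"
proof
  fix u
  have int: "integrable M (\<lambda>\<omega>. max 0 (u \<bullet> \<xi> \<omega>))" "integrable M (\<lambda>\<omega>. max 0 (- (u \<bullet> \<xi> \<omega>)))"
    using \<xi> by (intro integrable_max; auto)+
  have "(\<integral>\<omega>. \<bar>u \<bullet> \<xi> \<omega>\<bar> \<partial>M) = (\<integral>\<omega>. max 0 (u \<bullet> \<xi> \<omega>) + max 0 (- (u \<bullet> \<xi> \<omega>)) \<partial>M)"
    by (intro Bochner_Integration.integral_cong refl) auto
  also have "\<dots> = (\<integral>\<omega>. max 0 (u \<bullet> \<xi> \<omega>) \<partial>M) + (\<integral>\<omega>. max 0 (- (u \<bullet> \<xi> \<omega>)) \<partial>M)"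
    by (rule Bochner_Integration.integral_add[OF int])
  finally show "support (K_body M \<xi>) u = (1/2) * support (Z_body M \<xi>) u + (1/2) * support (Z_body M (\<lambda>\<omega>. - \<xi> \<omega>)) u"
    using \<xi> by (simp add: support_K_body support_Z_body)
qed

lemma K_body_props:
  fixes \<xi> :: "'w \<Rightarrow> 'a::euclidean_space"
  assumes \<xi>: "integrable M \<xi>"
  shows "compact (K_body M \<xi>)" "K_body M \<xi> \<noteq> {}"
proof -
  have "(1/2) * (\<integral>\<omega>. \<bar>u \<bullet> \<xi> \<omega>\<bar> \<partial>M) \<le> (\<integral>\<omega>. norm (\<xi> \<omega>) \<partial>M) * norm u" for u
  proof -
    have "(\<integral>\<omega>. \<bar>u \<bullet> \<xi> \<omega>\<bar> \<partial>M) \<le> (\<integral>\<omega>. norm (\<xi> \<omega>) * norm u \<partial>M)"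
    proof (rule integral_mono)
      show "\<bar>u \<bullet> \<xi> \<omega>\<bar> \<le> norm (\<xi> \<omega>) * norm u" for \<omega>
        using Cauchy_Schwarz_ineq2[of u "\<xi> \<omega>"] by (simp add: mult.commute)
    qed (use \<xi> in auto)
    also have "\<dots> = (\<integral>\<omega>. norm (\<xi> \<omega>) \<partial>M) * norm u" by simp
    finally show ?thesis by (rule order_trans[rotated]) simp
  qed
  then show "compact (K_body M \<xi>)" unfolding K_body_def by (rule compact_body_of)
  have "0 \<in> K_body M \<xi>" by (simp add: K_body_def body_of_def)
  then show "K_body M \<xi> \<noteq> {}" by blast
qed

lemma support_K_body_translate:
  fixes \<xi> :: "'w \<Rightarrow> 'a::euclidean_space"
  assumes \<xi>: "integrable M \<xi>"
  shows "support (K_body M \<xi> + {p}) = (\<lambda>u. support (K_body M \<xi>) u + p \<bullet> u)"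
  using support_Minkowski_sum[OF K_body_props[OF \<xi>], of "{p}"] by (simp add: fun_eq_iff support_sing)

lemma zero_simple: "subspace V \<Longrightarrow> 0 \<in> simple_vectors d V"
  unfolding simple_vectors_def
  by (rule CollectI, rule exI[of _ 0], rule exI[of _ "replicate d 0"]) (auto simp: subspace_0)

lemma random_simple_ext_pow:
  assumes "random_simple M d V \<xi>" shows "AE \<omega> in M. \<xi> \<omega> \<in> ext_pow d V"
proof -
  have "AE \<omega> in M. \<xi> \<omega> \<in> simple_vectors d V" using assms by (simp add: random_simple_def)
  then show ?thesis by eventually_elim (use simple_vectors_subset_ext_pow in blast)
qed

lemma random_simple_minus:
  assumes "random_simple M d V \<xi>" shows "random_simple M d V (\<lambda>\<omega>. - \<xi> \<omega>)"
proof -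
  have "AE \<omega> in M. \<xi> \<omega> \<in> simple_vectors d V" using assms by (simp add: random_simple_def)
  then have "AE \<omega> in M. - \<xi> \<omega> \<in> simple_vectors d V"
    by eventually_elim (use simple_vectors_scale[of _ d V "-1"] in simp)
  then show ?thesis using assms by (simp add: random_simple_def)
qed

text \<open>A deterministic vector. Pairing with its zonoid evaluates a virtual zonoid at
  \<open>w\<close>, up to the factor 2.\<close>

lemma random_simple_return:
  assumes "w \<in> simple_vectors d V" shows "random_simple (return borel (w :: 'n::{finite,linorder} ext)) d V (\<lambda>_. w)"
  unfolding random_simple_def
proof (intro conjI)
  interpret prob_space "return borel w" by (rule prob_space_return) simp
  show "prob_space (return borel w)" by (rule prob_space_return) simp
  show "integrable (return borel w) (\<lambda>_. w)" by simp
qed (use assms in simp)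

definition K_generators :: "nat \<Rightarrow> (real ^ 'n::{finite,linorder}) set \<Rightarrow> 'n ext virtual_body set" where
  "K_generators d V = {support (K_body M \<xi>) | (M :: 'n ext measure) \<xi>. random_simple M d V \<xi>}"

lemma G_centered_eq: "G_centered d V = fun_space.span (K_generators d V)"
  by (simp add: G_centered_def K_generators_def lin_span_eq_span)

text \<open>
  The set of simple vectors need not be a Borel set a priori, so the law of the vector is taken
  with respect to the finest sigma-algebra that makes it measurable.
\<close>

lemma K_generatorsI:
  fixes \<xi> :: "'w \<Rightarrow> 'n::{finite,linorder} ext"
  assumes V: "subspace V" and rs: "random_simple M d V \<xi>"
  shows "support (K_body M \<xi>) \<in> K_generators d V"
proof -
  interpret prob_space M using rs by (simp add: random_simple_def)
  have \<xi>: "integrable M \<xi>" and AE: "AE \<omega> in M. \<xi> \<omega> \<in> simple_vectors d V"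
    using rs by (auto simp: random_simple_def)
  have [measurable]: "\<xi> \<in> borel_measurable M" using \<xi> by auto
  obtain N where N: "{\<omega> \<in> space M. \<xi> \<omega> \<notin> simple_vectors d V} \<subseteq> N" "emeasure M N = 0" "N \<in> sets M"
    using AE by (rule AE_E)
  note [measurable] = N(3)
  \<comment> \<open>Replacing \<xi> by 0 on a null set makes all its values simple, which puts the
    set of simple vectors into the sigma-algebra \<open>F\<close> below.\<close>
  define \<eta> where "\<eta> \<omega> = (if \<omega> \<in> N then 0 else \<xi> \<omega>)" for \<omega>
  have [measurable]: "\<eta> \<in> borel_measurable M" unfolding \<eta>_def by measurable
  have eq: "AE \<omega> in M. \<eta> \<omega> = \<xi> \<omega>"
    using AE_not_in[of N M] N by (auto simp: \<eta>_def null_sets_def elim!: eventually_mono)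
  have simple: "\<eta> \<omega> \<in> simple_vectors d V" if "\<omega> \<in> space M" for \<omega>
    using N(1) that zero_simple[OF V] by (auto simp: \<eta>_def)
  have \<eta>: "integrable M \<eta>" using integrable_cong_AE[of \<eta> M \<xi>] eq \<xi> by simp
  define F where "F = {A. \<eta> -` A \<inter> space M \<in> sets M}"
  have F: "sigma_algebra UNIV F"
    unfolding sigma_algebra_iff2
  proof (intro conjI ballI allI impI)
    fix A assume "A \<in> F"
    moreover have "\<eta> -` (UNIV - A) \<inter> space M = space M - (\<eta> -` A \<inter> space M)" by auto
    ultimately show "UNIV - A \<in> F" by (simp add: F_def sets.compl_sets)
  next
    fix A :: "nat \<Rightarrow> 'n ext set" assume "range A \<subseteq> F"
    then have "(\<Union>i. \<eta> -` A i \<inter> space M) \<in> sets M" by (intro sets.countable_UN) (auto simp: F_def)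
    moreover have "\<eta> -` (\<Union>i. A i) \<inter> space M = (\<Union>i. \<eta> -` A i \<inter> space M)" by auto
    ultimately show "(\<Union>i. A i) \<in> F" unfolding F_def by simp
  qed (auto simp: F_def)
  define S where "S = sigma UNIV F"
  have sets: "sets S = F" "space S = UNIV"
    using sigma_algebra.sets_measure_of_eq[OF F] by (simp_all add: S_def space_measure_of_conv)
  have m1: "\<eta> \<in> measurable M S" by (rule measurableI) (auto simp: sets F_def)
  have m2: "(\<lambda>x. x) \<in> measurable S borel"
    by (rule measurableI) (use measurable_sets[of \<eta> M borel] in \<open>auto simp: sets F_def\<close>)
  let ?D = "distr M S \<eta>"
  have i: "integrable ?D (\<lambda>x. x)" using \<eta> by (subst integrable_distr_eq[OF m1 m2]) simp
  have "simple_vectors d V \<in> F"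
  proof -
    have "\<eta> -` simple_vectors d V \<inter> space M = space M" using simple by auto
    then show ?thesis by (simp add: F_def)
  qed
  then have "AE x in ?D. x \<in> simple_vectors d V"
    by (subst AE_distr_iff[OF m1]) (auto simp: sets simple)
  moreover have "prob_space ?D" by (rule prob_space_distr[OF m1])
  ultimately have "random_simple ?D d V (\<lambda>x. x)" using i by (simp add: random_simple_def)
  moreover have "support (K_body M \<xi>) = support (K_body ?D (\<lambda>x. x))"
  proof
    fix u
    have [measurable]: "(\<lambda>x. x) \<in> borel_measurable S" by (rule m2)
    have "(\<integral>x. \<bar>u \<bullet> x\<bar> \<partial>?D) = (\<integral>\<omega>. \<bar>u \<bullet> \<eta> \<omega>\<bar> \<partial>M)" by (rule integral_distr[OF m1]) measurable
    also have "\<dots> = (\<integral>\<omega>. \<bar>u \<bullet> \<xi> \<omega>\<bar> \<partial>M)"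
      by (rule integral_cong_AE) (use eq in \<open>auto elim!: eventually_mono\<close>)
    finally show "support (K_body M \<xi>) u = support (K_body ?D (\<lambda>x. x)) u"
      by (simp add: support_K_body[OF \<xi>] support_K_body[OF i])
  qed
  ultimately show ?thesis unfolding K_generators_def by blast
qed

lemma support_K_in_span_Z:
  fixes \<xi> :: "'w \<Rightarrow> 'n::{finite,linorder} ext"
  assumes rs: "random_simple M d V \<xi>"
  shows "support (K_body M \<xi>) \<in> fun_space.span (Z_generators d V)"
proof -
  have "support (Z_body M \<eta>) \<in> fun_space.span (Z_generators d V)" if "random_simple M d V \<eta>" for \<eta>
    using that random_simple_ext_pow[OF that] by (intro fun_space.span_base Z_generatorsI) (auto simp: random_simple_def)
  from fun_span_comb[OF this[OF rs] this[OF random_simple_minus[OF rs]], of "1/2" "1/2"] show ?thesis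
    using rs by (simp add: support_K_eq_Z random_simple_def)
qed

lemma G_centered_in_span_Z: "G_centered d V \<subseteq> fun_space.span (Z_generators d V)"
  unfolding G_centered_eq
  by (rule fun_space.span_minimal) (auto simp: K_generators_def support_K_in_span_Z fun_space.subspace_span)

text \<open>The difference of the bodies \<open>Z\<close> of the constants \<open>p\<close> and
  \<open>- p\<close>, because \<open>max 0 t - max 0 (-t) = t\<close>.\<close>

lemma point_in_span_Z:
  assumes p: "p \<in> ext_pow d V" shows "(\<lambda>u. p \<bullet> u) \<in> fun_space.span (Z_generators d V)"
proof -
  interpret prob_space "return borel (0::'a ext)" by (rule prob_space_return) simp
  have "support (Z_body (return borel (0::'a ext)) (\<lambda>_. q)) \<in> fun_space.span (Z_generators d V)" if "q \<in> ext_pow d V" for q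
    using that by (intro fun_space.span_base Z_generatorsI) (auto intro: prob_space_axioms)
  from fun_span_comb[OF this[OF p] this[of "- p"], of 1 "-1"] show ?thesis
    using p subspace_neg[OF subspace_ext_pow p] prob_space
    by (simp add: support_Z_body max_def inner_commute if_distrib cong: if_cong)
qed

lemma G_all_iff:
  assumes V: "subspace V"
  shows "h \<in> G_all d V \<longleftrightarrow> (\<exists>k\<in>G_centered d V. \<exists>p\<in>ext_pow d V. h = (\<lambda>u. k u + p \<bullet> u))"
proof
  let ?A = "{support (K_body M \<xi> + {p}) | (M :: 'a ext measure) \<xi> p. random_simple M d V \<xi> \<and> p \<in> ext_pow d V}"
  have G: "G_all d V = fun_space.span ?A" by (simp add: G_all_def lin_span_eq_span)
  note sp = subspace_ext_pow[of d V]
  assume "h \<in> G_all d V"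
  then show "\<exists>k\<in>G_centered d V. \<exists>p\<in>ext_pow d V. h = (\<lambda>u. k u + p \<bullet> u)"
    unfolding G
  proof (induction rule: fun_span_induct)
    case (base h)
    then obtain M :: "'a ext measure" and \<xi> p where h: "h = support (K_body M \<xi> + {p})" "random_simple M d V \<xi>" "p \<in> ext_pow d V" by blast
    then have "support (K_body M \<xi>) \<in> G_centered d V"
      unfolding G_centered_eq by (intro fun_space.span_base) (auto simp: K_generators_def)
    then show ?case using h by (auto simp: support_K_body_translate random_simple_def)
  next
    case (comb h k a b)
    then obtain h' p k' q where *: "h' \<in> G_centered d V" "p \<in> ext_pow d V" "h = (\<lambda>u. h' u + p \<bullet> u)"
      "k' \<in> G_centered d V" "q \<in> ext_pow d V" "k = (\<lambda>u. k' u + q \<bullet> u)" by blast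
    then have "(\<lambda>u. a * h' u + b * k' u) \<in> G_centered d V" unfolding G_centered_eq by (intro fun_span_comb)
    moreover have "a *\<^sub>R p + b *\<^sub>R q \<in> ext_pow d V" using * sp by (simp add: subspace_add subspace_scale)
    moreover have "(\<lambda>u. a * h u + b * k u) = (\<lambda>u. (a * h' u + b * k' u) + (a *\<^sub>R p + b *\<^sub>R q) \<bullet> u)"
      by (simp add: * fun_eq_iff inner_add_left algebra_simps)
    ultimately show ?case by (intro bexI)
  next
    have "(\<lambda>_. 0) \<in> G_centered d V" unfolding G_centered_eq using fun_space.span_zero by (simp add: zero_fun_def)
    moreover have "0 \<in> ext_pow d V" by (rule subspace_0[OF sp])
    ultimately show "\<exists>k\<in>G_centered d V. \<exists>p\<in>ext_pow d V. (\<lambda>_. 0) = (\<lambda>u. k u + p \<bullet> u)"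
      by (intro bexI[of _ "\<lambda>_. 0"] bexI[of _ 0]) auto
  qed
next
  let ?A = "{support (K_body M \<xi> + {p}) | (M :: 'a ext measure) \<xi> p. random_simple M d V \<xi> \<and> p \<in> ext_pow d V}"
  have G: "G_all d V = fun_space.span ?A" by (simp add: G_all_def lin_span_eq_span)
  assume "\<exists>k\<in>G_centered d V. \<exists>p\<in>ext_pow d V. h = (\<lambda>u. k u + p \<bullet> u)"
  then obtain k p where h: "k \<in> G_centered d V" "p \<in> ext_pow d V" "h = (\<lambda>u. k u + p \<bullet> u)" by blast
  have gen: "(\<lambda>u. support (K_body M \<xi>) u + q \<bullet> u) \<in> G_all d V" if "random_simple M d V \<xi>" "q \<in> ext_pow d V"
    for M :: "'a ext measure" and \<xi> q
    unfolding G using that support_K_body_translate[of M \<xi> q]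
    by (intro fun_space.span_base CollectI exI[of _ M] exI[of _ \<xi>] exI[of _ q]) (auto simp: random_simple_def)
  have k: "k \<in> G_all d V"
  proof -
    have "K_generators d V \<subseteq> G_all d V"
      using gen[OF _ subspace_0[OF subspace_ext_pow]] by (auto simp: K_generators_def)
    then have "fun_space.span (K_generators d V) \<subseteq> G_all d V"
      unfolding G by (rule fun_space.span_minimal) (rule fun_space.subspace_span)
    then show ?thesis using h(1) by (auto simp: G_centered_eq)
  qed
  \<comment> \<open>The zero vector has the origin as its body \<open>K\<close>, so every point of
    the exterior power is itself a generator.\<close>
  have z: "random_simple (return borel (0 :: 'a ext)) d V (\<lambda>_. 0)"
    using random_simple_return[OF zero_simple[OF V]] .
  have "(\<lambda>u. p \<bullet> u) \<in> G_all d V"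
    using gen[OF z h(2)] z by (simp add: support_K_body random_simple_def)
  with k show "h \<in> G_all d V" using fun_span_comb[of k ?A "\<lambda>u. p \<bullet> u" 1 1] by (simp add: G h(3))
qed

lemma G_all_in_span_Z: "subspace V \<Longrightarrow> G_all d V \<subseteq> fun_space.span (Z_generators d V)"
proof
  fix h assume "subspace V" "h \<in> G_all d V"
  then obtain k p where h: "k \<in> G_centered d V" "p \<in> ext_pow d V" "h = (\<lambda>u. k u + p \<bullet> u)"
    using G_all_iff by blast
  show "h \<in> fun_space.span (Z_generators d V)"
    using fun_span_comb[OF subsetD[OF G_centered_in_span_Z h(1)] point_in_span_Z[OF h(2)], of 1 1] by (simp add: h(3))
qed

section \<open>The pairing and its kernel\<close>

text \<open>As for the product, averaging over a chosen representative is linear in the other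
  argument. Here the integrand \<open>\<bar>x \<bullet> y\<bar>\<close> is symmetric, so the same
  \<open>L\<close> serves on both sides.\<close>

lemma pairing_exists:
  fixes V :: "(real ^ 'n::{finite,linorder}) set"
  shows "\<exists>B. bilinear_on (G_centered d V) (G_centered d V) B \<and>
     (\<forall>(M :: ('n ext \<times> 'n ext) measure) \<xi> \<zeta>.
        random_simple M d V \<xi> \<and> random_simple M d V \<zeta> \<and> prob_space.indep_var M borel \<xi> borel \<zeta> \<longrightarrow>
        B (support (K_body M \<xi>)) (support (K_body M \<zeta>)) = (\<integral>\<omega>. \<bar>\<xi> \<omega> \<bullet> \<zeta> \<omega>\<bar> \<partial>M))"
proof -
  define A where "A = {support (K_body M \<xi>) | (M :: ('n ext \<times> 'n ext) measure) \<xi>. random_simple M d V \<xi>}"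
  have A: "support (K_body M \<xi>) \<in> A" if "random_simple M d V \<xi>" for M :: "('n ext \<times> 'n ext) measure" and \<xi>
    unfolding A_def using that by blast
  have "\<forall>x\<in>A. \<exists>M\<xi>. random_simple (fst M\<xi> :: ('n ext \<times> 'n ext) measure) d V (snd M\<xi>) \<and> support (K_body (fst M\<xi>) (snd M\<xi>)) = x"
    unfolding A_def by auto
  then obtain f where f0: "\<forall>x\<in>A. random_simple (fst (f x) :: ('n ext \<times> 'n ext) measure) d V (snd (f x)) \<and> support (K_body (fst (f x)) (snd (f x))) = x"
    by (elim bchoice[THEN exE]) (rule that)
  have f: "random_simple (fst (f x)) d V (snd (f x))" "support (K_body (fst (f x)) (snd (f x))) = x" if "x \<in> A" for x
    using f0[THEN bspec, OF that] by simp_all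
  \<comment> \<open>The factor 2 cancels the factor 1/2 in the support function of
    \<open>K\<close>.\<close>
  define L where "L x k = 2 * (\<integral>\<omega>. k (snd (f x) \<omega>) \<partial>(fst (f x)))" for x k :: "'n ext virtual_body"
  have growth: "fun_space.span A \<subseteq> linear_growth"
  proof -
    have "A \<subseteq> fun_space.span (Z_generators d V)" unfolding A_def using support_K_in_span_Z by auto
    then have "fun_space.span A \<subseteq> fun_space.span (Z_generators d V)"
      by (rule fun_space.span_minimal) (rule fun_space.subspace_span)
    then show ?thesis using Z_generators_growth by blast
  qed
  have g: "continuous_on UNIV (\<lambda>(x :: 'n ext, y). \<bar>x \<bullet> y\<bar>)"
    "norm (case (x, y) of (x :: 'n ext, y) \<Rightarrow> \<bar>x \<bullet> y\<bar>) \<le> 1 * norm x * norm y" for x y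
    unfolding case_prod_beta' using Cauchy_Schwarz_ineq2[of x y] by (auto intro!: continuous_intros)
  have K: "2 * (\<integral>\<omega>. support (K_body N \<zeta>) (\<xi> \<omega>) \<partial>M) = (\<integral>\<omega>. \<integral>\<omega>'. \<bar>\<xi> \<omega> \<bullet> \<zeta> \<omega>'\<bar> \<partial>N \<partial>M)"
    if "random_simple M d V \<xi>" "random_simple N d V \<zeta>" for M N :: "('n ext \<times> 'n ext) measure" and \<xi> \<zeta>
    using that by (simp add: support_K_body random_simple_def)
  have swap: "(\<integral>\<omega>. \<integral>\<omega>'. \<bar>\<xi> \<omega> \<bullet> \<zeta> \<omega>'\<bar> \<partial>N \<partial>M) = (\<integral>\<omega>'. \<integral>\<omega>. \<bar>\<xi> \<omega> \<bullet> \<zeta> \<omega>'\<bar> \<partial>M \<partial>N)"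
    if "random_simple M d V \<xi>" "random_simple N d V \<zeta>" for M N :: "('n ext \<times> 'n ext) measure" and \<xi> \<zeta>
    using iterated_integral_swap[OF _ _ _ _ g, of M N \<xi> \<zeta>] that by (simp add: random_simple_def)
  have "\<exists>B. bilinear_on UNIV UNIV B \<and> (\<forall>x\<in>A. \<forall>y\<in>A. B x y = L x y)"
  proof (rule bilinear_extension[where R=L])
    show "linear_functional_on (fun_space.span A) (L x)" if "x \<in> A" for x
      using linear_functional_on_integral[OF _ bounded_linear_ident growth, of "fst (f x)" "snd (f x)" 2] f(1)[OF that]
      by (simp add: L_def[abs_def] random_simple_def)
    then show "linear_functional_on (fun_space.span A) (L x)" if "x \<in> A" for x using that .
    show "L x y = L y x" if x: "x \<in> A" and y: "y \<in> A" for x y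
      using K[OF f(1)[OF x] f(1)[OF y]] K[OF f(1)[OF y] f(1)[OF x]] swap[OF f(1)[OF x] f(1)[OF y]]
      by (simp add: L_def f(2)[OF x] f(2)[OF y] inner_commute)
  qed
  then obtain B where B1: "bilinear_on UNIV UNIV B" and B2: "\<forall>x\<in>A. \<forall>y\<in>A. B x y = L x y"
    by (elim exE conjE) (rule that)
  note B = B1 B2[rule_format]
  show ?thesis
  proof (intro exI[of _ B] conjI allI impI)
    show "bilinear_on (G_centered d V) (G_centered d V) B" using B(1) by (simp add: bilinear_on_def)
    fix M :: "('n ext \<times> 'n ext) measure" and \<xi> \<zeta>
    assume *: "random_simple M d V \<xi> \<and> random_simple M d V \<zeta> \<and> prob_space.indep_var M borel \<xi> borel \<zeta>"
    then have \<xi>: "random_simple M d V \<xi>" and \<zeta>: "random_simple M d V \<zeta>" by auto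
    have x: "support (K_body M \<xi>) \<in> A" and y: "support (K_body M \<zeta>) \<in> A" using A[OF \<xi>] A[OF \<zeta>] by simp_all
    let ?N = "fst (f (support (K_body M \<xi>)))" and ?\<eta> = "snd (f (support (K_body M \<xi>)))"
    have "B (support (K_body M \<xi>)) (support (K_body M \<zeta>)) = (\<integral>\<omega>. \<integral>\<omega>'. \<bar>?\<eta> \<omega> \<bullet> \<zeta> \<omega>'\<bar> \<partial>M \<partial>?N)"
      using K[OF f(1)[OF x] \<zeta>] by (simp add: B(2)[OF x y] L_def)
    also have "\<dots> = 2 * (\<integral>\<omega>. support (K_body M \<xi>) (\<zeta> \<omega>) \<partial>M)"
      using swap[OF f(1)[OF x] \<zeta>] K[OF \<zeta> f(1)[OF x]] by (simp add: f(2)[OF x] inner_commute)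
    also have "\<dots> = (\<integral>\<omega>. \<bar>\<xi> \<omega> \<bullet> \<zeta> \<omega>\<bar> \<partial>M)"
      using indep_integral(2)[OF _ _ _ _ g, of M \<xi> \<zeta>] * K[OF \<zeta> \<xi>] by (simp add: random_simple_def inner_commute)
    finally show "B (support (K_body M \<xi>)) (support (K_body M \<zeta>)) = (\<integral>\<omega>. \<bar>\<xi> \<omega> \<bullet> \<zeta> \<omega>\<bar> \<partial>M)" .
  qed
qed

lemmas pairing_spec = someI_ex[OF pairing_exists, folded pairing_def]

text \<open>On generators, independent copies and Fubini turn the expectation of
  \<open>\<bar>\<xi> \<bullet> \<zeta>\<bar>\<close> into twice the average of \<open>h\<close>
  along \<zeta>; both sides are linear in \<open>h\<close>.\<close>

lemma pairing_generator:
  fixes N :: "'n::{finite,linorder} ext measure" and \<zeta> :: "'n ext \<Rightarrow> 'n ext"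
  assumes h: "h \<in> G_centered d V" and \<zeta>: "random_simple N d V \<zeta>"
  shows "pairing d V h (support (K_body N \<zeta>)) = 2 * (\<integral>\<omega>. h (\<zeta> \<omega>) \<partial>N)"
proof (rule linear_functional_on_eq[OF _ _ _ h[unfolded G_centered_eq], where L="\<lambda>h. pairing d V h (support (K_body N \<zeta>))"])
  have y: "support (K_body N \<zeta>) \<in> G_centered d V"
    unfolding G_centered_eq by (rule fun_space.span_base) (use \<zeta> in \<open>auto simp: K_generators_def\<close>)
  show "linear_functional_on (fun_space.span (K_generators d V)) (\<lambda>h. pairing d V h (support (K_body N \<zeta>)))"
    using pairing_spec[of d V] y unfolding bilinear_on_def linear_functional_on_def G_centered_eq by blast
  show "linear_functional_on (fun_space.span (K_generators d V)) (\<lambda>h. 2 * (\<integral>\<omega>. h (\<zeta> \<omega>) \<partial>N))"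
  proof (rule linear_functional_on_integral[OF _ bounded_linear_ident])
    show "fun_space.span (K_generators d V) \<subseteq> linear_growth"
      using G_centered_in_span_Z[of d V] Z_generators_growth[of d V] by (simp add: G_centered_eq)
  qed (use \<zeta> in \<open>simp add: random_simple_def\<close>)
  fix h assume "h \<in> K_generators d V"
  then obtain M :: "'n ext measure" and \<xi> where h: "h = support (K_body M \<xi>)" and \<xi>: "random_simple M d V \<xi>"
    by (auto simp: K_generators_def)
  have i: "prob_space M" "prob_space N" "integrable M \<xi>" "integrable N \<zeta>" using \<xi> \<zeta> by (auto simp: random_simple_def)
  have [measurable]: "\<xi> \<in> borel_measurable M" "\<zeta> \<in> borel_measurable N" using i by auto
  note pm = pair_marginal_props[OF i]
  have g: "continuous_on UNIV (\<lambda>(x :: 'n ext, y). \<bar>x \<bullet> y\<bar>)"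
    "norm (case (x, y) of (x :: 'n ext, y) \<Rightarrow> \<bar>x \<bullet> y\<bar>) \<le> 1 * norm x * norm y" for x y
    unfolding case_prod_beta' using Cauchy_Schwarz_ineq2[of x y] by (auto intro!: continuous_intros)
  have r: "random_simple (M \<Otimes>\<^sub>M N) d V (\<lambda>\<omega>. \<xi> (fst \<omega>))" "random_simple (M \<Otimes>\<^sub>M N) d V (\<lambda>\<omega>. \<zeta> (snd \<omega>))"
    using \<xi> \<zeta> pm by (auto simp: random_simple_def)
  have e1: "support (K_body (M \<Otimes>\<^sub>M N) (\<lambda>\<omega>. \<xi> (fst \<omega>))) = h"
    unfolding h using pm(7)[where f="\<lambda>\<omega>. \<bar>u \<bullet> \<xi> \<omega>\<bar>" for u]
    by (intro ext) (simp add: support_K_body[OF pm(2)] support_K_body[OF i(3)])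
  have e2: "support (K_body (M \<Otimes>\<^sub>M N) (\<lambda>\<omega>. \<zeta> (snd \<omega>))) = support (K_body N \<zeta>)"
    using pm(8)[where g="\<lambda>\<omega>. \<bar>u \<bullet> \<zeta> \<omega>\<bar>" for u]
    by (intro ext) (simp add: support_K_body[OF pm(3)] support_K_body[OF i(4)])
  have hb: "(\<lambda>\<omega>. h (\<zeta> \<omega>)) \<in> borel_measurable N"
  proof -
    have "h \<in> linear_growth" unfolding h using support_K_in_span_Z[OF \<xi>] Z_generators_growth by blast
    from linear_growth_integrable[OF i(4) this bounded_linear_ident] show ?thesis by auto
  qed
  have "pairing d V h (support (K_body N \<zeta>)) = (\<integral>\<omega>. \<bar>\<xi> (fst \<omega>) \<bullet> \<zeta> (snd \<omega>)\<bar> \<partial>(M \<Otimes>\<^sub>M N))"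
    using pairing_spec[of d V, THEN conjunct2, rule_format, of "M \<Otimes>\<^sub>M N" "\<lambda>\<omega>. \<xi> (fst \<omega>)" "\<lambda>\<omega>. \<zeta> (snd \<omega>)"] r pm(4)
    by (simp add: e1 e2)
  also have "\<dots> = (\<integral>\<omega>'. \<integral>\<omega>. \<bar>\<xi> (fst \<omega>) \<bullet> \<zeta> (snd \<omega>')\<bar> \<partial>(M \<Otimes>\<^sub>M N) \<partial>(M \<Otimes>\<^sub>M N))"
    using indep_integral(2)[OF pm(1-4) g] by simp
  also have "\<dots> = (\<integral>\<omega>'. 2 * h (\<zeta> (snd \<omega>')) \<partial>(M \<Otimes>\<^sub>M N))"
    by (simp add: e1[symmetric] support_K_body[OF pm(2)] inner_commute)
  also have "\<dots> = 2 * (\<integral>\<omega>. h (\<zeta> \<omega>) \<partial>N)" using pm(8)[OF hb] by simp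
  finally show "pairing d V h (support (K_body N \<zeta>)) = 2 * (\<integral>\<omega>. h (\<zeta> \<omega>) \<partial>N)" .
qed

text \<open>The pairing with a deterministic simple vector \<open>w\<close> is
  \<open>2 * h w\<close>, and the pairing with any generator is an average of such values. From here
  on the kernel is handled without the pairing.\<close>

lemma I_deg_iff: "h \<in> I_deg d V \<longleftrightarrow> h \<in> G_centered d V \<and> (\<forall>w\<in>simple_vectors d V. h w = 0)"
proof
  assume h: "h \<in> I_deg d V"
  then have G: "h \<in> G_centered d V" by (simp add: I_deg_def)
  have "h w = 0" if w: "w \<in> simple_vectors d V" for w
  proof -
    note r = random_simple_return[OF w]
    interpret prob_space "return borel w" by (rule prob_space_return) simp
    have "support (K_body (return borel w) (\<lambda>_. w)) \<in> G_centered d V"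
      unfolding G_centered_eq using r by (intro fun_space.span_base) (auto simp: K_generators_def)
    then have "pairing d V h (support (K_body (return borel w) (\<lambda>_. w))) = 0"
      using h unfolding I_deg_def by blast
    then show ?thesis using pairing_generator[OF G r] prob_space by simp
  qed
  then show "h \<in> G_centered d V \<and> (\<forall>w\<in>simple_vectors d V. h w = 0)" using G by blast
next
  assume h: "h \<in> G_centered d V \<and> (\<forall>w\<in>simple_vectors d V. h w = 0)"
  have "pairing d V h k = 0" if "k \<in> G_centered d V" for k
  proof (rule linear_functional_on_eq[OF _ _ _ that[unfolded G_centered_eq]])
    show "linear_functional_on (fun_space.span (K_generators d V)) (pairing d V h)"
      using pairing_spec[of d V] h unfolding bilinear_on_def linear_functional_on_def G_centered_eq by blast
    show "linear_functional_on (fun_space.span (K_generators d V)) (\<lambda>_. 0)" by (simp add: linear_functional_on_def)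
    fix k assume "k \<in> K_generators d V"
    then obtain N :: "'a ext measure" and \<zeta> where k: "k = support (K_body N \<zeta>)" and \<zeta>: "random_simple N d V \<zeta>"
      by (auto simp: K_generators_def)
    have "AE \<omega> in N. \<zeta> \<omega> \<in> simple_vectors d V" using \<zeta> by (simp add: random_simple_def)
    then have "AE \<omega> in N. h (\<zeta> \<omega>) = 0" by eventually_elim (use h in blast)
    then have "(\<integral>\<omega>. h (\<zeta> \<omega>) \<partial>N) = 0" by (rule integral_eq_zero_AE)
    then show "pairing d V h k = 0" using pairing_generator[OF _ \<zeta>, of h] h by (simp add: k)
  qed
  then show "h \<in> I_deg d V" using h by (simp add: I_deg_def)
qed

lemma subspace_I_deg: "fun_space.subspace (I_deg d V)"
  unfolding fun_subspace_iff
proof (intro conjI ballI allI)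
  have "(\<lambda>_. 0) \<in> G_centered d V" unfolding G_centered_eq using fun_space.span_zero by (simp add: zero_fun_def)
  then have "(\<lambda>_. 0) \<in> I_deg d V" by (simp add: I_deg_iff)
  then show "I_deg d V \<noteq> {}" by blast
qed (auto simp: I_deg_iff G_centered_eq intro: fun_span_comb)

section \<open>Products of Grassmannian zonoids\<close>

text \<open>Writing each \<open>K\<close> as the mean of \<open>Z\<close> for a vector and for its
  negative expands the product into four terms, in which the two signs combine into one sign of the
  wedge product.\<close>

lemma zonoid_product_centered_generators:
  fixes M N :: "'n::{finite,linorder} ext measure" and \<xi> \<zeta> :: "'n ext \<Rightarrow> 'n ext"
  assumes \<xi>: "random_simple M p V \<xi>" and \<zeta>: "random_simple N q V \<zeta>"
  shows "zonoid_product V p q (support (K_body M \<xi>)) (support (K_body N \<zeta>)) =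
      support (K_body (M \<Otimes>\<^sub>M N) (\<lambda>\<omega>. wedge (\<xi> (fst \<omega>)) (\<zeta> (snd \<omega>))))"
    and "random_simple (M \<Otimes>\<^sub>M N) (p + q) V (\<lambda>\<omega>. wedge (\<xi> (fst \<omega>)) (\<zeta> (snd \<omega>)))"
proof -
  have i: "prob_space M" "prob_space N" "integrable M \<xi>" "integrable N \<zeta>" using \<xi> \<zeta> by (auto simp: random_simple_def)
  note pm = pair_marginal_props[OF i]
  have w: "integrable (M \<Otimes>\<^sub>M N) (\<lambda>\<omega>. wedge (\<xi> (fst \<omega>)) (\<zeta> (snd \<omega>)))"
    by (rule wedge_indep(1)[OF pm(1-4)])
  have "AE \<omega> in M \<Otimes>\<^sub>M N. \<xi> (fst \<omega>) \<in> simple_vectors p V" "AE \<omega> in M \<Otimes>\<^sub>M N. \<zeta> (snd \<omega>) \<in> simple_vectors q V"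
    using \<xi> \<zeta> by (auto simp: random_simple_def intro!: pm(5,6))
  then have "AE \<omega> in M \<Otimes>\<^sub>M N. wedge (\<xi> (fst \<omega>)) (\<zeta> (snd \<omega>)) \<in> simple_vectors (p + q) V"
    by eventually_elim (rule wedge_simple)
  then show "random_simple (M \<Otimes>\<^sub>M N) (p + q) V (\<lambda>\<omega>. wedge (\<xi> (fst \<omega>)) (\<zeta> (snd \<omega>)))"
    using w pm(1) by (simp add: random_simple_def)
  let ?P = "zonoid_product V p q"
  have Z: "?P (support (Z_body M x)) (support (Z_body N y)) = support (Z_body (M \<Otimes>\<^sub>M N) (\<lambda>\<omega>. wedge (x (fst \<omega>)) (y (snd \<omega>))))"
    "support (Z_body M x) \<in> fun_space.span (Z_generators p V)" "support (Z_body N y) \<in> fun_space.span (Z_generators q V)"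
    if "random_simple M p V x" "random_simple N q V y" for x y
    using that random_simple_ext_pow[OF that(1)] random_simple_ext_pow[OF that(2)] i
    by (auto simp: random_simple_def intro!: zonoid_product_generators(1) fun_space.span_base Z_generatorsI)
  note \<xi>' = random_simple_minus[OF \<xi>] and \<zeta>' = random_simple_minus[OF \<zeta>]
  note KN = support_K_in_span_Z[OF \<zeta>]
  show "?P (support (K_body M \<xi>)) (support (K_body N \<zeta>)) = support (K_body (M \<Otimes>\<^sub>M N) (\<lambda>\<omega>. wedge (\<xi> (fst \<omega>)) (\<zeta> (snd \<omega>))))"
  proof
    fix u
    have 1: "?P (support (Z_body M x)) (support (K_body N \<zeta>)) u =
        (1/2) * ?P (support (Z_body M x)) (support (Z_body N \<zeta>)) u + (1/2) * ?P (support (Z_body M x)) (support (Z_body N (\<lambda>\<omega>. - \<zeta> \<omega>))) u"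
      if x: "random_simple M p V x" for x
      unfolding support_K_eq_Z[OF i(4)]
      by (rule zonoid_product_bilinear(2)[OF Z(2)[OF x \<zeta>] Z(2)[OF x \<zeta>] Z(3)[OF x \<zeta>] Z(3)[OF x \<zeta>']])
    have "?P (support (K_body M \<xi>)) (support (K_body N \<zeta>)) u =
        (1/2) * ?P (support (Z_body M \<xi>)) (support (K_body N \<zeta>)) u + (1/2) * ?P (support (Z_body M (\<lambda>\<omega>. - \<xi> \<omega>))) (support (K_body N \<zeta>)) u"
      unfolding support_K_eq_Z[OF i(3)]
      by (rule zonoid_product_bilinear(1)[OF Z(2)[OF \<xi> \<zeta>] Z(2)[OF \<xi>' \<zeta>] KN KN])
    then show "?P (support (K_body M \<xi>)) (support (K_body N \<zeta>)) u =
        support (K_body (M \<Otimes>\<^sub>M N) (\<lambda>\<omega>. wedge (\<xi> (fst \<omega>)) (\<zeta> (snd \<omega>)))) u"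
      unfolding 1[OF \<xi>] 1[OF \<xi>'] Z(1)[OF \<xi> \<zeta>] Z(1)[OF \<xi>' \<zeta>] Z(1)[OF \<xi> \<zeta>'] Z(1)[OF \<xi>' \<zeta>'] support_K_eq_Z[OF w]
      by (simp add: wedge_linear_simps field_simps)
  qed
qed

lemma zonoid_product_centered:
  assumes V: "subspace V" and h: "h \<in> G_centered p V" and k: "k \<in> G_centered q V"
  shows "zonoid_product V p q h k \<in> G_centered (p + q) V"
proof -
  note Gp = G_centered_in_span_Z[of p V, unfolded G_centered_eq, THEN subsetD]
   and Gq = G_centered_in_span_Z[of q V, unfolded G_centered_eq, THEN subsetD]
  have zp: "(\<lambda>_. 0) \<in> fun_space.span (Z_generators d V)" for d
    using fun_space.span_zero by (simp add: zero_fun_def)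
  have z: "(\<lambda>_. 0) \<in> G_centered d V" for d
    unfolding G_centered_eq using fun_space.span_zero by (simp add: zero_fun_def)
  show ?thesis
    using h unfolding G_centered_eq[of p]
  proof (induction rule: fun_span_induct)
    case (base h)
    then obtain M :: "'a ext measure" and \<xi> where h: "h = support (K_body M \<xi>)" and \<xi>: "random_simple M p V \<xi>"
      by (auto simp: K_generators_def)
    have hZ: "h \<in> fun_space.span (Z_generators p V)" unfolding h by (rule support_K_in_span_Z[OF \<xi>])
    show ?case
      using k unfolding G_centered_eq[of q]
    proof (induction rule: fun_span_induct)
      case (base k)
      then obtain N :: "'a ext measure" and \<zeta> where k: "k = support (K_body N \<zeta>)" and \<zeta>: "random_simple N q V \<zeta>"
        by (auto simp: K_generators_def)
      show ?case unfolding h k zonoid_product_centered_generators(1)[OF \<xi> \<zeta>] G_centered_eq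
        by (rule fun_space.span_base, rule K_generatorsI[OF V zonoid_product_centered_generators(2)[OF \<xi> \<zeta>]])
    next
      case (comb k k' a b)
      have "zonoid_product V p q h (\<lambda>u. a * k u + b * k' u) = (\<lambda>u. a * zonoid_product V p q h k u + b * zonoid_product V p q h k' u)"
        by (intro ext zonoid_product_bilinear(2)[OF hZ hZ Gq[OF comb(1)] Gq[OF comb(2)]])
      then show ?case using comb(3,4) by (simp add: G_centered_eq fun_span_comb)
    next
      have "zonoid_product V p q h (\<lambda>u. 0) = (\<lambda>u. 0)"
        using zonoid_product_bilinear(2)[OF hZ hZ zp zp, where a=0 and b=0] by (simp add: fun_eq_iff)
      then show "zonoid_product V p q h (\<lambda>_. 0) \<in> G_centered (p + q) V" using z by simp
    qed
  next
    case (comb h h' a b)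
    have kZ: "k \<in> fun_space.span (Z_generators q V)" using G_centered_in_span_Z k by blast
    have "zonoid_product V p q (\<lambda>u. a * h u + b * h' u) k = (\<lambda>u. a * zonoid_product V p q h k u + b * zonoid_product V p q h' k u)"
      by (intro ext zonoid_product_bilinear(1)[OF Gp[OF comb(1)] Gp[OF comb(2)] kZ kZ])
    then show ?case using comb(3,4) by (simp add: G_centered_eq fun_span_comb)
  next
    have kZ: "k \<in> fun_space.span (Z_generators q V)" using G_centered_in_span_Z k by blast
    have "zonoid_product V p q (\<lambda>u. 0) k = (\<lambda>u. 0)"
      using zonoid_product_bilinear(1)[OF zp zp kZ kZ, where a=0 and b=0] by (simp add: fun_eq_iff)
    then show "zonoid_product V p q (\<lambda>_. 0) k \<in> G_centered (p + q) V" using z by simp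
  qed
qed

text \<open>The function of a point is odd, while a centered zonoid averages over contractions by
  \<xi> and by \<open>- \<xi>\<close>; the two contributions cancel. So point parts and centered
  parts multiply separately.\<close>

lemma zonoid_product_point:
  assumes V: "subspace V" and b: "b \<in> ext_pow d V"
  shows "h \<in> G_centered p V \<Longrightarrow> zonoid_product V p d h (\<lambda>u. b \<bullet> u) = (\<lambda>_. 0)"
    and "h \<in> G_centered p V \<Longrightarrow> zonoid_product V d p (\<lambda>u. b \<bullet> u) h = (\<lambda>_. 0)"
proof -
  note pt = point_in_span_Z[OF b]
  note sub = G_centered_in_span_Z[of p V, unfolded G_centered_eq]
  assume h: "h \<in> G_centered p V"
  have zero: "linear_functional_on T (\<lambda>_. 0)" for T :: "'a ext virtual_body set" by (simp add: linear_functional_on_def)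
  have gen: "\<exists>M \<xi>. k = (\<lambda>u. (1/2) * support (Z_body (M :: 'a ext measure) \<xi>) u + (1/2) * support (Z_body M (\<lambda>\<omega>. - \<xi> \<omega>)) u) \<and>
      prob_space M \<and> integrable M \<xi> \<and> (AE \<omega> in M. \<xi> \<omega> \<in> ext_pow p V) \<and> (AE \<omega> in M. - \<xi> \<omega> \<in> ext_pow p V)"
    if k: "k \<in> K_generators p V" for k
  proof -
    obtain M :: "'a ext measure" and \<xi> where *: "k = support (K_body M \<xi>)" "random_simple M p V \<xi>"
      using k by (auto simp: K_generators_def)
    show ?thesis
      using * support_K_eq_Z[of M \<xi>] random_simple_ext_pow[OF *(2)] random_simple_ext_pow[OF random_simple_minus[OF *(2)]]
      by (intro exI[of _ M] exI[of _ \<xi>]) (simp add: random_simple_def)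
  qed
  have 1: "zonoid_product V p d h (\<lambda>u. b \<bullet> u) u = 0" for u
  proof (rule linear_functional_on_eq[OF _ zero _ h[unfolded G_centered_eq], where L="\<lambda>h. zonoid_product V p d h (\<lambda>u. b \<bullet> u) u"])
    show "linear_functional_on (fun_space.span (K_generators p V)) (\<lambda>h. zonoid_product V p d h (\<lambda>u. b \<bullet> u) u)"
      unfolding linear_functional_on_def
      by (intro ballI allI zonoid_product_bilinear(1)[OF subsetD[OF sub] subsetD[OF sub] pt pt])
    fix k assume "k \<in> K_generators p V"
    then obtain M :: "'a ext measure" and \<xi> where k: "k = (\<lambda>u. (1/2) * support (Z_body M \<xi>) u + (1/2) * support (Z_body M (\<lambda>\<omega>. - \<xi> \<omega>)) u)"
      and M: "prob_space M" "integrable M \<xi>" "AE \<omega> in M. \<xi> \<omega> \<in> ext_pow p V" "AE \<omega> in M. - \<xi> \<omega> \<in> ext_pow p V"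
      using gen by blast
    have i: "integrable M (\<lambda>\<omega>. - \<xi> \<omega>)" using M by simp
    have Z: "support (Z_body M \<xi>) \<in> fun_space.span (Z_generators p V)" "support (Z_body M (\<lambda>\<omega>. - \<xi> \<omega>)) \<in> fun_space.span (Z_generators p V)"
      by (intro fun_space.span_base Z_generatorsI M i)+
    show "zonoid_product V p d k (\<lambda>u. b \<bullet> u) u = 0"
      unfolding k zonoid_product_bilinear(1)[OF Z pt pt]
        zonoid_product_left[OF M(1) M(2) M(3) pt] zonoid_product_left[OF M(1) i M(4) pt]
      by (simp add: contract_minus)
  qed
  have 2: "zonoid_product V d p (\<lambda>u. b \<bullet> u) h u = 0" for u
  proof (rule linear_functional_on_eq[OF _ zero _ h[unfolded G_centered_eq], where L="\<lambda>h. zonoid_product V d p (\<lambda>u. b \<bullet> u) h u"])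
    show "linear_functional_on (fun_space.span (K_generators p V)) (\<lambda>h. zonoid_product V d p (\<lambda>u. b \<bullet> u) h u)"
      unfolding linear_functional_on_def
      by (intro ballI allI zonoid_product_bilinear(2)[OF pt pt subsetD[OF sub] subsetD[OF sub]])
    fix k assume "k \<in> K_generators p V"
    then obtain M :: "'a ext measure" and \<xi> where k: "k = (\<lambda>u. (1/2) * support (Z_body M \<xi>) u + (1/2) * support (Z_body M (\<lambda>\<omega>. - \<xi> \<omega>)) u)"
      and M: "prob_space M" "integrable M \<xi>" "AE \<omega> in M. \<xi> \<omega> \<in> ext_pow p V" "AE \<omega> in M. - \<xi> \<omega> \<in> ext_pow p V"
      using gen by blast
    have i: "integrable M (\<lambda>\<omega>. - \<xi> \<omega>)" using M by simp
    have Z: "support (Z_body M \<xi>) \<in> fun_space.span (Z_generators p V)" "support (Z_body M (\<lambda>\<omega>. - \<xi> \<omega>)) \<in> fun_space.span (Z_generators p V)"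
      by (intro fun_space.span_base Z_generatorsI M i)+
    show "zonoid_product V d p (\<lambda>u. b \<bullet> u) k u = 0"
      unfolding k zonoid_product_bilinear(2)[OF pt pt Z]
        zonoid_product_right[OF M(1) M(2) M(3) pt] zonoid_product_right[OF M(1) i M(4) pt]
      by (simp add: contract_minus)
  qed
  show "zonoid_product V p d h (\<lambda>u. b \<bullet> u) = (\<lambda>_. 0)" "zonoid_product V d p (\<lambda>u. b \<bullet> u) h = (\<lambda>_. 0)"
    using 1 2 by (auto simp: fun_eq_iff)
qed

text \<open>
  Contraction by a simple vector maps simple vectors to simple vectors, so a function that vanishes
  on the latter still does so after multiplication.
\<close>

lemma zonoid_product_vanish:
  assumes V: "subspace V" and h: "h \<in> I_deg p V" and k: "k \<in> G_centered q V"
  shows "u \<in> simple_vectors (p + q) V \<Longrightarrow> zonoid_product V p q h k u = 0"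
    and "u \<in> simple_vectors (p + q) V \<Longrightarrow> zonoid_product V q p k h u = 0"
proof -
  assume u: "u \<in> simple_vectors (p + q) V"
  have hG: "h \<in> G_centered p V" and h0: "\<And>w. w \<in> simple_vectors p V \<Longrightarrow> h w = 0"
    using h by (auto simp: I_deg_iff)
  then have hZ: "h \<in> fun_space.span (Z_generators p V)" using G_centered_in_span_Z by blast
  note sub = G_centered_in_span_Z[of q V, unfolded G_centered_eq]
  have zero: "linear_functional_on T (\<lambda>_. 0)" for T :: "'a ext virtual_body set" by (simp add: linear_functional_on_def)
  have gen: "\<exists>M \<xi>. k = (\<lambda>u. (1/2) * support (Z_body (M :: 'a ext measure) \<xi>) u + (1/2) * support (Z_body M (\<lambda>\<omega>. - \<xi> \<omega>)) u) \<and>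
      random_simple M q V \<xi> \<and> random_simple M q V (\<lambda>\<omega>. - \<xi> \<omega>)"
    if k: "k \<in> K_generators q V" for k
  proof -
    obtain M :: "'a ext measure" and \<xi> where *: "k = support (K_body M \<xi>)" "random_simple M q V \<xi>"
      using k by (auto simp: K_generators_def)
    show ?thesis
      using * support_K_eq_Z[of M \<xi>] random_simple_minus[OF *(2)]
      by (intro exI[of _ M] exI[of _ \<xi>]) (simp add: random_simple_def)
  qed
  have r: "zonoid_product V p q h (support (Z_body M \<xi>)) u = 0" "zonoid_product V q p (support (Z_body M \<xi>)) h u = 0"
    "support (Z_body M \<xi>) \<in> fun_space.span (Z_generators q V)"
    if \<xi>: "random_simple M q V \<xi>" for M :: "'a ext measure" and \<xi>
  proof -
    have M: "prob_space M" "integrable M \<xi>" and AE: "AE \<omega> in M. \<xi> \<omega> \<in> simple_vectors q V"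
      using \<xi> by (auto simp: random_simple_def)
    note e = random_simple_ext_pow[OF \<xi>]
    have "AE \<omega> in M. h (right_contract (\<xi> \<omega>) u) = 0" "AE \<omega> in M. h (left_contract (\<xi> \<omega>) u) = 0"
      using AE by (eventually_elim, auto simp: right_contract_def left_contract_def intro!: h0 adjoint_wedge_simple[OF V _ u])+
    then show "zonoid_product V p q h (support (Z_body M \<xi>)) u = 0" "zonoid_product V q p (support (Z_body M \<xi>)) h u = 0"
      unfolding zonoid_product_right[OF M e hZ] zonoid_product_left[OF M e hZ] by (auto intro: integral_eq_zero_AE)
    show "support (Z_body M \<xi>) \<in> fun_space.span (Z_generators q V)"
      by (intro fun_space.span_base Z_generatorsI M e)
  qed
  show "zonoid_product V p q h k u = 0"
  proof (rule linear_functional_on_eq[OF _ zero _ k[unfolded G_centered_eq], where L="\<lambda>k. zonoid_product V p q h k u"])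
    show "linear_functional_on (fun_space.span (K_generators q V)) (\<lambda>k. zonoid_product V p q h k u)"
      unfolding linear_functional_on_def
      by (intro ballI allI zonoid_product_bilinear(2)[OF hZ hZ subsetD[OF sub] subsetD[OF sub]])
    fix k assume "k \<in> K_generators q V"
    then obtain M :: "'a ext measure" and \<xi> where k: "k = (\<lambda>u. (1/2) * support (Z_body M \<xi>) u + (1/2) * support (Z_body M (\<lambda>\<omega>. - \<xi> \<omega>)) u)"
      and M: "random_simple M q V \<xi>" "random_simple M q V (\<lambda>\<omega>. - \<xi> \<omega>)"
      using gen by blast
    show "zonoid_product V p q h k u = 0"
      unfolding k zonoid_product_bilinear(2)[OF hZ hZ r(3)[OF M(1)] r(3)[OF M(2)]] r(1)[OF M(1)] r(1)[OF M(2)] by simp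
  qed
  show "zonoid_product V q p k h u = 0"
  proof (rule linear_functional_on_eq[OF _ zero _ k[unfolded G_centered_eq], where L="\<lambda>k. zonoid_product V q p k h u"])
    show "linear_functional_on (fun_space.span (K_generators q V)) (\<lambda>k. zonoid_product V q p k h u)"
      unfolding linear_functional_on_def
      by (intro ballI allI zonoid_product_bilinear(1)[OF subsetD[OF sub] subsetD[OF sub] hZ hZ])
    fix k assume "k \<in> K_generators q V"
    then obtain M :: "'a ext measure" and \<xi> where k: "k = (\<lambda>u. (1/2) * support (Z_body M \<xi>) u + (1/2) * support (Z_body M (\<lambda>\<omega>. - \<xi> \<omega>)) u)"
      and M: "random_simple M q V \<xi>" "random_simple M q V (\<lambda>\<omega>. - \<xi> \<omega>)"
      using gen by blast
    show "zonoid_product V q p k h u = 0"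
      unfolding k zonoid_product_bilinear(1)[OF r(3)[OF M(1)] r(3)[OF M(2)] hZ hZ] r(2)[OF M(1)] r(2)[OF M(2)] by simp
  qed
qed

text \<open>The point part of \<open>k\<close> annihilates the centered \<open>h\<close>; for the
  centered part the product is centered and vanishes on simple vectors.\<close>

lemma zonoid_product_ideal:
  assumes V: "subspace V" and h: "h \<in> I_deg p V" and k: "k \<in> G_all q V"
  shows "zonoid_product V p q h k \<in> I_deg (p + q) V" "zonoid_product V q p k h \<in> I_deg (q + p) V"
proof -
  obtain k' b where k': "k' \<in> G_centered q V" "b \<in> ext_pow q V" "k = (\<lambda>u. 1 * k' u + 1 * (b \<bullet> u))"
    using k by (auto simp: G_all_iff[OF V])
  have hG: "h \<in> G_centered p V" using h by (auto simp: I_deg_iff)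
  note hZ = subsetD[OF G_centered_in_span_Z hG] and k'Z = subsetD[OF G_centered_in_span_Z k'(1)]
  have 1: "zonoid_product V p q h k = zonoid_product V p q h k'"
    unfolding k'(3)
    by (intro ext, subst zonoid_product_bilinear(2)[OF hZ hZ k'Z point_in_span_Z[OF k'(2)]])
      (simp add: zonoid_product_point(1)[OF V k'(2) hG])
  have 2: "zonoid_product V q p k h = zonoid_product V q p k' h"
    unfolding k'(3)
    by (intro ext, subst zonoid_product_bilinear(1)[OF k'Z point_in_span_Z[OF k'(2)] hZ hZ])
      (simp add: zonoid_product_point(2)[OF V k'(2) hG])
  show "zonoid_product V p q h k \<in> I_deg (p + q) V"
    unfolding 1 I_deg_iff using zonoid_product_centered[OF V hG k'(1)] zonoid_product_vanish(1)[OF V h k'(1)] by blast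
  show "zonoid_product V q p k h \<in> I_deg (q + p) V"
    unfolding 2 I_deg_iff using zonoid_product_centered[OF V k'(1) hG] zonoid_product_vanish(2)[OF V h k'(1)]
    by (simp add: add.commute)
qed

section \<open>Images under linear maps\<close>

definition orth_proj :: "'a::euclidean_space set \<Rightarrow> 'a \<Rightarrow> 'a" where
  "orth_proj V = (SOME P. linear P \<and> range P \<subseteq> V \<and> (\<forall>v\<in>V. P v = v) \<and> adjoint P = P \<and> (\<forall>v\<in>V\<^sup>\<bottom>. P v = 0))"

lemma orth_proj:
  fixes V :: "'a::euclidean_space set"
  assumes V: "subspace V"
  shows "linear (orth_proj V)" "range (orth_proj V) \<subseteq> V" "\<And>v. v \<in> V \<Longrightarrow> orth_proj V v = v"
    "adjoint (orth_proj V) = orth_proj V" "\<And>v. v \<in> V\<^sup>\<bottom> \<Longrightarrow> orth_proj V v = 0"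
proof -
  have "\<forall>x. \<exists>y. y \<in> V \<and> (\<forall>w\<in>V. orthogonal (x - y) w)"
  proof
    fix x
    obtain y z where "y \<in> span V" "\<And>w. w \<in> span V \<Longrightarrow> orthogonal z w" "x = y + z"
      using orthogonal_subspace_decomp_exists[of V x] by blast
    then show "\<exists>y. y \<in> V \<and> (\<forall>w\<in>V. orthogonal (x - y) w)"
      using span_eq_iff[THEN iffD2, OF V] by (intro exI[of _ y]) auto
  qed
  then obtain P where P0: "\<forall>x. P x \<in> V \<and> (\<forall>w\<in>V. orthogonal (x - P x) w)"
    by (elim choice[THEN exE]) (rule that)
  then have P: "P x \<in> V" "w \<in> V \<Longrightarrow> orthogonal (x - P x) w" for x w by auto
  have iP: "P x \<bullet> y = P x \<bullet> P y" "x \<bullet> P y = P x \<bullet> P y" for x y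
    using P(2)[OF P(1)[of x], of y] P(2)[OF P(1)[of y], of x] by (simp_all add: orthogonal_def inner_diff_left) (simp_all add: inner_commute)
  have a: "P x \<bullet> y = x \<bullet> P y" for x y using iP by metis
  have "linear P"
    by (rule linearI; subst vector_eq_rdot[symmetric]; simp add: a inner_add_left)
  moreover have "P v = v" if "v \<in> V" for v
  proof -
    have "v - P v \<in> V" using that P(1) V by (simp add: subspace_diff)
    from P(2)[OF this, of v] show ?thesis by (simp add: orthogonal_self)
  qed
  moreover have "adjoint P = P" by (rule adjoint_unique) (simp add: a)
  moreover have "P v = 0" if "v \<in> V\<^sup>\<bottom>" for v
    using that P(1)[of v] iP(1)[of v v] by (auto simp: orthogonal_comp_def orthogonal_def inner_commute)
  ultimately have "linear P \<and> range P \<subseteq> V \<and> (\<forall>v\<in>V. P v = v) \<and> adjoint P = P \<and> (\<forall>v\<in>V\<^sup>\<bottom>. P v = 0)"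
    using P(1) by auto
  then have *: "linear (orth_proj V) \<and> range (orth_proj V) \<subseteq> V \<and> (\<forall>v\<in>V. orth_proj V v = v) \<and>
      adjoint (orth_proj V) = orth_proj V \<and> (\<forall>v\<in>V\<^sup>\<bottom>. orth_proj V v = 0)"
    unfolding orth_proj_def
    by (rule someI[where P="\<lambda>P. linear P \<and> range P \<subseteq> V \<and> (\<forall>v\<in>V. P v = v) \<and> adjoint P = P \<and> (\<forall>v\<in>V\<^sup>\<bottom>. P v = 0)"])
  then show "linear (orth_proj V)" "range (orth_proj V) \<subseteq> V" "adjoint (orth_proj V) = orth_proj V"
    "\<And>v. v \<in> V \<Longrightarrow> orth_proj V v = v" "\<And>v. v \<in> V\<^sup>\<bottom> \<Longrightarrow> orth_proj V v = 0" by auto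
qed

lemma virtual_map_ext_map:
  "linear \<phi> \<Longrightarrow> virtual_map (ext_map \<phi>) h = (\<lambda>u. h (ext_map (adjoint \<phi>) u))"
  by (simp add: virtual_map_def adjoint_ext_map)

lemma inner_ext_map_adjoint:
  "linear \<phi> \<Longrightarrow> ext_map (adjoint \<phi>) u \<bullet> x = u \<bullet> ext_map \<phi> x"
  using adjoint_works[OF linear_ext_map, of x \<phi> u] by (simp add: adjoint_ext_map inner_commute)

lemma bounded_linear_ext_map: "bounded_linear (ext_map \<phi>)"
  using linear_ext_map by (simp add: linear_conv_bounded_linear)

lemma virtual_map_Z:
  assumes \<phi>: "linear \<phi>" and \<xi>: "integrable M \<xi>"
  shows "virtual_map (ext_map \<phi>) (support (Z_body M \<xi>)) = support (Z_body M (\<lambda>\<omega>. ext_map \<phi> (\<xi> \<omega>)))"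
    and "virtual_map (ext_map \<phi>) (support (K_body M \<xi>)) = support (K_body M (\<lambda>\<omega>. ext_map \<phi> (\<xi> \<omega>)))"
  using integrable_bounded_linear[OF bounded_linear_ext_map \<xi>, of \<phi>]
  by (simp_all add: virtual_map_ext_map[OF \<phi>] support_Z_body support_K_body \<xi> inner_ext_map_adjoint[OF \<phi>] fun_eq_iff)

lemma virtual_map_point:
  "linear \<phi> \<Longrightarrow> virtual_map (ext_map \<phi>) (\<lambda>u. p \<bullet> u) = (\<lambda>u. ext_map \<phi> p \<bullet> u)"
  using inner_ext_map_adjoint[of \<phi> _ p] by (simp add: virtual_map_ext_map inner_commute fun_eq_iff)

lemma random_simple_ext_map:
  assumes "linear \<phi>" "\<phi> ` V \<subseteq> W" "random_simple M d V \<xi>"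
  shows "random_simple M d W (\<lambda>\<omega>. ext_map \<phi> (\<xi> \<omega>))"
proof -
  have "AE \<omega> in M. \<xi> \<omega> \<in> simple_vectors d V" using assms by (simp add: random_simple_def)
  then have "AE \<omega> in M. ext_map \<phi> (\<xi> \<omega>) \<in> simple_vectors d W"
    by eventually_elim (rule ext_map_simple[OF assms(1,2)])
  then show ?thesis
    using assms integrable_bounded_linear[OF bounded_linear_ext_map] by (auto simp: random_simple_def)
qed

lemma virtual_map_G:
  assumes \<phi>: "linear \<phi>" "\<phi> ` V \<subseteq> W" and V: "subspace V" and W: "subspace W"
  shows "h \<in> G_centered d V \<Longrightarrow> virtual_map (ext_map \<phi>) h \<in> G_centered d W"
    and "h \<in> G_all d V \<Longrightarrow> virtual_map (ext_map \<phi>) h \<in> G_all d W"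
    and "h \<in> I_deg d V \<Longrightarrow> virtual_map (ext_map \<phi>) h \<in> I_deg d W"
proof -
  show 1: "virtual_map (ext_map \<phi>) h \<in> G_centered d W" if "h \<in> G_centered d V" for h
    using that unfolding G_centered_eq
  proof (induction rule: fun_span_induct)
    case (base h)
    then obtain M :: "'a ext measure" and \<xi> where h: "h = support (K_body M \<xi>)" "random_simple M d V \<xi>"
      by (auto simp: K_generators_def)
    then have "virtual_map (ext_map \<phi>) h = support (K_body M (\<lambda>\<omega>. ext_map \<phi> (\<xi> \<omega>)))"
      by (simp add: virtual_map_Z(2)[OF \<phi>(1)] random_simple_def)
    then show ?case
      by (simp only:) (rule fun_space.span_base[OF K_generatorsI[OF W random_simple_ext_map[OF \<phi> h(2)]]])
  next
    case (comb h k a b)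
    then show ?case by (simp add: virtual_map_ext_map[OF \<phi>(1)] fun_span_comb)
  next
    show "virtual_map (ext_map \<phi>) (\<lambda>_. 0) \<in> fun_space.span (K_generators d W)"
      using fun_space.span_zero by (simp add: virtual_map_def zero_fun_def)
  qed
  show "virtual_map (ext_map \<phi>) h \<in> G_all d W" if G: "h \<in> G_all d V" for h
  proof -
    obtain k p where k: "k \<in> G_centered d V" "p \<in> ext_pow d V" "h = (\<lambda>u. k u + p \<bullet> u)"
      using G by (auto simp: G_all_iff[OF V])
    have "virtual_map (ext_map \<phi>) h = (\<lambda>u. virtual_map (ext_map \<phi>) k u + ext_map \<phi> p \<bullet> u)"
      using inner_ext_map_adjoint[OF \<phi>(1), of _ p] by (simp add: k(3) virtual_map_ext_map[OF \<phi>(1)] fun_eq_iff inner_commute)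
    then show ?thesis unfolding G_all_iff[OF W]
      by (intro bexI[OF _ 1[OF k(1)]] bexI[OF _ ext_map_span(1)[OF \<phi> k(2)]])
  qed
  show "virtual_map (ext_map \<phi>) h \<in> I_deg d W" if "h \<in> I_deg d V" for h
  proof -
    have "h (ext_map (adjoint \<phi>) u) = 0" if u: "u \<in> simple_vectors d W" for u
    proof -
      text \<open>The adjoint need not map \<open>W\<close> into \<open>V\<close>, but elements of degree \<open>d\<close> over \<open>V\<close> only see the projection to \<open>V\<close>.\<close>
      define P where "P = orth_proj V"
      note P = orth_proj[OF V, folded P_def]
      have hP: "h (ext_map P x) = h x" for x
      proof -
        have "h \<in> fun_space.span (K_generators d V)" using \<open>h \<in> I_deg d V\<close> by (simp add: I_deg_iff G_centered_eq)
        then show ?thesis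
        proof (induction rule: fun_span_induct)
          case (base h)
          then obtain M :: "'a ext measure" and \<xi> where h: "h = support (K_body M \<xi>)" "random_simple M d V \<xi>"
            by (auto simp: K_generators_def)
          have \<xi>: "integrable M \<xi>" and [measurable]: "\<xi> \<in> borel_measurable M" using h(2) by (auto simp: random_simple_def)
          have "(\<integral>\<omega>. \<bar>ext_map P x \<bullet> \<xi> \<omega>\<bar> \<partial>M) = (\<integral>\<omega>. \<bar>x \<bullet> \<xi> \<omega>\<bar> \<partial>M)"
          proof (rule integral_cong_AE)
            show "AE \<omega> in M. \<bar>ext_map P x \<bullet> \<xi> \<omega>\<bar> = \<bar>x \<bullet> \<xi> \<omega>\<bar>"
              using random_simple_ext_pow[OF h(2)]
            proof eventually_elim
              fix \<omega> assume "\<xi> \<omega> \<in> ext_pow d V"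
              then have "ext_map P (\<xi> \<omega>) = \<xi> \<omega>"
                using ext_map_id_on[OF P(1,3)] ext_pow_subset_carrier by blast
              then show "\<bar>ext_map P x \<bullet> \<xi> \<omega>\<bar> = \<bar>x \<bullet> \<xi> \<omega>\<bar>"
                using inner_ext_map_adjoint[OF P(1), of x "\<xi> \<omega>"] by (simp add: P(4))
            qed
          qed auto
          then show ?case by (simp add: h(1) support_K_body[OF \<xi>])
        qed auto
      qed
      have "ext_map P (ext_map (adjoint \<phi>) u) = ext_map (P \<circ> adjoint \<phi>) u"
        by (rule ext_map_comp[OF P(1) adjoint_linear[OF \<phi>(1)]])
      also have "\<dots> \<in> simple_vectors d V"
        using P(2) u linear_compose[OF adjoint_linear[OF \<phi>(1)] P(1)]
        by (intro ext_map_simple[of _ W]) (auto simp: o_def)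
      finally have "h (ext_map P (ext_map (adjoint \<phi>) u)) = 0" using \<open>h \<in> I_deg d V\<close> unfolding I_deg_iff by blast
      then show ?thesis by (simp add: hP)
    qed
    then show ?thesis using 1 that by (simp add: I_deg_iff) (simp add: virtual_map_ext_map[OF \<phi>(1)])
  qed
qed

lemma left_contract_ext_map:
  "linear \<phi> \<Longrightarrow> left_contract \<xi> (ext_map (adjoint \<phi>) u) = ext_map (adjoint \<phi>) (left_contract (ext_map \<phi> \<xi>) u)"
  by (subst vector_eq_rdot[symmetric]) (simp add: inner_left_contract inner_ext_map_adjoint ext_map_wedge)

text \<open>Bilinearity reduces the claim to generators, where both sides average \<open>k\<close>
  over contractions; \<open>left_contract_ext_map\<close> matches these contractions.\<close>

lemma zonoid_product_virtual_map:
  assumes \<phi>: "linear \<phi>" "\<phi> ` V \<subseteq> W" and h: "h \<in> fun_space.span (Z_generators p V)" and k: "k \<in> fun_space.span (Z_generators q V)"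
  shows "virtual_map (ext_map \<phi>) (zonoid_product V p q h k) =
    zonoid_product W p q (virtual_map (ext_map \<phi>) h) (virtual_map (ext_map \<phi>) k)"
proof -
  let ?m = "virtual_map (ext_map \<phi>)"
  have vm: "?m (support (Z_body M \<xi>)) = support (Z_body M (\<lambda>\<omega>. ext_map \<phi> (\<xi> \<omega>)))" "integrable M (\<lambda>\<omega>. ext_map \<phi> (\<xi> \<omega>))"
     "AE \<omega> in M. ext_map \<phi> (\<xi> \<omega>) \<in> ext_pow d W"
    if "integrable M \<xi>" "AE \<omega> in M. \<xi> \<omega> \<in> ext_pow d V" for M :: "'a ext measure" and \<xi> d
  proof -
    show "?m (support (Z_body M \<xi>)) = support (Z_body M (\<lambda>\<omega>. ext_map \<phi> (\<xi> \<omega>)))" by (rule virtual_map_Z(1)[OF \<phi>(1) that(1)])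
    show "integrable M (\<lambda>\<omega>. ext_map \<phi> (\<xi> \<omega>))" by (rule integrable_bounded_linear[OF bounded_linear_ext_map that(1)])
    show "AE \<omega> in M. ext_map \<phi> (\<xi> \<omega>) \<in> ext_pow d W"
      using that(2) by eventually_elim (rule ext_map_span(1)[OF \<phi>])
  qed
  have vmZ: "?m h \<in> fun_space.span (Z_generators d W)" if "h \<in> fun_space.span (Z_generators d V)" for h d
    using that
  proof (induction rule: fun_span_induct)
    case (base h)
    then obtain M :: "'a ext measure" and \<xi> where h: "h = support (Z_body M \<xi>)" "prob_space M" "integrable M \<xi>" "AE \<omega> in M. \<xi> \<omega> \<in> ext_pow d V"
      by (auto simp: Z_generators_def)
    show ?case unfolding h(1) vm(1)[OF h(3,4)]
      by (rule fun_space.span_base[OF Z_generatorsI[OF h(2) vm(2,3)[OF h(3,4)]]])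
  next
    case (comb h k a b)
    then show ?case by (simp add: virtual_map_ext_map[OF \<phi>(1)] fun_span_comb)
  next
    show "virtual_map (ext_map \<phi>) (\<lambda>_. 0) \<in> fun_space.span (Z_generators d W)"
      using fun_space.span_zero by (simp add: virtual_map_def zero_fun_def)
  qed
  have vmlin: "?m (\<lambda>u. a * x u + b * y u) = (\<lambda>u. a * ?m x u + b * ?m y u)" for x y :: "'a ext virtual_body" and a b
    by (simp add: virtual_map_def)
  have "?m (zonoid_product V p q h k) u = zonoid_product W p q (?m h) (?m k) u" for u
  proof (rule linear_functional_on_eq[OF _ _ _ h, where L="\<lambda>h. ?m (zonoid_product V p q h k) u" and R="\<lambda>h. zonoid_product W p q (?m h) (?m k) u"])
    show "linear_functional_on (fun_space.span (Z_generators p V)) (\<lambda>h. ?m (zonoid_product V p q h k) u)"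
      unfolding linear_functional_on_def virtual_map_def
      by (intro ballI allI zonoid_product_bilinear(1)[OF _ _ k k])
    show "linear_functional_on (fun_space.span (Z_generators p V)) (\<lambda>h. zonoid_product W p q (?m h) (?m k) u)"
      unfolding linear_functional_on_def vmlin
      by (intro ballI allI zonoid_product_bilinear(1)[OF vmZ vmZ vmZ[OF k] vmZ[OF k]])
    fix h assume "h \<in> Z_generators p V"
    then obtain M :: "'a ext measure" and \<xi> where h: "h = support (Z_body M \<xi>)" "prob_space M" "integrable M \<xi>" "AE \<omega> in M. \<xi> \<omega> \<in> ext_pow p V"
      by (auto simp: Z_generators_def)
    have hZ: "h \<in> fun_space.span (Z_generators p V)" unfolding h(1)
      by (rule fun_space.span_base[OF Z_generatorsI[OF h(2-4)]])
    show "?m (zonoid_product V p q h k) u = zonoid_product W p q (?m h) (?m k) u"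
    proof (rule linear_functional_on_eq[OF _ _ _ k, where L="\<lambda>k. ?m (zonoid_product V p q h k) u" and R="\<lambda>k. zonoid_product W p q (?m h) (?m k) u"])
      show "linear_functional_on (fun_space.span (Z_generators q V)) (\<lambda>k. ?m (zonoid_product V p q h k) u)"
        unfolding linear_functional_on_def virtual_map_def
        by (intro ballI allI zonoid_product_bilinear(2)[OF hZ hZ])
      show "linear_functional_on (fun_space.span (Z_generators q V)) (\<lambda>k. zonoid_product W p q (?m h) (?m k) u)"
        unfolding linear_functional_on_def vmlin
        by (intro ballI allI zonoid_product_bilinear(2)[OF vmZ[OF hZ] vmZ[OF hZ] vmZ vmZ])
      fix k assume "k \<in> Z_generators q V"
      then obtain N :: "'a ext measure" and \<zeta> where k: "k = support (Z_body N \<zeta>)" "prob_space N" "integrable N \<zeta>" "AE \<omega> in N. \<zeta> \<omega> \<in> ext_pow q V"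
        by (auto simp: Z_generators_def)
      note kZ = fun_space.span_base[OF Z_generatorsI[OF k(2-4)]]
      have "?m (zonoid_product V p q h k) u = (\<integral>\<omega>. k (left_contract (\<xi> \<omega>) (ext_map (adjoint \<phi>) u)) \<partial>M)"
        unfolding virtual_map_ext_map[OF \<phi>(1)] h(1) k(1) by (rule zonoid_product_left[OF h(2-4) kZ])
      also have "\<dots> = (\<integral>\<omega>. ?m k (left_contract (ext_map \<phi> (\<xi> \<omega>)) u) \<partial>M)"
        by (simp add: virtual_map_ext_map[OF \<phi>(1)] left_contract_ext_map[OF \<phi>(1)])
      also have "\<dots> = zonoid_product W p q (?m h) (?m k) u"
      proof -
        text \<open>The law of the image of \<open>\<xi>\<close> is realised on the exterior algebra of the target.\<close>
        let ?D = "distr M borel (\<lambda>\<omega>. ext_map \<phi> (\<xi> \<omega>))"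
        note v = vm[OF h(3,4)]
        have [measurable]: "(\<lambda>\<omega>. ext_map \<phi> (\<xi> \<omega>)) \<in> borel_measurable M" using v(2) by auto
        interpret prob_space M by (rule h(2))
        have D: "prob_space ?D" by (rule prob_space_distr) simp
        have i: "integrable ?D (\<lambda>x. x)" using v(2) by (subst integrable_distr_eq) auto
        have e: "support (Z_body M (\<lambda>\<omega>. ext_map \<phi> (\<xi> \<omega>))) = support (Z_body ?D (\<lambda>x. x))"
          by (simp add: fun_eq_iff support_Z_body[OF v(2)] support_Z_body[OF i] integral_distr)
        have AE: "AE x in ?D. x \<in> ext_pow p W"
          using v(3) closed_subspace[OF subspace_ext_pow, of p W] by (subst AE_distr_iff) auto
        have mk: "?m k \<in> fun_space.span (Z_generators q W)" unfolding k(1) by (rule vmZ[OF kZ])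
        then have kg: "?m k \<in> linear_growth" using Z_generators_growth by blast
        have "zonoid_product W p q (?m h) (?m k) u = (\<integral>x. ?m k (left_contract x u) \<partial>?D)"
          unfolding h(1) v(1) e by (rule zonoid_product_left[OF D i AE mk])
        also have "\<dots> = (\<integral>\<omega>. ?m k (left_contract (ext_map \<phi> (\<xi> \<omega>)) u) \<partial>M)"
        proof (rule integral_distr)
          have "continuous_on UNIV (?m k)" using kg by (simp add: linear_growth_def)
          moreover have "continuous_on UNIV (\<lambda>x :: 'b ext. left_contract x u)"
            using bounded_linear_contract(1) by (rule linear_continuous_on)
          ultimately have "continuous_on UNIV (\<lambda>x. ?m k (left_contract x u))"
            by (rule continuous_on_compose2) simp
          then show "(\<lambda>x. ?m k (left_contract x u)) \<in> borel_measurable borel" by (rule borel_measurable_continuous_onI)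
        qed simp
        finally show ?thesis by simp
      qed
      finally show "?m (zonoid_product V p q h k) u = zonoid_product W p q (?m h) (?m k) u" .
    qed
  qed
  then show ?thesis by (simp add: fun_eq_iff)
qed

section \<open>The quotient algebra\<close>

lemma support_sing_fun: "support {p} = (\<lambda>u. p \<bullet> u)"
  by (simp add: fun_eq_iff support_sing)

lemma adjoint_comp:
  fixes f :: "'a::euclidean_space \<Rightarrow> 'b::euclidean_space" and g :: "'b \<Rightarrow> 'c::euclidean_space"
  assumes "linear f" "linear g"
  shows "adjoint (g \<circ> f) = adjoint f \<circ> adjoint g"
  by (rule adjoint_unique) (simp add: adjoint_works[OF assms(1)] adjoint_works[OF assms(2)])

lemma I_deg_comb:
  "h \<in> I_deg d V \<Longrightarrow> k \<in> I_deg d V \<Longrightarrow> (\<lambda>u. a * h u + b * k u) \<in> I_deg d V"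
  by (rule subspace_I_deg[of d V, unfolded fun_subspace_iff, THEN conjunct2, THEN bspec, THEN bspec, THEN spec, THEN spec])

lemma I_deg_simple_combs:
  "(\<lambda>_. 0) \<in> I_deg d V"
  "h \<in> I_deg d V \<Longrightarrow> k \<in> I_deg d V \<Longrightarrow> (\<lambda>u. h u + k u) \<in> I_deg d V"
  "h \<in> I_deg d V \<Longrightarrow> k \<in> I_deg d V \<Longrightarrow> (\<lambda>u. h u - k u) \<in> I_deg d V"
  "h \<in> I_deg d V \<Longrightarrow> (\<lambda>u. a * h u) \<in> I_deg d V"
  using fun_space.subspace_0[OF subspace_I_deg[of d V]] I_deg_comb[of h d V k 1 1] I_deg_comb[of h d V k 1 "-1"]
    I_deg_comb[of h d V h a 0] by (simp_all add: zero_fun_def)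

lemma I_deg_sum: "finite A \<Longrightarrow> (\<And>p. p \<in> A \<Longrightarrow> f p \<in> I_deg d V) \<Longrightarrow> (\<lambda>u. \<Sum>p\<in>A. f p u) \<in> I_deg d V"
  by (induction rule: finite_induct) (simp_all add: I_deg_simple_combs)

lemma I_deg_subset_centered: "h \<in> I_deg d V \<Longrightarrow> h \<in> G_centered d V"
  by (simp add: I_deg_iff)

lemma G_centered_subset_all: "subspace V \<Longrightarrow> h \<in> G_centered d V \<Longrightarrow> h \<in> G_all d V"
  unfolding G_all_iff by (rule bexI[of _ h], rule bexI[of _ 0]) (simp_all add: subspace_0[OF subspace_ext_pow])

lemma G_all_comb: "subspace V \<Longrightarrow> h \<in> G_all d V \<Longrightarrow> k \<in> G_all d V \<Longrightarrow> (\<lambda>u. a * h u + b * k u) \<in> G_all d V"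
  by (simp add: G_all_def lin_span_eq_span fun_span_comb)

lemma Q_class_mem: "y \<in> Q_class V x \<longleftrightarrow> (\<forall>d. (\<lambda>u. y d u - x d u) \<in> I_deg d V)"
proof
  assume "y \<in> Q_class V x"
  then obtain i where "i \<in> I_ideal V" "y = (\<lambda>d u. i d u + x d u)"
    by (auto simp: Q_class_def a_r_coset_def r_coset_def G_algebra_def)
  then show "\<forall>d. (\<lambda>u. y d u - x d u) \<in> I_deg d V" by (simp add: I_ideal_def)
next
  assume "\<forall>d. (\<lambda>u. y d u - x d u) \<in> I_deg d V"
  then have "(\<lambda>d u. y d u - x d u) \<in> I_ideal V" by (simp add: I_ideal_def)
  then show "y \<in> Q_class V x"
    by (auto simp: Q_class_def a_r_coset_def r_coset_def G_algebra_def intro!: bexI[of _ "\<lambda>d u. y d u - x d u"])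
qed

lemma Q_class_self: "x \<in> Q_class V x"
  by (simp add: Q_class_mem I_deg_simple_combs)

lemma Q_class_eq_iff: "Q_class V x = Q_class V y \<longleftrightarrow> (\<forall>d. (\<lambda>u. x d u - y d u) \<in> I_deg d V)"
proof
  assume "Q_class V x = Q_class V y"
  then show "\<forall>d. (\<lambda>u. x d u - y d u) \<in> I_deg d V" using Q_class_self[of x V] by (simp add: Q_class_mem)
next
  assume *: "\<forall>d. (\<lambda>u. x d u - y d u) \<in> I_deg d V"
  show "Q_class V x = Q_class V y"
  proof (rule Set.set_eqI)
    fix z
    have "(\<lambda>u. z d u - x d u) \<in> I_deg d V \<longleftrightarrow> (\<lambda>u. z d u - y d u) \<in> I_deg d V" for d
      using I_deg_simple_combs(2)[of "\<lambda>u. z d u - x d u" d V "\<lambda>u. x d u - y d u"]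
        I_deg_simple_combs(3)[of "\<lambda>u. z d u - y d u" d V "\<lambda>u. x d u - y d u"] * by auto
    then show "z \<in> Q_class V x \<longleftrightarrow> z \<in> Q_class V y" by (simp add: Q_class_mem)
  qed
qed

text \<open>The quotient construction is unfolded here once and for all. The centered quotient has
  the same operations and differs only in its carrier and its unit.\<close>

lemma Q_record:
  "carrier (Q V) = Q_class V ` {x. \<forall>d. x d \<in> G_all d V}"
  "\<one>\<^bsub>Q V\<^esub> = Q_class V (in_degree 0 (support (closed_segment 0 ext_one)))"
  "X \<otimes>\<^bsub>Q V\<^esub> Y = rcoset_mult (G_algebra V) (I_ideal V) X Y"
  "X \<oplus>\<^bsub>Q V\<^esub> Y = X <+>\<^bsub>G_algebra V\<^esub> Y"
  "a \<odot>\<^bsub>Q V\<^esub> X = (\<Union>x\<in>X. Q_class V (\<lambda>d u. a * x d u))"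
  "carrier (Q_centered V) = Q_class V ` {x. \<forall>d. x d \<in> G_centered d V}"
  "\<one>\<^bsub>Q_centered V\<^esub> = Q_class V (in_degree 0 (support (closed_segment ((-1/2) *\<^sub>R ext_one) ((1/2) *\<^sub>R ext_one))))"
  "X \<otimes>\<^bsub>Q_centered V\<^esub> Y = rcoset_mult (G_algebra V) (I_ideal V) X Y"
  "X \<oplus>\<^bsub>Q_centered V\<^esub> Y = X <+>\<^bsub>G_algebra V\<^esub> Y"
  "a \<odot>\<^bsub>Q_centered V\<^esub> X = (\<Union>x\<in>X. Q_class V (\<lambda>d u. a * x d u))"
  by (auto simp: Q_def Q_centered_def quotient_algebra_def ring.defs module.defs FactRing_def A_RCOSETS_def RCOSETS_def
      Q_class_def G_algebra_def G_centered_algebra_def a_r_coset_def r_coset_def rcoset_mult_def set_add_def set_mult_def)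

lemma Q_add_class: "Q_class V x <+>\<^bsub>G_algebra V\<^esub> Q_class V y = Q_class V (\<lambda>d u. x d u + y d u)"
proof (rule Set.set_eqI)
  fix z
  have "z \<in> Q_class V x <+>\<^bsub>G_algebra V\<^esub> Q_class V y \<longleftrightarrow>
      (\<exists>a\<in>Q_class V x. \<exists>b\<in>Q_class V y. z = (\<lambda>d u. a d u + b d u))"
    by (auto simp: set_add_def set_mult_def G_algebra_def)
  also have "\<dots> \<longleftrightarrow> z \<in> Q_class V (\<lambda>d u. x d u + y d u)"
  proof
    assume "\<exists>a\<in>Q_class V x. \<exists>b\<in>Q_class V y. z = (\<lambda>d u. a d u + b d u)"
    then obtain a b where ab: "a \<in> Q_class V x" "b \<in> Q_class V y" "z = (\<lambda>d u. a d u + b d u)" by auto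
    have "(\<lambda>u. z d u - (x d u + y d u)) \<in> I_deg d V" for d
      using I_deg_simple_combs(2)[of "\<lambda>u. a d u - x d u" d V "\<lambda>u. b d u - y d u"] ab
      by (simp add: Q_class_mem algebra_simps)
    then show "z \<in> Q_class V (\<lambda>d u. x d u + y d u)" by (simp add: Q_class_mem)
  next
    assume "z \<in> Q_class V (\<lambda>d u. x d u + y d u)"
    then have "(\<lambda>d u. z d u - y d u) \<in> Q_class V x" by (simp add: Q_class_mem algebra_simps)
    then show "\<exists>a\<in>Q_class V x. \<exists>b\<in>Q_class V y. z = (\<lambda>d u. a d u + b d u)"
      by (rule bexI[rotated]) (rule bexI[OF _ Q_class_self], simp)
  qed
  finally show "z \<in> Q_class V x <+>\<^bsub>G_algebra V\<^esub> Q_class V y \<longleftrightarrow> z \<in> Q_class V (\<lambda>d u. x d u + y d u)" .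
qed

text \<open>Operations on cosets are unions over representatives; independence of the representative
  makes such a union a single coset.\<close>

lemma UN_constant_class: "X \<noteq> {} \<Longrightarrow> (\<And>x. x \<in> X \<Longrightarrow> f x = C) \<Longrightarrow> (\<Union>x\<in>X. f x) = C"
  by auto

lemma Q_class_nonempty: "Q_class V x \<noteq> {}"
  using Q_class_self by fast

lemma Q_smult_class: "(\<Union>y\<in>Q_class V x. Q_class V (\<lambda>d u. a * y d u)) = Q_class V (\<lambda>d u. a * x d u)"
proof (rule UN_constant_class[OF Q_class_nonempty])
  fix y assume "y \<in> Q_class V x"
  then have "(\<lambda>u. a * (y d u - x d u)) \<in> I_deg d V" for d by (intro I_deg_simple_combs(4)) (simp add: Q_class_mem)
  then show "Q_class V (\<lambda>d u. a * y d u) = Q_class V (\<lambda>d u. a * x d u)"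
    by (simp add: Q_class_eq_iff right_diff_distrib)
qed

lemma Q_class_in_G_all:
  assumes V: "subspace V" and "y \<in> Q_class V x" "x d \<in> G_all d V"
  shows "y d \<in> G_all d V"
proof -
  have "(\<lambda>u. y d u - x d u) \<in> G_all d V"
    using assms(2) by (intro G_centered_subset_all[OF V] I_deg_subset_centered) (simp add: Q_class_mem)
  from G_all_comb[OF V this assms(3), of 1 1] show ?thesis by simp
qed

text \<open>The difference of the products is \<open>(h' - h) k' + h (k' - k)\<close>, and both
  summands lie in the ideal.\<close>

lemma zonoid_product_mod_I:
  assumes V: "subspace V" and G: "h \<in> G_all p V" "h' \<in> G_all p V" "k \<in> G_all q V" "k' \<in> G_all q V"
    and I: "(\<lambda>u. h' u - h u) \<in> I_deg p V" "(\<lambda>u. k' u - k u) \<in> I_deg q V"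
  shows "(\<lambda>u. zonoid_product V p q h' k' u - zonoid_product V p q h k u) \<in> I_deg (p + q) V"
proof -
  let ?P = "zonoid_product V p q"
  note Z = G_all_in_span_Z[OF V, THEN subsetD]
  have "?P (\<lambda>u. 1 * h' u + (-1) * h u) k' u = 1 * ?P h' k' u + (-1) * ?P h k' u" for u
    by (rule zonoid_product_bilinear(1)[OF Z[OF G(2)] Z[OF G(1)] Z[OF G(4)] Z[OF G(4)]])
  moreover have "?P h (\<lambda>u. 1 * k' u + (-1) * k u) u = 1 * ?P h k' u + (-1) * ?P h k u" for u
    by (rule zonoid_product_bilinear(2)[OF Z[OF G(1)] Z[OF G(1)] Z[OF G(4)] Z[OF G(3)]])
  ultimately have eq: "(\<lambda>u. ?P h' k' u - ?P h k u) = (\<lambda>u. ?P (\<lambda>u. h' u - h u) k' u + ?P h (\<lambda>u. k' u - k u) u)"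
    by (simp add: fun_eq_iff)
  show ?thesis unfolding eq
    by (rule I_deg_simple_combs(2)[OF zonoid_product_ideal(1)[OF V I(1) G(4)] zonoid_product_ideal(2)[OF V I(2) G(1)]])
qed

lemma Q_mult_class:
  assumes V: "subspace V" and x: "\<And>d. x d \<in> G_all d V" and y: "\<And>d. y d \<in> G_all d V"
  shows "rcoset_mult (G_algebra V) (I_ideal V) (Q_class V x) (Q_class V y) = Q_class V (x \<otimes>\<^bsub>G_algebra V\<^esub> y)"
proof -
  have "Q_class V (a \<otimes>\<^bsub>G_algebra V\<^esub> b) = Q_class V (x \<otimes>\<^bsub>G_algebra V\<^esub> y)"
    if a: "a \<in> Q_class V x" and b: "b \<in> Q_class V y" for a b
  proof -
    have "(\<lambda>u. (a \<otimes>\<^bsub>G_algebra V\<^esub> b) n u - (x \<otimes>\<^bsub>G_algebra V\<^esub> y) n u) \<in> I_deg n V" for n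
    proof -
      have *: "(\<lambda>u. zonoid_product V p (n - p) (a p) (b (n - p)) u - zonoid_product V p (n - p) (x p) (y (n - p)) u) \<in> I_deg (p + (n - p)) V" for p
        by (rule zonoid_product_mod_I[OF V x _ y _])
          (use a b in \<open>auto intro: Q_class_in_G_all[OF V _ x] Q_class_in_G_all[OF V _ y] simp: Q_class_mem\<close>)
      \<comment> \<open>With truncated subtraction the total degree is \<open>n\<close> only for
        \<open>p \<le> n\<close>, which is the range of the sum.\<close>
      have "(\<lambda>u. zonoid_product V p (n - p) (a p) (b (n - p)) u - zonoid_product V p (n - p) (x p) (y (n - p)) u) \<in> I_deg n V"
        if "p \<le> n" for p using *[of p] that by simp
      then have "(\<lambda>u. \<Sum>p\<le>n. zonoid_product V p (n - p) (a p) (b (n - p)) u - zonoid_product V p (n - p) (x p) (y (n - p)) u) \<in> I_deg n V"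
        by (intro I_deg_sum) auto
      then show ?thesis by (simp add: G_algebra_def sum_subtractf)
    qed
    then show ?thesis by (simp add: Q_class_eq_iff)
  qed
  then show ?thesis
    unfolding rcoset_mult_def Q_class_def[symmetric] by (intro UN_constant_class Q_class_nonempty)
qed

section \<open>Maps induced on the quotient algebras\<close>

definition graded_map ::
  "(real ^ 'n::{finite,linorder} \<Rightarrow> real ^ 'm::{finite,linorder}) \<Rightarrow> 'n graded_zonoid \<Rightarrow> 'm graded_zonoid"
where
  "graded_map \<phi> x = (\<lambda>d. virtual_map (ext_map \<phi>) (x d))"

lemma graded_map_pointwise:
  "graded_map \<phi> (\<lambda>d u. x d u + y d u) = (\<lambda>d u. graded_map \<phi> x d u + graded_map \<phi> y d u)"
  "graded_map \<phi> (\<lambda>d u. x d u - y d u) = (\<lambda>d u. graded_map \<phi> x d u - graded_map \<phi> y d u)"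
  "graded_map \<phi> (\<lambda>d u. a * x d u) = (\<lambda>d u. a * graded_map \<phi> x d u)"
  "graded_map \<phi> (in_degree e h) = in_degree e (virtual_map (ext_map \<phi>) h)"
  by (auto simp: graded_map_def virtual_map_def in_degree_def fun_eq_iff)

text \<open>The map is given on the ambient space but constrained only on \<open>V\<close>, since
  the intended instances are adjoints of normalised differentials and orthogonal
  projections.\<close>

locale subspace_map =
  fixes V :: "(real ^ 'n::{finite,linorder}) set" and W :: "(real ^ 'm::{finite,linorder}) set"
    and \<phi> :: "real ^ 'n::{finite,linorder} \<Rightarrow> real ^ 'm::{finite,linorder}"
  assumes V: "subspace V" and W: "subspace W" and lin: "linear \<phi>" and map: "\<phi> ` V \<subseteq> W"
begin

lemma Q_map_class: "Q_map W \<phi> (Q_class V x) = Q_class W (graded_map \<phi> x)"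
  unfolding Q_map_def
proof (rule UN_constant_class[OF Q_class_nonempty])
  fix y assume y: "y \<in> Q_class V x"
  have "(\<lambda>u. graded_map \<phi> y d u - graded_map \<phi> x d u) \<in> I_deg d W" for d
  proof -
    have "virtual_map (ext_map \<phi>) (\<lambda>u. y d u - x d u) \<in> I_deg d W"
      using y by (intro virtual_map_G(3)[OF lin map V W]) (simp add: Q_class_mem)
    then show ?thesis by (simp add: graded_map_def virtual_map_def)
  qed
  then show "Q_class W (\<lambda>d. virtual_map (ext_map \<phi>) (y d)) = Q_class W (graded_map \<phi> x)"
    by (simp add: Q_class_eq_iff graded_map_def)
qed

lemma graded_map_mult:
  assumes "\<And>d. x d \<in> G_all d V" "\<And>d. y d \<in> G_all d V"
  shows "graded_map \<phi> (x \<otimes>\<^bsub>G_algebra V\<^esub> y) = graded_map \<phi> x \<otimes>\<^bsub>G_algebra W\<^esub> graded_map \<phi> y"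
proof -
  have "virtual_map (ext_map \<phi>) (zonoid_product V p q (x p) (y q)) u =
      zonoid_product W p q (virtual_map (ext_map \<phi>) (x p)) (virtual_map (ext_map \<phi>) (y q)) u" for p q u
    using zonoid_product_virtual_map[OF lin map, of "x p" p "y q" q] G_all_in_span_Z[OF V] assms by (simp add: subset_iff)
  then show ?thesis by (simp add: fun_eq_iff G_algebra_def graded_map_def) (simp add: virtual_map_def)
qed

lemma graded_map_G:
  "(\<And>d. x d \<in> G_all d V) \<Longrightarrow> graded_map \<phi> x d \<in> G_all d W"
  "(\<And>d. x d \<in> G_centered d V) \<Longrightarrow> graded_map \<phi> x d \<in> G_centered d W"
  by (auto simp: graded_map_def intro: virtual_map_G[OF lin map V W])

lemma Q_map_carrier:
  "X \<in> carrier (Q V) \<Longrightarrow> Q_map W \<phi> X \<in> carrier (Q W)"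
  "X \<in> carrier (Q_centered V) \<Longrightarrow> Q_map W \<phi> X \<in> carrier (Q_centered W)"
  by (auto simp: Q_record Q_map_class intro!: imageI graded_map_G)

lemma Q_map_deg: "X \<in> Q_deg d V \<Longrightarrow> Q_map W \<phi> X \<in> Q_deg d W"
  unfolding Q_deg_def
  by (auto simp: Q_map_class graded_map_pointwise intro!: virtual_map_G[OF lin map V W])

lemma Q_centered_subset: "carrier (Q_centered V) \<subseteq> carrier (Q V)"
  unfolding Q_record by (intro image_mono) (auto intro: G_centered_subset_all[OF V])

lemma Q_map_mult:
  assumes "X \<in> carrier (Q V)" "Y \<in> carrier (Q V)"
  shows "Q_map W \<phi> (rcoset_mult (G_algebra V) (I_ideal V) X Y) =
    rcoset_mult (G_algebra W) (I_ideal W) (Q_map W \<phi> X) (Q_map W \<phi> Y)"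
proof -
  obtain x y where x: "X = Q_class V x" "\<And>d. x d \<in> G_all d V" and y: "Y = Q_class V y" "\<And>d. y d \<in> G_all d V"
    using assms by (auto simp: Q_record)
  show ?thesis
    unfolding x(1) y(1) Q_mult_class[OF V x(2) y(2)] Q_map_class
      Q_mult_class[OF W graded_map_G(1)[OF x(2)] graded_map_G(1)[OF y(2)]] graded_map_mult[OF x(2) y(2)] ..
qed

lemma Q_map_add:
  assumes "X \<in> range (Q_class V)" "Y \<in> range (Q_class V)"
  shows "Q_map W \<phi> (X <+>\<^bsub>G_algebra V\<^esub> Y) = Q_map W \<phi> X <+>\<^bsub>G_algebra W\<^esub> Q_map W \<phi> Y"
  using assms by (auto simp: Q_add_class Q_map_class graded_map_pointwise)

lemma Q_map_smult:
  assumes "X \<in> range (Q_class V)"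
  shows "Q_map W \<phi> (\<Union>x\<in>X. Q_class V (\<lambda>d u. a * x d u)) = (\<Union>x\<in>Q_map W \<phi> X. Q_class W (\<lambda>d u. a * x d u))"
proof -
  obtain x where "X = Q_class V x" using assms by auto
  then show ?thesis by (simp only: Q_smult_class Q_map_class graded_map_pointwise)
qed

lemma Q_map_one:
  "Q_map W \<phi> \<one>\<^bsub>Q V\<^esub> = \<one>\<^bsub>Q W\<^esub>" "Q_map W \<phi> \<one>\<^bsub>Q_centered V\<^esub> = \<one>\<^bsub>Q_centered W\<^esub>"
proof -
  have seg: "virtual_map (ext_map \<phi>) (support (closed_segment (a *\<^sub>R ext_one) (b *\<^sub>R ext_one))) =
      support (closed_segment (a *\<^sub>R ext_one) (b *\<^sub>R ext_one))" for a b
  proof -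
    have "ext_map \<phi> ` closed_segment (a *\<^sub>R ext_one) (b *\<^sub>R ext_one) = closed_segment (a *\<^sub>R ext_one) (b *\<^sub>R ext_one)"
      using closed_segment_linear_image[OF linear_ext_map, of \<phi> "a *\<^sub>R ext_one" "b *\<^sub>R ext_one"]
      by (simp add: linear_cmul[OF linear_ext_map] ext_map_one)
    then show ?thesis
      using support_linear_image[OF linear_ext_map, of \<phi> "closed_segment (a *\<^sub>R ext_one) (b *\<^sub>R ext_one)"]
      by (simp add: virtual_map_def fun_eq_iff)
  qed
  show "Q_map W \<phi> \<one>\<^bsub>Q V\<^esub> = \<one>\<^bsub>Q W\<^esub>"
    using seg[of 0 1] by (simp add: Q_record Q_map_class graded_map_pointwise)
  show "Q_map W \<phi> \<one>\<^bsub>Q_centered V\<^esub> = \<one>\<^bsub>Q_centered W\<^esub>"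
    using seg[of "-1/2" "1/2"] by (simp add: Q_record Q_map_class graded_map_pointwise)
qed

lemma Q_map_ext_incl: "Q_map W \<phi> (ext_incl V w) = ext_incl W (ext_map \<phi> w)"
  by (simp add: ext_incl_def Q_map_class graded_map_def support_sing_fun virtual_map_point[OF lin] ext_map_component[OF lin]
      linear_cmul[OF linear_ext_map] del: inner_scaleR_left)

end

lemma Q_map_comp:
  assumes "subspace_map V W \<phi>" "subspace_map W U \<psi>" and X: "X \<in> carrier (Q V)"
  shows "Q_map U \<psi> (Q_map W \<phi> X) = Q_map U (\<psi> \<circ> \<phi>) X"
proof -
  interpret a: subspace_map V W \<phi> by fact
  interpret b: subspace_map W U \<psi> by fact
  interpret c: subspace_map V U "\<psi> \<circ> \<phi>"
  proof (rule subspace_map.intro[OF a.V b.W])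
    show "linear (\<psi> \<circ> \<phi>)" using linear_compose[OF a.lin b.lin] by (simp add: o_def)
    show "(\<psi> \<circ> \<phi>) ` V \<subseteq> U" using a.map b.map by auto
  qed
  obtain x where x: "X = Q_class V x" using X by (auto simp: Q_record)
  have "graded_map \<psi> (graded_map \<phi> x) = graded_map (\<psi> \<circ> \<phi>) x"
    by (simp add: graded_map_def virtual_map_ext_map a.lin b.lin c.lin adjoint_comp[OF a.lin b.lin]
        ext_map_comp[OF adjoint_linear[OF a.lin] adjoint_linear[OF b.lin]])
  then show ?thesis by (simp add: x a.Q_map_class b.Q_map_class c.Q_map_class)
qed

text \<open>The random vectors take values almost surely in the exterior power of \<open>V\<close>,
  where \<open>ext_map \<phi>\<close> is the identity. The lemma is applied to maps such as
  orthogonal projections, which are not the identity on the ambient space.\<close>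

lemma Q_map_id:
  assumes "subspace_map V V \<phi>" and id: "\<And>v. v \<in> V \<Longrightarrow> \<phi> v = v" and X: "X \<in> carrier (Q V)"
  shows "Q_map V \<phi> X = X"
proof -
  interpret subspace_map V V \<phi> by fact
  obtain x where x: "X = Q_class V x" "\<And>d. x d \<in> G_all d V" using X by (auto simp: Q_record)
  have "virtual_map (ext_map \<phi>) h = h" if "h \<in> fun_space.span (Z_generators d V)" for h d
    using that
  proof (induction rule: fun_span_induct)
    case (base h)
    then obtain M :: "'a ext measure" and \<xi> where h: "h = support (Z_body M \<xi>)" "integrable M \<xi>" "AE \<omega> in M. \<xi> \<omega> \<in> ext_pow d V"
      by (auto simp: Z_generators_def)
    note i = integrable_bounded_linear[OF bounded_linear_ext_map h(2), of \<phi>]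
    have [measurable]: "\<xi> \<in> borel_measurable M" "(\<lambda>\<omega>. ext_map \<phi> (\<xi> \<omega>)) \<in> borel_measurable M" using h(2) i by auto
    have "AE \<omega> in M. ext_map \<phi> (\<xi> \<omega>) = \<xi> \<omega>"
      using h(3) by eventually_elim (use ext_map_id_on[OF lin id] ext_pow_subset_carrier in blast)
    then have "(\<integral>\<omega>. max 0 (u \<bullet> ext_map \<phi> (\<xi> \<omega>)) \<partial>M) = (\<integral>\<omega>. max 0 (u \<bullet> \<xi> \<omega>) \<partial>M)" for u
      by (intro integral_cong_AE) (auto elim!: eventually_mono)
    then show ?case
      unfolding h(1) virtual_map_Z(1)[OF lin h(2)] by (simp add: fun_eq_iff support_Z_body[OF h(2)] support_Z_body[OF i])
  qed (simp_all add: virtual_map_def fun_eq_iff)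
  from this[OF subsetD[OF G_all_in_span_Z[OF V] x(2)]] have "graded_map \<phi> x = x"
    by (simp add: graded_map_def)
  then show ?thesis by (simp add: x(1) Q_map_class)
qed

lemma Q_map_Z_class:
  assumes "subspace_map V W \<phi>" and \<xi>: "integrable M \<xi>"
  shows "Q_map W \<phi> (Q_class V (in_degree d (support (Z_body M \<xi>)))) =
    Q_class W (in_degree d (support (Z_body M (\<lambda>\<omega>. ext_map \<phi> (\<xi> \<omega>)))))"
proof -
  interpret subspace_map V W \<phi> by fact
  show ?thesis by (simp add: Q_map_class graded_map_pointwise virtual_map_Z[OF lin \<xi>])
qed

section \<open>Differentials in charts\<close>

lemma orth_proj_in: "subspace V \<Longrightarrow> orth_proj V x \<in> V"
  using orth_proj(2) by auto

lemma orth_proj_idem: "subspace V \<Longrightarrow> orth_proj V (orth_proj V x) = orth_proj V x"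
  by (rule orth_proj(3)[OF _ orth_proj_in])

lemma orth_proj_diff_comp: "subspace V \<Longrightarrow> x - orth_proj V x \<in> V\<^sup>\<bottom>"
proof -
  assume V: "subspace V"
  have "w \<bullet> (x - orth_proj V x) = 0" if "w \<in> V" for w
  proof -
    have "w \<bullet> orth_proj V x = orth_proj V w \<bullet> x"
      using adjoint_works[OF orth_proj(1)[OF V], of w x] orth_proj(4)[OF V] by (simp add: inner_commute)
    then show ?thesis by (simp add: inner_diff_right orth_proj(3)[OF V that])
  qed
  then show ?thesis by (simp add: orthogonal_comp_def orthogonal_def inner_commute)
qed

lemma orth_proj_unique:
  assumes V: "subspace V" and "y \<in> V" "x - y \<in> V\<^sup>\<bottom>"
  shows "orth_proj V x = y"
proof -
  have "orth_proj V (x - y) = 0" by (rule orth_proj(5)[OF V assms(3)])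
  then show ?thesis by (simp add: linear_diff[OF orth_proj(1)[OF V]] orth_proj(3)[OF V assms(2)])
qed

lemma bounded_linear_orth_proj: "subspace (V :: 'a::euclidean_space set) \<Longrightarrow> bounded_linear (orth_proj V)"
  using orth_proj(1) by (simp add: linear_conv_bounded_linear)

lemma has_derivative_orth_proj: "subspace (V :: 'a::euclidean_space set) \<Longrightarrow> (orth_proj V has_derivative orth_proj V) F"
  using bounded_linear_imp_has_derivative[OF bounded_linear_orth_proj] .

section \<open>Charts with values in a model subspace\<close>

text \<open>What \<open>smooth_manifold\<close> demands of a single chart. Product charts satisfy it
  too, so calculus on a product manifold can work with them directly.\<close>

definition chart_of :: "('m, 'e::euclidean_space) manifold \<Rightarrow> 'm set \<times> ('m \<Rightarrow> 'e) \<Rightarrow> bool" where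
  "chart_of M c \<longleftrightarrow> subspace (model M) \<and> openin (mtop M) (fst c) \<and>
     openin (top_of_set (model M)) (snd c ` fst c) \<and>
     homeomorphic_map (subtopology (mtop M) (fst c)) (top_of_set (snd c ` fst c)) (snd c)"

lemma atlas_chart: "smooth_manifold M \<Longrightarrow> c \<in> atlas M \<Longrightarrow> chart_of M c"
proof -
  assume M: "smooth_manifold M" and c: "c \<in> atlas M"
  have "case c of (U, d) \<Rightarrow> openin (mtop M) U \<and> openin (top_of_set (model M)) (d ` U) \<and>
        homeomorphic_map (subtopology (mtop M) U) (top_of_set (d ` U)) d"
    using M c unfolding smooth_manifold_def by blast
  moreover have "subspace (model M)" using M by (simp add: smooth_manifold_def)
  ultimately show "chart_of M c" by (simp add: chart_of_def case_prod_beta)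
qed

lemma has_derivative_cong_nhds:
  assumes f: "(f has_derivative D) (at x)" and eq: "\<forall>\<^sub>F y in nhds x. f y = g y"
  shows "(g has_derivative D) (at x)"
proof (rule has_derivative_transform_eventually[OF f])
  show "\<forall>\<^sub>F y in at x. f y = g y" using eq by (auto simp: eventually_at_filter elim: eventually_mono)
  show "f x = g x" using eventually_nhds_x_imp_x[OF eq] .
qed simp

lemma atlas_cover: "smooth_manifold M \<Longrightarrow> p \<in> topspace (mtop M) \<Longrightarrow> \<exists>c\<in>atlas M. p \<in> fst c"
proof -
  assume M: "smooth_manifold M" and "p \<in> topspace (mtop M)"
  then have "p \<in> (\<Union>(U, c)\<in>atlas M. U)" by (simp add: smooth_manifold_def)
  then show "\<exists>c\<in>atlas M. p \<in> fst c" by force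
qed

context
  fixes M :: "('m, 'e::euclidean_space) manifold" and c :: "'m set \<times> ('m \<Rightarrow> 'e)"
  assumes c: "chart_of M c"
begin

lemma chart_subspace: "subspace (model M)" using c by (simp add: chart_of_def)

lemma chart_subset: "fst c \<subseteq> topspace (mtop M)" using c by (simp add: chart_of_def openin_subset)

lemma chart_inj: "inj_on (snd c) (fst c)"
proof -
  have "inj_on (snd c) (topspace (subtopology (mtop M) (fst c)))"
    by (rule homeomorphic_imp_injective_map) (use c in \<open>auto simp: chart_of_def\<close>)
  moreover have "topspace (subtopology (mtop M) (fst c)) = fst c" using chart_subset by auto
  ultimately show ?thesis by simp
qed

lemma chart_in_model: "q \<in> fst c \<Longrightarrow> snd c q \<in> model M"
  using c by (auto simp: chart_of_def dest!: openin_imp_subset)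

lemma chart_inv: "q \<in> fst c \<Longrightarrow> inv_into (fst c) (snd c) (snd c q) = q"
  by (rule inv_into_f_f[OF chart_inj])

lemma chart_proj: "q \<in> fst c \<Longrightarrow> orth_proj (model M) (snd c q) = snd c q"
  by (rule orth_proj(3)[OF chart_subspace chart_in_model])

lemma chart_image_open:
  assumes "openin (mtop M) A" "A \<subseteq> fst c"
  shows "openin (top_of_set (model M)) (snd c ` A)"
proof -
  have "open_map (subtopology (mtop M) (fst c)) (top_of_set (snd c ` fst c)) (snd c)"
    by (rule homeomorphic_imp_open_map) (use c in \<open>auto simp: chart_of_def\<close>)
  moreover have "openin (subtopology (mtop M) (fst c)) A"
    using assms by (auto simp: openin_subtopology)
  ultimately have "openin (top_of_set (snd c ` fst c)) (snd c ` A)" by (simp add: open_map_def)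
  then show ?thesis using c openin_trans by (auto simp: chart_of_def)
qed

lemma chart_preimage_open:
  assumes "open W"
  shows "openin (mtop M) {q \<in> fst c. snd c q \<in> W}"
proof -
  have "continuous_map (subtopology (mtop M) (fst c)) (top_of_set (snd c ` fst c)) (snd c)"
    by (rule homeomorphic_imp_continuous_map) (use c in \<open>auto simp: chart_of_def\<close>)
  then have "continuous_map (subtopology (mtop M) (fst c)) euclidean (snd c)"
    by (rule continuous_map_into_fulltopology)
  then have "openin (subtopology (mtop M) (fst c)) {q \<in> topspace (subtopology (mtop M) (fst c)). snd c q \<in> W}"
    by (rule openin_continuous_map_preimage) (use assms in simp)
  moreover have ts: "topspace (subtopology (mtop M) (fst c)) = fst c" using chart_subset by auto
  ultimately have "openin (subtopology (mtop M) (fst c)) {q \<in> fst c. snd c q \<in> W}" unfolding ts by simp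
  moreover have "openin (mtop M) (fst c)" using c by (simp add: chart_of_def)
  ultimately show ?thesis using openin_trans_full by blast
qed

text \<open>A chart image is open only relative to the model subspace; its preimage under the
  projection is open in the Euclidean space, so derivatives there are ordinary ones.\<close>

lemma chart_open_extension:
  assumes "openin (mtop M) A" "A \<subseteq> fst c"
  shows "open {x. orth_proj (model M) x \<in> snd c ` A}"
proof -
  obtain T where T: "open T" "snd c ` A = model M \<inter> T"
    using chart_image_open[OF assms] unfolding openin_open by auto
  have "{x. orth_proj (model M) x \<in> snd c ` A} = orth_proj (model M) -` T"
    using orth_proj_in[OF chart_subspace] by (auto simp: T(2))
  moreover have "continuous_on UNIV (orth_proj (model M))"
    using bounded_linear_orth_proj[OF chart_subspace] by (rule linear_continuous_on)
  ultimately show ?thesis using T(1) by (simp add: open_vimage)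
qed

lemma chart_eventually:
  assumes q: "q \<in> fst c" and A: "openin (mtop M) A" "q \<in> A"
  shows "\<forall>\<^sub>F x in nhds (snd c q). orth_proj (model M) x \<in> snd c ` fst c \<and>
    inv_into (fst c) (snd c) (orth_proj (model M) x) \<in> A"
proof -
  have o: "openin (mtop M) (A \<inter> fst c)" using A c by (auto simp: chart_of_def)
  have "open {x. orth_proj (model M) x \<in> snd c ` (A \<inter> fst c)}"
    by (rule chart_open_extension[OF o]) simp
  moreover have "snd c q \<in> {x. orth_proj (model M) x \<in> snd c ` (A \<inter> fst c)}"
    using q A by (auto simp: chart_proj)
  ultimately have "\<forall>\<^sub>F x in nhds (snd c q). x \<in> {x. orth_proj (model M) x \<in> snd c ` (A \<inter> fst c)}"
    by (rule eventually_nhds_in_open)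
  then show ?thesis by eventually_elim (auto simp: chart_inv)
qed

end

section \<open>Calculus of differentials in charts\<close>

definition local_rep ::
  "('m, 'e::euclidean_space) manifold \<Rightarrow> 'm set \<times> ('m \<Rightarrow> 'e) \<Rightarrow> 'n set \<times> ('n \<Rightarrow> 'f::euclidean_space) \<Rightarrow>
   ('m \<Rightarrow> 'n) \<Rightarrow> 'e \<Rightarrow> 'f"
where
  "local_rep M c c' f = (\<lambda>x. snd c' (f (inv_into (fst c) (snd c) (orth_proj (model M) x))))"

text \<open>
  Precomposing with the orthogonal projection onto the model space turns derivatives within the
  model space into derivatives on the whole Euclidean space, normalised as in \<open>differential\<close>.
\<close>

definition has_differential ::
  "('m, 'e::euclidean_space) manifold \<Rightarrow> 'm set \<times> ('m \<Rightarrow> 'e) \<Rightarrow> 'n set \<times> ('n \<Rightarrow> 'f::euclidean_space) \<Rightarrow>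
   ('m \<Rightarrow> 'n) \<Rightarrow> 'm \<Rightarrow> ('e \<Rightarrow> 'f) \<Rightarrow> bool"
where
  "has_differential M c c' f p D \<longleftrightarrow> p \<in> fst c \<and> f p \<in> fst c' \<and>
     (\<forall>\<^sub>F x in nhds (snd c p). orth_proj (model M) x \<in> snd c ` fst c \<and>
        f (inv_into (fst c) (snd c) (orth_proj (model M) x)) \<in> fst c') \<and>
     (local_rep M c c' f has_derivative D) (at (snd c p))"

lemma local_rep_at: "chart_of M c \<Longrightarrow> p \<in> fst c \<Longrightarrow> local_rep M c c' f (snd c p) = snd c' (f p)"
  by (simp add: local_rep_def chart_proj chart_inv)

text \<open>Composing the local representative with the projection does not change it, so uniqueness
  of the derivative applies.\<close>

lemma has_differential_proj:
  assumes c: "chart_of M c" and D: "has_differential M c c' f p D"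
  shows "D (orth_proj (model M) v) = D v" "linear D"
proof -
  let ?P = "orth_proj (model M)" and ?F = "local_rep M c c' f"
  have p: "p \<in> fst c" and d: "(?F has_derivative D) (at (snd c p))" using D by (auto simp: has_differential_def)
  show "linear D" using has_derivative_bounded_linear[OF d] by (rule bounded_linear.linear)
  have "(?F has_derivative D) (at (?P (snd c p)))" using d p by (simp add: chart_proj[OF c])
  then have "((\<lambda>x. ?F (?P x)) has_derivative (\<lambda>x. D (?P x))) (at (snd c p))"
    by (rule has_derivative_compose[OF has_derivative_orth_proj[OF chart_subspace[OF c]]])
  moreover have "(\<lambda>x. ?F (?P x)) = ?F" by (simp add: local_rep_def orth_proj_idem[OF chart_subspace[OF c]] fun_eq_iff)
  ultimately have "(?F has_derivative (\<lambda>x. D (?P x))) (at (snd c p))" by simp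
  from has_derivative_unique[OF this d] show "D (?P v) = D v" by metis
qed

text \<open>Near the point the representative takes values in the model of the target, so projecting
  its values changes nothing there; uniqueness of the derivative applies again.\<close>

lemma has_differential_range:
  assumes c: "chart_of M c" and c': "chart_of N c'" and D: "has_differential M c c' f p D"
  shows "D v \<in> model N"
proof -
  let ?P = "orth_proj (model N)" and ?F = "local_rep M c c' f"
  have ev: "\<forall>\<^sub>F x in nhds (snd c p). f (inv_into (fst c) (snd c) (orth_proj (model M) x)) \<in> fst c'"
    and p: "f p \<in> fst c'" "p \<in> fst c" and d: "(?F has_derivative D) (at (snd c p))"
    using D by (auto simp: has_differential_def elim: eventually_mono)
  have "((\<lambda>x. ?P (?F x)) has_derivative (\<lambda>x. ?P (D x))) (at (snd c p))"
    by (rule has_derivative_compose[OF d has_derivative_orth_proj[OF chart_subspace[OF c']]])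
  moreover have "\<forall>\<^sub>F x in nhds (snd c p). ?P (?F x) = ?F x"
    using ev by eventually_elim (simp add: local_rep_def chart_proj[OF c'])
  ultimately have "(?F has_derivative (\<lambda>x. ?P (D x))) (at (snd c p))"
    by (rule has_derivative_cong_nhds)
  from has_derivative_unique[OF this d] have "?P (D v) = D v" by metis
  then show ?thesis using orth_proj_in[OF chart_subspace[OF c'], of "D v"] by simp
qed

text \<open>Connects the working notion with the description by \<open>THE\<close>: on the model a
  candidate is determined by the derivative of the projected representative, and on the complement
  all candidates vanish.\<close>

lemma differential_eqI:
  assumes c: "chart_of M c" and D: "has_differential M c c' f p D"
  shows "differential M c c' f p = D"
proof -
  let ?P = "orth_proj (model M)" and ?F = "local_rep M c c' f" and ?g = "snd c' \<circ> f \<circ> inv_into (fst c) (snd c)"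
  have p: "p \<in> fst c" and d: "(?F has_derivative D) (at (snd c p))" using D by (auto simp: has_differential_def)
  note V = chart_subspace[OF c]
  have F: "?F = (\<lambda>x. ?g (?P x))" by (simp add: local_rep_def fun_eq_iff)
  have uniq: "E = D" if E: "linear E" "\<forall>v\<in>(model M)\<^sup>\<bottom>. E v = 0" "(?g has_derivative E) (at (snd c p) within model M)" for E
  proof -
    have "(?g has_derivative E) (at (?P (snd c p)) within model M)" using E(3) p by (simp add: chart_proj[OF c])
    then have "(?g has_derivative E) (at (?P (snd c p)) within range ?P)"
      by (rule has_derivative_subset[OF _ orth_proj(2)[OF V]])
    from has_derivative_in_compose[OF has_derivative_orth_proj[OF V] this]
    have "((\<lambda>x. ?g (?P x)) has_derivative (\<lambda>x. E (?P x))) (at (snd c p))" .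
    from has_derivative_unique[OF this d[unfolded F]] have "E (?P v) = D v" for v by metis
    moreover have "E v = E (?P v)" for v
      using E(1,2) orth_proj_diff_comp[OF V, of v] linear_diff[of E v "?P v"] by simp
    ultimately show ?thesis by (simp add: fun_eq_iff)
  qed
  have "D v = 0" if "v \<in> (model M)\<^sup>\<bottom>" for v
    using has_differential_proj[OF c D] orth_proj(5)[OF V that] linear_0[of D] by metis
  moreover have "(?g has_derivative D) (at (snd c p) within model M)"
  proof (rule has_derivative_transform[OF chart_in_model[OF c p]])
    show "(?F has_derivative D) (at (snd c p) within model M)" using d by (rule has_derivative_at_withinI)
    show "?g x = ?F x" if "x \<in> model M" for x by (simp add: local_rep_def orth_proj(3)[OF V that])
  qed
  ultimately have "(THE D. linear D \<and> (\<forall>v\<in>(model M)\<^sup>\<bottom>. D v = 0) \<and> (?g has_derivative D) (at (snd c p) within model M)) = D"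
    using has_differential_proj(2)[OF c D] by (intro the_equality) (auto intro: uniq)
  then show ?thesis by (simp add: differential_def case_prod_beta)
qed

lemma has_differential_compose:
  assumes c: "chart_of M c" and c': "chart_of N c'"
    and f: "has_differential M c c' f p D" and g: "has_differential N c' c'' g (f p) E"
  shows "has_differential M c c'' (\<lambda>x. g (f x)) p (\<lambda>v. E (D v))"
proof -
  let ?F = "local_rep M c c' f" and ?G = "local_rep N c' c'' g"
  let ?P = "orth_proj (model M)" and ?Q = "orth_proj (model N)"
  have p: "p \<in> fst c" "f p \<in> fst c'" "g (f p) \<in> fst c''" and d: "(?F has_derivative D) (at (snd c p))"
    and e: "(?G has_derivative E) (at (snd c' (f p)))"
    and evf: "\<forall>\<^sub>F x in nhds (snd c p). ?P x \<in> snd c ` fst c \<and> f (inv_into (fst c) (snd c) (?P x)) \<in> fst c'"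
    and evg: "\<forall>\<^sub>F y in nhds (snd c' (f p)). ?Q y \<in> snd c' ` fst c' \<and> g (inv_into (fst c') (snd c') (?Q y)) \<in> fst c''"
    using f g by (auto simp: has_differential_def)
  have at: "?F (snd c p) = snd c' (f p)" by (rule local_rep_at[OF c p(1)])
  have "isCont ?F (snd c p)" using has_derivative_continuous[OF d] by simp
  \<comment> \<open>Continuity at the point pulls the domain condition of the second map back along
    the first one.\<close>
  then have "filterlim ?F (nhds (snd c' (f p))) (nhds (snd c p))"
    unfolding isCont_def tendsto_at_iff_tendsto_nhds by (simp add: at)
  from filterlim_iff[THEN iffD1, OF this, rule_format, OF evg] evf
  have ev: "\<forall>\<^sub>F x in nhds (snd c p). ?P x \<in> snd c ` fst c \<and> g (f (inv_into (fst c) (snd c) (?P x))) \<in> fst c'' \<and>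
      f (inv_into (fst c) (snd c) (?P x)) \<in> fst c'"
    by eventually_elim (auto simp: local_rep_def chart_proj[OF c'] chart_inv[OF c'])
  have "((\<lambda>x. ?G (?F x)) has_derivative (\<lambda>v. E (D v))) (at (snd c p))"
    using has_derivative_compose[OF d, of ?G E] e by (simp add: at)
  moreover have "\<forall>\<^sub>F x in nhds (snd c p). ?G (?F x) = local_rep M c c'' (\<lambda>x. g (f x)) x"
    using ev by eventually_elim (simp add: local_rep_def chart_proj[OF c'] chart_inv[OF c'])
  ultimately have "(local_rep M c c'' (\<lambda>x. g (f x)) has_derivative (\<lambda>v. E (D v))) (at (snd c p))"
    by (rule has_derivative_cong_nhds)
  then show ?thesis using p ev by (auto simp: has_differential_def elim: eventually_mono)
qed

lemma has_differential_cong: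
  assumes c: "chart_of M c" and f: "has_differential M c c' f p D" and eq: "\<And>x. x \<in> fst c \<Longrightarrow> f x = g x"
  shows "has_differential M c c' g p D"
proof -
  let ?P = "orth_proj (model M)"
  have p: "p \<in> fst c" "f p \<in> fst c'" and d: "(local_rep M c c' f has_derivative D) (at (snd c p))"
    and ev: "\<forall>\<^sub>F x in nhds (snd c p). ?P x \<in> snd c ` fst c \<and> f (inv_into (fst c) (snd c) (?P x)) \<in> fst c'"
    using f by (auto simp: has_differential_def)
  have "\<forall>\<^sub>F x in nhds (snd c p). local_rep M c c' f x = local_rep M c c' g x"
    using ev by eventually_elim (auto simp: local_rep_def eq chart_inv[OF c])
  with d have "(local_rep M c c' g has_derivative D) (at (snd c p))"
    by (rule has_derivative_cong_nhds)
  moreover have "\<forall>\<^sub>F x in nhds (snd c p). ?P x \<in> snd c ` fst c \<and> g (inv_into (fst c) (snd c) (?P x)) \<in> fst c'"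
    using ev by eventually_elim (auto simp: eq chart_inv[OF c])
  ultimately show ?thesis using p eq by (simp add: has_differential_def)
qed

lemma has_differential_id:
  assumes c: "chart_of M c" and p: "p \<in> fst c"
  shows "has_differential M c c (\<lambda>x. x) p (orth_proj (model M))"
proof -
  let ?P = "orth_proj (model M)"
  have "openin (mtop M) (fst c)" using c by (simp add: chart_of_def)
  from chart_eventually[OF c p this p]
  have ev: "\<forall>\<^sub>F x in nhds (snd c p). ?P x \<in> snd c ` fst c \<and> inv_into (fst c) (snd c) (?P x) \<in> fst c" .
  have "\<forall>\<^sub>F x in nhds (snd c p). ?P x = local_rep M c c (\<lambda>x. x) x"
    using ev by eventually_elim (auto simp: local_rep_def chart_inv[OF c])
  with has_derivative_orth_proj[OF chart_subspace[OF c]]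
  have "(local_rep M c c (\<lambda>x. x) has_derivative ?P) (at (snd c p))"
    by (rule has_derivative_cong_nhds)
  then show ?thesis using ev p by (simp add: has_differential_def)
qed

lemma has_differential_unique:
  "chart_of M c \<Longrightarrow> has_differential M c c' f p D \<Longrightarrow> has_differential M c c' f p E \<Longrightarrow> D = E"
  using differential_eqI by metis

section \<open>Continuously differentiable maps and local sections\<close>

text \<open>Continuity of the derivative is stated vector by vector, as in \<open>C_k\<close>; in
  finite dimension \<open>C1_on_blinfun\<close> turns it into continuity in the operator
  norm.\<close>

definition C1_on :: "'a::euclidean_space set \<Rightarrow> ('a \<Rightarrow> 'b::euclidean_space) \<Rightarrow> ('a \<Rightarrow> 'a \<Rightarrow> 'b) \<Rightarrow> bool" where
  "C1_on S F F' \<longleftrightarrow> open S \<and> (\<forall>x\<in>S. (F has_derivative F' x) (at x)) \<and> (\<forall>v. continuous_on S (\<lambda>x. F' x v))"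

text \<open>The derivative within the model is transported along the projection by the chain rule;
  therefore it depends on \<open>x\<close> only through the projection of \<open>x\<close>.\<close>

lemma C1_local_rep:
  assumes c: "chart_of M c" and A: "openin (mtop M) A" "A \<subseteq> fst c"
    and smooth: "C_infinity (snd c ` A) (snd c' \<circ> f \<circ> inv_into (fst c) (snd c))"
  shows "\<exists>F'. C1_on {x. orth_proj (model M) x \<in> snd c ` A} (local_rep M c c' f) F' \<and>
    (\<forall>x. F' (orth_proj (model M) x) = F' x)"
proof -
  let ?S = "snd c ` A" and ?P = "orth_proj (model M)" and ?g = "snd c' \<circ> f \<circ> inv_into (fst c) (snd c)"
  note V = chart_subspace[OF c]
  have "C_k (Suc 0) ?S ?g" using smooth by (simp only: C_infinity_def)
  then obtain g' where g': "\<forall>x\<in>?S. (?g has_derivative g' x) (at x within ?S)" "\<forall>v. continuous_on ?S (\<lambda>x. g' x v)"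
    by (simp only: C_k.simps) blast
  have o: "open {x. ?P x \<in> ?S}" by (rule chart_open_extension[OF c A])
  have lr: "local_rep M c c' f = (\<lambda>x. ?g (?P x))" by (simp add: local_rep_def fun_eq_iff)
  have "(local_rep M c c' f has_derivative (\<lambda>v. g' (?P x) (?P v))) (at x)" if x: "?P x \<in> ?S" for x
  proof -
    have "(?g has_derivative g' (?P x)) (at (?P x) within ?S)" using g'(1) x by blast
    then have "(?g has_derivative g' (?P x)) (at (?P x) within ?P ` {x. ?P x \<in> ?S})"
      by (rule has_derivative_subset) auto
    from has_derivative_in_compose[OF has_derivative_orth_proj[OF V] this]
    have "((\<lambda>x. ?g (?P x)) has_derivative (\<lambda>v. g' (?P x) (?P v))) (at x within {x. ?P x \<in> ?S})" .
    moreover have "at x within {x. ?P x \<in> ?S} = at x" by (rule at_within_open[OF _ o]) (simp add: x)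
    ultimately show ?thesis unfolding lr by simp
  qed
  moreover have "continuous_on {x. ?P x \<in> ?S} (\<lambda>x. g' (?P x) (?P v))" for v
    by (rule continuous_on_compose2[where g="\<lambda>x. g' x (?P v)" and t="?S"])
      (use g'(2) linear_continuous_on[OF bounded_linear_orth_proj[OF V]] in auto)
  ultimately have "C1_on {x. ?P x \<in> ?S} (local_rep M c c' f) (\<lambda>x v. g' (?P x) (?P v))"
    using o by (simp add: C1_on_def)
  then show ?thesis by (intro exI[of _ "\<lambda>x v. g' (?P x) (?P v)"]) (simp add: orth_proj_idem[OF V])
qed

lemma smooth_map_C1:
  assumes cM: "chart_of M c" and cN: "chart_of N c'" and f: "smooth_map M N f"
    and c: "c \<in> atlas M" and c': "c' \<in> atlas N"
  defines "A \<equiv> {q \<in> fst c. f q \<in> fst c'}"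
  shows "openin (mtop M) A"
    and "\<exists>F'. C1_on {x. orth_proj (model M) x \<in> snd c ` A} (local_rep M c c' f) F' \<and>
      (\<forall>x. F' (orth_proj (model M) x) = F' x) \<and>
      (\<forall>p\<in>A. has_differential M c c' f p (F' (snd c p)))"
proof -
  have "openin (mtop M) {q \<in> topspace (mtop M). f q \<in> fst c'}"
    by (rule openin_continuous_map_preimage[of _ "mtop N"]) (use f cN in \<open>auto simp: smooth_map_def chart_of_def\<close>)
  then have "openin (mtop M) (fst c \<inter> {q \<in> topspace (mtop M). f q \<in> fst c'})"
    using cM by (auto simp: chart_of_def)
  moreover have "fst c \<inter> {q \<in> topspace (mtop M). f q \<in> fst c'} = A" using chart_subset[OF cM] by (auto simp: A_def)
  ultimately show A: "openin (mtop M) A" by simp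
  have "C_infinity (snd c ` (fst c \<inter> f -` fst c')) (snd c' \<circ> f \<circ> inv_into (fst c) (snd c))"
    using f c c' unfolding smooth_map_def by (auto split: prod.splits)
  moreover have "fst c \<inter> f -` fst c' = A" by (auto simp: A_def)
  ultimately have "C_infinity (snd c ` A) (snd c' \<circ> f \<circ> inv_into (fst c) (snd c))" by simp
  from C1_local_rep[OF cM A _ this] obtain F' where F': "C1_on {x. orth_proj (model M) x \<in> snd c ` A} (local_rep M c c' f) F'"
    "\<forall>x. F' (orth_proj (model M) x) = F' x" by (auto simp: A_def)
  have "has_differential M c c' f p (F' (snd c p))" if p: "p \<in> A" for p
  proof -
    have pc: "p \<in> fst c" "f p \<in> fst c'" using p by (auto simp: A_def)
    have "(local_rep M c c' f has_derivative F' (snd c p)) (at (snd c p))"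
      using F'(1) p pc by (auto simp: C1_on_def chart_proj[OF cM])
    moreover have "\<forall>\<^sub>F x in nhds (snd c p). orth_proj (model M) x \<in> snd c ` fst c \<and>
        f (inv_into (fst c) (snd c) (orth_proj (model M) x)) \<in> fst c'"
      using chart_eventually[OF cM pc(1) A p] by eventually_elim (auto simp: A_def)
    ultimately show ?thesis using pc by (simp add: has_differential_def)
  qed
  then show "\<exists>F'. C1_on {x. orth_proj (model M) x \<in> snd c ` A} (local_rep M c c' f) F' \<and>
      (\<forall>x. F' (orth_proj (model M) x) = F' x) \<and>
      (\<forall>p\<in>A. has_differential M c c' f p (F' (snd c p)))"
    using F' by (intro exI[of _ F']) simp
qed

lemma C1_on_blinfun:
  assumes "C1_on S F F'"
  shows "\<exists>B. (\<forall>x\<in>S. (F has_derivative blinfun_apply (B x)) (at x)) \<and> continuous_on S B \<and> (\<forall>x\<in>S. blinfun_apply (B x) = F' x)"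
proof -
  have bl: "bounded_linear (F' x)" if "x \<in> S" for x
    using assms that by (auto simp: C1_on_def intro: has_derivative_bounded_linear)
  then have eq: "blinfun_apply (Blinfun (F' x)) = F' x" if "x \<in> S" for x
    using that by (simp add: bounded_linear_Blinfun_apply)
  have "continuous_on S (\<lambda>x. Blinfun (F' x))"
  proof (rule continuous_on_blinfun_componentwise)
    fix i :: 'a
    show "continuous_on S (\<lambda>x. blinfun_apply (Blinfun (F' x)) i)"
      using assms by (subst continuous_on_cong[OF refl, of _ _ "\<lambda>x. F' x i"]) (auto simp: eq C1_on_def)
  qed
  then show ?thesis using assms eq by (intro exI[of _ "\<lambda>x. Blinfun (F' x)"]) (auto simp: C1_on_def)
qed

text \<open>The inverse function theorem at a point where the derivative is the identity. The
  applications arrange this by composing with linear one-sided inverses and adding a projection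
  term.\<close>

lemma C1_local_inverse:
  assumes C1: "C1_on S \<psi> \<psi>'" and y0: "y0 \<in> S" and id: "\<And>v. \<psi>' y0 v = v"
  shows "\<exists>U W g g'. open U \<and> U \<subseteq> S \<and> y0 \<in> U \<and> open W \<and> \<psi> y0 \<in> W \<and> homeomorphism U W \<psi> g \<and>
    (\<forall>y\<in>W. (g has_derivative g' y) (at y)) \<and> (\<forall>y\<in>W. \<forall>v. \<psi>' (g y) (g' y v) = v) \<and>
    (\<forall>y\<in>W. surj (\<psi>' (g y)))"
proof -
  obtain B where B: "\<forall>y\<in>S. (\<psi> has_derivative blinfun_apply (B y)) (at y)" "continuous_on S B"
    "\<forall>y\<in>S. blinfun_apply (B y) = \<psi>' y"
    using C1_on_blinfun[OF C1] by (elim exE conjE) (rule that)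
  show ?thesis
  proof (rule inverse_function_theorem[of S \<psi> B y0 id_blinfun])
    show "open S" using C1 by (simp add: C1_on_def)
    show "(\<psi> has_derivative blinfun_apply (B x)) (at x)" if "x \<in> S" for x using B(1) that by simp
    show "continuous_on S B" "y0 \<in> S" by fact+
    show "id_blinfun o\<^sub>L B y0 = id_blinfun" by (rule blinfun_eqI) (use B(3) y0 id in simp)
    fix U W g g'
    assume g: "open U" "U \<subseteq> S" "y0 \<in> U" "open W" "\<psi> y0 \<in> W" "homeomorphism U W \<psi> g"
      "\<And>y. y \<in> W \<Longrightarrow> (g has_derivative g' y) (at y)"
      "\<And>y. y \<in> W \<Longrightarrow> g' y = inv_into UNIV (blinfun_apply (B (g y)))"
      "\<And>y. y \<in> W \<Longrightarrow> bij (blinfun_apply (B (g y)))"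
    have "g y \<in> S" if "y \<in> W" for y using g(2,6) that by (auto simp: homeomorphism_def)
    then have *: "\<psi>' (g y) = blinfun_apply (B (g y))" if "y \<in> W" for y using B(3) that by simp
    have "\<psi>' (g y) (g' y v) = v" if "y \<in> W" for y v
      unfolding *[OF that] g(8)[OF that] by (rule surj_f_inv_f[OF bij_is_surj[OF g(9)[OF that]]])
    moreover have "surj (\<psi>' (g y))" if "y \<in> W" for y unfolding *[OF that] by (rule bij_is_surj[OF g(9)[OF that]])
    ultimately show ?thesis using g(1-7) by (intro exI[of _ U] exI[of _ W] exI[of _ g] exI[of _ g'] conjI ballI allI) auto
  qed
qed

text \<open>Near the point the submersion \<pi> has a differentiable local section \<open>s\<close>,
  and there \<open>f\<close> is the composition of \<open>f \<circ> \<pi>\<close> with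
  \<open>s\<close>. The section comes from inverting \<psi>.\<close>

lemma has_differential_descend:
  assumes c: "chart_of M c" and cn: "chart_of N cn"
    and C1: "C1_on S (local_rep M c cn \<pi>) F'" and p: "snd c p \<in> S"
    and \<pi>: "has_differential M c cn \<pi> p (F' (snd c p))" and onto: "F' (snd c p) ` model M = model N"
    and f: "has_differential M c c' (\<lambda>x. f (\<pi> x)) p D"
  shows "\<exists>E. has_differential N cn c' f (\<pi> p) E"
proof -
  let ?F = "local_rep M c cn \<pi>" and ?P = "orth_proj (model N)" and ?R = "orth_proj (model M)"
  note V = chart_subspace[OF cn] and VM = chart_subspace[OF c]
  define x0 where "x0 = snd c p"
  define y0 where "y0 = snd cn (\<pi> p)"
  have pU: "p \<in> fst c" "\<pi> p \<in> fst cn" "f (\<pi> p) \<in> fst c'"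
    and ev\<pi>: "\<forall>\<^sub>F x in nhds x0. ?R x \<in> snd c ` fst c \<and> \<pi> (inv_into (fst c) (snd c) (?R x)) \<in> fst cn"
    and evf: "\<forall>\<^sub>F x in nhds x0. ?R x \<in> snd c ` fst c \<and> f (\<pi> (inv_into (fst c) (snd c) (?R x))) \<in> fst c'"
    and D: "(local_rep M c c' (\<lambda>x. f (\<pi> x)) has_derivative D) (at x0)"
    using \<pi> f by (auto simp: has_differential_def x0_def)
  have Py0: "?P y0 = y0" unfolding y0_def by (rule chart_proj[OF cn pU(2)])
  have Fx0: "?F x0 = y0" unfolding x0_def y0_def by (rule local_rep_at[OF c pU(1)])
  have linL: "linear (F' x0)" unfolding x0_def by (rule has_differential_proj(2)[OF c \<pi>])
  obtain g0 where g0: "linear g0" "\<forall>v\<in>F' x0 ` UNIV. F' x0 (g0 v) = v"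
    using linear_exists_right_inverse_on[OF linL subspace_UNIV] by (elim exE conjE) (rule that)
  \<comment> \<open>A linear section of the differential of \<pi>, extended by zero to the
    complement of the model.\<close>
  define \<sigma> where "\<sigma> v = g0 (?P v)" for v
  have lin\<sigma>: "linear \<sigma>" unfolding \<sigma>_def using linear_compose[OF orth_proj(1)[OF V] g0(1)] by (simp add: o_def)
  have L\<sigma>: "F' x0 (\<sigma> v) = ?P v" for v
  proof -
    have "?P v \<in> F' x0 ` model M" using orth_proj_in[OF V, of v] onto unfolding x0_def by simp
    then obtain w where "?P v = F' x0 w" by (rule imageE)
    then show ?thesis using g0(2) by (simp add: \<sigma>_def)
  qed
  \<comment> \<open>Composing \<pi> with an affine section of its differential gives the identity as
    derivative on the model; the summand \<open>y - ?P y\<close> makes this hold in all directions,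
    so that \<psi> is locally invertible.\<close>
  define \<psi> where "\<psi> y = ?F (x0 + \<sigma> (y - y0)) + (y - ?P y)" for y
  define S1 where "S1 = {y. x0 + \<sigma> (y - y0) \<in> S}"
  have bl\<sigma>: "bounded_linear \<sigma>" using lin\<sigma> by (simp add: linear_conv_bounded_linear)
  have cont\<sigma>: "continuous_on A (\<lambda>y. x0 + \<sigma> (y - y0))" for A
    by (intro continuous_intros linear_continuous_on_compose[OF _ lin\<sigma>])
  have "open S1"
  proof -
    have "S1 = (\<lambda>y. x0 + \<sigma> (y - y0)) -` S" by (auto simp: S1_def)
    then show ?thesis using C1 cont\<sigma>[of UNIV] by (auto simp: C1_on_def intro: open_vimage)
  qed
  have C1\<psi>: "C1_on S1 \<psi> (\<lambda>y v. F' (x0 + \<sigma> (y - y0)) (\<sigma> v) + (v - ?P v))"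
    unfolding C1_on_def
  proof (intro conjI ballI allI)
    show "open S1" by fact
    fix y assume y: "y \<in> S1"
    have "((\<lambda>y. y - y0) has_derivative (\<lambda>v. v)) (at y)" by (auto intro!: derivative_eq_intros)
    from has_derivative_add[OF has_derivative_const[of x0] bounded_linear.has_derivative[OF bl\<sigma> this]]
    have "((\<lambda>y. x0 + \<sigma> (y - y0)) has_derivative \<sigma>) (at y)" by simp
    from has_derivative_compose[OF this, of ?F "F' (x0 + \<sigma> (y - y0))"] y C1
    have 1: "((\<lambda>y. ?F (x0 + \<sigma> (y - y0))) has_derivative (\<lambda>v. F' (x0 + \<sigma> (y - y0)) (\<sigma> v))) (at y)"
      by (simp add: C1_on_def S1_def)
    show "(\<psi> has_derivative (\<lambda>v. F' (x0 + \<sigma> (y - y0)) (\<sigma> v) + (v - ?P v))) (at y)"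
      unfolding \<psi>_def by (intro has_derivative_add[OF 1] has_derivative_diff has_derivative_ident has_derivative_orth_proj[OF V])
  next
    fix v
    have "continuous_on S1 (\<lambda>y. F' (x0 + \<sigma> (y - y0)) (\<sigma> v))"
      by (rule continuous_on_compose2[where g="\<lambda>x. F' x (\<sigma> v)" and t=S])
        (use C1 cont\<sigma> in \<open>auto simp: C1_on_def S1_def\<close>)
    then show "continuous_on S1 (\<lambda>y. F' (x0 + \<sigma> (y - y0)) (\<sigma> v) + (v - ?P v))" by (intro continuous_intros)
  qed
  have \<sigma>0: "\<sigma> 0 = 0" by (rule linear_0[OF lin\<sigma>])
  have y0S: "y0 \<in> S1" using p by (simp add: S1_def \<sigma>0 x0_def)
  obtain U' W g g' where g: "U' \<subseteq> S1" "y0 \<in> U'" "open W" "\<psi> y0 \<in> W" "homeomorphism U' W \<psi> g"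
    "\<forall>y\<in>W. (g has_derivative (g' y)) (at y)"
    using C1_local_inverse[OF C1\<psi> y0S] by (simp add: \<sigma>0 L\<sigma>) (elim exE conjE, rule that)
  have \<psi>y0: "\<psi> y0 = y0" by (simp add: \<psi>_def \<sigma>0 Fx0 Py0)
  have gy0: "g y0 = y0" using homeomorphism_apply1[OF g(5) g(2)] \<psi>y0 by simp
  define s where "s y = x0 + \<sigma> (g y - y0)" for y
  have s0: "s y0 = x0" by (simp add: s_def gy0 \<sigma>0)
  have ds: "(s has_derivative (\<lambda>v. \<sigma> (g' y0 v))) (at y0)"
  proof -
    have "((\<lambda>y. g y - y0) has_derivative g' y0) (at y0)"
      using g(4,6) \<psi>y0 by (auto intro!: derivative_eq_intros)
    from has_derivative_add[OF has_derivative_const[of x0] bounded_linear.has_derivative[OF bl\<sigma> this]]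
    show ?thesis by (simp add: s_def[abs_def])
  qed
  have "isCont s y0" using has_derivative_continuous[OF ds] by simp
  then have lim: "filterlim s (nhds x0) (nhds y0)"
    unfolding isCont_def tendsto_at_iff_tendsto_nhds by (simp add: s0)
  have evW: "\<forall>\<^sub>F y in nhds y0. y \<in> W" by (rule eventually_nhds_in_open) (use g \<psi>y0 in auto)
  \<comment> \<open>Since \<open>y = \<psi> (g y)\<close>, the difference of \<open>y\<close> and
    \<open>?F (s y)\<close> is orthogonal to the model, while \<open>?F (s y)\<close> lies in
    it.\<close>
  have Fs: "?F (s y) = ?P y" if y: "y \<in> W" and q: "\<pi> (inv_into (fst c) (snd c) (?R (s y))) \<in> fst cn" for y
  proof -
    have "y = \<psi> (g y)" using homeomorphism_apply2[OF g(5) y] by simp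
    then have "y - ?F (s y) = g y - ?P (g y)" by (simp add: \<psi>_def s_def algebra_simps)
    moreover have "?F (s y) \<in> model N" unfolding local_rep_def by (rule chart_in_model[OF cn q])
    ultimately show ?thesis using orth_proj_unique[OF V, of "?F (s y)" y] orth_proj_diff_comp[OF V, of "g y"] by simp
  qed
  from evW filterlim_iff[THEN iffD1, OF lim, rule_format, OF ev\<pi>] filterlim_iff[THEN iffD1, OF lim, rule_format, OF evf]
  have ev: "\<forall>\<^sub>F y in nhds y0. ?P y \<in> snd cn ` fst cn \<and>
      f (inv_into (fst cn) (snd cn) (?P y)) \<in> fst c' \<and>
      local_rep M c c' (\<lambda>x. f (\<pi> x)) (s y) = local_rep N cn c' f y"
  proof eventually_elim
    case (elim y)
    define q where "q = inv_into (fst c) (snd c) (?R (s y))"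
    have q: "\<pi> q \<in> fst cn" "f (\<pi> q) \<in> fst c'" using elim by (auto simp: q_def)
    have Py: "?P y = snd cn (\<pi> q)" using Fs[of y] elim by (simp add: local_rep_def q_def)
    then have "inv_into (fst cn) (snd cn) (?P y) = \<pi> q" by (simp add: chart_inv[OF cn q(1)])
    then show ?case using Py q by (simp add: local_rep_def q_def)
  qed
  have "((\<lambda>y. local_rep M c c' (\<lambda>x. f (\<pi> x)) (s y)) has_derivative (\<lambda>v. D (\<sigma> (g' y0 v)))) (at y0)"
    using has_derivative_compose[OF ds, of "local_rep M c c' (\<lambda>x. f (\<pi> x))" D] D by (simp add: s0)
  then have "(local_rep N cn c' f has_derivative (\<lambda>v. D (\<sigma> (g' y0 v)))) (at y0)"
    by (rule has_derivative_cong_nhds) (use ev in \<open>auto elim: eventually_mono\<close>)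
  moreover have "\<forall>\<^sub>F y in nhds y0. ?P y \<in> snd cn ` fst cn \<and> f (inv_into (fst cn) (snd cn) (?P y)) \<in> fst c'"
    using ev by eventually_elim simp
  ultimately have "has_differential N cn c' f (\<pi> p) (\<lambda>v. D (\<sigma> (g' y0 v)))"
    using pU by (simp add: has_differential_def y0_def)
  then show ?thesis by (intro exI[of _ "\<lambda>v. D (\<sigma> (g' y0 v))"])
qed

section \<open>Product charts and translations\<close>

lemma chart_of_prod:
  assumes c: "chart_of M c" and d: "chart_of N d"
  shows "chart_of (prod_manifold M N) (fst c \<times> fst d, map_prod (snd c) (snd d))"
proof -
  have img: "map_prod (snd c) (snd d) ` (fst c \<times> fst d) = snd c ` fst c \<times> snd d ` fst d"
    by (auto simp: map_prod_def)
  have top: "top_of_set (A \<times> B) = prod_topology (top_of_set A) (top_of_set B)" for A :: "'x::topological_space set" and B :: "'y::topological_space set"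
    by (simp add: subtopology_Times euclidean_product_topology)
  obtain c1 where c1: "homeomorphic_maps (subtopology (mtop M) (fst c)) (top_of_set (snd c ` fst c)) (snd c) c1"
    using c by (auto simp: chart_of_def homeomorphic_map_maps)
  obtain d1 where d1: "homeomorphic_maps (subtopology (mtop N) (fst d)) (top_of_set (snd d ` fst d)) (snd d) d1"
    using d by (auto simp: chart_of_def homeomorphic_map_maps)
  have "homeomorphic_maps (prod_topology (subtopology (mtop M) (fst c)) (subtopology (mtop N) (fst d)))
     (prod_topology (top_of_set (snd c ` fst c)) (top_of_set (snd d ` fst d)))
     (\<lambda>(x, y). (snd c x, snd d y)) (\<lambda>(x, y). (c1 x, d1 y))"
    unfolding homeomorphic_maps_def
  proof (intro conjI ballI)
    show "continuous_map (prod_topology (subtopology (mtop M) (fst c)) (subtopology (mtop N) (fst d)))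
       (prod_topology (top_of_set (snd c ` fst c)) (top_of_set (snd d ` fst d))) (\<lambda>(x, y). (snd c x, snd d y))"
      by (rule continuous_map_prod_top[THEN iffD2]) (use c1 d1 in \<open>simp add: homeomorphic_maps_def\<close>)
    show "continuous_map (prod_topology (top_of_set (snd c ` fst c)) (top_of_set (snd d ` fst d)))
       (prod_topology (subtopology (mtop M) (fst c)) (subtopology (mtop N) (fst d))) (\<lambda>(x, y). (c1 x, d1 y))"
      by (rule continuous_map_prod_top[THEN iffD2]) (use c1 d1 in \<open>simp add: homeomorphic_maps_def\<close>)
  qed (use c1 d1 in \<open>auto simp: homeomorphic_maps_def\<close>)
  then have "homeomorphic_map (subtopology (prod_topology (mtop M) (mtop N)) (fst c \<times> fst d))
      (top_of_set (snd c ` fst c \<times> snd d ` fst d)) (map_prod (snd c) (snd d))"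
    unfolding top subtopology_Times by (auto simp: homeomorphic_map_maps map_prod_def)
  moreover have "openin (top_of_set (model M \<times> model N)) (snd c ` fst c \<times> snd d ` fst d)"
    unfolding top by (rule openin_prod_Times_iff[THEN iffD2]) (use c d in \<open>simp add: chart_of_def\<close>)
  moreover have "subspace (model M \<times> model N)"
    using c d by (intro subspace_Times) (auto simp: chart_of_def)
  moreover have "openin (prod_topology (mtop M) (mtop N)) (fst c \<times> fst d)"
    using c d by (simp add: openin_prod_Times_iff chart_of_def)
  ultimately show ?thesis unfolding chart_of_def prod_manifold_def by (simp add: img)
qed

lemma orth_proj_Times:
  assumes V: "subspace V" and W: "subspace W"
  shows "orth_proj (V \<times> W) (x, y) = (orth_proj V x, orth_proj W y)"
proof (rule orth_proj_unique[OF subspace_Times[OF V W]])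
  show "(orth_proj V x, orth_proj W y) \<in> V \<times> W" by (simp add: orth_proj_in V W)
  show "(x, y) - (orth_proj V x, orth_proj W y) \<in> (V \<times> W)\<^sup>\<bottom>"
    using orth_proj_diff_comp[OF V, of x] orth_proj_diff_comp[OF W, of y]
    by (auto simp: orthogonal_comp_def orthogonal_def)
qed

text \<open>Left translation by \<open>h\<close> is a slice of the smooth multiplication. Keeping
  the derivative \<open>F'\<close> in both variables records that the differential varies
  continuously with \<open>h\<close>, which \<open>stab_action_locally_bounded\<close> relies
  on.\<close>

lemma left_translation:
  assumes G: "lie_group G M" and ch: "ch \<in> atlas M" and cx: "cx \<in> atlas M" and c': "c' \<in> atlas M"
  shows "\<exists>S F F'. C1_on S F F' \<and>
    (\<forall>h y. h \<in> fst ch \<and> y \<in> fst cx \<and> h \<otimes>\<^bsub>G\<^esub> y \<in> fst c' \<longrightarrow> (snd ch h, snd cx y) \<in> S \<and>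
      has_differential M cx c' (\<lambda>y. h \<otimes>\<^bsub>G\<^esub> y) y (\<lambda>v. F' (snd ch h, snd cx y) (0, v)))"
proof -
  have M: "smooth_manifold M" and mult: "smooth_map (prod_manifold M M) M (\<lambda>(x, y). x \<otimes>\<^bsub>G\<^esub> y)"
    using G by (auto simp: lie_group_def)
  note Ch = atlas_chart[OF M ch] and Cx = atlas_chart[OF M cx] and C' = atlas_chart[OF M c']
  let ?c = "(fst ch \<times> fst cx, map_prod (snd ch) (snd cx))" and ?f = "\<lambda>(x, y). x \<otimes>\<^bsub>G\<^esub> y"
  let ?MM = "prod_manifold M M" and ?P = "orth_proj (model M)"
  note C = chart_of_prod[OF Ch Cx] and V = chart_subspace[OF Ch]
  have atlas: "?c \<in> atlas ?MM"
  proof -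
    show ?thesis unfolding prod_manifold_def manifold.select_convs mem_Collect_eq
      by (rule exI[of _ "fst ch"], rule exI[of _ "snd ch"], rule exI[of _ "fst cx"], rule exI[of _ "snd cx"])
        (use ch cx in simp)
  qed
  define A where "A = {q \<in> fst ?c. ?f q \<in> fst c'}"
  define S where "S = {x. orth_proj (model ?MM) x \<in> snd ?c ` A}"
  let ?F = "local_rep ?MM ?c c' ?f"
  have oA: "openin (mtop ?MM) A" and "\<exists>F'. C1_on S ?F F' \<and> (\<forall>x. F' (orth_proj (model ?MM) x) = F' x) \<and>
      (\<forall>p\<in>A. has_differential ?MM ?c c' ?f p (F' (snd ?c p)))"
    unfolding A_def S_def by (rule smooth_map_C1[OF C C' mult atlas c'])+
  then obtain F' where F': "C1_on S ?F F'" by (elim exE conjE) (rule that)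
  have proj: "orth_proj (model ?MM) (a, b) = (?P a, ?P b)" for a b
    by (simp add: prod_manifold_def orth_proj_Times[OF V V])
  have "(snd ch h, snd cx y) \<in> S \<and>
      has_differential M cx c' (\<lambda>y. h \<otimes>\<^bsub>G\<^esub> y) y (\<lambda>v. F' (snd ch h, snd cx y) (0, v))"
    if hy: "h \<in> fst ch" "y \<in> fst cx" "h \<otimes>\<^bsub>G\<^esub> y \<in> fst c'" for h y
  proof
    have hyA: "(h, y) \<in> A" using hy by (simp add: A_def)
    then show inS: "(snd ch h, snd cx y) \<in> S"
      by (force simp: S_def proj chart_proj[OF Ch hy(1)] chart_proj[OF Cx hy(2)])
    have "((\<lambda>b. (snd ch h, b)) has_derivative (\<lambda>v. (0, v))) (at (snd cx y))"
      by (auto intro!: derivative_eq_intros)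
    from has_derivative_compose[OF this, of ?F "F' (snd ch h, snd cx y)"] F' inS
    have d: "((\<lambda>b. ?F (snd ch h, b)) has_derivative (\<lambda>v. F' (snd ch h, snd cx y) (0, v))) (at (snd cx y))"
      by (simp add: C1_on_def)
    have ev: "\<forall>\<^sub>F b in nhds (snd cx y). ?P b \<in> snd cx ` fst cx \<and> h \<otimes>\<^bsub>G\<^esub> inv_into (fst cx) (snd cx) (?P b) \<in> fst c'
       \<and> ?F (snd ch h, b) = local_rep M cx c' (\<lambda>y. h \<otimes>\<^bsub>G\<^esub> y) b"
    proof -
      have "open ((\<lambda>b. (snd ch h, b)) -` S)"
        using F' by (intro open_vimage) (auto simp: C1_on_def intro!: continuous_intros)
      then have "\<forall>\<^sub>F b in nhds (snd cx y). b \<in> (\<lambda>b. (snd ch h, b)) -` S"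
        by (rule eventually_nhds_in_open) (use inS in simp)
      then show ?thesis
      proof eventually_elim
        case (elim b)
        then obtain h' z where hz: "(h', z) \<in> A" "snd ch h' = snd ch h" "snd cx z = ?P b"
          by (auto simp: S_def proj chart_proj[OF Ch hy(1)])
        then have z: "h' \<in> fst ch" "z \<in> fst cx" "h' \<otimes>\<^bsub>G\<^esub> z \<in> fst c'" by (auto simp: A_def)
        have h': "h' = h" using inj_onD[OF chart_inj[OF Ch] hz(2) z(1) hy(1)] .
        have i1: "inv_into (fst cx) (snd cx) (?P b) = z" using chart_inv[OF Cx z(2)] hz(3) by simp
        have "inv_into (fst ?c) (snd ?c) (snd ?c (h, z)) = (h, z)"
          by (rule chart_inv[OF C]) (use hy z in simp)
        then have i2: "inv_into (fst ?c) (snd ?c) (orth_proj (model ?MM) (snd ch h, b)) = (h, z)"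
          by (simp add: proj chart_proj[OF Ch hy(1)] hz(3)[symmetric])
        have "?P b \<in> snd cx ` fst cx" using hz(3) z(2) by force
        then show ?case using z i1 i2 by (simp add: local_rep_def h')
      qed
    qed
    have "(local_rep M cx c' (\<lambda>y. h \<otimes>\<^bsub>G\<^esub> y) has_derivative (\<lambda>v. F' (snd ch h, snd cx y) (0, v))) (at (snd cx y))"
      by (rule has_derivative_cong_nhds[OF d]) (use ev in \<open>auto elim: eventually_mono\<close>)
    then show "has_differential M cx c' (\<lambda>y. h \<otimes>\<^bsub>G\<^esub> y) y (\<lambda>v. F' (snd ch h, snd cx y) (0, v))"
      using ev hy by (auto simp: has_differential_def elim: eventually_mono)
  qed
  then show ?thesis using F' by (intro exI[of _ S] exI[of _ ?F] exI[of _ F'] conjI allI impI) auto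
qed

section \<open>Homogeneous spaces\<close>

locale homogeneous =
  fixes X :: "('g, 'e::euclidean_space, 'n::{finite,linorder}) hspace"
  assumes homogeneous: "homogeneous_space X"
begin

abbreviation "G \<equiv> grp X"
abbreviation "H \<equiv> stab X"
abbreviation "MG \<equiv> grp_manifold X"
abbreviation "MX \<equiv> quot_manifold X"
abbreviation "proj g \<equiv> g <#\<^bsub>grp X\<^esub> stab X"

lemma lie: "lie_group G MG" and group: "group G" and MG: "smooth_manifold MG" and MX: "smooth_manifold MX"
  and topG: "topspace (mtop MG) = carrier G" and topX: "topspace (mtop MX) = points X"
  and sub: "subgroup H G" and subm: "submersion MG MX proj" and base: "base_chart X \<in> atlas MX" "H \<in> fst (base_chart X)"
  and compact: "compact_space (mtop MG)" and closed: "closedin (mtop MG) H"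
  using homogeneous by (auto simp: homogeneous_space_def lie_group_def)

lemma H_subset: "H \<subseteq> carrier G" using subgroup.subset[OF sub] .

lemma points_eq: "points X = proj ` carrier G"
  by (auto simp: LCOSETS_def)

lemma proj_stab: "h \<in> H \<Longrightarrow> proj h = H"
proof
  assume h: "h \<in> H"
  interpret group G by (rule group)
  have hG: "h \<in> carrier G" using h H_subset by auto
  show "proj h \<subseteq> H" using h subgroup.m_closed[OF sub] by (auto simp: l_coset_def)
  show "H \<subseteq> proj h"
  proof
    fix k assume k: "k \<in> H"
    then have "k = h \<otimes>\<^bsub>G\<^esub> (inv\<^bsub>G\<^esub> h \<otimes>\<^bsub>G\<^esub> k)" using hG H_subset
      by (subst m_assoc[symmetric]) auto
    moreover have "inv\<^bsub>G\<^esub> h \<otimes>\<^bsub>G\<^esub> k \<in> H" using h k sub by (simp add: subgroup.m_closed subgroup.m_inv_closed)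
    ultimately show "k \<in> proj h" unfolding l_coset_def by auto
  qed
qed

lemma proj_one: "proj \<one>\<^bsub>G\<^esub> = H"
  by (rule proj_stab[OF subgroup.one_closed[OF sub]])

lemma stab_in_points: "H \<in> points X"
  using proj_one group.is_monoid[OF group] monoid.one_closed by (force simp: points_eq)

lemma act_proj: "g \<in> carrier G \<Longrightarrow> x \<in> carrier G \<Longrightarrow> act X g (proj x) = proj (g \<otimes>\<^bsub>G\<^esub> x)"
  unfolding act_def by (rule group.lcos_m_assoc[OF group H_subset])

lemma act_mult:
  "g \<in> carrier G \<Longrightarrow> h \<in> carrier G \<Longrightarrow> q \<in> points X \<Longrightarrow> act X g (act X h q) = act X (g \<otimes>\<^bsub>G\<^esub> h) q"
  using group.is_monoid[OF group] by (auto simp: points_eq act_proj monoid.m_closed monoid.m_assoc)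

lemma act_one: "q \<in> points X \<Longrightarrow> act X \<one>\<^bsub>G\<^esub> q = q"
  using group.is_monoid[OF group] by (auto simp: points_eq act_proj monoid.l_one)

lemma act_stab: "h \<in> H \<Longrightarrow> act X h H = H"
  by (simp add: act_def proj_stab)

lemma inv_closed: "g \<in> carrier G \<Longrightarrow> inv\<^bsub>G\<^esub> g \<in> carrier G"
  by (rule group.inv_closed[OF group])

lemma chart_X: "c \<in> atlas MX \<Longrightarrow> chart_of MX c" and chart_G: "d \<in> atlas MG \<Longrightarrow> chart_of MG d"
  by (rule atlas_chart[OF MX], assumption) (rule atlas_chart[OF MG], assumption)

lemma chart_X_subset: "c \<in> atlas MX \<Longrightarrow> q \<in> fst c \<Longrightarrow> q \<in> points X"
  using chart_subset[OF chart_X] topX by blast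

lemma chart_G_subset: "c \<in> atlas MG \<Longrightarrow> g \<in> fst c \<Longrightarrow> g \<in> carrier G"
  using chart_subset[OF chart_G] topG by blast

lemma proj_differential:
  assumes c: "c \<in> atlas MG" and c': "c' \<in> atlas MX"
  shows "\<exists>S F'. C1_on S (local_rep MG c c' proj) F' \<and>
    (\<forall>x\<in>fst c. proj x \<in> fst c' \<longrightarrow> snd c x \<in> S \<and> has_differential MG c c' proj x (F' (snd c x)) \<and>
      F' (snd c x) ` model MG = model MX)"
proof -
  have sm: "smooth_map MG MX proj" using subm by (simp add: submersion_def)
  let ?A = "{q \<in> fst c. proj q \<in> fst c'}"
  let ?S = "{x. orth_proj (model MG) x \<in> snd c ` ?A}"
  obtain F' where F': "C1_on ?S (local_rep MG c c' proj) F'" "\<forall>p\<in>?A. has_differential MG c c' proj p (F' (snd c p))"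
    using smooth_map_C1(2)[OF chart_G[OF c] chart_X[OF c'] sm c c'] by (elim exE conjE) (rule that)
  have "snd c x \<in> ?S \<and> has_differential MG c c' proj x (F' (snd c x)) \<and> F' (snd c x) ` model MG = model MX"
    if x: "x \<in> fst c" "proj x \<in> fst c'" for x
  proof (intro conjI)
    show "snd c x \<in> ?S" using x by (simp add: chart_proj[OF chart_G[OF c]])
    show d: "has_differential MG c c' proj x (F' (snd c x))" using F'(2) x by blast
    have "differential MG c c' proj x ` model MG = model MX"
      using subm x c c' chart_G_subset[OF c x(1)] by (simp add: submersion_def topG)
    then show "F' (snd c x) ` model MG = model MX" by (simp add: differential_eqI[OF chart_G[OF c] d])
  qed
  then show ?thesis using F'(1) by (intro exI[of _ ?S] exI[of _ F'] conjI ballI impI) auto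
qed

text \<open>The projection intertwines the action of \<open>g\<close> with left translation. So the
  action composed with the projection is differentiable, and differentiability descends along the
  submersion.\<close>

lemma act_differential:
  assumes g: "g \<in> carrier G" and c: "c \<in> atlas MX" and c': "c' \<in> atlas MX"
    and q: "q \<in> fst c" "act X g q \<in> fst c'"
  shows "\<exists>E. has_differential MX c c' (act X g) q E"
proof -
  obtain x where x: "x \<in> carrier G" "q = proj x" using chart_X_subset[OF c q(1)] by (auto simp: points_eq)
  have gx: "g \<otimes>\<^bsub>G\<^esub> x \<in> carrier G" by (rule monoid.m_closed[OF group.is_monoid[OF group] g x(1)])
  obtain cg where cg: "cg \<in> atlas MG" "g \<in> fst cg" using atlas_cover[OF MG] g topG by blast
  obtain cx where cx: "cx \<in> atlas MG" "x \<in> fst cx" using atlas_cover[OF MG] x(1) topG by blast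
  obtain cgx where cgx: "cgx \<in> atlas MG" "g \<otimes>\<^bsub>G\<^esub> x \<in> fst cgx" using atlas_cover[OF MG] gx topG by blast
  obtain E1 where E1: "has_differential MG cx cgx (\<lambda>y. g \<otimes>\<^bsub>G\<^esub> y) x E1"
    using left_translation[OF lie cg(1) cx(1) cgx(1)] cg(2) cx(2) cgx(2) by blast
  obtain E2 where E2: "has_differential MG cgx c' proj (g \<otimes>\<^bsub>G\<^esub> x) E2"
    using proj_differential[OF cgx(1) c'] cgx(2) q(2) by (auto simp: x(2) act_proj[OF g x(1)])
  have "has_differential MG cx c' (\<lambda>y. proj (g \<otimes>\<^bsub>G\<^esub> y)) x (\<lambda>v. E2 (E1 v))"
    by (rule has_differential_compose[OF chart_G[OF cx(1)] chart_G[OF cgx(1)] E1 E2])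
  then have f: "has_differential MG cx c' (\<lambda>y. act X g (proj y)) x (\<lambda>v. E2 (E1 v))"
    by (rule has_differential_cong[OF chart_G[OF cx(1)]]) (simp add: act_proj[OF g chart_G_subset[OF cx(1)]])
  obtain S F' where S: "C1_on S (local_rep MG cx c proj) F'" "snd cx x \<in> S" "has_differential MG cx c proj x (F' (snd cx x))"
    "F' (snd cx x) ` model MG = model MX"
  proof -
    obtain S F' where S: "C1_on S (local_rep MG cx c proj) F'"
      "\<forall>x\<in>fst cx. proj x \<in> fst c \<longrightarrow> snd cx x \<in> S \<and> has_differential MG cx c proj x (F' (snd cx x)) \<and>
        F' (snd cx x) ` model MG = model MX"
      using proj_differential[OF cx(1) c] by (elim exE conjE) (rule that)
    from S(2) cx(2) q(1) x(2) have "snd cx x \<in> S" "has_differential MG cx c proj x (F' (snd cx x))"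
      "F' (snd cx x) ` model MG = model MX" by simp_all
    with S(1) show ?thesis by (rule that)
  qed
  show ?thesis unfolding x(2)
    by (rule has_differential_descend[OF chart_G[OF cx(1)] chart_X[OF c] S f])
qed

text \<open>The chain rule for \<open>g\<close> and its inverse; the differential of the identity is
  the projection onto the model, so the inverse relations hold on the model.\<close>

lemma act_differential_inverse:
  assumes g: "g \<in> carrier G" and c: "c \<in> atlas MX" and c': "c' \<in> atlas MX"
    and q: "q \<in> fst c" and E: "has_differential MX c c' (act X g) q E"
  shows "\<exists>E'. linear E' \<and> (\<forall>v\<in>model MX. E' (E v) = v) \<and> (\<forall>v\<in>model MX. E (E' v) = v) \<and> range E' \<subseteq> model MX"
proof -
  note p = chart_X_subset[OF c q]
  have q': "act X g q \<in> fst c'" using E by (simp add: has_differential_def)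
  have cancel: "act X (inv\<^bsub>G\<^esub> g) (act X g r) = r" "act X g (act X (inv\<^bsub>G\<^esub> g) r) = r" if "r \<in> points X" for r
    using that g by (simp_all add: act_mult inv_closed act_one group.l_inv[OF group] group.r_inv[OF group])
  obtain E' where E': "has_differential MX c' c (act X (inv\<^bsub>G\<^esub> g)) (act X g q) E'"
    using act_differential[OF inv_closed[OF g] c' c q'] q cancel(1)[OF p] by auto
  note V = chart_subspace[OF chart_X[OF c]]
  have "has_differential MX c c (\<lambda>r. act X (inv\<^bsub>G\<^esub> g) (act X g r)) q (\<lambda>v. E' (E v))"
    by (rule has_differential_compose[OF chart_X[OF c] chart_X[OF c'] E E'])
  then have "has_differential MX c c (\<lambda>r. r) q (\<lambda>v. E' (E v))"
    by (rule has_differential_cong[OF chart_X[OF c]]) (simp add: cancel chart_X_subset[OF c])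
  from has_differential_unique[OF chart_X[OF c] this has_differential_id[OF chart_X[OF c] q]]
  have 1: "E' (E v) = orth_proj (model MX) v" for v by (rule fun_cong)
  have E2: "has_differential MX c c' (act X g) (act X (inv\<^bsub>G\<^esub> g) (act X g q)) E" using E cancel(1)[OF p] by simp
  have "has_differential MX c' c' (\<lambda>r. act X g (act X (inv\<^bsub>G\<^esub> g) r)) (act X g q) (\<lambda>v. E (E' v))"
    by (rule has_differential_compose[OF chart_X[OF c'] chart_X[OF c] E' E2])
  then have "has_differential MX c' c' (\<lambda>r. r) (act X g q) (\<lambda>v. E (E' v))"
    by (rule has_differential_cong[OF chart_X[OF c']]) (simp add: cancel chart_X_subset[OF c'])
  from has_differential_unique[OF chart_X[OF c'] this has_differential_id[OF chart_X[OF c'] q']]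
  have 2: "E (E' v) = orth_proj (model MX) v" for v by (rule fun_cong)
  show ?thesis
    using has_differential_proj(2)[OF chart_X[OF c'] E'] has_differential_range[OF chart_X[OF c'] chart_X[OF c] E'] 1 2
    by (intro exI[of _ E']) (auto simp: orth_proj(3)[OF V])
qed

section \<open>Boundedness of the differentials of the stabilizer action\<close>

lemma base_act_differential:
  "h \<in> H \<Longrightarrow> has_differential MX (base_chart X) (base_chart X) (act X h) H (base_diff X X (act X h))"
proof -
  assume h: "h \<in> H"
  then obtain E where E: "has_differential MX (base_chart X) (base_chart X) (act X h) H E"
    using act_differential[OF _ base(1) base(1) base(2)] H_subset base(2) act_stab by (metis subsetD)
  then show ?thesis unfolding base_diff_def using differential_eqI[OF chart_X[OF base(1)] E] by simp
qed

text \<open>Along the projection, the differential of the action of \<open>h\<close> becomes that of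
  left translation followed by the projection. This is an expression \<kappa> in the coordinates of
  \<open>h\<close> which is continuous, hence bounded near \<open>h0\<close>.\<close>

lemma stab_action_locally_bounded:
  assumes h0: "h0 \<in> H" and ce: "ce \<in> atlas MG" "\<one>\<^bsub>G\<^esub> \<in> fst ce"
    and L: "has_differential MG ce (base_chart X) proj \<one>\<^bsub>G\<^esub> L"
  shows "\<exists>A C. openin (mtop MG) A \<and> h0 \<in> A \<and>
    (\<forall>h\<in>A \<inter> H. \<forall>w\<in>Basis. norm (base_diff X X (act X h) (L w)) \<le> C)"
proof -
  let ?cb = "base_chart X"
  obtain ch where ch: "ch \<in> atlas MG" "h0 \<in> fst ch" using atlas_cover[OF MG] h0 H_subset topG by blast
  obtain S F F' where F: "C1_on S F F'"
    "\<forall>h y. h \<in> fst ch \<and> y \<in> fst ce \<and> h \<otimes>\<^bsub>G\<^esub> y \<in> fst ch \<longrightarrow> (snd ch h, snd ce y) \<in> S \<and>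
      has_differential MG ce ch (\<lambda>y. h \<otimes>\<^bsub>G\<^esub> y) y (\<lambda>v. F' (snd ch h, snd ce y) (0, v))"
    using left_translation[OF lie ch(1) ce(1) ch(1)] by (elim exE conjE) (rule that)
  obtain T K' where K: "C1_on T (local_rep MG ch ?cb proj) K'"
    "\<forall>x\<in>fst ch. proj x \<in> fst ?cb \<longrightarrow> snd ch x \<in> T \<and> has_differential MG ch ?cb proj x (K' (snd ch x)) \<and>
      K' (snd ch x) ` model MG = model MX"
    using proj_differential[OF ch(1) base(1)] by (elim exE conjE) (rule that)
  define e where "e = snd ce \<one>\<^bsub>G\<^esub>"
  define S2 where "S2 = T \<inter> (\<lambda>a. (a, e)) -` S"
  define \<kappa> where "\<kappa> w a = K' a (F' (a, e) (0, w))" for w a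
  have h1: "h \<otimes>\<^bsub>G\<^esub> \<one>\<^bsub>G\<^esub> = h" if "h \<in> H" for h
    using that H_subset group.is_monoid[OF group] by (auto simp: monoid.r_one)
  have in_S2: "snd ch h \<in> S2" and diff: "base_diff X X (act X h) (L w) = \<kappa> w (snd ch h)"
    if h: "h \<in> H" "h \<in> fst ch" for h w
  proof -
    have hG: "h \<in> carrier G" using h H_subset by blast
    have 1: "(snd ch h, e) \<in> S" "has_differential MG ce ch (\<lambda>y. h \<otimes>\<^bsub>G\<^esub> y) \<one>\<^bsub>G\<^esub> (\<lambda>v. F' (snd ch h, e) (0, v))"
      using F(2)[rule_format, of h "\<one>\<^bsub>G\<^esub>"] h ce(2) by (auto simp: h1 e_def)
    have 2: "snd ch h \<in> T" "has_differential MG ch ?cb proj h (K' (snd ch h))"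
      using K(2) h base(2) by (auto simp: proj_stab)
    show "snd ch h \<in> S2" using 1 2 by (simp add: S2_def)
    have "has_differential MG ce ?cb (\<lambda>y. proj (h \<otimes>\<^bsub>G\<^esub> y)) \<one>\<^bsub>G\<^esub> (\<lambda>v. K' (snd ch h) (F' (snd ch h, e) (0, v)))"
      using 2(2) h by (intro has_differential_compose[OF chart_G[OF ce(1)] chart_G[OF ch(1)] 1(2)]) (simp add: h1)
    then have A: "has_differential MG ce ?cb (\<lambda>y. act X h (proj y)) \<one>\<^bsub>G\<^esub> (\<lambda>v. K' (snd ch h) (F' (snd ch h, e) (0, v)))"
      by (rule has_differential_cong[OF chart_G[OF ce(1)]]) (simp add: act_proj[OF hG chart_G_subset[OF ce(1)]])
    have B: "has_differential MG ce ?cb (\<lambda>y. act X h (proj y)) \<one>\<^bsub>G\<^esub> (\<lambda>v. base_diff X X (act X h) (L v))"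
      by (rule has_differential_compose[OF chart_G[OF ce(1)] chart_X[OF base(1)] L])
        (use base_act_differential[OF h(1)] in \<open>simp add: proj_one\<close>)
    show "base_diff X X (act X h) (L w) = \<kappa> w (snd ch h)"
      unfolding \<kappa>_def by (rule fun_cong[OF has_differential_unique[OF chart_G[OF ce(1)] B A]])
  qed
  have "open S2" unfolding S2_def using F(1) K(1)
    by (intro open_Int open_vimage) (auto simp: C1_on_def intro!: continuous_intros)
  have cont: "continuous_on S2 (\<kappa> w)" for w
  proof -
    \<comment> \<open>The derivative \<open>K'\<close> is known to be continuous for a fixed
      argument only, so the moving argument is first expanded in the basis.\<close>
    have "continuous_on S2 (\<lambda>a. \<Sum>b\<in>Basis. (F' (a, e) (0, w) \<bullet> b) *\<^sub>R K' a b)"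
    proof (intro continuous_intros)
      show "continuous_on S2 (\<lambda>a. F' (a, e) (0, w))"
        by (rule continuous_on_compose2[where g="\<lambda>z. F' z (0, w)" and t=S])
          (use F(1) in \<open>auto simp: C1_on_def S2_def intro!: continuous_intros\<close>)
      show "continuous_on S2 (\<lambda>a. K' a b)" for b
        using K(1) by (auto simp: C1_on_def S2_def intro: continuous_on_subset)
    qed
    moreover have "(\<Sum>b\<in>Basis. (F' (a, e) (0, w) \<bullet> b) *\<^sub>R K' a b) = \<kappa> w a" if "a \<in> S2" for a
    proof -
      have "linear (K' a)" using K(1) that
        by (auto simp: C1_on_def S2_def intro: bounded_linear.linear has_derivative_bounded_linear)
      then have "K' a (\<Sum>b\<in>Basis. (F' (a, e) (0, w) \<bullet> b) *\<^sub>R b) = (\<Sum>b\<in>Basis. (F' (a, e) (0, w) \<bullet> b) *\<^sub>R K' a b)"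
        by (simp add: linear_sum linear_cmul)
      then show ?thesis by (simp add: \<kappa>_def euclidean_representation)
    qed
    ultimately show ?thesis by (simp cong: continuous_on_cong)
  qed
  define a0 where "a0 = snd ch h0"
  define C where "C = (\<Sum>w\<in>Basis. norm (\<kappa> w a0) + 1)"
  have a0: "a0 \<in> S2" unfolding a0_def by (rule in_S2[OF h0 ch(2)])
  define W where "W = (\<Inter>w\<in>Basis. S2 \<inter> \<kappa> w -` ball 0 (norm (\<kappa> w a0) + 1))"
  have "open W" unfolding W_def
    by (intro open_INT ballI continuous_open_preimage[OF cont \<open>open S2\<close>]) auto
  have "a0 \<in> W" using a0 by (simp add: W_def)
  have "norm (base_diff X X (act X h) (L w)) \<le> C" if h: "h \<in> H" "h \<in> fst ch" "snd ch h \<in> W" and w: "w \<in> Basis" for h w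
  proof -
    have "norm (\<kappa> w (snd ch h)) \<le> norm (\<kappa> w a0) + 1" using h(3) w by (auto simp: W_def less_imp_le)
    also have "\<dots> \<le> C" unfolding C_def by (rule member_le_sum[OF w]) auto
    finally show ?thesis by (simp add: diff[OF h(1,2)])
  qed
  moreover have "openin (mtop MG) {q \<in> fst ch. snd ch q \<in> W}"
    by (rule chart_preimage_open[OF chart_G[OF ch(1)] \<open>open W\<close>])
  ultimately show ?thesis
    using ch(2) \<open>a0 \<in> W\<close> by (intro exI[of _ "{q \<in> fst ch. snd ch q \<in> W}"] exI[of _ C]) (auto simp: a0_def)
qed

text \<open>The stabilizer is compact, so finitely many local bounds suffice. They control images of
  basis vectors under \<open>L\<close>, and since \<open>L\<close> maps onto the model, every vector
  of the model is the image of some \<open>u\<close> whose norm is bounded linearly in terms of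
  it.\<close>

lemma stab_differential_bounded: "\<exists>C. \<forall>h\<in>H. \<forall>v. norm (base_diff X X (act X h) v) \<le> C * norm v"
proof -
  let ?D = "\<lambda>h. base_diff X X (act X h)"
  have one: "\<one>\<^bsub>G\<^esub> \<in> carrier G" using group.is_monoid[OF group] by (rule monoid.one_closed)
  obtain ce where ce: "ce \<in> atlas MG" "\<one>\<^bsub>G\<^esub> \<in> fst ce" using atlas_cover[OF MG] one topG by blast
  obtain L where L: "has_differential MG ce (base_chart X) proj \<one>\<^bsub>G\<^esub> L" and onto: "L ` model MG = model MX"
    using proj_differential[OF ce(1) base(1)] ce(2) base(2) by (auto simp: proj_one)
  note V = chart_subspace[OF chart_X[OF base(1)]]
  define \<U> where "\<U> = {A. openin (mtop MG) A \<and> (\<exists>C. \<forall>h\<in>A \<inter> H. \<forall>w\<in>Basis. norm (?D h (L w)) \<le> C)}"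
  have "compactin (mtop MG) H" by (rule closedin_compact_space[OF compact closed])
  moreover have "H \<subseteq> \<Union>\<U>"
  proof
    fix h0 assume "h0 \<in> H"
    from stab_action_locally_bounded[OF this ce L] show "h0 \<in> \<Union>\<U>" unfolding \<U>_def by blast
  qed
  ultimately obtain \<F> where \<F>: "finite \<F>" "\<F> \<subseteq> \<U>" "H \<subseteq> \<Union>\<F>"
    unfolding compactin_def \<U>_def by (metis (no_types, lifting) mem_Collect_eq)
  have "\<forall>A\<in>\<F>. \<exists>C. \<forall>h\<in>A \<inter> H. \<forall>w\<in>Basis. norm (?D h (L w)) \<le> C" using \<F>(2) by (auto simp: \<U>_def)
  from bchoice[OF this] obtain C where C: "\<forall>A\<in>\<F>. \<forall>h\<in>A \<inter> H. \<forall>w\<in>Basis. norm (?D h (L w)) \<le> C A" by (elim exE) (rule that)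
  define B where "B = (\<Sum>A\<in>\<F>. \<bar>C A\<bar>)"
  have "B \<ge> 0" unfolding B_def by (simp add: sum_nonneg)
  have bound: "norm (?D h (L w)) \<le> B" if h: "h \<in> H" and w: "w \<in> Basis" for h w
  proof -
    obtain A where A: "A \<in> \<F>" "h \<in> A" using \<F>(3) h by blast
    then have "norm (?D h (L w)) \<le> \<bar>C A\<bar>" using C h w by (meson IntI abs_ge_self order_trans)
    also have "\<dots> \<le> B" unfolding B_def by (rule member_le_sum[OF A(1)]) (use \<F>(1) in auto)
    finally show ?thesis .
  qed
  have linL: "linear L" by (rule has_differential_proj(2)[OF chart_G[OF ce(1)] L])
  obtain g0 where g0: "linear g0" "\<forall>v\<in>L ` UNIV. L (g0 v) = v"
    using linear_exists_right_inverse_on[OF linL subspace_UNIV] by (elim exE conjE) (rule that)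
  have "bounded_linear (\<lambda>v. g0 (orth_proj (model MX) v))"
    using linear_compose[OF orth_proj(1)[OF V] g0(1)] by (simp add: o_def linear_conv_bounded_linear)
  then obtain K where K: "K > 0" "\<And>v. norm (g0 (orth_proj (model MX) v)) \<le> norm v * K"
    using bounded_linear.pos_bounded by blast
  \<comment> \<open>One term for each basis vector, with coefficient at most
    \<open>norm v * K\<close> and image of norm at most \<open>B\<close>.\<close>
  have "norm (?D h v) \<le> (real DIM('e) * K * B) * norm v" if h: "h \<in> H" for h v
  proof -
    note E = base_act_differential[OF h]
    note linE = has_differential_proj(2)[OF chart_X[OF base(1)] E]
    define u where "u = g0 (orth_proj (model MX) v)"
    have "orth_proj (model MX) v \<in> L ` model MG" using orth_proj_in[OF V] by (simp add: onto)
    then have "orth_proj (model MX) v \<in> L ` UNIV" by blast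
    then have Lu: "L u = orth_proj (model MX) v" using g0(2) by (simp only: u_def)
    have "?D h v = ?D h (L u)" unfolding Lu by (rule has_differential_proj(1)[OF chart_X[OF base(1)] E, symmetric])
    also have "\<dots> = ?D h (L (\<Sum>w\<in>Basis. (u \<bullet> w) *\<^sub>R w))" by (simp add: euclidean_representation)
    also have "\<dots> = (\<Sum>w\<in>Basis. (u \<bullet> w) *\<^sub>R ?D h (L w))"
      by (simp only: linear_sum[OF linL] linear_sum[OF linE] linear_cmul[OF linL] linear_cmul[OF linE])
    finally have "norm (?D h v) \<le> (\<Sum>w\<in>Basis. norm ((u \<bullet> w) *\<^sub>R ?D h (L w)))" by (simp only:) (rule norm_sum)
    also have "\<dots> \<le> (\<Sum>w\<in>(Basis :: 'e set). (norm v * K) * B)"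
    proof (rule sum_mono)
      fix w :: 'e assume w: "w \<in> Basis"
      have "\<bar>u \<bullet> w\<bar> \<le> norm v * K" using Basis_le_norm[OF w, of u] K(2)[of v] by (simp add: u_def)
      then show "norm ((u \<bullet> w) *\<^sub>R ?D h (L w)) \<le> (norm v * K) * B"
        using bound[OF h w] by (simp add: mult_mono)
    qed
    finally show ?thesis by (simp add: mult_ac)
  qed
  then show ?thesis by blast
qed

end

section \<open>Maps of constant rank\<close>

text \<open>If \<open>f\<close> kills a nonzero \<open>v\<close>, the part of \<open>R\<close>
  orthogonal to \<open>v\<close> has the same image but smaller dimension.\<close>

lemma linear_injective_if_dim_image:
  fixes f :: "'a::euclidean_space \<Rightarrow> 'b::euclidean_space"
  assumes f: "linear f" and R: "subspace R" and dim: "dim R \<le> dim (f ` R)" and v: "v \<in> R" "f v = 0"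
  shows "v = 0"
proof (rule ccontr)
  assume v0: "v \<noteq> 0"
  define R' where "R' = R \<inter> {x. v \<bullet> x = 0}"
  have R': "subspace R'" unfolding R'_def by (intro subspace_inter R subspace_hyperplane)
  have "v \<in> R - R'" using v v0 by (simp add: R'_def)
  then have "R' \<subset> R" unfolding R'_def by blast
  then have less: "dim R' < dim R" using R R' by (intro dim_psubset) (simp add: span_eq_iff[THEN iffD2])
  have "f ` R \<subseteq> f ` R'"
  proof (rule image_subsetI)
    fix x assume x: "x \<in> R"
    let ?y = "x - ((v \<bullet> x) / (v \<bullet> v)) *\<^sub>R v"
    have "?y \<in> R'" using x v v0 R by (simp add: R'_def subspace_diff subspace_scale inner_diff_right)
    moreover have "f ?y = f x" using f v by (simp add: linear_diff linear_cmul)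
    ultimately show "f x \<in> f ` R'" by (metis imageI)
  qed
  then have "dim (f ` R) \<le> dim (f ` R')" by (rule dim_subset)
  also have "\<dots> \<le> dim R'" using f by (rule dim_image_le)
  finally show False using dim less by simp
qed

text \<open>In the coordinates \<Phi>, built from \<open>A (F x)\<close> and the kernel component of
  \<open>x\<close>, the map \<open>F\<close> depends only on the first part. Two consequences are
  recorded: \<open>F\<close> is constant along kernel directions, which serves the injective case,
  and its values are determined by \<open>A (F x)\<close>, which serves the null set
  argument.\<close>

lemma constant_rank:
  fixes F :: "'a::euclidean_space \<Rightarrow> 'b::euclidean_space"
  assumes C1: "C1_on S F F'" and x0: "x0 \<in> S"
    and rank: "\<forall>x\<in>S. dim (range (F' x)) = dim (range (F' x0))"
  defines "N \<equiv> {v. F' x0 v = 0}"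
  shows "\<exists>A \<Psi> \<epsilon> U. linear A \<and> (\<forall>y. A (F' x0 (A y)) = A y) \<and> \<epsilon> > 0 \<and> open U \<and> x0 \<in> U \<and> U \<subseteq> S \<and>
    (\<forall>x\<in>U. F x = F (\<Psi> (A (F x) + orth_proj N x0)) \<and> dist (A (F x) + orth_proj N x0) (A (F x0) + orth_proj N x0) < \<epsilon>) \<and>
    (\<forall>z\<in>ball (A (F x0) + orth_proj N x0) \<epsilon>. \<Psi> z \<in> S \<and> \<Psi> differentiable at z \<and>
      (F \<circ> \<Psi>) differentiable at z \<and> A (F (\<Psi> z)) + orth_proj N (\<Psi> z) = z) \<and>
    (\<forall>z\<in>ball (A (F x0) + orth_proj N x0) \<epsilon>. \<forall>n\<in>N. z + n \<in> ball (A (F x0) + orth_proj N x0) \<epsilon> \<longrightarrow>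
      F (\<Psi> (z + n)) = F (\<Psi> z)) \<and> \<Psi> (A (F x0) + orth_proj N x0) = x0"
proof -
  have lin: "linear (F' x)" if "x \<in> S" for x
    using C1 that by (auto simp: C1_on_def intro: bounded_linear.linear has_derivative_bounded_linear)
  note L0 = lin[OF x0]
  have N: "subspace N" unfolding N_def using L0 by (rule linear_subspace_kernel)
  let ?P = "orth_proj N"
  note P = orth_proj[OF N]
  have Nc: "subspace (N\<^sup>\<bottom>)" by (rule subspace_orthogonal_comp)
  have cap: "v = 0" if "v \<in> N" "v \<in> N\<^sup>\<bottom>" for v
    using that by (auto simp: orthogonal_comp_def orthogonal_def dest: bspec[of N _ v])
  have "inj_on (F' x0) (N\<^sup>\<bottom>)"
  proof (rule inj_onI)
    fix u v assume "u \<in> N\<^sup>\<bottom>" "v \<in> N\<^sup>\<bottom>" "F' x0 u = F' x0 v"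
    then have "u - v \<in> N" "u - v \<in> N\<^sup>\<bottom>" using L0 Nc by (simp_all add: N_def linear_diff subspace_diff)
    then show "u = v" using cap by force
  qed
  \<comment> \<open>A left inverse of the derivative on the complement of its kernel; with it the
    derivative of \<Phi> at \<open>x0\<close> becomes the identity.\<close>
  from linear_exists_left_inverse_on[OF L0 Nc this]
  obtain A where A: "range A \<subseteq> N\<^sup>\<bottom>" "linear A" "\<forall>v\<in>N\<^sup>\<bottom>. A (F' x0 v) = v" by (elim exE conjE) (rule that)
  have blA: "bounded_linear A" using A(2) by (simp add: linear_conv_bounded_linear)
  have A_in: "A y \<in> N\<^sup>\<bottom>" for y using A(1) by blast
  have AF0: "A (F' x0 v) = v - ?P v" for v
  proof -
    have "F' x0 (?P v) = 0" using orth_proj_in[OF N, of v] by (simp add: N_def)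
    then have "F' x0 v = F' x0 (v - ?P v)" using L0 by (simp add: linear_diff)
    then show ?thesis using A(3) orth_proj_diff_comp[OF N, of v] by simp
  qed
  define \<Phi> where "\<Phi> x = A (F x) + ?P x" for x
  have \<Phi>C1: "C1_on S \<Phi> (\<lambda>x v. A (F' x v) + ?P v)"
    unfolding C1_on_def
  proof (intro conjI ballI allI)
    show "open S" using C1 by (simp add: C1_on_def)
    show "(\<Phi> has_derivative (\<lambda>v. A (F' x v) + ?P v)) (at x)" if "x \<in> S" for x
      unfolding \<Phi>_def using C1 that
      by (intro has_derivative_add bounded_linear.has_derivative[OF blA] has_derivative_orth_proj[OF N])
        (auto simp: C1_on_def)
    show "continuous_on S (\<lambda>x. A (F' x v) + ?P v)" for v
      using C1 by (auto simp: C1_on_def intro!: continuous_intros bounded_linear.continuous_on[OF blA])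
  qed
  have id: "A (F' x0 v) + ?P v = v" for v by (simp add: AF0)
  from C1_local_inverse[OF \<Phi>C1 x0 id] obtain U0 W \<Psi> g' where g: "open U0" "U0 \<subseteq> S" "x0 \<in> U0" "open W" "\<Phi> x0 \<in> W"
    "homeomorphism U0 W \<Phi> \<Psi>" "\<forall>y\<in>W. (\<Psi> has_derivative g' y) (at y)"
    "\<forall>y\<in>W. \<forall>v. A (F' (\<Psi> y) (g' y v)) + ?P (g' y v) = v" "\<forall>y\<in>W. surj (\<lambda>v. A (F' (\<Psi> y) v) + ?P v)"
    by (elim exE conjE) (rule that)
  have \<Psi>W: "\<Psi> y \<in> U0" "\<Phi> (\<Psi> y) = y" if "y \<in> W" for y using g(6) that by (auto simp: homeomorphism_def)
  have \<Psi>\<Phi>: "\<Phi> x \<in> W" "\<Psi> (\<Phi> x) = x" if "x \<in> U0" for x using g(6) that by (auto simp: homeomorphism_def)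
  \<comment> \<open>The image under \<open>A\<close> of the range of the derivative at a nearby
    point contains the complement of the kernel, whose dimension is at least the rank at
    \<open>x0\<close>. This is where constancy of the rank enters.\<close>
  have A_inj: "w = 0" if y: "y \<in> W" and w: "w \<in> range (F' (\<Psi> y))" "A w = 0" for y w
  proof (rule linear_injective_if_dim_image[OF A(2) _ _ w])
    have S: "\<Psi> y \<in> S" using \<Psi>W(1)[OF y] g(2) by blast
    show "subspace (range (F' (\<Psi> y)))" using lin[OF S] by (intro linear_subspace_image subspace_UNIV)
    have "N\<^sup>\<bottom> \<subseteq> A ` range (F' (\<Psi> y))"
    proof
      fix u assume u: "u \<in> N\<^sup>\<bottom>"
      have "surj (\<lambda>v. A (F' (\<Psi> y) v) + ?P v)" using g(9) y by blast
      then obtain w where w: "u = A (F' (\<Psi> y) w) + ?P w" unfolding surj_def by blast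
      then have "?P w = u - A (F' (\<Psi> y) w)" by simp
      then have "?P w \<in> N\<^sup>\<bottom>" using u A_in Nc by (simp add: subspace_diff)
      then have "?P w = 0" using orth_proj_in[OF N] cap by blast
      then show "u \<in> A ` range (F' (\<Psi> y))" using w by simp
    qed
    then have "dim (N\<^sup>\<bottom>) \<le> dim (A ` range (F' (\<Psi> y)))" by (rule dim_subset)
    moreover have "range (F' x0) \<subseteq> F' x0 ` (N\<^sup>\<bottom>)"
    proof (rule image_subsetI)
      fix v
      have "F' x0 (?P v) = 0" using orth_proj_in[OF N, of v] by (simp add: N_def)
      then have "F' x0 v = F' x0 (v - ?P v)" using L0 by (simp add: linear_diff)
      show "F' x0 v \<in> F' x0 ` (N\<^sup>\<bottom>)" by (rule image_eqI[where x="v - ?P v"]) (fact | rule orth_proj_diff_comp[OF N])+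
    qed
    then have "dim (range (F' x0)) \<le> dim (F' x0 ` (N\<^sup>\<bottom>))" by (rule dim_subset)
    moreover have "dim (F' x0 ` (N\<^sup>\<bottom>)) \<le> dim (N\<^sup>\<bottom>)" using L0 by (rule dim_image_le)
    ultimately show "dim (range (F' (\<Psi> y))) \<le> dim (A ` range (F' (\<Psi> y)))" using bspec[OF rank S] by simp
  qed
  obtain \<epsilon> where \<epsilon>: "\<epsilon> > 0" "ball (\<Phi> x0) \<epsilon> \<subseteq> W" using g(4,5) open_contains_ball by blast
  have F_der: "((\<lambda>z. F (\<Psi> z)) has_derivative (\<lambda>v. F' (\<Psi> y) (g' y v))) (at y)" if y: "y \<in> W" for y
  proof (rule has_derivative_compose[where f=\<Psi> and g=F and g'="F' (\<Psi> y)"])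
    show "(\<Psi> has_derivative g' y) (at y)" using g(7) y by blast
    show "(F has_derivative F' (\<Psi> y)) (at (\<Psi> y))" using C1 \<Psi>W(1)[OF y] g(2) by (auto simp: C1_on_def)
  qed
  have const: "F (\<Psi> (z + n)) = F (\<Psi> z)" if z: "z \<in> ball (\<Phi> x0) \<epsilon>" "z + n \<in> ball (\<Phi> x0) \<epsilon>" and n: "n \<in> N" for z n
  proof -
    have "\<exists>c. \<forall>t\<in>{0..1::real}. F (\<Psi> (z + t *\<^sub>R n)) = c"
    proof (rule has_derivative_zero_constant)
      fix t :: real assume t: "t \<in> {0..1}"
      have "z + t *\<^sub>R n = (1 - t) *\<^sub>R z + t *\<^sub>R (z + n)" by (simp add: algebra_simps)
      also have "\<dots> \<in> ball (\<Phi> x0) \<epsilon>" using z t by (intro convexD[OF convex_ball]) auto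
      finally have y: "z + t *\<^sub>R n \<in> W" using \<epsilon> by blast
      define w where "w = g' (z + t *\<^sub>R n) n"
      have "A (F' (\<Psi> (z + t *\<^sub>R n)) w) + ?P w = n" using g(8) y by (simp add: w_def)
      \<comment> \<open>The right side lies in the kernel and the left side in its complement, so
        both vanish, and \<open>A_inj\<close> shows that \<open>F \<circ> \<Psi>\<close> has
        derivative zero along \<open>n\<close>.\<close>
      then have eq: "A (F' (\<Psi> (z + t *\<^sub>R n)) w) = n - ?P w" by (simp add: algebra_simps)
      have "n - ?P w \<in> N" using n orth_proj_in[OF N] N by (simp add: subspace_diff)
      then have "A (F' (\<Psi> (z + t *\<^sub>R n)) w) = 0" using A_in[of "F' (\<Psi> (z + t *\<^sub>R n)) w"] unfolding eq by (rule cap)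
      then have w0: "F' (\<Psi> (z + t *\<^sub>R n)) w = 0" using A_inj[OF y] by blast
      note D = F_der[OF y]
      have "((\<lambda>t. F (\<Psi> (z + t *\<^sub>R n))) has_derivative (\<lambda>s. F' (\<Psi> (z + t *\<^sub>R n)) (g' (z + t *\<^sub>R n) (s *\<^sub>R n)))) (at t)"
        by (rule has_derivative_compose[where f="\<lambda>t. z + t *\<^sub>R n" and g="\<lambda>z. F (\<Psi> z)", OF _ D])
          (auto intro!: derivative_eq_intros)
      moreover have "F' (\<Psi> (z + t *\<^sub>R n)) (g' (z + t *\<^sub>R n) (s *\<^sub>R n)) = 0" for s
        using linear_cmul[OF bounded_linear.linear[OF has_derivative_bounded_linear[OF D]], of s n] w0
        by (simp add: w_def)
      ultimately show "((\<lambda>t. F (\<Psi> (z + t *\<^sub>R n))) has_derivative (\<lambda>h. 0)) (at t within {0..1})"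
        by (simp add: has_derivative_at_withinI)
    qed simp
    then obtain c where "\<forall>t\<in>{0..1::real}. F (\<Psi> (z + t *\<^sub>R n)) = c" by (elim exE) (rule that)
    from this[rule_format, of 0] this[rule_format, of 1] show ?thesis by simp
  qed
  have contF: "continuous_on U0 F" using C1 g(2)
    by (auto simp: C1_on_def intro!: continuous_at_imp_continuous_on has_derivative_continuous)
  have cont\<Phi>: "continuous_on U0 \<Phi>" using g(6) by (simp add: homeomorphism_def)
  \<comment> \<open>The second condition keeps the point whose kernel component is frozen at that of
    \<open>x0\<close> inside the ball, where constancy along the kernel applies.\<close>
  define U where "U = (U0 \<inter> \<Phi> -` ball (\<Phi> x0) \<epsilon>) \<inter> (U0 \<inter> (\<lambda>x. A (F x) + ?P x0) -` ball (\<Phi> x0) \<epsilon>)"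
  have "open U" unfolding U_def
    by (intro open_Int continuous_open_preimage g(1) cont\<Phi>)
      (auto intro!: continuous_intros bounded_linear.continuous_on[OF blA] contF)
  have "x0 \<in> U" using g(3) \<epsilon>(1) by (simp add: U_def \<Phi>_def)
  have F_eq: "F x = F (\<Psi> (A (F x) + ?P x0))" if x: "x \<in> U" for x
  proof -
    have xU: "x \<in> U0" "\<Phi> x \<in> ball (\<Phi> x0) \<epsilon>" "A (F x) + ?P x0 \<in> ball (\<Phi> x0) \<epsilon>"
      using x by (simp_all add: U_def)
    have eq: "\<Phi> x + (?P x0 - ?P x) = A (F x) + ?P x0" by (simp add: \<Phi>_def)
    have n: "?P x0 - ?P x \<in> N" by (intro subspace_diff N orth_proj_in)
    have "F (\<Psi> (A (F x) + ?P x0)) = F (\<Psi> (\<Phi> x))" using const[OF xU(2) _ n] xU(3) by (simp only: eq)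
    then show ?thesis using \<Psi>\<Phi>(2)[OF xU(1)] by simp
  qed
  have "\<forall>x\<in>U. F x = F (\<Psi> (A (F x) + ?P x0)) \<and> dist (A (F x) + ?P x0) (\<Phi> x0) < \<epsilon>"
  proof (intro ballI conjI)
    fix x assume x: "x \<in> U"
    then show "F x = F (\<Psi> (A (F x) + ?P x0))" by (rule F_eq)
    show "dist (A (F x) + ?P x0) (\<Phi> x0) < \<epsilon>" using x by (simp add: U_def dist_commute)
  qed
  moreover have "\<forall>y. A (F' x0 (A y)) = A y" using A(3) A_in by blast
  moreover have "\<forall>z\<in>ball (\<Phi> x0) \<epsilon>. \<Psi> z \<in> S \<and> \<Psi> differentiable at z \<and> (F \<circ> \<Psi>) differentiable at z \<and> \<Phi> (\<Psi> z) = z"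
  proof (intro ballI conjI)
    fix z assume "z \<in> ball (\<Phi> x0) \<epsilon>"
    then have z: "z \<in> W" using \<epsilon> by blast
    show "\<Psi> z \<in> S" "\<Phi> (\<Psi> z) = z" using \<Psi>W[OF z] g(2) by blast+
    show "\<Psi> differentiable at z" using g(7) z unfolding differentiable_def by blast
    show "(F \<circ> \<Psi>) differentiable at z" unfolding differentiable_def o_def
      by (rule exI[where x="\<lambda>v. F' (\<Psi> z) (g' z v)"]) (rule F_der[OF z])
  qed
  moreover have "\<forall>z\<in>ball (\<Phi> x0) \<epsilon>. \<forall>n\<in>N. z + n \<in> ball (\<Phi> x0) \<epsilon> \<longrightarrow> F (\<Psi> (z + n)) = F (\<Psi> z)"
    using const by (intro ballI impI) assumption
  moreover have "U \<subseteq> S" using g(2) unfolding U_def by blast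
  moreover note A(2) \<epsilon>(1) \<Psi>\<Phi>(2)[OF g(3)] \<open>x0 \<in> U\<close> \<open>open U\<close>
  ultimately show ?thesis unfolding \<Phi>_def
    by (intro exI[of _ A] exI[of _ \<Psi>] exI[of _ \<epsilon>] exI[of _ U] conjI) assumption+
qed

section \<open>Differentials of morphisms of homogeneous spaces\<close>

locale morphism = X1: homogeneous X1 + X2: homogeneous X2
  for X1 :: "('g1, 'e1::euclidean_space, 'n1::{finite,linorder}) hspace"
    and X2 :: "('g2, 'e2::euclidean_space, 'n2::{finite,linorder}) hspace" +
  fixes \<rho> :: "'g1 \<Rightarrow> 'g2" and f :: "'g1 set \<Rightarrow> 'g2 set"
  assumes morphism: "hspace_morphism X1 X2 \<rho> f"
begin

abbreviation "D \<equiv> base_diff X1 X2 f"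

lemma \<rho>_stab: "h \<in> stab X1 \<Longrightarrow> \<rho> h \<in> stab X2" and \<rho>_hom: "\<rho> \<in> hom (grp X1) (grp X2)"
  and smooth: "smooth_map (quot_manifold X1) (quot_manifold X2) f" and f_stab: "f (stab X1) = stab X2"
  and f_act: "g \<in> carrier (grp X1) \<Longrightarrow> p \<in> points X1 \<Longrightarrow> f (act X1 g p) = act X2 (\<rho> g) (f p)"
  using morphism by (auto simp: hspace_morphism_def)

lemma \<rho>_carrier: "g \<in> carrier (grp X1) \<Longrightarrow> \<rho> g \<in> carrier (grp X2)"
  using \<rho>_hom by (auto simp: hom_def)

lemma f_differential:
  assumes "c \<in> atlas (quot_manifold X1)" "c' \<in> atlas (quot_manifold X2)" "p \<in> fst c" "f p \<in> fst c'"
  shows "\<exists>E. has_differential (quot_manifold X1) c c' f p E"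
  using smooth_map_C1(2)[OF X1.chart_X X2.chart_X smooth assms(1,2), OF assms(1,2)] assms(3,4) by blast

lemma base_differential:
  "has_differential (quot_manifold X1) (base_chart X1) (base_chart X2) f (stab X1) D"
proof -
  obtain E where E: "has_differential (quot_manifold X1) (base_chart X1) (base_chart X2) f (stab X1) E"
    using f_differential[OF X1.base(1) X2.base(1) X1.base(2)] X2.base(2) by (auto simp: f_stab)
  then show ?thesis unfolding base_diff_def using differential_eqI[OF X1.chart_X[OF X1.base(1)] E] by simp
qed

lemma linear_D: "linear D" and D_proj: "D (orth_proj (cotangent X1) v) = D v" and D_range: "D v \<in> cotangent X2"
  unfolding cotangent_def
  using has_differential_proj[OF X1.chart_X[OF X1.base(1)] base_differential]
    has_differential_range[OF X1.chart_X[OF X1.base(1)] X2.chart_X[OF X2.base(1)] base_differential] by auto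

text \<open>Differentiating the equivariance of \<open>f\<close> at the base point, which
  \<open>h\<close> and \<open>\<rho> h\<close> fix.\<close>

lemma D_equivariant:
  assumes h: "h \<in> stab X1"
  shows "D (base_diff X1 X1 (act X1 h) v) = base_diff X2 X2 (act X2 (\<rho> h)) (D v)"
proof -
  note b = X1.chart_X[OF X1.base(1)] and b2 = X2.chart_X[OF X2.base(1)]
  have 1: "has_differential (quot_manifold X1) (base_chart X1) (base_chart X2) (\<lambda>x. f (act X1 h x)) (stab X1)
    (\<lambda>v. D (base_diff X1 X1 (act X1 h) v))"
    using base_differential by (intro has_differential_compose[OF b b X1.base_act_differential[OF h]]) (simp add: X1.act_stab[OF h])
  have 2: "has_differential (quot_manifold X1) (base_chart X1) (base_chart X2) (\<lambda>x. act X2 (\<rho> h) (f x)) (stab X1)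
    (\<lambda>v. base_diff X2 X2 (act X2 (\<rho> h)) (D v))"
    using X2.base_act_differential[OF \<rho>_stab[OF h]]
    by (intro has_differential_compose[OF b b2 base_differential]) (simp add: f_stab)
  have "has_differential (quot_manifold X1) (base_chart X1) (base_chart X2) (\<lambda>x. f (act X1 h x)) (stab X1)
    (\<lambda>v. base_diff X2 X2 (act X2 (\<rho> h)) (D v))"
    using f_act X1.chart_X_subset[OF X1.base(1)] h X1.H_subset
    by (intro has_differential_cong[OF b 2]) (simp add: subset_iff)
  from has_differential_unique[OF b 1 this] show ?thesis by (rule fun_cong)
qed

text \<open>Translating from the base point to \<open>p\<close> gives
  \<open>E (A v) = B (D v)\<close>, where \<open>A\<close> and \<open>B\<close> are differentials of
  the actions and are invertible on the model spaces, so the rank does not change.\<close>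

lemma rank_eq:
  assumes c: "c \<in> atlas (quot_manifold X1)" and p: "p \<in> fst c" "f p \<in> fst (base_chart X2)"
    and E: "has_differential (quot_manifold X1) c (base_chart X2) f p E"
  shows "dim (range E) = dim (range D)"
proof -
  let ?V1 = "model (quot_manifold X1)"
  note b = X1.chart_X[OF X1.base(1)] and b2 = X2.chart_X[OF X2.base(1)]
  obtain g where g: "g \<in> carrier (grp X1)" "p = act X1 g (stab X1)"
    using X1.chart_X_subset[OF c p(1)] by (auto simp: X1.points_eq act_def)
  obtain A where A: "has_differential (quot_manifold X1) (base_chart X1) c (act X1 g) (stab X1) A"
    using X1.act_differential[OF g(1) X1.base(1) c X1.base(2)] p(1) g(2) by auto
  obtain A' where A': "\<forall>v\<in>?V1. A (A' v) = v" "range A' \<subseteq> ?V1"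
    using X1.act_differential_inverse[OF g(1) X1.base(1) c X1.base(2) A] by auto
  have fp: "f p = act X2 (\<rho> g) (stab X2)" using f_act[OF g(1) X1.stab_in_points] by (simp add: g(2) f_stab)
  obtain B where B: "has_differential (quot_manifold X2) (base_chart X2) (base_chart X2) (act X2 (\<rho> g)) (stab X2) B"
    using X2.act_differential[OF \<rho>_carrier[OF g(1)] X2.base(1) X2.base(1) X2.base(2)] p(2) fp by auto
  obtain B' where B': "\<forall>v\<in>model (quot_manifold X2). B' (B v) = v"
    using X2.act_differential_inverse[OF \<rho>_carrier[OF g(1)] X2.base(1) X2.base(1) X2.base(2) B] by auto
  have 1: "has_differential (quot_manifold X1) (base_chart X1) (base_chart X2) (\<lambda>x. f (act X1 g x)) (stab X1) (\<lambda>v. E (A v))"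
    using E g(2) by (intro has_differential_compose[OF b X1.chart_X[OF c] A]) simp
  have 2: "has_differential (quot_manifold X1) (base_chart X1) (base_chart X2) (\<lambda>x. act X2 (\<rho> g) (f x)) (stab X1) (\<lambda>v. B (D v))"
    by (rule has_differential_compose[OF b b2 base_differential]) (use B in \<open>simp add: f_stab\<close>)
  have "has_differential (quot_manifold X1) (base_chart X1) (base_chart X2) (\<lambda>x. f (act X1 g x)) (stab X1) (\<lambda>v. B (D v))"
    using f_act[OF g(1)] X1.chart_X_subset[OF X1.base(1)] by (intro has_differential_cong[OF b 2]) simp_all
  from has_differential_unique[OF b 1 this] have EA: "E (A v) = B (D v)" for v by (rule fun_cong)
  have "range E = B ` range D"
  proof (rule equalityI)
    show "range E \<subseteq> B ` range D"
    proof (rule image_subsetI)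
      fix v
      have "orth_proj ?V1 v = A (A' (orth_proj ?V1 v))" using A'(1) orth_proj_in[OF chart_subspace[OF b]] by simp
      then have "E v = B (D (A' (orth_proj ?V1 v)))"
        using has_differential_proj(1)[OF X1.chart_X[OF c] E, of v] EA by metis
      then show "E v \<in> B ` range D" by blast
    qed
    show "B ` range D \<subseteq> range E"
    proof
      fix y assume "y \<in> B ` range D"
      then obtain v where "y = B (D v)" by blast
      then show "y \<in> range E" using EA[of v] by (metis rangeI)
    qed
  qed
  moreover have "dim (B ` range D) = dim (range D)"
  proof (rule dim_image_eq)
    show "linear B" by (rule has_differential_proj(2)[OF b2 B])
    have sp: "span (range D) = range D" using linear_D by (intro span_eq_iff[THEN iffD2] linear_subspace_image subspace_UNIV)
    show "inj_on B (span (range D))" unfolding sp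
      by (rule inj_on_inverseI[where g=B']) (use B' D_range in \<open>auto simp: cotangent_def\<close>)
  qed
  ultimately show ?thesis by simp
qed

end

section \<open>The differential of an injective and of a surjective morphism\<close>

context morphism
begin

lemma constant_rank_rep:
  assumes c: "c \<in> atlas (quot_manifold X1)" and p: "p \<in> fst c" "f p \<in> fst (base_chart X2)"
  shows "\<exists>S F'. C1_on S (local_rep (quot_manifold X1) c (base_chart X2) f) F' \<and> snd c p \<in> S \<and>
    (\<forall>x\<in>S. \<exists>q\<in>fst c. f q \<in> fst (base_chart X2) \<and> orth_proj (model (quot_manifold X1)) x = snd c q) \<and>
    has_differential (quot_manifold X1) c (base_chart X2) f p (F' (snd c p)) \<and>
    (\<forall>x\<in>S. dim (range (F' x)) = dim (range D))"
proof -
  let ?P = "orth_proj (model (quot_manifold X1))"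
  define A where "A = {q \<in> fst c. f q \<in> fst (base_chart X2)}"
  obtain F' where F': "C1_on {x. ?P x \<in> snd c ` A} (local_rep (quot_manifold X1) c (base_chart X2) f) F'"
    "\<forall>x. F' (?P x) = F' x" "\<forall>p\<in>A. has_differential (quot_manifold X1) c (base_chart X2) f p (F' (snd c p))"
    using smooth_map_C1(2)[OF X1.chart_X[OF c] X2.chart_X[OF X2.base(1)] smooth c X2.base(1), folded A_def]
    by (elim exE conjE) (rule that)
  have q: "\<exists>q\<in>fst c. f q \<in> fst (base_chart X2) \<and> ?P x = snd c q" if "?P x \<in> snd c ` A" for x
    using that by (auto simp: A_def)
  have "dim (range (F' x)) = dim (range D)" if x: "?P x \<in> snd c ` A" for x
  proof -
    obtain q where q: "q \<in> A" "?P x = snd c q" using x by blast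
    have "dim (range (F' (snd c q))) = dim (range D)"
      using q(1) F'(3) by (intro rank_eq[OF c, of q]) (auto simp: A_def)
    then show ?thesis using F'(2) by (metis q(2))
  qed
  moreover have "p \<in> A" using p by (simp add: A_def)
  moreover have "?P (snd c p) \<in> snd c ` A"
    using p \<open>p \<in> A\<close> chart_proj[OF X1.chart_X[OF c]] by simp
  ultimately show ?thesis using F'(1,3) q
    by (intro exI[of _ "{x. ?P x \<in> snd c ` A}"] exI[of _ F'] conjI) simp_all
qed

text \<open>Moving by a multiple of \<open>v\<close> in the straightened coordinates keeps the value
  of \<open>f\<close>, so by injectivity the point of the manifold does not move. What remains is a
  displacement orthogonal to the model, whereas \<open>v\<close> lies in the model.\<close>

lemma D_injective:
  assumes inj: "inj_on f (points X1)" and v: "v \<in> cotangent X1" "D v = 0"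
  shows "v = 0"
proof -
  note b = X1.chart_X[OF X1.base(1)] and b2 = X2.chart_X[OF X2.base(1)]
  note V = chart_subspace[OF b]
  let ?P = "orth_proj (model (quot_manifold X1))"
  define F where "F = local_rep (quot_manifold X1) (base_chart X1) (base_chart X2) f"
  define x0 where "x0 = snd (base_chart X1) (stab X1)"
  obtain S F' where S: "C1_on S F F'" "x0 \<in> S"
    "\<forall>x\<in>S. \<exists>q\<in>fst (base_chart X1). f q \<in> fst (base_chart X2) \<and> ?P x = snd (base_chart X1) q"
    "has_differential (quot_manifold X1) (base_chart X1) (base_chart X2) f (stab X1) (F' x0)"
    "\<forall>x\<in>S. dim (range (F' x)) = dim (range D)"
    using constant_rank_rep[OF X1.base, unfolded f_stab, OF X2.base(2), folded F_def x0_def]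
    by (elim exE conjE) (rule that)
  have F'0: "F' x0 = D" by (rule has_differential_unique[OF b S(4) base_differential])
  let ?N = "{v. D v = 0}"
  have N: "subspace ?N" using linear_D by (rule linear_subspace_kernel)
  have Fq: "F x = snd (base_chart X2) (f q)" if "q \<in> fst (base_chart X1)" "?P x = snd (base_chart X1) q" for x q
    using that by (simp add: F_def local_rep_def chart_inv[OF b])
  have r: "\<forall>x\<in>S. dim (range (F' x)) = dim (range (F' x0))" using S(2,5) by simp
  obtain A \<Psi> \<epsilon> where \<epsilon>: "\<epsilon> > 0"
    and \<Psi>: "\<forall>z\<in>ball (A (F x0) + orth_proj ?N x0) \<epsilon>. \<Psi> z \<in> S \<and> \<Psi> differentiable at z \<and>
      (F \<circ> \<Psi>) differentiable at z \<and> A (F (\<Psi> z)) + orth_proj ?N (\<Psi> z) = z"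
    and const: "\<forall>z\<in>ball (A (F x0) + orth_proj ?N x0) \<epsilon>. \<forall>n\<in>?N. z + n \<in> ball (A (F x0) + orth_proj ?N x0) \<epsilon> \<longrightarrow>
      F (\<Psi> (z + n)) = F (\<Psi> z)" and at0: "\<Psi> (A (F x0) + orth_proj ?N x0) = x0"
    using constant_rank[OF S(1,2) r] unfolding F'0 by (elim exE conjE) (rule that)
  define z0 where "z0 = A (F x0) + orth_proj ?N x0"
  \<comment> \<open>The added 1 keeps the denominator positive when \<open>v = 0\<close> and makes
    \<open>t * norm v < \<epsilon>\<close>.\<close>
  define t where "t = \<epsilon> / (norm v + 1)"
  have t: "t > 0" using \<epsilon> by (simp add: t_def add_nonneg_pos)
  have "norm v + 1 \<noteq> 0" using norm_ge_zero[of v] by linarith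
  then have "t * (norm v + 1) = \<epsilon>" by (simp add: t_def)
  then have "t * norm v < \<epsilon>" using t by (simp add: distrib_left)
  then have ball: "z0 + t *\<^sub>R v \<in> ball z0 \<epsilon>" "z0 \<in> ball z0 \<epsilon>" using t \<epsilon> by (simp_all add: dist_norm)
  have tN: "t *\<^sub>R v \<in> ?N" using v(2) linear_D by (simp add: linear_cmul)
  define x where "x = \<Psi> (z0 + t *\<^sub>R v)"
  have F_eq: "F x = F x0" using const ball tN at0 unfolding x_def z0_def by metis
  have xS: "x \<in> S" "A (F x) + orth_proj ?N x = z0 + t *\<^sub>R v"
    using \<Psi> ball(1) unfolding x_def z0_def by blast+
  then have PN: "orth_proj ?N x = orth_proj ?N x0 + t *\<^sub>R v" by (simp add: F_eq z0_def)
  obtain q where q: "q \<in> fst (base_chart X1)" "f q \<in> fst (base_chart X2)" "?P x = snd (base_chart X1) q"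
    using S(3) xS(1) by (elim ballE[where x=x] bexE conjE) (rule that, simp_all)
  have Px0: "?P x0 = x0" unfolding x0_def by (rule chart_proj[OF b X1.base(2)])
  have "snd (base_chart X2) (f q) = snd (base_chart X2) (f (stab X1))"
    using F_eq Fq[OF q(1,3)] Fq[OF X1.base(2), of x0] Px0 by (simp add: x0_def)
  then have "f q = f (stab X1)" using chart_inj[OF b2] q(2) X2.base(2) by (auto simp: inj_on_def f_stab)
  then have "q = stab X1" using inj X1.chart_X_subset[OF X1.base(1)] q(1) X1.base(2) by (auto simp: inj_on_def)
  then have Px: "?P x = x0" using q(3) by (simp add: x0_def)
  \<comment> \<open>Equality of the points only means equality of the model components, so
    \<open>d\<close> is orthogonal to the model. There \<open>D\<close> vanishes, hence
    \<open>d\<close> lies in the kernel and equals its kernel projection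
    \<open>t *\<^sub>R v\<close>.\<close>
  define d where "d = x - x0"
  have lP: "linear ?P" by (rule orth_proj(1)[OF V])
  have Pd: "?P d = 0" using Px Px0 lP by (simp add: d_def linear_diff)
  have "D d = D (?P d)" using D_proj[of d] by (simp add: cotangent_def)
  then have dN: "d \<in> ?N" using linear_D by (simp add: Pd linear_0)
  have "orth_proj ?N d = t *\<^sub>R v" using PN orth_proj(1)[OF N] by (simp add: d_def linear_diff)
  then have "d = t *\<^sub>R v" using orth_proj(3)[OF N] dN by simp
  moreover have "?P v = v" using orth_proj(3)[OF V] v(1) by (simp add: cotangent_def)
  ultimately have "t *\<^sub>R v = 0" using Pd lP by (simp add: linear_cmul)
  then show "v = 0" using t by simp
qed

text \<open>Near \<open>p\<close> the value of \<open>F\<close> is a differentiable function of its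
  image under \<open>A\<close>, so the values lie in the image under \<open>J\<close> of a subset of
  the proper subspace \<open>L\<close>. They are thickened by the orthogonal complement of the model
  so that they can be measured in the Euclidean space.\<close>

lemma locally_negligible_image:
  assumes less: "dim (range D) < dim (cotangent X2)" and p: "p \<in> points X1" "f p \<in> fst (base_chart X2)"
  shows "\<exists>W. openin (mtop (quot_manifold X1)) W \<and> p \<in> W \<and>
    negligible {y. \<exists>q\<in>W. f q \<in> fst (base_chart X2) \<and> orth_proj (cotangent X2) y = snd (base_chart X2) (f q)}"
proof -
  note b2 = X2.chart_X[OF X2.base(1)]
  let ?P = "orth_proj (cotangent X2)"
  have V: "subspace (cotangent X2)" unfolding cotangent_def by (rule chart_subspace[OF b2])
  obtain c where c: "c \<in> atlas (quot_manifold X1)" "p \<in> fst c"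
    using atlas_cover[OF X1.MX] p(1) X1.topX by blast
  note c1 = X1.chart_X[OF c(1)]
  define F where "F = local_rep (quot_manifold X1) c (base_chart X2) f"
  define x0 where "x0 = snd c p"
  obtain S F' where S: "C1_on S F F'" "x0 \<in> S" "has_differential (quot_manifold X1) c (base_chart X2) f p (F' x0)"
    "\<forall>x\<in>S. dim (range (F' x)) = dim (range D)"
    using constant_rank_rep[OF c p(2), folded F_def x0_def] by (elim exE conjE) (rule that; assumption)
  have lin: "linear (F' x0)" by (rule has_differential_proj(2)[OF c1 S(3)])
  have F'_in: "F' x0 v \<in> cotangent X2" for v
    unfolding cotangent_def by (rule has_differential_range[OF c1 b2 S(3)])
  let ?N = "{v. F' x0 v = 0}"
  define n where "n = orth_proj ?N x0"
  have r: "\<forall>x\<in>S. dim (range (F' x)) = dim (range (F' x0))" using S(2,4) by simp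
  obtain A \<Psi> \<epsilon> U where A: "linear A" "\<forall>y. A (F' x0 (A y)) = A y" and U: "open U" "x0 \<in> U" "U \<subseteq> S"
    and F_eq: "\<forall>x\<in>U. F x = F (\<Psi> (A (F x) + n)) \<and> dist (A (F x) + n) (A (F x0) + n) < \<epsilon>"
    and \<Psi>: "\<forall>z\<in>ball (A (F x0) + n) \<epsilon>. \<Psi> z \<in> S \<and> \<Psi> differentiable at z \<and>
      (F \<circ> \<Psi>) differentiable at z \<and> A (F (\<Psi> z)) + orth_proj ?N (\<Psi> z) = z"
    using constant_rank[OF S(1,2) r, folded n_def] by (elim exE conjE) (rule that)
  \<comment> \<open>The range of the derivative plus the orthogonal complement of the model; it is
    proper because the rank is too small.\<close>
  define L where "L = {y. ?P y \<in> range (F' x0)}"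
  have R: "subspace (range (F' x0))" using lin by (intro linear_subspace_image subspace_UNIV)
  have "subspace L" using R orth_proj(1)[OF V] unfolding L_def
    by (intro subspaceI) (simp_all add: linear_0 linear_add linear_cmul subspace_0 subspace_add subspace_scale)
  have "L \<noteq> UNIV"
  proof
    assume "L = UNIV"
    have "cotangent X2 \<subseteq> range (F' x0)"
    proof
      fix v assume "v \<in> cotangent X2"
      moreover have "?P v \<in> range (F' x0)" using UNIV_I[of v] unfolding \<open>L = UNIV\<close>[symmetric] L_def by (rule CollectD)
      ultimately show "v \<in> range (F' x0)" by (simp only: orth_proj(3)[OF V])
    qed
    then have "dim (cotangent X2) \<le> dim (range (F' x0))" by (rule dim_subset)
    then show False using less S(2,4) by simp
  qed
  then have "dim L < DIM(real ^ 'n2::{finite,linorder})"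
    using dim_eq_full[of L] dim_subset_UNIV[of L] span_eq_iff[THEN iffD2, OF \<open>subspace L\<close>] by (simp add: less_le)
  then have negL: "negligible L" by (rule negligible_lowdim)
  define S' where "S' = {y \<in> L. A (?P y) + n \<in> ball (A (F x0) + n) \<epsilon>}"
  \<comment> \<open>The model component is rebuilt from its image under \<open>A\<close>, and the
    orthogonal component is kept.\<close>
  define J where "J y = (F \<circ> \<Psi>) (A (?P y) + n) + (y - ?P y)" for y
  have bP: "bounded_linear ?P" by (rule bounded_linear_orth_proj[OF V])
  have bA: "bounded_linear A" using A(1) by (simp add: linear_conv_bounded_linear)
  have "J differentiable at y" if "y \<in> S'" for y
  proof -
    have a: "(F \<circ> \<Psi>) differentiable at (A (?P y) + n)" using \<Psi> that by (simp add: S'_def)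
    have b: "(\<lambda>y. A (?P y) + n) differentiable at y"
      by (intro derivative_intros bounded_linear_imp_differentiable bounded_linear_compose[OF bA bP])
    have "(F \<circ> \<Psi>) \<circ> (\<lambda>y. A (?P y) + n) differentiable at y" by (rule differentiable_chain_at[OF b a])
    moreover have "(\<lambda>y. y - ?P y) differentiable at y"
      by (intro derivative_intros bounded_linear_imp_differentiable bP)
    ultimately show ?thesis unfolding J_def by (auto intro: differentiable_add simp: o_def)
  qed
  then have "J differentiable_on S'" by (simp add: differentiable_at_imp_differentiable_on)
  moreover have "negligible S'" by (rule negligible_subset[OF negL]) (auto simp: S'_def)
  ultimately have neg: "negligible (J ` S')" by (intro negligible_differentiable_image_negligible) simp_all
  define W where "W = {q \<in> fst c. snd c q \<in> U}"
  have "y \<in> J ` S'" if q: "q \<in> W" "f q \<in> fst (base_chart X2)" "?P y = snd (base_chart X2) (f q)" for y q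
  proof -
    define x where "x = snd c q"
    have x: "x \<in> U" "F x = ?P y" using q by (auto simp: W_def x_def F_def local_rep_at[OF c1])
    have fe: "?P y = F (\<Psi> (A (?P y) + n))" and de: "dist (A (?P y) + n) (A (F x0) + n) < \<epsilon>"
      using F_eq x by metis+
    \<comment> \<open>The model component of \<open>y\<close> is replaced by an element of the range
      of the derivative with the same image under \<open>A\<close>, which is all that
      \<open>J\<close> reads of it.\<close>
    define y' where "y' = F' x0 (A (?P y)) + (y - ?P y)"
    have "?P (y - ?P y) = 0"
      using orth_proj(1)[OF V] by (simp add: linear_diff orth_proj_idem[OF V])
    then have P': "?P y' = F' x0 (A (?P y))"
      using orth_proj(1)[OF V] orth_proj(3)[OF V F'_in] by (simp add: y'_def linear_add)
    then have AP: "A (?P y') = A (?P y)" using A(2) by simp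
    have "y' \<in> S'" using P' de A(2) by (simp add: S'_def L_def dist_commute)
    moreover have "J y' = y"
    proof -
      have "J y' = F (\<Psi> (A (?P y) + n)) + (y' - ?P y')" by (simp only: J_def AP o_def)
      also have "\<dots> = ?P y + (y' - F' x0 (A (?P y)))" by (simp only: P' fe[symmetric])
      finally show ?thesis by (simp add: y'_def)
    qed
    ultimately show ?thesis by (metis imageI)
  qed
  then have "{y. \<exists>q\<in>W. f q \<in> fst (base_chart X2) \<and> ?P y = snd (base_chart X2) (f q)} \<subseteq> J ` S'" by blast
  then have "negligible {y. \<exists>q\<in>W. f q \<in> fst (base_chart X2) \<and> ?P y = snd (base_chart X2) (f q)}"
    by (rule negligible_subset[OF neg])
  moreover have "openin (mtop (quot_manifold X1)) W" unfolding W_def by (rule chart_preimage_open[OF c1 U(1)])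
  moreover have "p \<in> W" using c(2) U(2) by (simp add: W_def x0_def)
  ultimately show ?thesis by (intro exI[of _ W] conjI)
qed

lemma D_surjective:
  assumes surj: "f ` points X1 = points X2"
  shows "range D = cotangent X2"
proof (rule ccontr)
  assume ne: "range D \<noteq> cotangent X2"
  note b2 = X2.chart_X[OF X2.base(1)]
  let ?P = "orth_proj (cotangent X2)" and ?b = "base_chart X2" and ?M = "mtop (quot_manifold X1)"
  have V: "subspace (cotangent X2)" unfolding cotangent_def by (rule chart_subspace[OF b2])
  have R: "subspace (range D)" using linear_D by (intro linear_subspace_image subspace_UNIV)
  have "range D \<subset> cotangent X2" using ne D_range by blast
  then have "span (range D) \<subset> span (cotangent X2)"
    unfolding span_eq_iff[THEN iffD2, OF V] span_eq_iff[THEN iffD2, OF R] .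
  then have less: "dim (range D) < dim (cotangent X2)" by (rule dim_psubset)
  define E where "E W = {y. \<exists>q\<in>W. f q \<in> fst ?b \<and> ?P y = snd ?b (f q)}" for W
  define \<U> where "\<U> = {W. openin ?M W \<and> negligible (E W)}"
  define T where "T = {p \<in> points X1. f p \<in> fst ?b}"
  \<comment> \<open>Second countability enters through the Lindelof property: countably many of the
    local neighbourhoods cover the part of the space that \<open>f\<close> maps into the base
    chart.\<close>
  have "second_countable ?M" using X1.MX by (simp add: smooth_manifold_def)
  then have "Lindelof_space (subtopology ?M T)"
    by (intro second_countable_imp_Lindelof_space second_countable_subtopology)
  moreover have "\<forall>W\<in>\<U>. openin ?M W" by (simp add: \<U>_def)
  moreover have "T \<subseteq> \<Union>\<U>"
  proof
    fix p assume "p \<in> T"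
    then obtain W where "openin ?M W" "p \<in> W" "negligible (E W)"
      using locally_negligible_image[OF less, of p] unfolding T_def E_def by blast
    then show "p \<in> \<Union>\<U>" by (auto simp: \<U>_def)
  qed
  moreover have "T \<subseteq> topspace ?M" by (auto simp: T_def X1.topX)
  ultimately obtain \<V> where \<V>: "countable \<V>" "\<V> \<subseteq> \<U>" "T \<subseteq> \<Union>\<V>"
    unfolding Lindelof_space_subtopology_subset[OF \<open>T \<subseteq> topspace ?M\<close>] by meson
  have "negligible (\<Union>(E ` \<V>))"
    by (rule negligible_countable_Union) (use \<V>(1,2) in \<open>auto simp: \<U>_def\<close>)
  moreover have "{y. ?P y \<in> snd ?b ` fst ?b} \<subseteq> \<Union>(E ` \<V>)"
  proof
    fix y assume "y \<in> {y. ?P y \<in> snd ?b ` fst ?b}"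
    then obtain q where q: "q \<in> fst ?b" "?P y = snd ?b q" by blast
    then have "q \<in> f ` points X1" using X2.chart_X_subset[OF X2.base(1)] by (simp add: surj)
    then obtain p where p: "p \<in> points X1" "q = f p" by blast
    then have "p \<in> T" using q by (simp add: T_def)
    then obtain W where W: "W \<in> \<V>" "p \<in> W" using \<V>(3) by blast
    have "y \<in> E W" using W q p by (auto simp: E_def)
    then show "y \<in> \<Union>(E ` \<V>)" using W(1) by blast
  qed
  ultimately have "negligible {y. ?P y \<in> snd ?b ` fst ?b}" by (rule negligible_subset)
  moreover have "open {y. ?P y \<in> snd ?b ` fst ?b}"
    unfolding cotangent_def by (rule chart_open_extension[OF b2]) (use b2 in \<open>simp_all add: chart_of_def\<close>)
  moreover have "snd ?b (stab X2) \<in> {y. ?P y \<in> snd ?b ` fst ?b}"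
    using X2.base(2) by (simp add: cotangent_def chart_proj[OF b2])
  ultimately show False using open_not_negligible by blast
qed

end

section \<open>A common fixed point of a bounded family of linear maps\<close>

text \<open>If \<open>T0\<close> moved a minimiser \<open>x\<close> of \<open>m\<close> to a
  different point, the midpoint would have a smaller value by the parallelogram law. Inverses are
  demanded on \<open>span S\<close> only, because the unit of the stabilizer acts as a projection of
  the ambient space.\<close>

lemma bounded_family_common_fixed_point:
  fixes S :: "'a::euclidean_space set" and \<T> :: "('a \<Rightarrow> 'a) set"
  assumes S: "closed S" "convex S" "S \<noteq> {}" and ne: "\<T> \<noteq> {}"
    and lin: "\<And>T. T \<in> \<T> \<Longrightarrow> linear T" and maps: "\<And>T x. T \<in> \<T> \<Longrightarrow> x \<in> S \<Longrightarrow> T x \<in> S"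
    and bound: "\<And>T x. T \<in> \<T> \<Longrightarrow> norm (T x) \<le> C * norm x"
    and comp: "\<And>T T'. T \<in> \<T> \<Longrightarrow> T' \<in> \<T> \<Longrightarrow> \<exists>T''\<in>\<T>. \<forall>x\<in>S. T (T' x) = T'' x"
    and inverse: "\<And>T. T \<in> \<T> \<Longrightarrow> \<exists>T'\<in>\<T>. \<forall>x. x \<in> span S \<longrightarrow> T' (T x) = x"
  shows "\<exists>x\<in>S. \<forall>T\<in>\<T>. T x = x"
proof -
  \<comment> \<open>A positive bound, since \<open>K\<close> becomes a denominator below.\<close>
  define K where "K = max C 1"
  have K: "K > 0" by (simp add: K_def)
  have b: "norm (T x) \<le> K * norm x" if "T \<in> \<T>" for T x
  proof -
    have "norm (T x) \<le> C * norm x" by (rule bound[OF that])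
    also have "\<dots> \<le> K * norm x" by (intro mult_right_mono) (simp_all add: K_def)
    finally show ?thesis .
  qed
  define m where "m x = (SUP T\<in>\<T>. norm (T x))" for x
  have bdd: "bdd_above ((\<lambda>T. norm (T x)) ` \<T>)" for x using b by (intro bdd_aboveI2[where M="K * norm x"])
  have upper: "norm (T x) \<le> m x" if "T \<in> \<T>" for T x unfolding m_def by (rule cSUP_upper[OF that bdd])
  have least: "m x \<le> c" if "\<And>T. T \<in> \<T> \<Longrightarrow> norm (T x) \<le> c" for x c
    unfolding m_def by (rule cSUP_least[OF ne that])
  have m0: "0 \<le> m x" for x using ne upper norm_ge_zero order_trans by blast
  have lower: "norm x \<le> K * m x" if x: "x \<in> S" for x
  proof -
    obtain T where T: "T \<in> \<T>" using ne by blast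
    obtain T' where T': "T' \<in> \<T>" "T' (T x) = x" using inverse[OF T] span_base[OF x] by blast
    have "norm x \<le> K * norm (T x)" using b[OF T'(1), of "T x"] T'(2) by simp
    also have "\<dots> \<le> K * m x" using upper[OF T] K by simp
    finally show ?thesis .
  qed
  have lip: "m x \<le> m y + K * norm (x - y)" for x y
  proof (rule least)
    fix T assume T: "T \<in> \<T>"
    have "T x = T y + T (x - y)" using lin[OF T] by (simp add: linear_diff)
    then have "norm (T x) \<le> norm (T y) + norm (T (x - y))" by (metis norm_triangle_ineq)
    then show "norm (T x) \<le> m y + K * norm (x - y)" using upper[OF T, of y] b[OF T, of "x - y"] by simp
  qed
  have "K-lipschitz_on UNIV m"
  proof (rule lipschitz_onI)
    show "dist (m x) (m y) \<le> K * dist x y" for x y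
      using lip[of x y] lip[of y x] by (simp add: dist_norm norm_minus_commute abs_le_iff)
  qed (use K in simp)
  then have cont: "continuous_on A m" for A
    using lipschitz_on_continuous_on continuous_on_subset by blast
  obtain s where s: "s \<in> S" using S(3) by blast
  \<comment> \<open>Outside this ball \<open>lower\<close> gives \<open>m y > m s\<close>, so the
    minimum over the compact part is the minimum over \<open>S\<close>; the first entry puts
    \<open>s\<close> into the ball.\<close>
  define R where "R = max (norm s) (K * m s)"
  have "compact (S \<inter> cball 0 R)" using S(1) by (rule closed_Int_compact) simp
  moreover have "s \<in> S \<inter> cball 0 R" using s by (simp add: R_def)
  ultimately have "\<exists>x\<in>S \<inter> cball 0 R. \<forall>y\<in>S \<inter> cball 0 R. m x \<le> m y"
    by (intro continuous_attains_inf cont) blast+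
  then obtain x where x: "x \<in> S" "\<forall>y\<in>S \<inter> cball 0 R. m x \<le> m y" by (elim bexE IntE) (rule that)
  have min: "m x \<le> m y" if "y \<in> S" for y
  proof (cases "norm y \<le> R")
    case True then show ?thesis using bspec[OF x(2), of y] that by simp
  next
    case False
    then have "K * m s < K * m y" using lower[OF that] by (auto simp: R_def)
    then have "m s < m y" using K by simp
    moreover have "m x \<le> m s" using x(2) \<open>s \<in> S \<inter> cball 0 R\<close> by blast
    ultimately show ?thesis by simp
  qed
  have m_le: "m (T x) \<le> m x" if T: "T \<in> \<T>" for T
  proof (rule least)
    fix T' assume T': "T' \<in> \<T>"
    obtain T'' where "T'' \<in> \<T>" "T' (T x) = T'' x" using comp[OF T' T] x(1) by blast
    then show "norm (T' (T x)) \<le> m x" using upper by simp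
  qed
  have "T0 x = x" if T0: "T0 \<in> \<T>" for T0
  proof (rule ccontr)
    assume "T0 x \<noteq> x"
    define y where "y = T0 x"
    define d where "d = norm (x - y) / K"
    have d: "d > 0" using \<open>T0 x \<noteq> x\<close> K by (simp add: d_def y_def)
    have y: "y \<in> S" "m y \<le> m x" using maps[OF T0 x(1)] m_le[OF T0] by (simp_all add: y_def)
    define z where "z = (1/2) *\<^sub>R x + (1/2) *\<^sub>R y"
    have z: "z \<in> S" unfolding z_def using S(2) x(1) y(1) by (intro convexD) auto
    \<comment> \<open>The gain \<open>d\<close> does not depend on \<open>T\<close>: the inverse of
      \<open>T\<close> is bounded by \<open>K\<close>, so \<open>T\<close> shrinks
      \<open>x - y\<close> at most by that factor. Hence the supremum over all \<open>T\<close>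
      decreases as well.\<close>
    have "(norm (T z))\<^sup>2 \<le> (m x)\<^sup>2 - (d / 2)\<^sup>2" if T: "T \<in> \<T>" for T
    proof -
      obtain T' where T': "T' \<in> \<T>" "\<forall>x. x \<in> span S \<longrightarrow> T' (T x) = x" using inverse[OF T] by blast
      have "T' (T (x - y)) = x - y" using T'(2) x(1) y(1) by (simp add: span_base span_diff)
      then have "norm (x - y) \<le> K * norm (T (x - y))" using b[OF T'(1), of "T (x - y)"] by simp
      then have 1: "d \<le> norm (T x - T y)" using K lin[OF T] by (simp add: d_def linear_diff field_simps)
      have "T z = (1/2) *\<^sub>R (T x + T y)" using lin[OF T]
        by (simp add: z_def linear_add linear_cmul scaleR_add_right)
      then have "(norm (T z))\<^sup>2 = (norm (T x + T y))\<^sup>2 / 4" by (simp add: power_mult_distrib power_divide)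
      also have "(norm (T x + T y))\<^sup>2 = 2 * (norm (T x))\<^sup>2 + 2 * (norm (T y))\<^sup>2 - (norm (T x - T y))\<^sup>2"
        by (simp add: power2_norm_eq_inner algebra_simps inner_commute)
      finally have "(norm (T z))\<^sup>2 = (norm (T x))\<^sup>2 / 2 + (norm (T y))\<^sup>2 / 2 - (norm (T x - T y))\<^sup>2 / 4" by (simp add: field_simps)
      moreover have "(norm (T x))\<^sup>2 \<le> (m x)\<^sup>2" using upper[OF T, of x] by (intro power_mono) simp_all
      moreover have "(norm (T y))\<^sup>2 \<le> (m x)\<^sup>2" using upper[OF T, of y] y(2) by (intro power_mono) simp_all
      moreover have "d\<^sup>2 \<le> (norm (T x - T y))\<^sup>2" using 1 d by (intro power_mono) simp_all
      ultimately show ?thesis by (simp add: power_divide)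
    qed
    then have "norm (T z) \<le> sqrt ((m x)\<^sup>2 - (d / 2)\<^sup>2)" if "T \<in> \<T>" for T
      using that by (simp add: real_le_rsqrt)
    then have "m z \<le> sqrt ((m x)\<^sup>2 - (d / 2)\<^sup>2)" by (rule least)
    also have "\<dots> < sqrt ((m x)\<^sup>2)" using d by (intro real_sqrt_less_mono) simp
    also have "\<dots> = m x" using m0 by simp
    finally show False using min[OF z] by simp
  qed
  then show ?thesis using x(1) by blast
qed

section \<open>The action of the stabilizer\<close>

lemma norm_adjoint_le:
  fixes f :: "'a::euclidean_space \<Rightarrow> 'b::euclidean_space"
  assumes f: "linear f" and bound: "\<And>v. norm (f v) \<le> C * norm v"
  shows "norm (adjoint f w) \<le> C * norm w"
proof (cases "adjoint f w = 0")
  case True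
  have "0 \<le> C * norm w"
  proof (cases "w = 0")
    case False
    obtain b :: 'a where "b \<in> Basis" using nonempty_Basis by blast
    then have "0 \<le> C" using order_trans[OF norm_ge_zero bound[of b]] by simp
    then show ?thesis by simp
  qed simp
  then show ?thesis using True by simp
next
  case False
  have "norm (adjoint f w) * norm (adjoint f w) = adjoint f w \<bullet> adjoint f w"
    by (simp add: power2_norm_eq_inner[symmetric] power2_eq_square)
  also have "\<dots> = f (adjoint f w) \<bullet> w" using adjoint_works[OF f, of "adjoint f w" w] by simp
  also have "\<dots> \<le> norm (f (adjoint f w)) * norm w" by (rule norm_cauchy_schwarz)
  also have "\<dots> \<le> C * norm (adjoint f w) * norm w" using bound by (intro mult_right_mono) simp_all
  finally have "norm (adjoint f w) * norm (adjoint f w) \<le> (C * norm w) * norm (adjoint f w)" by (simp add: mult_ac)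
  then show ?thesis using False by simp
qed

text \<open>The fixed point argument runs in the space of matrices, so bounds on maps have to be
  converted into bounds on the norm of a matrix and back; crude constants are enough.\<close>

lemma norm_matrix_le:
  fixes A :: "real ^ 'n ^ 'm"
  shows "norm A \<le> CARD('m) * (\<Sum>j\<in>UNIV. norm (A *v axis j 1))"
proof -
  have "norm A \<le> (\<Sum>i\<in>UNIV. norm (A $ i))" unfolding norm_vec_def by (rule L2_set_le_sum) simp
  also have "\<dots> \<le> (\<Sum>i\<in>(UNIV :: 'm set). \<Sum>j\<in>UNIV. norm (A *v axis j 1))"
  proof (rule sum_mono)
    fix i
    have "norm (A $ i) \<le> (\<Sum>j\<in>UNIV. \<bar>A $ i $ j\<bar>)" by (rule norm_le_l1_cart)
    also have "\<dots> \<le> (\<Sum>j\<in>UNIV. norm (A *v axis j 1))"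
    proof (rule sum_mono)
      fix j
      have "A $ i $ j = (A *v axis j 1) $ i" by (simp add: matrix_vector_mult_basis column_def)
      then show "\<bar>A $ i $ j\<bar> \<le> norm (A *v axis j 1)" by (simp add: component_le_norm_cart)
    qed
    finally show "norm (A $ i) \<le> (\<Sum>j\<in>UNIV. norm (A *v axis j 1))" .
  qed
  finally show ?thesis by simp
qed

lemma norm_matrix_vector_le:
  fixes A :: "real ^ 'n ^ 'm"
  shows "norm (A *v x) \<le> CARD('m) * norm A * norm x"
proof -
  have "norm (A *v x) \<le> (\<Sum>i\<in>UNIV. \<bar>(A *v x) $ i\<bar>)" by (rule norm_le_l1_cart)
  also have "\<dots> \<le> (\<Sum>i\<in>(UNIV :: 'm set). norm A * norm x)"
  proof (rule sum_mono)
    fix i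
    have "\<bar>(A *v x) $ i\<bar> \<le> norm (A $ i) * norm x"
      unfolding matrix_vector_mul_component by (rule Cauchy_Schwarz_ineq2)
    also have "\<dots> \<le> norm A * norm x" by (intro mult_right_mono Finite_Cartesian_Product.norm_nth_le) simp
    finally show "\<bar>(A *v x) $ i\<bar> \<le> norm A * norm x" .
  qed
  finally show ?thesis by simp
qed

context homogeneous
begin

lemma cotangent: "subspace (cotangent X)"
  unfolding cotangent_def by (rule chart_subspace[OF chart_X[OF base(1)]])

lemmas orth_proj_cotangent = orth_proj[OF cotangent]

lemma act_diff:
  assumes h: "h \<in> H"
  shows linear_act_diff: "linear (base_diff X X (act X h))"
    and act_diff_proj: "base_diff X X (act X h) (orth_proj (cotangent X) v) = base_diff X X (act X h) v"
  unfolding cotangent_def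
  using has_differential_proj[OF chart_X[OF base(1)] base_act_differential[OF h]] by auto

lemma act_diff_mult:
  assumes h: "h \<in> H" "k \<in> H"
  shows "base_diff X X (act X (h \<otimes>\<^bsub>G\<^esub> k)) v = base_diff X X (act X h) (base_diff X X (act X k) v)"
proof -
  note b = chart_X[OF base(1)]
  have hk: "h \<otimes>\<^bsub>G\<^esub> k \<in> H" using h by (rule subgroup.m_closed[OF sub])
  have 1: "has_differential MX (base_chart X) (base_chart X) (\<lambda>x. act X h (act X k x)) H
      (\<lambda>v. base_diff X X (act X h) (base_diff X X (act X k) v))"
    by (rule has_differential_compose[OF b b base_act_differential[OF h(2)]])
      (simp add: act_stab[OF h(2)] base_act_differential[OF h(1)])
  have "has_differential MX (base_chart X) (base_chart X) (act X (h \<otimes>\<^bsub>G\<^esub> k)) H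
      (\<lambda>v. base_diff X X (act X h) (base_diff X X (act X k) v))"
    by (rule has_differential_cong[OF b 1]) (use h H_subset in \<open>simp add: act_mult chart_X_subset[OF base(1)] subset_iff\<close>)
  from has_differential_unique[OF b base_act_differential[OF hk] this] show ?thesis by (rule fun_cong)
qed

lemma act_diff_one: "base_diff X X (act X \<one>\<^bsub>G\<^esub>) = orth_proj (cotangent X)"
proof -
  note b = chart_X[OF base(1)]
  have "has_differential MX (base_chart X) (base_chart X) (act X \<one>\<^bsub>G\<^esub>) H (orth_proj (cotangent X))"
    unfolding cotangent_def by (rule has_differential_cong[OF b has_differential_id[OF b base(2)]])
      (simp add: act_one chart_X_subset[OF base(1)])
  then show ?thesis
    by (rule has_differential_unique[OF b base_act_differential[OF subgroup.one_closed[OF sub]]])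
qed

lemma stab_inv: "h \<in> H \<Longrightarrow> inv\<^bsub>G\<^esub> h \<in> H"
  by (rule subgroup.m_inv_closed[OF sub])

lemma linear_stab_action: "h \<in> H \<Longrightarrow> linear (stab_action X h)"
  by (simp add: stab_action_def base_codiff_def adjoint_linear[OF linear_act_diff[OF stab_inv]])

text \<open>Differentials are normalised to vanish on the complement of the model, so even the unit
  acts as the projection.\<close>

lemma stab_action_one: "stab_action X \<one>\<^bsub>G\<^esub> = orth_proj (cotangent X)"
  by (simp add: stab_action_def base_codiff_def act_diff_one orth_proj_cotangent(4) monoid.inv_one[OF group.is_monoid[OF group]])

text \<open>The inverse in the definition compensates the reversal of order by the adjoint, so this
  is a left action.\<close>

lemma stab_action_mult:
  assumes h: "h \<in> H" "k \<in> H"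
  shows "stab_action X h (stab_action X k v) = stab_action X (h \<otimes>\<^bsub>G\<^esub> k) v"
proof -
  have hk: "inv\<^bsub>G\<^esub> (h \<otimes>\<^bsub>G\<^esub> k) = inv\<^bsub>G\<^esub> k \<otimes>\<^bsub>G\<^esub> inv\<^bsub>G\<^esub> h"
    using h H_subset by (intro group.inv_mult_group[OF group]) blast+
  have "base_diff X X (act X (inv\<^bsub>G\<^esub> (h \<otimes>\<^bsub>G\<^esub> k))) =
      base_diff X X (act X (inv\<^bsub>G\<^esub> k)) \<circ> base_diff X X (act X (inv\<^bsub>G\<^esub> h))"
    by (simp add: hk act_diff_mult[OF stab_inv stab_inv] h fun_eq_iff)
  then show ?thesis
    using adjoint_comp[OF linear_act_diff[OF stab_inv[OF h(1)]] linear_act_diff[OF stab_inv[OF h(2)]]]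
    by (simp add: stab_action_def base_codiff_def)
qed

lemma stab_action_proj:
  assumes h: "h \<in> H"
  shows "stab_action X h (orth_proj (cotangent X) v) = stab_action X h v"
    and "orth_proj (cotangent X) (stab_action X h v) = stab_action X h v"
  using stab_action_mult[OF h subgroup.one_closed[OF sub]] stab_action_mult[OF subgroup.one_closed[OF sub] h]
    h H_subset group.is_monoid[OF group]
  by (simp_all add: stab_action_one subset_iff monoid.r_one monoid.l_one)

lemma stab_action_range: "h \<in> H \<Longrightarrow> stab_action X h v \<in> cotangent X"
  using stab_action_proj(2)[of h v] orth_proj_in[OF cotangent] by metis

lemma stab_action_inverse:
  assumes h: "h \<in> H"
  shows "stab_action X h (stab_action X (inv\<^bsub>G\<^esub> h) v) = orth_proj (cotangent X) v"
    and "stab_action X (inv\<^bsub>G\<^esub> h) (stab_action X h v) = orth_proj (cotangent X) v"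
  using h H_subset
  by (simp_all add: stab_action_mult stab_inv group.r_inv[OF group] group.l_inv[OF group] subset_iff stab_action_one)

lemma stab_action_bounded: "\<exists>C. \<forall>h\<in>H. \<forall>v. norm (stab_action X h v) \<le> C * norm v"
proof -
  obtain C where C: "\<forall>h\<in>H. \<forall>v. norm (base_diff X X (act X h) v) \<le> C * norm v"
    using stab_differential_bounded by blast
  have "norm (stab_action X h v) \<le> C * norm v" if "h \<in> H" for h v
    unfolding stab_action_def base_codiff_def
    by (rule norm_adjoint_le[OF linear_act_diff[OF stab_inv[OF that]]]) (use C stab_inv[OF that] in blast)
  then show ?thesis by blast
qed

lemma subspace_map_stab: "h \<in> H \<Longrightarrow> subspace_map (cotangent X) (cotangent X) (stab_action X h)"
  unfolding subspace_map_def using cotangent linear_stab_action stab_action_range by auto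

end

section \<open>The codifferential of a morphism and its equivariant sections\<close>

context morphism
begin

abbreviation "\<phi> \<equiv> base_codiff X1 X2 f"
abbreviation "V1 \<equiv> cotangent X1"
abbreviation "V2 \<equiv> cotangent X2"

lemma linear_codiff: "linear \<phi>"
  by (simp add: base_codiff_def adjoint_linear[OF linear_D])

lemma codiff_proj: "\<phi> (orth_proj V2 v) = \<phi> v" and proj_codiff: "orth_proj V1 (\<phi> v) = \<phi> v"
proof -
  have D2: "orth_proj V2 \<circ> D = D" using D_range X2.orth_proj_cotangent(3) by (auto simp: fun_eq_iff)
  show "\<phi> (orth_proj V2 v) = \<phi> v"
    using fun_cong[OF adjoint_comp[OF linear_D X2.orth_proj_cotangent(1), unfolded D2 X2.orth_proj_cotangent(4)]] by (simp add: base_codiff_def)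
  have D1: "D \<circ> orth_proj V1 = D" by (simp add: D_proj fun_eq_iff)
  show "orth_proj V1 (\<phi> v) = \<phi> v"
    using fun_cong[OF adjoint_comp[OF X1.orth_proj_cotangent(1) linear_D, unfolded D1 X1.orth_proj_cotangent(4)]] by (simp add: base_codiff_def)
qed

lemma codiff_range: "\<phi> v \<in> V1"
  using proj_codiff[of v] orth_proj_in[OF X1.cotangent] by metis

lemma \<rho>_inv: "h \<in> stab X1 \<Longrightarrow> \<rho> (inv\<^bsub>grp X1\<^esub> h) = inv\<^bsub>grp X2\<^esub> (\<rho> h)"
  using X1.H_subset \<rho>_hom by (intro group_hom.hom_inv group_hom.intro X1.group X2.group group_hom_axioms.intro) blast+

text \<open>The adjoint of \<open>D_equivariant\<close> for the inverse of \<open>h\<close>.\<close>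

lemma codiff_equivariant:
  assumes h: "h \<in> stab X1"
  shows "stab_action X1 h (\<phi> v) = \<phi> (stab_action X2 (\<rho> h) v)"
proof -
  let ?k = "inv\<^bsub>grp X1\<^esub> h"
  have k: "?k \<in> stab X1" by (rule X1.stab_inv[OF h])
  have "D \<circ> base_diff X1 X1 (act X1 ?k) = base_diff X2 X2 (act X2 (\<rho> ?k)) \<circ> D"
    by (simp add: D_equivariant[OF k] fun_eq_iff)
  then have "adjoint (D \<circ> base_diff X1 X1 (act X1 ?k)) = adjoint (base_diff X2 X2 (act X2 (\<rho> ?k)) \<circ> D)" by simp
  then show ?thesis
    unfolding adjoint_comp[OF X1.linear_act_diff[OF k] linear_D] adjoint_comp[OF linear_D X2.linear_act_diff[OF \<rho>_stab[OF k]]]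
    by (simp add: stab_action_def base_codiff_def \<rho>_inv[OF h] fun_eq_iff)
qed

text \<open>The adjoint of a right inverse of \<open>D\<close>, which exists because
  \<open>D\<close> is onto; the projection makes it take values in \<open>V2\<close>.\<close>

lemma codiff_left_inverse:
  assumes "f ` points X1 = points X2"
  shows "\<exists>\<psi>. linear \<psi> \<and> \<psi> ` V1 \<subseteq> V2 \<and> (\<forall>v\<in>V2. \<psi> (\<phi> v) = v)"
proof -
  have R: "range D = V2" by (rule D_surjective[OF assms])
  obtain g where g: "linear g" "\<forall>w\<in>D ` UNIV. D (g w) = w"
    using linear_exists_right_inverse_on[OF linear_D subspace_UNIV] by (elim exE conjE) (rule that)
  have DgP: "D \<circ> (g \<circ> orth_proj V2) = orth_proj V2" using g(2) orth_proj_in[OF X2.cotangent] by (auto simp: R fun_eq_iff)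
  have gP: "linear (g \<circ> orth_proj V2)" by (rule linear_compose[OF X2.orth_proj_cotangent(1) g(1)])
  have inv: "adjoint (g \<circ> orth_proj V2) (\<phi> v) = orth_proj V2 v" for v
    using fun_cong[OF adjoint_comp[OF gP linear_D, unfolded DgP X2.orth_proj_cotangent(4)]] by (simp add: base_codiff_def)
  have "adjoint (g \<circ> orth_proj V2) v \<in> V2" for v
    using adjoint_comp[OF X2.orth_proj_cotangent(1) g(1)] orth_proj_in[OF X2.cotangent] by (simp add: X2.orth_proj_cotangent(4))
  then show ?thesis using inv adjoint_linear[OF gP] by (intro exI[of _ "adjoint (g \<circ> orth_proj V2)"]) (auto simp: X2.orth_proj_cotangent(3))
qed

text \<open>Dually, the adjoint of a left inverse of \<open>D\<close> on \<open>V1\<close>; the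
  projections on both sides make it vanish orthogonally to \<open>V1\<close> and map into
  \<open>V2\<close>.\<close>

lemma codiff_section:
  assumes "inj_on f (points X1)"
  shows "\<exists>s. linear s \<and> (\<forall>v. s v \<in> V2 \<and> s (orth_proj V1 v) = s v \<and> \<phi> (s v) = orth_proj V1 v)"
proof -
  have "inj_on D V1"
  proof (rule inj_onI)
    fix u v assume uv: "u \<in> V1" "v \<in> V1" "D u = D v"
    then have "u - v = 0" by (intro D_injective[OF assms]) (simp_all add: subspace_diff[OF X1.cotangent] linear_diff[OF linear_D])
    then show "u = v" by simp
  qed
  from linear_exists_left_inverse_on[OF linear_D X1.cotangent this]
  obtain g where g: "linear g" "\<forall>v\<in>V1. g (D v) = v" by (elim exE conjE) (rule that)
  have "g (D v) = orth_proj V1 v" for v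
    using g(2) orth_proj_in[OF X1.cotangent, of v] D_proj[of v] by metis
  then have gD: "g \<circ> D = orth_proj V1" by auto
  have inv: "\<phi> (adjoint g v) = orth_proj V1 v" for v
    using fun_cong[OF adjoint_comp[OF linear_D g(1), unfolded gD X1.orth_proj_cotangent(4)]] by (simp add: base_codiff_def)
  define s where "s = orth_proj V2 \<circ> adjoint g \<circ> orth_proj V1"
  have "linear s" unfolding s_def by (intro linear_compose X1.orth_proj_cotangent(1) X2.orth_proj_cotangent(1) adjoint_linear g(1))
  then show ?thesis
    using orth_proj_in[OF X2.cotangent]
    by (intro exI[of _ s]) (simp add: s_def inv codiff_proj orth_proj_idem[OF X1.cotangent])
qed

text \<open>The sections form an affine space of matrices on which the stabilizer acts by
  conjugation, and a fixed point of this action is an equivariant section.\<close>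

lemma codiff_equivariant_section:
  assumes "inj_on f (points X1)"
  shows "\<exists>s. linear s \<and> (\<forall>v. s v \<in> V2 \<and> \<phi> (s v) = orth_proj V1 v) \<and>
    (\<forall>h\<in>stab X1. \<forall>v. stab_action X2 (\<rho> h) (s v) = s (stab_action X1 h v))"
proof -
  \<comment> \<open>The three entries express that the matrix maps into \<open>V2\<close>, vanishes
    orthogonally to \<open>V1\<close>, and is a section of \<phi>. All are linear equations in the
    matrix, so \<open>S\<close> is closed and convex.\<close>
  define \<Lambda> :: "real ^ 'n1::{finite,linorder} \<Rightarrow> real ^ 'n1::{finite,linorder} ^ 'n2::{finite,linorder} \<Rightarrow> _"
    where "\<Lambda> v A = (orth_proj V2 (A *v v) - A *v v, A *v orth_proj V1 v - A *v v, \<phi> (A *v v))" for v A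
  define S where "S = {A. \<forall>v. \<Lambda> v A = (0, 0, orth_proj V1 v)}"
  note lins = linear_add[OF X2.orth_proj_cotangent(1)] linear_add[OF linear_codiff] linear_cmul[OF X2.orth_proj_cotangent(1)] linear_cmul[OF linear_codiff]
  have lin\<Lambda>: "linear (\<Lambda> v)" for v
    unfolding \<Lambda>_def
    by (rule linearI) (simp_all add: matrix_vector_mult_add_rdistrib scaleR_matrix_vector_assoc[symmetric] lins algebra_simps)
  have S_iff: "A \<in> S \<longleftrightarrow> (\<forall>v. A *v v \<in> V2 \<and> A *v orth_proj V1 v = A *v v \<and> \<phi> (A *v v) = orth_proj V1 v)" for A
  proof -
    have "orth_proj V2 w = w \<longleftrightarrow> w \<in> V2" for w using orth_proj_in[OF X2.cotangent, of w] X2.orth_proj_cotangent(3) by metis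
    then show ?thesis by (simp add: S_def \<Lambda>_def)
  qed
  define T where "T h A = matrix (\<lambda>v. stab_action X2 (\<rho> h) (A *v stab_action X1 (inv\<^bsub>grp X1\<^esub> h) v))" for h A
  have T: "T h A *v v = stab_action X2 (\<rho> h) (A *v stab_action X1 (inv\<^bsub>grp X1\<^esub> h) v)" if h: "h \<in> stab X1" for h A v
  proof -
    have "linear (stab_action X2 (\<rho> h) \<circ> ((*v) A \<circ> stab_action X1 (inv\<^bsub>grp X1\<^esub> h)))"
      by (intro linear_compose X1.linear_stab_action X2.linear_stab_action X1.stab_inv \<rho>_stab h matrix_vector_mul_linear)
    then show ?thesis unfolding T_def by (subst matrix_works) (simp_all add: linear_matrix_vector_mul_eq o_def)
  qed
  have \<rho>_mult: "\<rho> (h \<otimes>\<^bsub>grp X1\<^esub> k) = \<rho> h \<otimes>\<^bsub>grp X2\<^esub> \<rho> k" if "h \<in> stab X1" "k \<in> stab X1" for h k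
    using \<rho>_hom that X1.H_subset by (auto simp: hom_def)
  have T_mult: "T h (T k A) = T (h \<otimes>\<^bsub>grp X1\<^esub> k) A" if h: "h \<in> stab X1" "k \<in> stab X1" for h k A
  proof -
    have hk: "inv\<^bsub>grp X1\<^esub> (h \<otimes>\<^bsub>grp X1\<^esub> k) = inv\<^bsub>grp X1\<^esub> k \<otimes>\<^bsub>grp X1\<^esub> inv\<^bsub>grp X1\<^esub> h"
      using h X1.H_subset by (intro group.inv_mult_group[OF X1.group]) blast+
    have "T h (T k A) *v v = T (h \<otimes>\<^bsub>grp X1\<^esub> k) A *v v" for v
      by (simp add: T h subgroup.m_closed[OF X1.sub] \<rho>_stab X2.stab_action_mult \<rho>_mult hk
          X1.stab_action_mult[OF X1.stab_inv X1.stab_inv, symmetric])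
    then show ?thesis by (simp add: matrix_eq)
  qed
  have T_inv: "T (inv\<^bsub>grp X1\<^esub> h) (T h A) = A" if h: "h \<in> stab X1" and A: "A \<in> span S" for h A
  proof -
    \<comment> \<open>The first two conditions are homogeneous and pass to \<open>span S\<close>,
      while the third is only affine. The two suffice for conjugation by the inverse to undo
      conjugation by \<open>h\<close>.\<close>
    have "subspace {A. \<forall>v. A *v v \<in> V2 \<and> A *v orth_proj V1 v = A *v v}"
      by (rule subspaceI) (simp_all add: matrix_vector_mult_add_rdistrib scaleR_matrix_vector_assoc[symmetric]
          subspace_0 subspace_add subspace_scale X2.cotangent)
    then have "span S \<subseteq> {A. \<forall>v. A *v v \<in> V2 \<and> A *v orth_proj V1 v = A *v v}"
      by (intro span_minimal) (auto simp: S_iff)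
    then have A': "A *v v \<in> V2" "A *v orth_proj V1 v = A *v v" for v using A by blast+
    have "inv\<^bsub>grp X1\<^esub> (inv\<^bsub>grp X1\<^esub> h) = h" using h X1.H_subset group.inv_inv[OF X1.group] by blast
    then have "T (inv\<^bsub>grp X1\<^esub> h) (T h A) *v v = A *v v" for v
      by (simp add: T h X1.stab_inv \<rho>_inv X1.stab_action_inverse X2.stab_action_inverse \<rho>_stab A' X2.orth_proj_cotangent(3))
    then show ?thesis by (simp add: matrix_eq)
  qed
  obtain C1 C2 where C: "\<forall>h\<in>stab X1. \<forall>v. norm (stab_action X1 h v) \<le> C1 * norm v"
    "\<forall>h\<in>stab X2. \<forall>v. norm (stab_action X2 h v) \<le> C2 * norm v"
    using X1.stab_action_bounded X2.stab_action_bounded by (elim exE) (rule that)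
  \<comment> \<open>The constants \<open>C1\<close> and \<open>C2\<close> bound the two actions, and
    the cardinality is the factor of \<open>norm_matrix_vector_le\<close>.\<close>
  define K where "K = \<bar>C2\<bar> * (real CARD('n2) * \<bar>C1\<bar>)"
  have T_bound: "norm (T h A) \<le> (real CARD('n2) * (real CARD('n1) * K)) * norm A" if h: "h \<in> stab X1" for h A
  proof -
    have "norm (T h A *v axis j 1) \<le> K * norm A" for j
    proof -
      let ?w = "stab_action X1 (inv\<^bsub>grp X1\<^esub> h) (axis j 1)"
      have "norm ?w \<le> C1 * norm (axis j (1::real) :: real ^ 'n1::{finite,linorder})" using C(1) X1.stab_inv[OF h] by blast
      then have w: "norm ?w \<le> \<bar>C1\<bar>" by simp
      have "norm (T h A *v axis j 1) \<le> C2 * norm (A *v ?w)" unfolding T[OF h] using C(2) \<rho>_stab[OF h] by blast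
      also have "\<dots> \<le> \<bar>C2\<bar> * norm (A *v ?w)" by (intro mult_right_mono) simp_all
      also have "\<dots> \<le> \<bar>C2\<bar> * (CARD('n2) * norm A * norm ?w)" by (intro mult_left_mono norm_matrix_vector_le) simp
      also have "\<dots> \<le> \<bar>C2\<bar> * (CARD('n2) * norm A * \<bar>C1\<bar>)" using w by (intro mult_left_mono) simp_all
      finally show ?thesis by (simp add: K_def mult_ac)
    qed
    then have "(\<Sum>j\<in>UNIV. norm (T h A *v axis j 1)) \<le> (\<Sum>j\<in>(UNIV :: 'n1 set). K * norm A)" by (intro sum_mono)
    then have e: "real CARD('n2) * (\<Sum>j\<in>UNIV. norm (T h A *v axis j 1)) \<le> real CARD('n2) * (real CARD('n1) * (K * norm A))"
      by (intro mult_left_mono) simp_all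
    show ?thesis using order_trans[OF norm_matrix_le e] by (simp only: mult.assoc)
  qed
  have T_S: "T h A \<in> S" if h: "h \<in> stab X1" and A: "A \<in> S" for h A
    using A h by (simp add: S_iff T X2.stab_action_range \<rho>_stab X1.stab_action_proj X1.stab_inv
        codiff_equivariant[symmetric] X1.stab_action_inverse)
  have linT: "linear (T h)" if h: "h \<in> stab X1" for h
    using linear_add[OF X2.linear_stab_action[OF \<rho>_stab[OF h]]] linear_cmul[OF X2.linear_stab_action[OF \<rho>_stab[OF h]]]
    by (intro linearI) (simp_all add: T_def matrix_def vec_eq_iff matrix_vector_mult_add_rdistrib scaleR_matrix_vector_assoc[symmetric])
  have "\<exists>A\<in>S. \<forall>U\<in>T ` stab X1. U A = A"
  proof (rule bounded_family_common_fixed_point)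
    show "closed S" unfolding S_def
      by (intro closed_Collect_all closed_Collect_eq continuous_on_const linear_continuous_on)
        (use lin\<Lambda> in \<open>simp add: linear_conv_bounded_linear\<close>)
    show "convex S"
    proof (rule convexI)
      fix A B :: "real ^ 'n1::{finite,linorder} ^ 'n2::{finite,linorder}" and u v :: real
      assume *: "A \<in> S" "B \<in> S" "0 \<le> u" "0 \<le> v" "u + v = 1"
      have "\<Lambda> w (u *\<^sub>R A + v *\<^sub>R B) = (u + v) *\<^sub>R (0, 0, orth_proj V1 w)" for w
        using *(1,2) by (simp add: linear_add[OF lin\<Lambda>] linear_cmul[OF lin\<Lambda>] S_def scaleR_add_left)
      then show "u *\<^sub>R A + v *\<^sub>R B \<in> S" by (simp add: S_def *(5))
    qed
    obtain s where "linear s" "\<forall>v. s v \<in> V2 \<and> s (orth_proj V1 v) = s v \<and> \<phi> (s v) = orth_proj V1 v"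
      using codiff_section[OF assms] by (elim exE conjE) (rule that)
    then have "matrix s \<in> S" by (simp add: S_iff matrix_works linear_matrix_vector_mul_eq)
    then show "S \<noteq> {}" by blast
    show "T ` stab X1 \<noteq> {}" using subgroup.one_closed[OF X1.sub] by blast
    show "\<exists>U''\<in>T ` stab X1. \<forall>A\<in>S. U (U' A) = U'' A" if U: "U \<in> T ` stab X1" "U' \<in> T ` stab X1" for U U'
    proof -
      obtain h k where "h \<in> stab X1" "U = T h" "k \<in> stab X1" "U' = T k" using U by blast
      then show ?thesis using subgroup.m_closed[OF X1.sub]
        by (intro bexI[of _ "T (h \<otimes>\<^bsub>grp X1\<^esub> k)"]) (simp_all add: T_mult)
    qed
    show "\<exists>U'\<in>T ` stab X1. \<forall>A. A \<in> span S \<longrightarrow> U' (U A) = A" if U: "U \<in> T ` stab X1" for U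
    proof -
      obtain h where "h \<in> stab X1" "U = T h" using U by blast
      then show ?thesis using X1.stab_inv T_inv by (intro bexI[of _ "T (inv\<^bsub>grp X1\<^esub> h)"]) simp_all
    qed
  qed (use linT T_S T_bound in auto)
  then obtain A where A: "A \<in> S" "\<And>h. h \<in> stab X1 \<Longrightarrow> T h A = A" by blast
  have "stab_action X2 (\<rho> h) (A *v v) = A *v stab_action X1 h v" if h: "h \<in> stab X1" for h v
  proof -
    have "A *v stab_action X1 h v = T h A *v stab_action X1 h v" by (simp add: A(2)[OF h])
    then show ?thesis using A(1) by (simp add: T h X1.stab_action_inverse S_iff)
  qed
  then show ?thesis using A(1) by (intro exI[of _ "(*v) A"]) (simp add: S_iff)
qed

end

section \<open>The induced homomorphism\<close>

lemma H_E_ops: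
  "x \<otimes>\<^bsub>H_E X\<^esub> y = rcoset_mult (G_algebra (cotangent X)) (I_ideal (cotangent X)) x y"
  "x \<oplus>\<^bsub>H_E X\<^esub> y = x <+>\<^bsub>G_algebra (cotangent X)\<^esub> y"
  "a \<odot>\<^bsub>H_E X\<^esub> x = (\<Union>z\<in>x. Q_class (cotangent X) (\<lambda>d u. a * z d u))"
  "\<one>\<^bsub>H_E X\<^esub> = \<one>\<^bsub>Q_centered (cotangent X)\<^esub>"
  by (simp_all add: H_E_def Q_record)

context morphism
begin

sublocale codiff: subspace_map V2 V1 \<phi>
  using X2.cotangent X1.cotangent linear_codiff codiff_range by (auto simp: subspace_map_def)

lemma codiff_invariant:
  assumes h: "h \<in> stab X1" and x: "x \<in> carrier (Q V2)" "\<forall>k\<in>stab X2. Q_map V2 (stab_action X2 k) x = x"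
  shows "Q_map V1 (stab_action X1 h) (Q_map V1 \<phi> x) = Q_map V1 \<phi> x"
proof -
  have "stab_action X1 h \<circ> \<phi> = \<phi> \<circ> stab_action X2 (\<rho> h)" by (simp add: codiff_equivariant[OF h] fun_eq_iff)
  then have "Q_map V1 (stab_action X1 h) (Q_map V1 \<phi> x) = Q_map V1 \<phi> (Q_map V2 (stab_action X2 (\<rho> h)) x)"
    using Q_map_comp[OF codiff.subspace_map_axioms X1.subspace_map_stab[OF h] x(1)]
      Q_map_comp[OF X2.subspace_map_stab[OF \<rho>_stab[OF h]] codiff.subspace_map_axioms x(1)] by simp
  then show ?thesis using x(2) \<rho>_stab[OF h] by simp
qed

lemma Q_carrier_range: "X \<in> carrier (Q V) \<Longrightarrow> X \<in> range (Q_class V)"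
  by (auto simp: Q_record)

lemma pull_H_hom:
  "graded_algebra_hom (H_plus X2) (H_plus_deg X2) (H_plus X1) (H_plus_deg X1) (pull_H X1 X2 f)"
  "graded_algebra_hom (H_E X2) (H_E_deg X2) (H_E X1) (H_E_deg X1) (pull_H X1 X2 f)"
proof -
  have inv: "pull_H X1 X2 f x \<in> carrier (H_plus X1)" if "x \<in> carrier (H_plus X2)" for x
    using that by (simp add: H_plus_def pull_H_def codiff.Q_map_carrier codiff_invariant)
  have invE: "pull_H X1 X2 f x \<in> carrier (H_E X1)" if "x \<in> carrier (H_E X2)" for x
  proof -
    have "x \<in> carrier (Q V2)" using that codiff.Q_centered_subset by (auto simp: H_E_def)
    then show ?thesis using that by (simp add: H_E_def pull_H_def codiff.Q_map_carrier codiff_invariant)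
  qed
  have 1: "x \<in> carrier (Q V2)" "x \<in> range (Q_class V2)" if "x \<in> carrier (H_plus X2)" for x
    using that Q_carrier_range by (auto simp: H_plus_def)
  have 2: "x \<in> carrier (Q V2)" "x \<in> range (Q_class V2)" if "x \<in> carrier (H_E X2)" for x
    using that Q_carrier_range codiff.Q_centered_subset by (auto simp: H_E_def)
  show "graded_algebra_hom (H_plus X2) (H_plus_deg X2) (H_plus X1) (H_plus_deg X1) (pull_H X1 X2 f)"
    unfolding graded_algebra_hom_def ring_hom_def
  proof (intro conjI CollectI ballI allI PiE_I Pi_I)
    show "pull_H X1 X2 f ` H_plus_deg X2 d \<subseteq> H_plus_deg X1 d" for d
      using inv codiff.Q_map_deg by (auto simp: H_plus_deg_def pull_H_def)
  qed (use inv in \<open>simp_all add: 1 H_plus_def Q_record pull_H_def codiff.Q_map_mult codiff.Q_map_add codiff.Q_map_smult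
      codiff.Q_map_one[unfolded Q_record]\<close>)
  show "graded_algebra_hom (H_E X2) (H_E_deg X2) (H_E X1) (H_E_deg X1) (pull_H X1 X2 f)"
    unfolding graded_algebra_hom_def ring_hom_def
  proof (intro conjI CollectI ballI allI PiE_I Pi_I)
    show "pull_H X1 X2 f ` H_E_deg X2 d \<subseteq> H_E_deg X1 d" for d
      using invE codiff.Q_map_deg by (auto simp: H_E_deg_def pull_H_def)
  qed (simp_all add: 2 H_E_ops invE[unfolded pull_H_def] pull_H_def codiff.Q_map_mult codiff.Q_map_add codiff.Q_map_smult
      codiff.Q_map_one)
qed

lemma pull_H_c_hom: "graded_algebra_hom (H_c X2) (H_c_deg X2) (H_c X1) (H_c_deg X1) (pull_H_c X1 X2 f)"
proof -
  have inv: "pull_H_c X1 X2 f w \<in> carrier (H_c X1)" if w: "w \<in> carrier (H_c X2)" for w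
  proof -
    have "ext_map (stab_action X1 h) (ext_map \<phi> w) = ext_map \<phi> w" if h: "h \<in> stab X1" for h
    proof -
      have e: "stab_action X1 h \<circ> \<phi> = \<phi> \<circ> stab_action X2 (\<rho> h)" by (simp add: codiff_equivariant[OF h] fun_eq_iff)
      have "ext_map (stab_action X1 h) (ext_map \<phi> w) = ext_map \<phi> (ext_map (stab_action X2 (\<rho> h)) w)"
        unfolding ext_map_comp[OF X1.linear_stab_action[OF h] linear_codiff] e
          ext_map_comp[OF linear_codiff X2.linear_stab_action[OF \<rho>_stab[OF h]]] ..
      then show ?thesis using w \<rho>_stab[OF h] by (simp add: H_c_def)
    qed
    then show ?thesis using w ext_map_span(2)[OF linear_codiff codiff.map] by (simp add: H_c_def pull_H_c_def ext_algebra_def)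
  qed
  show ?thesis unfolding graded_algebra_hom_def ring_hom_def
  proof (intro conjI CollectI ballI allI Pi_I)
    show "pull_H_c X1 X2 f ` H_c_deg X2 d \<subseteq> H_c_deg X1 d" for d
      using inv ext_map_span(1)[OF linear_codiff codiff.map] by (auto simp: H_c_deg_def pull_H_c_def)
  qed (use inv in \<open>simp_all add: H_c_def ext_algebra_def pull_H_c_def ext_map_wedge[OF linear_codiff]
      linear_add[OF linear_ext_map] linear_cmul[OF linear_ext_map] ext_map_one\<close>)
qed

lemma pull_H_decomposition:
  assumes x: "x \<in> carrier (H_E X2)"
  shows "pull_H X1 X2 f (x \<oplus>\<^bsub>H_plus X2\<^esub> ext_incl V2 w) =
    pull_H X1 X2 f x \<oplus>\<^bsub>H_plus X1\<^esub> ext_incl V1 (pull_H_c X1 X2 f w)"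
proof -
  have "x \<in> carrier (Q V2)" using x codiff.Q_centered_subset by (auto simp: H_E_def)
  moreover have "ext_incl V2 w \<in> range (Q_class V2)" by (simp add: ext_incl_def)
  ultimately show ?thesis
    using codiff.Q_map_add[OF Q_carrier_range] by (simp add: H_plus_def Q_record pull_H_def pull_H_c_def codiff.Q_map_ext_incl)
qed

text \<open>Both forms have the same values on wedge products from \<open>V1\<close>, so their
  difference is orthogonal to the exterior algebra of \<open>V1\<close>, to which it
  belongs.\<close>

lemma pull_form_eq: "pull_form X1 X2 f \<omega> = ext_map \<phi> \<omega>"
  unfolding pull_form_def
proof (rule the_equality)
  have adj: "form_eval (ext_map \<phi> \<omega>) vs = form_eval \<omega> (map D vs)" for vs
    using inner_ext_map_adjoint[OF linear_D] by (simp add: form_eval_def base_codiff_def ext_map_wedge_list[OF linear_D])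
  show mem: "ext_map \<phi> \<omega> \<in> ext_carrier V1 \<and>
      (\<forall>vs. set vs \<subseteq> V1 \<longrightarrow> form_eval (ext_map \<phi> \<omega>) vs = form_eval \<omega> (map D vs))"
    using adj ext_map_in_carrier[OF linear_codiff] codiff_range by blast
  fix \<eta> assume \<eta>: "\<eta> \<in> ext_carrier V1 \<and> (\<forall>vs. set vs \<subseteq> V1 \<longrightarrow> form_eval \<eta> vs = form_eval \<omega> (map D vs))"
  define \<delta> where "\<delta> = \<eta> - ext_map \<phi> \<omega>"
  have \<delta>: "\<delta> \<in> ext_carrier V1" unfolding \<delta>_def using \<eta> mem by (intro subspace_diff subspace_ext_carrier) simp_all
  have "\<delta> \<bullet> x = 0" if "x \<in> ext_carrier V1" for x
    using that unfolding ext_carrier_def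
  proof (induction rule: span_induct)
    case base
    show ?case by (rule subspace_hyperplane)
  next
    case (step x)
    then show ?case using \<eta> adj by (auto simp: \<delta>_def form_eval_def inner_diff_left)
  qed
  from this[OF \<delta>] show "\<eta> = ext_map \<phi> \<omega>" by (simp add: \<delta>_def)
qed

lemma pull_H_Z_class:
  assumes "random_simple M d V2 \<xi>"
  shows "pull_H X1 X2 f (Z_class X2 d M \<xi>) = Z_class X1 d M (\<lambda>\<omega>. pull_form X1 X2 f (\<xi> \<omega>))"
  unfolding pull_H_def Z_class_def pull_form_eq
  by (rule Q_map_Z_class[OF codiff.subspace_map_axioms]) (use assms in \<open>simp add: random_simple_def\<close>)

text \<open>Injectivity already holds on the whole of \<open>Q V2\<close>: a left inverse \<psi> of
  \<phi> on \<open>V2\<close> induces a map that undoes the one induced by \<phi>.\<close>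

lemma pull_H_injective:
  assumes "f ` points X1 = points X2"
  shows "inj_on (pull_H X1 X2 f) (carrier (H_plus X2))"
proof -
  obtain \<psi> where \<psi>: "linear \<psi>" "\<psi> ` V1 \<subseteq> V2" "\<forall>v\<in>V2. \<psi> (\<phi> v) = v"
    using codiff_left_inverse[OF assms] by (elim exE conjE) (rule that)
  have m: "subspace_map V1 V2 \<psi>" using \<psi> X1.cotangent X2.cotangent by (auto simp: subspace_map_def)
  have m2: "subspace_map V2 V2 (\<psi> \<circ> \<phi>)"
    using \<psi> X2.cotangent linear_compose[OF linear_codiff \<psi>(1)] by (auto simp: subspace_map_def o_def)
  show ?thesis
  proof (rule inj_on_inverseI[where g="Q_map V2 \<psi>"])
    fix x assume "x \<in> carrier (H_plus X2)"
    then have x: "x \<in> carrier (Q V2)" by (simp add: H_plus_def)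
    show "Q_map V2 \<psi> (pull_H X1 X2 f x) = x"
      unfolding pull_H_def Q_map_comp[OF codiff.subspace_map_axioms m x]
      by (rule Q_map_id[OF m2 _ x]) (simp add: \<psi>(3))
  qed
qed

text \<open>The preimage of \<open>y\<close> is its image under an equivariant section. Every
  element of \<open>stab X2\<close> is some \<open>\<rho> h\<close>, so equivariance over
  \<open>stab X1\<close> makes this preimage invariant under all of \<open>stab X2\<close>.\<close>

lemma pull_H_surjective:
  assumes inj: "inj_on f (points X1)" and onto: "\<rho> ` stab X1 = stab X2"
  shows "pull_H X1 X2 f ` carrier (H_plus X2) = carrier (H_plus X1)"
proof
  show "pull_H X1 X2 f ` carrier (H_plus X2) \<subseteq> carrier (H_plus X1)"
    using pull_H_hom(1) by (auto simp: graded_algebra_hom_def ring_hom_def)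
  obtain s where s: "linear s" "\<forall>v. s v \<in> V2 \<and> \<phi> (s v) = orth_proj V1 v"
    "\<forall>h\<in>stab X1. \<forall>v. stab_action X2 (\<rho> h) (s v) = s (stab_action X1 h v)"
    using codiff_equivariant_section[OF inj] by (elim exE conjE) (rule that)
  have m: "subspace_map V1 V2 s" using s X1.cotangent X2.cotangent by (auto simp: subspace_map_def)
  have \<phi>s: "\<phi> \<circ> s = orth_proj V1" using s(2) by auto
  have m1: "subspace_map V1 V1 (orth_proj V1)"
    using X1.cotangent X1.orth_proj_cotangent(1,2) by (auto simp: subspace_map_def)
  show "carrier (H_plus X1) \<subseteq> pull_H X1 X2 f ` carrier (H_plus X2)"
  proof
    fix y assume y: "y \<in> carrier (H_plus X1)"
    then have y1: "y \<in> carrier (Q V1)" and yh: "\<And>h. h \<in> stab X1 \<Longrightarrow> Q_map V1 (stab_action X1 h) y = y"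
      by (simp_all add: H_plus_def)
    have "pull_H X1 X2 f (Q_map V2 s y) = y"
      unfolding pull_H_def Q_map_comp[OF m codiff.subspace_map_axioms y1] \<phi>s
      by (rule Q_map_id[OF m1 X1.orth_proj_cotangent(3) y1])
    moreover have "Q_map V2 s y \<in> carrier (H_plus X2)"
    proof -
      have "Q_map V2 (stab_action X2 k) (Q_map V2 s y) = Q_map V2 s y" if k: "k \<in> stab X2" for k
      proof -
        obtain h where h: "h \<in> stab X1" "k = \<rho> h" using k onto by blast
        have e: "stab_action X2 k \<circ> s = s \<circ> stab_action X1 h" using s(3) h by (simp add: fun_eq_iff)
        have "Q_map V2 (stab_action X2 k) (Q_map V2 s y) = Q_map V2 s (Q_map V1 (stab_action X1 h) y)"
          unfolding Q_map_comp[OF m X2.subspace_map_stab[OF k] y1] e Q_map_comp[OF X1.subspace_map_stab[OF h(1)] m y1] ..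
        then show ?thesis by (simp add: yh[OF h(1)])
      qed
      moreover have "Q_map V2 s y \<in> carrier (Q V2)" by (rule subspace_map.Q_map_carrier(1)[OF m y1])
      ultimately show ?thesis by (simp add: H_plus_def)
    qed
    ultimately show "y \<in> pull_H X1 X2 f ` carrier (H_plus X2)" by (metis imageI)
  qed
qed

end

text \<open>The chain rule at the base point, with the order reversed by the adjoint.\<close>

lemma pull_H_comp:
  assumes f: "morphism X1 X2 \<rho> f" and f': "morphism X2 X3 \<rho>' f'" and x: "x \<in> carrier (H_plus X3)"
  shows "pull_H X1 X3 (f' \<circ> f) x = pull_H X1 X2 f (pull_H X2 X3 f' x)"
proof -
  interpret a: morphism X1 X2 \<rho> f by (rule f)
  interpret b: morphism X2 X3 \<rho>' f' by (rule f')
  note c = a.X1.chart_X[OF a.X1.base(1)] a.X2.chart_X[OF a.X2.base(1)]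
  have "has_differential (quot_manifold X1) (base_chart X1) (base_chart X3) (\<lambda>x. f' (f x)) (stab X1) (\<lambda>v. b.D (a.D v))"
    by (rule has_differential_compose[OF c a.base_differential]) (simp add: a.f_stab b.base_differential)
  then have "base_diff X1 X3 (f' \<circ> f) = b.D \<circ> a.D"
    unfolding base_diff_def[of X1 X3] o_def by (rule differential_eqI[OF c(1)])
  then have "base_codiff X1 X3 (f' \<circ> f) = a.\<phi> \<circ> b.\<phi>"
    by (simp add: base_codiff_def adjoint_comp[OF a.linear_D b.linear_D])
  moreover have "x \<in> carrier (Q (cotangent X3))" using x by (simp add: H_plus_def)
  ultimately show ?thesis
    using Q_map_comp[OF b.codiff.subspace_map_axioms a.codiff.subspace_map_axioms] by (simp add: pull_H_def)
qed

theorem proposition5p17: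
  fixes X1 :: "('g1, 'e1::euclidean_space, 'n1::{finite,linorder}) hspace"
    and X2 :: "('g2, 'e2::euclidean_space, 'n2::{finite,linorder}) hspace"
    and \<rho> :: "'g1 \<Rightarrow> 'g2"
    and f :: "'g1 set \<Rightarrow> 'g2 set"
  assumes "homogeneous_space X1" and "homogeneous_space X2"
    and "hspace_morphism X1 X2 \<rho> f"
  shows
    "graded_algebra_hom (H_plus X2) (H_plus_deg X2) (H_plus X1) (H_plus_deg X1) (pull_H X1 X2 f) \<and>
     graded_algebra_hom (H_E X2) (H_E_deg X2) (H_E X1) (H_E_deg X1) (pull_H X1 X2 f) \<and>
     graded_algebra_hom (H_c X2) (H_c_deg X2) (H_c X1) (H_c_deg X1) (pull_H_c X1 X2 f) \<and>
     (\<forall>x\<in>carrier (H_E X2). \<forall>w\<in>carrier (H_c X2).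
        pull_H X1 X2 f (x \<oplus>\<^bsub>H_plus X2\<^esub> ext_incl (cotangent X2) w) =
        pull_H X1 X2 f x \<oplus>\<^bsub>H_plus X1\<^esub> ext_incl (cotangent X1) (pull_H_c X1 X2 f w)) \<and>
     (\<forall>(X3 :: ('g3, 'e3::euclidean_space, 'n3::{finite,linorder}) hspace) \<rho>' f'.
        homogeneous_space X3 \<and> hspace_morphism X2 X3 \<rho>' f' \<longrightarrow>
        (\<forall>x\<in>carrier (H_plus X3).
           pull_H X1 X3 (f' \<circ> f) x = pull_H X1 X2 f (pull_H X2 X3 f' x))) \<and>
     (\<forall>(M :: 'w measure) d \<xi>.
        random_simple M d (cotangent X2) \<xi> \<and> invariant_distribution X2 M \<xi> \<longrightarrow>
        pull_H X1 X2 f (Z_class X2 d M \<xi>) = Z_class X1 d M (\<lambda>\<omega>. pull_form X1 X2 f (\<xi> \<omega>))) \<and>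
     (f ` points X1 = points X2 \<longrightarrow>
        inj_on (pull_H X1 X2 f) (carrier (H_plus X2))) \<and>
     (inj_on f (points X1) \<and> \<rho> ` stab X1 = stab X2 \<longrightarrow>
        pull_H X1 X2 f ` carrier (H_plus X2) = carrier (H_plus X1))"
proof -
  interpret morphism X1 X2 \<rho> f using assms by unfold_locales
  have comp: "pull_H X1 X3 (f' \<circ> f) x = pull_H X1 X2 f (pull_H X2 X3 f' x)"
    if "homogeneous_space X3" "hspace_morphism X2 X3 \<rho>' f'" "x \<in> carrier (H_plus X3)"
    for X3 :: "('g3, 'e3::euclidean_space, 'n3::{finite,linorder}) hspace" and \<rho>' f' x
  proof (rule pull_H_comp[OF morphism_axioms _ that(3)])
    show "morphism X2 X3 \<rho>' f'" using assms(2) that by unfold_locales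
  qed
  show ?thesis
    by (intro conjI ballI allI impI pull_H_hom pull_H_c_hom; (elim conjE)?;
        rule pull_H_decomposition comp pull_H_Z_class pull_H_injective pull_H_surjective; assumption)
qed

end
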